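(* Suppose Assumptions 1, 2 and 3 hold (with $\kappa>2$) and that $G_2=G_\mu''(x^* )>0$. Let $0<\epsilon<\min\left(\frac{\kappa-2}{6(\kappa+1)},\frac1{15}\right)$ and $\sigma>0$. Then, as $n\to\infty$, \[ \frac{1}{c_2n^{2/3}}\tilde K_{n,t_{n}^{\rm Ai}(\tau_1),t_{n}^{\rm Ai}(\tau_2)}\left(x^{\rm Ai}_n(\tau_1)+\frac{u}{c_2n^{2/3}},\, x^{\rm Ai}_n(\tau_2)+\frac{v}{c_2n^{2/3}}\right)=\mathbb K^{\rm Ai}_{\tau_1,\tau_2}(u,v)+\mathcal O\left( \frac{e^{- \sigma(u+v)}}{n^{\epsilon}}\right), \] where the $\mathcal O$-term is uniform for $\tau_1,\tau_2$ in any compact subset of $\mathbb R$ and for $u,v\in[-M,Mn^{\epsilon}]$, for any fixed constant $M>0$.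
   Context: Non-intersecting Brownian motions (NIBM): $X(t)=(X_1(t)\le\dots\le X_n(t))$ solves $dX_j(t)=n^{-1/2}dB_j(t)+\frac1n\sum_{k\neq j}\frac{dt}{X_j(t)-X_k(t)}$, $j=1,\dots,n$, with independent standard Brownian motions $B_j$ and deterministic initial points $X_1(0),\dots,X_n(0)$. Let $\mu_n=\frac1n\sum_{j=1}^n\delta_{X_j(0)}$, $F_n$ its distribution function. Assumption 1: the supports of all $\mu_n$ lie in a fixed bounded set, $\mu_n\to\mu$ weakly, $\mu$ has a density $\psi$ continuous on its support, and there is $x^*\in\mathbb R$, $c>0$, $\kappa>2$ with $\psi(x)\sim c|x-x^*|^\kappa$ as $x\to x^*$. Assumption 2: there are $M_0>0,n_0$ with $|F_n(x)-F(x)|\le M_0/n$ for all $n\ge n_0$, $x\in\mathbb R$, where $F$ is the distribution function of $\mu$. Assumption 3: there are $m>0,n_0$ such that $[x^*-mn^{-1/(\kappa+1)},x^*+mn^{-1/(\kappa+1)}]$ does not meet the support of $\mu_n$ for $n\ge n_0$. Notation: $G_\mu(z)=\int\frac{\mu(ds)}{z-s}$; $G_j:=G_\mu^{(j)}(x^* )=(-1)^jj!\int\frac{\mu(ds)}{(x^*-s)^{j+1}}$ for $j=0,1,2,3$; $t_{\rm cr}:=\left(\int\frac{\mu(ds)}{(x^*-s)^2}\right)^{-1}$. Set $c_2:=\frac{2^{1/3}}{G_2^{1/3}t_{\rm cr}}$, $t_n^{\rm Ai}(\tau):=t_{\rm cr}+\frac{2\tau}{c_2^2n^{1/3}}$,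 $x_n^{\rm Ai}(\tau):=x^*+t_n^{\rm Ai}(\tau)G_0$. Correlation kernel of NIBM (the space-time correlation functions are determinants built from it): for $s,t>0$, \[K_{n,s,t}(x,y)=\frac{n}{(2\pi i)^2\sqrt{st}}\int_{x_0+i\mathbb R}dz\int_\Gamma dw\,\frac{\exp\left(\frac{n}{2t}[(z-y)^2+2tg_{\mu_n}(z)]-\frac{n}{2s}[(w-x)^2+2sg_{\mu_n}(w)]\right)}{z-w}-1(s>t)\frac{\sqrt n}{\sqrt{2\pi(s-t)}}e^{-\frac{n(x-y)^2}{2(s-t)}},\] where $g_{\mu_n}(z)=\int\log(z-s)d\mu_n(s)$ (principal branch), $\Gamma$ is a positively oriented closed curve (or union of such) winding once around each initial point, and $x_0\in\mathbb R$ is such that $x_0+i\mathbb R$ (oriented upwards) does not meet $\Gamma$. The conjugated kernel is $\tilde K_{n,s,t}(x,y):=K_{n,s,t}(x,y)e^{f_n(t,y)-f_n(s,x)}$ with $f_n(s,x):=-nG_0x+\frac{nG_0^2s}{2}$. Extended Airy kernel: \[\mathbb K^{\rm Ai}_{\tau_1,\tau_2}(u,v)=\frac{1}{(2\pi i)^2}\int_{\Sigma^{\rm Ai}}d\zeta\int_{\Gamma^{\rm Ai}}d\omega\,\frac{\exp\left(\frac{\zeta^3}{3}-\zeta v-\tau_2\zeta^2-\frac{\omega^3}{3}+\omega u+\tau_1\omega^2\right)}{\zeta-\omega}-1(\tau_1>\tau_2)\frac{1}{\sqrt{4\pi(\tau_1-\tau_2)}}e^{-\frac{(u-v)^2}{4(\tau_1-\tau_2)}},\]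 where $\Sigma^{\rm Ai}$ consists of the rays from $\infty e^{-i\pi/3}$ to $0$ and from $0$ to $\infty e^{i\pi/3}$, and $\Gamma^{\rm Ai}$ consists of the rays from $\infty e^{-2i\pi/3}$ to $0$ and from $0$ to $\infty e^{2i\pi/3}$. *)

theory Defs
  imports "HOL-Complex_Analysis.Complex_Analysis" "HOL-Library.Landau_Symbols"
begin

text \<open>Initial points: X0 n j for j = 1..n is X_j(0) for the n-particle system.\<close>

definition Fn :: "(nat \<Rightarrow> nat \<Rightarrow> real) \<Rightarrow> nat \<Rightarrow> real \<Rightarrow> real" where
  "Fn X0 n x = real (card {j\<in>{1..n}. X0 n j \<le> x}) / real n"

definition Fmu :: "(real \<Rightarrow> real) \<Rightarrow> real \<Rightarrow> real" where
  "Fmu psi x = (LINT s:{..x}|lborel. psi s)"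

definition supp_dens :: "(real \<Rightarrow> real) \<Rightarrow> real set" where
  "supp_dens psi = {x. \<forall>e>0. (LINT s:ball x e|lborel. psi s) > 0}"

text \<open>G_j = G_mu^(j)(x*) = (-1)^j j! int mu(ds)/(x*-s)^(j+1).\<close>
definition Gder :: "(real \<Rightarrow> real) \<Rightarrow> real \<Rightarrow> nat \<Rightarrow> real" where
  "Gder psi xs j = (-1)^j * fact j * (LINT s|lborel. psi s / (xs - s)^(j+1))"

definition tcr :: "(real \<Rightarrow> real) \<Rightarrow> real \<Rightarrow> real" where
  "tcr psi xs = 1 / (LINT s|lborel. psi s / (xs - s)^2)"

definition c2 :: "(real \<Rightarrow> real) \<Rightarrow> real \<Rightarrow> real" where
  "c2 psi xs = 2 powr (1/3) / (Gder psi xs 2 powr (1/3) * tcr psi xs)"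

definition tAi :: "(real \<Rightarrow> real) \<Rightarrow> real \<Rightarrow> nat \<Rightarrow> real \<Rightarrow> real" where
  "tAi psi xs n \<tau> = tcr psi xs + 2 * \<tau> / ((c2 psi xs)^2 * real n powr (1/3))"

definition xAi :: "(real \<Rightarrow> real) \<Rightarrow> real \<Rightarrow> nat \<Rightarrow> real \<Rightarrow> real" where
  "xAi psi xs n \<tau> = xs + tAi psi xs n \<tau> * Gder psi xs 0"

definition gmun :: "(nat \<Rightarrow> nat \<Rightarrow> real) \<Rightarrow> nat \<Rightarrow> complex \<Rightarrow> complex" where
  "gmun X0 n z = (\<Sum>j=1..n. Ln (z - of_real (X0 n j))) / of_nat n"

text \<open>Correlation kernel of NIBM.  Concrete admissible choice of contours:
  Gamma = positively oriented circle of radius R centred at 0 enclosing all initial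
  points, and the vertical line Re z = x0 = R + 1 (parametrised z = x0 + i r, dz = i dr).
  By Cauchy's theorem the value does not depend on this choice.\<close>
definition KNIBM :: "(nat \<Rightarrow> nat \<Rightarrow> real) \<Rightarrow> nat \<Rightarrow> real \<Rightarrow> real \<Rightarrow> real \<Rightarrow> real \<Rightarrow> complex" where
  "KNIBM X0 n s t x y =
    (let R = 1 + Max {\<bar>X0 n j\<bar> | j. j \<in> {1..n}};
         x0 = R + 1;
         N = (of_nat n :: complex)
     in N / ((2 * of_real pi * \<i>)^2 * of_real (sqrt (s * t))) *
        (LINT r|lborel.
           \<i> * contour_integral (circlepath 0 R)
             (\<lambda>w. let z = of_real x0 + \<i> * of_real r in
                 exp (N / (2 * of_real t) * ((z - of_real y)^2 + 2 * of_real t * gmun X0 n z)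
                      - N / (2 * of_real s) * ((w - of_real x)^2 + 2 * of_real s * gmun X0 n w))
                 / (z - w)))
     - (if s > t then of_real (sqrt (real n) / sqrt (2 * pi * (s - t))
                                * exp (- real n * (x - y)^2 / (2 * (s - t)))) else 0))"

definition fconj :: "(real \<Rightarrow> real) \<Rightarrow> real \<Rightarrow> nat \<Rightarrow> real \<Rightarrow> real \<Rightarrow> real" where
  "fconj psi xs n s x = - real n * Gder psi xs 0 * x + real n * (Gder psi xs 0)^2 * s / 2"

definition KNIBMconj :: "(nat \<Rightarrow> nat \<Rightarrow> real) \<Rightarrow> (real \<Rightarrow> real) \<Rightarrow> real \<Rightarrow> nat
    \<Rightarrow> real \<Rightarrow> real \<Rightarrow> real \<Rightarrow> real \<Rightarrow> complex" where
  "KNIBMconj X0 psi xs n s t x y =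
     KNIBM X0 n s t x y * of_real (exp (fconj psi xs n t y - fconj psi xs n s x))"

text \<open>Airy contours parametrised over the real line.
  Sigma^Ai: r<0 gives zeta = -r e^{-i pi/3} (from infinity e^{-i pi/3} to 0),
  r>=0 gives zeta = r e^{i pi/3} (from 0 to infinity e^{i pi/3}).
  Gamma^Ai analogous with angles -+2pi/3.\<close>
definition rayp :: "real \<Rightarrow> real \<Rightarrow> complex" where
  "rayp \<theta> r = (if r < 0 then of_real (- r) * cis (- \<theta>) else of_real r * cis \<theta>)"

definition rayp' :: "real \<Rightarrow> real \<Rightarrow> complex" where
  "rayp' \<theta> r = (if r < 0 then - cis (- \<theta>) else cis \<theta>)"

definition KAiry :: "real \<Rightarrow> real \<Rightarrow> real \<Rightarrow> real \<Rightarrow> complex" where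
  "KAiry \<tau>1 \<tau>2 u v =
     1 / (2 * of_real pi * \<i>)^2 *
       (LINT r|lborel. LINT q|lborel.
          (let \<zeta> = rayp (pi/3) r; \<omega> = rayp (2*pi/3) q in
            exp (\<zeta>^3/3 - \<zeta> * of_real v - of_real \<tau>2 * \<zeta>^2
                 - \<omega>^3/3 + \<omega> * of_real u + of_real \<tau>1 * \<omega>^2) / (\<zeta> - \<omega>)
            * rayp' (pi/3) r * rayp' (2*pi/3) q))
     - (if \<tau>1 > \<tau>2 then of_real (1 / sqrt (4 * pi * (\<tau>1 - \<tau>2))
                                  * exp (- ((u - v)^2) / (4 * (\<tau>1 - \<tau>2)))) else 0)"

end

theory Submission
  imports Defs
begin

text \<open>
  Conjugating the kernel and putting \<open>z = xs + h\<close> turns the exponential weights into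
  \<open>E0 n h = exp (n (h^2 / (2 t0) - G0 h)) * \<Prod>\<^sub>j (1 + h / (xs - X\<^sub>j))\<close>, up to factors that are elementary on the
  Airy scale \<open>h = hs n * \<zeta>\<close>; the Gaussian parts of the two kernels agree exactly.  Since the initial points
  keep the distance \<open>n powr (- 1 / (\<kappa> + 1))\<close> from \<open>xs\<close>, the rate in Assumption 2 controls
  their inverse moments of order at most three, and a cubic expansion gives \<open>E0 n (hs n * \<zeta>) \<approx> exp (\<zeta>^3 / 3)\<close>
  as long as \<open>\<zeta>\<close> is not too large; on the vertical line a Gaussian bound holds globally.

  The contour around the points has to be continued to a macroscopic distance so that \<open>1 / E0 n\<close> stays
  exponentially small, although no limiting steepest descent path is known.  Along vertical lines \<open>ln |E0 n|\<close> is concave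
  in \<open>y^2\<close>, so the set of \<open>h\<close> in the upper half plane where \<open>|E0 n h|\<close> is eventually not much smaller
  than at the starting point has connected fibres, and the maximum modulus principle shows that no fibre is empty.
  This set is therefore connected and open, which yields the path; its reflection closes the contour.
\<close>

text \<open>The vertical line must pass just to the right of \<open>xs\<close>, with initial points
  on both sides, while the circle in the kernel winds around all of them. It is therefore split into
  one loop on each side of the line: the left loop carries the Airy contour, the right one is
  negligible. Both Airy contours are pushed to distance s from the origin, and s >= 2 \<sigma> is
  what produces exp (- \<sigma> (u + v)).

  The inverse moments of order p are off by n^(p \<gamma> - 1) with \<gamma> = 1 / (\<kappa> + 1),
  which for h of order n^(-1/3) gives an error n^(\<gamma> - 1/3) in the exponent. The bound on
  \<epsilon> says 2 \<epsilon> < 1/3 - \<gamma>, which leaves room for \<zeta> up to n^(\<epsilon> /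
  8).

  At macroscopic distance only weak convergence is available. It makes the exponential rate of |E0 n
  h| / |E0 n P| converge at every h off the real axis, so that at each point E0 is either eventually
  not much smaller than at P or eventually much smaller. This dichotomy turns an empty fibre into an
  upper bound on a whole line.\<close>

abbreviation for_large :: "(nat \<Rightarrow> bool) \<Rightarrow> bool" (binder "EV " 10) where
  "for_large P \<equiv> eventually P sequentially"

section \<open>Contour integral tools\<close>

lemma integrable_exp_minus_abs: "integrable lborel (\<lambda>y::real. exp (- \<bar>y\<bar>))"
proof -
  have "(\<lambda>y::real. exp (- 1 * y)) absolutely_integrable_on {0..}"
    by (intro nonnegative_absolutely_integrable_1)
       (use has_integral_exp_minus_to_infinity[of 1 0] in \<open>auto simp: integrable_on_def\<close>)
  then have *: "set_integrable lborel {0..} (\<lambda>y::real. exp (-y))"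
    unfolding absolutely_integrable_on_def set_integrable_def
    by (subst integrable_completion[symmetric]) auto
  have **: "set_integrable lborel {..0} (\<lambda>y::real. exp y)"
    using * unfolding set_integrable_def
    by (subst lborel_integrable_real_affine_iff[where c="-1" and t=0, symmetric])
       (auto elim!: back_subst[of "integrable lborel"] simp: indicator_def)
  have "set_integrable lborel ({0..} \<union> {..0}) (\<lambda>y::real. exp (-\<bar>y\<bar>))"
  proof (intro set_integrable_Un)
    have "(\<lambda>y::real. indicator {0..} y *\<^sub>R exp (-\<bar>y\<bar>)) = (\<lambda>y. indicator {0..} y *\<^sub>R exp (-y))"
      by (auto simp: fun_eq_iff indicator_def)
    then show "set_integrable lborel {0..} (\<lambda>y::real. exp (-\<bar>y\<bar>))"
      using * by (simp add: set_integrable_def)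
    have "(\<lambda>y::real. indicator {..0} y *\<^sub>R exp (-\<bar>y\<bar>)) = (\<lambda>y. indicator {..0} y *\<^sub>R exp y)"
      by (auto simp: fun_eq_iff indicator_def)
    then show "set_integrable lborel {..0} (\<lambda>y::real. exp (-\<bar>y\<bar>))"
      using ** by (simp add: set_integrable_def)
  qed auto
  moreover have "{0..} \<union> {..0} = (UNIV::real set)" by auto
  ultimately show ?thesis by (simp add: set_integrable_def)
qed

lemma integrable_exp_decay:
  fixes f :: "real \<Rightarrow> complex"
  assumes "f \<in> borel_measurable borel" "\<And>y. norm (f y) <= K * exp (- \<bar>y\<bar>)"
  shows "integrable lborel f"
  by (rule Bochner_Integration.integrable_bound[OF integrable_mult_right[OF integrable_exp_minus_abs, of K]])
     (use assms in \<open>auto intro!: always_eventually intro: order_trans[OF _ abs_ge_self]\<close>)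

lemma integral_interval_tendsto:
  fixes f :: "real \<Rightarrow> complex"
  assumes "integrable lborel f"
  shows "(\<lambda>k. integral {- real k..real k} f) \<longlonglongrightarrow> (LINT y|lborel. f y)"
proof -
  have "(\<lambda>k. LINT y|lborel. indicator {- real k..real k} y *\<^sub>R f y) \<longlonglongrightarrow> (LINT y|lborel. f y)"
  proof (rule integral_dominated_convergence[where w="\<lambda>y. norm (f y)"])
    show "AE y in lborel. (\<lambda>k. indicator {- real k..real k} y *\<^sub>R f y) \<longlonglongrightarrow> f y"
    proof (rule always_eventually, rule allI)
      fix y :: real
      obtain k0 :: nat where "\<bar>y\<bar> <= real k0" using real_arch_simple by blast
      then have "\<forall>\<^sub>F k in sequentially. indicator {- real k..real k} y *\<^sub>R f y = f y"
        by (intro eventually_sequentiallyI[of k0]) (auto simp: indicator_def)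
      then show "(\<lambda>k. indicator {- real k..real k} y *\<^sub>R f y) \<longlonglongrightarrow> f y"
        by (rule tendsto_eventually)
    qed
  qed (use assms in \<open>auto simp: indicator_def\<close>)
  moreover have "(LINT y|lborel. indicator {- real k..real k} y *\<^sub>R f y) = integral {- real k..real k} f" for k
    using set_borel_integral_eq_integral(2)[of "{- real k..real k}" f] assms
    by (simp add: set_lebesgue_integral_def set_integrable_def integrable_mult_indicator)
  ultimately show ?thesis by simp
qed

text \<open>Both integrals are telescoped through one primitive on the convex set; only the
  increments of the primitive along the connecting segments at height \<^term>\<open>H\<close> remain.\<close>

lemma contour_shift:
  fixes f :: "complex \<Rightarrow> complex" and p q p' q' :: "real \<Rightarrow> complex"
  assumes S: "convex S" "open S" "f holomorphic_on S"
    and p: "continuous_on UNIV p" "\<And>y. p y \<in> S" "\<And>y. y \<noteq> 0 ==> (p has_vector_derivative p' y) (at y)"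
    and q: "continuous_on UNIV q" "\<And>y. q y \<in> S" "\<And>y. y \<noteq> 0 ==> (q has_vector_derivative q' y) (at y)"
    and ip: "integrable lborel (\<lambda>y. f (p y) * p' y)"
    and iq: "integrable lborel (\<lambda>y. f (q y) * q' y)"
    and lim: "\<And>e. e > 0 ==> \<exists>H0. \<forall>H. \<bar>H\<bar> >= H0 -->
                (\<forall>z\<in>closed_segment (p H) (q H). norm (f z) * norm (q H - p H) <= e)"
  shows "(LINT y|lborel. f (p y) * p' y) = (LINT y|lborel. f (q y) * q' y)"
proof -
  obtain P where P: "\<And>x. x \<in> S ==> (P has_field_derivative f x) (at x within S)"
    using holomorphic_convex_primitive'[OF S] by metis
  have P': "(P has_field_derivative f x) (at x)" if "x \<in> S" for x
    using P[OF that] S(2) that at_within_open by metis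
  have contP: "continuous_on S P"
    using P' by (meson DERIV_isCont continuous_at_imp_continuous_on)
  have ftc: "integral {- real k..real k} (\<lambda>y. f (r y) * r' y) = P (r (real k)) - P (r (- real k))"
    if r: "continuous_on UNIV r" "\<And>y. r y \<in> S" "\<And>y. y \<noteq> 0 ==> (r has_vector_derivative r' y) (at y)"
    for r r' :: "real \<Rightarrow> complex" and k :: nat
  \<comment> \<open>Rays and vees have a corner at parameter 0, so the exceptional set
    \<open>{0}\<close> is left out of the derivative condition and only continuity is asked
    there.\<close>
  proof (rule integral_unique, rule fundamental_theorem_of_calculus_interior_strong[where S="{0}" and f="\<lambda>y. P (r y)"])
    fix x assume "x \<in> {- real k<..<real k} - {0}"
    then have "(r has_vector_derivative r' x) (at x)" using r by auto
    from field_vector_diff_chain_at[OF this P'[OF r(2)]]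
    show "((\<lambda>y. P (r y)) has_vector_derivative f (r x) * r' x) (at x)"
      by (simp add: o_def mult.commute)
  next
    show "continuous_on {- real k..real k} (\<lambda>y. P (r y))"
      by (rule continuous_on_compose2[OF contP]) (use r in \<open>auto intro: continuous_on_subset\<close>)
  qed auto
  have incr: "\<exists>H0. \<forall>H. \<bar>H\<bar> >= H0 --> norm (P (q H) - P (p H)) <= e" if "e > 0" for e
  proof -
    from lim[OF that] obtain H0 where H0: "\<forall>H. \<bar>H\<bar> >= H0 --> (\<forall>z\<in>closed_segment (p H) (q H). norm (f z) * norm (q H - p H) <= e)" ..
    have "norm (P (q H) - P (p H)) <= e" if H: "\<bar>H\<bar> >= H0" for H
    proof (cases "q H = p H")
      case False
      let ?T = "closed_segment (p H) (q H)"
      have sub: "?T \<subseteq> S" using closed_segment_subset[OF p(2) q(2) S(1)] .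
      have "norm (P (q H) - P (p H)) <= (e / norm (q H - p H)) * norm (q H - p H)"
      proof (rule field_differentiable_bound[where S="?T" and f'=f])
        fix z assume z: "z \<in> ?T"
        show "(P has_field_derivative f z) (at z within ?T)"
          using P[of z] sub z DERIV_subset by blast
        show "norm (f z) <= e / norm (q H - p H)"
          using H0[rule_format, OF H z] False by (simp add: field_simps)
      qed auto
      then show ?thesis using False by simp
    qed (use \<open>e > 0\<close> in auto)
    then show ?thesis by blast
  qed
  have "(\<lambda>k. integral {- real k..real k} (\<lambda>y. f (q y) * q' y) - integral {- real k..real k} (\<lambda>y. f (p y) * p' y)) \<longlonglongrightarrow> 0"
  proof (rule LIMSEQ_I)
    fix r :: real assume r: "r > 0"
    obtain H0 where H0: "\<forall>H. \<bar>H\<bar> >= H0 --> norm (P (q H) - P (p H)) <= r / 3"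
      using incr[of "r/3"] r by auto
    obtain k0 :: nat where k0: "H0 <= real k0" using real_arch_simple by blast
    show "\<exists>no. \<forall>k\<ge>no. norm (integral {- real k..real k} (\<lambda>y. f (q y) * q' y) - integral {- real k..real k} (\<lambda>y. f (p y) * p' y) - 0) < r"
    proof (intro exI allI impI)
      fix k assume "k >= k0"
      then have a: "norm (P (q (real k)) - P (p (real k))) <= r/3" "norm (P (q (- real k)) - P (p (- real k))) <= r/3"
        using H0 k0 by auto
      have "norm ((P (q (real k)) - P (p (real k))) - (P (q (- real k)) - P (p (- real k)))) <= r/3 + r/3"
        using a norm_triangle_ineq4[of "P (q (real k)) - P (p (real k))"] by (smt (verit))
      have e: "integral {- real k..real k} (\<lambda>y. f (q y) * q' y) = P (q (real k)) - P (q (- real k))"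
        "integral {- real k..real k} (\<lambda>y. f (p y) * p' y) = P (p (real k)) - P (p (- real k))"
        using ftc[of q q' k] ftc[of p p' k] p q by blast+
      from \<open>norm (_ - _) <= r/3 + r/3\<close> show "norm (integral {- real k..real k} (\<lambda>y. f (q y) * q' y) - integral {- real k..real k} (\<lambda>y. f (p y) * p' y) - 0) < r"
        using r unfolding e by (simp add: algebra_simps)
    qed
  qed
  moreover have "(\<lambda>k. integral {- real k..real k} (\<lambda>y. f (q y) * q' y) - integral {- real k..real k} (\<lambda>y. f (p y) * p' y))
      \<longlonglongrightarrow> (LINT y|lborel. f (q y) * q' y) - (LINT y|lborel. f (p y) * p' y)"
    by (intro tendsto_diff integral_interval_tendsto ip iq)
  ultimately show ?thesis using LIMSEQ_unique by fastforce
qed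

lemma cubic_exp_bound:
  fixes A B D :: real
  assumes "D > 0"
  shows "\<exists>K. \<forall>b\<ge>0. A * b + B * b^2 - D * b^3 <= K - b"
proof -
  \<comment> \<open>Beyond \<open>b0\<close> the cubic term alone beats |A| b + |B| b^2 + b, because
    D b >= |A| + 1 + |B| and b >= 1 there; below it everything is bounded.\<close>
  define b0 where "b0 = 1 + (\<bar>A\<bar> + 1 + \<bar>B\<bar>) / D"
  have b0: "b0 >= 1" using assms by (simp add: b0_def)
  show ?thesis
  proof (intro exI allI impI)
    fix b :: real assume b: "b >= 0"
    show "A * b + B * b^2 - D * b^3 <= ((\<bar>A\<bar>+1) * b0 + \<bar>B\<bar> * b0^2) - b"
    proof (cases "b <= b0")
      case True
      have "A * b <= \<bar>A\<bar> * b" "B * b^2 <= \<bar>B\<bar> * b^2" using b by (auto intro!: mult_right_mono)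
      moreover have "(\<bar>A\<bar>+1) * b <= (\<bar>A\<bar>+1) * b0" "\<bar>B\<bar> * b^2 <= \<bar>B\<bar> * b0^2"
        using True b by (auto intro!: mult_left_mono power_mono)
      moreover have "D * b^3 >= 0" using assms b by simp
      ultimately show ?thesis by (simp add: algebra_simps)
    next
      case False
      then have b1: "b >= 1" using b0 by linarith
      have "\<bar>A\<bar> + 1 + \<bar>B\<bar> <= D * b0" using assms by (simp add: b0_def field_simps)
      also have "\<dots> <= D * b" using False assms by simp
      finally have "(\<bar>A\<bar> + 1 + \<bar>B\<bar>) * b^2 <= D * b * b^2" by (intro mult_right_mono) auto
      then have 1: "(\<bar>A\<bar> + 1) * b^2 + \<bar>B\<bar> * b^2 <= D * b^3" by (simp add: algebra_simps power2_eq_square power3_eq_cube)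
      have "b <= b^2" using b1 by (simp add: power2_eq_square)
      then have "(\<bar>A\<bar> + 1) * b <= (\<bar>A\<bar> + 1) * b^2" by (intro mult_left_mono) auto
      moreover have "A * b <= \<bar>A\<bar> * b" "B * b^2 <= \<bar>B\<bar> * b^2" using b by (auto intro!: mult_right_mono)
      moreover have "(\<bar>A\<bar>+1) * b0 + \<bar>B\<bar> * b0^2 >= 0" using b0 by auto
      ultimately show ?thesis using 1 by (simp add: algebra_simps)
    qed
  qed
qed

lemma quadratic_exp_bound:
  fixes A D :: real
  assumes "D > 0"
  shows "\<exists>K. \<forall>b\<ge>0. A * b - D * b^2 <= K - b"
proof (intro exI allI impI)
  fix b :: real
  have "0 <= D * (b - (A+1)/(2*D))^2" using assms by simp
  also have "\<dots> = D * b^2 - (A+1) * b + (A+1)^2/(4*D)"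
    using assms by (simp add: power2_eq_square field_simps)
  finally show "A * b - D * b^2 <= (A+1)^2/(4*D) - b" by (simp add: algebra_simps)
qed

text \<open>Factors are exchanged one at a time. For the factors z - X j and w - X j every
  difference a k - b k is z - w, which exhibits the difference quotient of the polynomial as a
  finite sum of terms separated in z and w.\<close>

lemma prod_diff_telescope:
  fixes a b :: "nat \<Rightarrow> complex"
  shows "(\<Prod>j=1..n. a j) - (\<Prod>j=1..n. b j)
     = (\<Sum>k=1..n. (a k - b k) * ((\<Prod>j=1..<k. a j) * (\<Prod>j\<in>{k<..n}. b j)))"
proof (induction n)
  case (Suc n)
  have 1: "(\<Prod>j\<in>{k<..Suc n}. b j) = (\<Prod>j\<in>{k<..n}. b j) * b (Suc n)" if "k <= n" for k
  proof -
    have "{k<..Suc n} = insert (Suc n) {k<..n}" using that by auto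
    then show ?thesis by (simp add: mult.commute)
  qed
  have "(\<Sum>k=1..Suc n. (a k - b k) * ((\<Prod>j=1..<k. a j) * (\<Prod>j\<in>{k<..Suc n}. b j)))
     = (\<Sum>k=1..n. (a k - b k) * ((\<Prod>j=1..<k. a j) * (\<Prod>j\<in>{k<..n}. b j))) * b (Suc n)
       + (a (Suc n) - b (Suc n)) * (\<Prod>j=1..n. a j)"
    by (simp add: sum_distrib_right 1 mult.assoc atLeastLessThanSuc_atLeastAtMost)
  also have "\<dots> = (\<Prod>j=1..Suc n. a j) - (\<Prod>j=1..Suc n. b j)"
    unfolding Suc.IH[symmetric] by (simp add: algebra_simps)
  finally show ?case by simp
qed simp

text \<open>For w in the closed upper half plane the number - i (w - x) has real part Im w >= 0, so
  away from x it never meets the branch cut, and its principal logarithm is a primitive along the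
  whole path.\<close>

lemma contour_integral_inverse_upper:
  fixes U :: "real \<Rightarrow> complex" and x :: real
  assumes U: "valid_path U" "\<And>z. z \<in> path_image U ==> Im z >= 0" "of_real x \<notin> path_image U"
  shows "((\<lambda>w. 1 / (w - of_real x)) has_contour_integral
            (Ln (- \<i> * (pathfinish U - of_real x)) - Ln (- \<i> * (pathstart U - of_real x)))) U"
proof (rule contour_integral_primitive[OF _ U(1) subset_refl])
  fix w assume w: "w \<in> path_image U"
  have ne: "w \<noteq> of_real x" using w U by blast
  have "- \<i> * (w - of_real x) \<notin> \<real>\<^sub>\<le>\<^sub>0"
  proof
    assume "- \<i> * (w - of_real x) \<in> \<real>\<^sub>\<le>\<^sub>0"
    then have "Im w <= 0" "Re w = x" by (auto simp: complex_nonpos_Reals_iff)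
    with U(2)[OF w] have "w = of_real x" by (simp add: complex_eq_iff)
    with ne show False by simp
  qed
  then show "((\<lambda>w. Ln (- \<i> * (w - of_real x))) has_field_derivative 1 / (w - of_real x)) (at w within path_image U)"
    using ne by (auto intro!: derivative_eq_intros simp: field_simps)
qed

lemma Im_Ln_imag_axis:
  assumes "y \<noteq> 0" shows "Im (Ln (- \<i> * of_real y)) = (if y > 0 then - pi/2 else pi/2)"
proof (cases "y > 0")
  case True
  have "- \<i> * of_real y = of_real y * (-\<i>)" by simp
  moreover have "Ln (of_real y * (-\<i>)) = of_real (ln y) + Ln (-\<i>)" using Ln_times_of_real[of y "-\<i>"] Ln_of_real[of y] True by simp
  ultimately have "Ln (- \<i> * of_real y) = of_real (ln y) + Ln (-\<i>)" by metis
  then show ?thesis using True by simp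
next
  case False
  have "- \<i> * of_real y = of_real (-y) * \<i>" by simp
  moreover have "Ln (of_real (-y) * \<i>) = of_real (ln (-y)) + Ln \<i>"
    using Ln_times_of_real[of "-y" "\<i>"] Ln_of_real[of "-y"] False assms by simp
  ultimately have "Ln (- \<i> * of_real y) = of_real (ln (-y)) + Ln \<i>" by metis
  then show ?thesis using False by simp
qed

text \<open>Reflection conjugates the integral I of 1 / (w - x) along \<open>U\<close>, so the
  closed path contributes I - cnj I = 2 i Im I, and Im I depends only on which side of x the two
  real end points lie. The winding number is thus found without any knowledge of the path in
  between.\<close>

lemma winding_number_mirror_path:
  fixes U :: "real \<Rightarrow> complex" and x b A :: real
  assumes U: "valid_path U" "\<And>z. z \<in> path_image U ==> Im z >= 0" "of_real x \<notin> path_image U"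
    and ends: "pathstart U = of_real b" "pathfinish U = of_real A"
  defines "G \<equiv> U +++ reversepath (cnj \<circ> U)"
  shows "valid_path G" "pathfinish G = pathstart G" "path_image G = path_image U \<union> cnj ` path_image U"
    "winding_number G (of_real x) = (if x > A then 1/2 else -1/2) - (if x > b then 1/2 else -1/2) "
    "\<lbrakk>open S; f holomorphic_on S; path_image G \<subseteq> S\<rbrakk> \<Longrightarrow> contour_integral G f = contour_integral U f - contour_integral (cnj \<circ> U) f"
proof -
  have vc: "valid_path (cnj \<circ> U)" using U(1) valid_path_cnj by blast
  have joins: "pathfinish U = pathstart (reversepath (cnj \<circ> U))" by (simp add: ends pathfinish_compose)
  show v: "valid_path G" unfolding G_def by (intro valid_path_join U valid_path_imp_reverse vc joins)
  show loop: "pathfinish G = pathstart G" by (simp add: G_def ends pathstart_compose)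
  show im: "path_image G = path_image U \<union> cnj ` path_image U"
    unfolding G_def by (subst path_image_join) (auto simp: joins path_image_compose)
  have cx: "of_real x \<notin> cnj ` path_image U" using U(3) by (metis complex_cnj_complex_of_real complex_cnj_cnj imageE)
  have int: "contour_integral G f = contour_integral U f - contour_integral (cnj \<circ> U) f"
    if cf: "open S" "f holomorphic_on S" "path_image G \<subseteq> S" for f S
  proof -
    have vr: "valid_path (reversepath (cnj \<circ> U))" using vc by simp
    have i1: "f contour_integrable_on U"
      by (rule contour_integrable_holomorphic_simple[OF cf(2,1) U(1)]) (use im cf in auto)
    have i2: "f contour_integrable_on (cnj \<circ> U)"
      by (rule contour_integrable_holomorphic_simple[OF cf(2,1) vc]) (use im cf in \<open>auto simp: path_image_compose\<close>)
    have "contour_integral G f = contour_integral U f + contour_integral (reversepath (cnj \<circ> U)) f"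
      unfolding G_def using U vr i1 i2 vc by (simp add: contour_integral_join contour_integrable_reversepath)
    then show ?thesis by (simp add: contour_integral_reversepath vc)
  qed
  then show "\<lbrakk>open S; f holomorphic_on S; path_image G \<subseteq> S\<rbrakk> \<Longrightarrow> contour_integral G f = contour_integral U f - contour_integral (cnj \<circ> U) f" .
  have xG: "of_real x \<notin> path_image G" using im cx U by auto
  define I where "I = Ln (- \<i> * (of_real A - of_real x)) - Ln (- \<i> * (of_real b - of_real x))"
  have I1: "contour_integral U (\<lambda>w. 1 / (w - of_real x)) = I"
    using contour_integral_inverse_upper[OF U] contour_integral_unique ends by (simp add: I_def)
  have I2: "contour_integral (cnj \<circ> U) (\<lambda>w. 1 / (w - of_real x)) = cnj I"
  proof -
    have "cnj \<circ> (\<lambda>w. 1 / (w - of_real x)) \<circ> cnj = (\<lambda>w. 1 / (w - of_real x))" by (auto simp: fun_eq_iff)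
    then show ?thesis using I1 by (simp add: contour_integral_cnj[OF U(1)])
  qed
  have Ab: "A \<noteq> x" "b \<noteq> x" using U(3) ends by (metis pathfinish_in_path_image, metis pathstart_in_path_image)
  have "Im I = (if x > A then pi/2 else -pi/2) - (if x > b then pi/2 else -pi/2)"
    unfolding I_def using Im_Ln_imag_axis[of "A-x"] Im_Ln_imag_axis[of "b-x"] Ab by auto
  moreover have "winding_number G (of_real x) = of_real (Im I / pi)"
  proof -
    have "winding_number G (of_real x) = 1/(2*pi*\<i>) * (I - cnj I)"
      using xG I1 I2 int[of "- {of_real x}" "\<lambda>w. 1 / (w - of_real x)"] v
      by (subst winding_number_valid_path) (fastforce intro!: holomorphic_intros)+
    moreover have "I - cnj I = of_real (2 * Im I) * \<i>" by (simp add: complex_eq_iff)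
    ultimately show ?thesis by simp
  qed
  ultimately show "winding_number G (of_real x) = (if x > A then 1/2 else -1/2) - (if x > b then 1/2 else -1/2)"
    by (auto simp: add_divide_distrib diff_divide_distrib)
qed

text \<open>Clearing the denominator turns the contour integral over the circle into a polynomial in
  \<^term>\<open>z\<close> (the difference quotient of \<^term>\<open>\<lambda>z. \<Prod>j=1..n. z - of_real (X j)\<close> is a polynomial), so
  the vertical line can be moved across the circle; afterwards the circle may be split.\<close>

lemma double_contour_shift:
  fixes X :: "nat \<Rightarrow> real" and n :: nat and R x1 \<alpha> \<beta> :: real and F :: "complex \<Rightarrow> complex" and \<Gamma> \<Delta> :: "real \<Rightarrow> complex"
  defines "p \<equiv> \<lambda>z. \<Prod>j=1..n. z - of_real (X j)"
    and "A \<equiv> \<lambda>z. exp (of_real \<alpha> * z^2 + of_real \<beta> * z)"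
    and "l \<equiv> \<lambda>x r. of_real x + \<i> * of_real r"
  assumes X: "\<And>j. j \<in> {1..n} ==> \<bar>X j\<bar> < R" and R: "R > 0" and \<alpha>: "\<alpha> > 0" and F: "F holomorphic_on UNIV"
    and \<Gamma>: "valid_path \<Gamma>" "pathfinish \<Gamma> = pathstart \<Gamma>" "\<And>w. w \<in> path_image \<Gamma> ==> Re w < x1" "path_image \<Gamma> \<inter> of_real ` X ` {1..n} = {}"
    and \<Delta>: "valid_path \<Delta>" "pathfinish \<Delta> = pathstart \<Delta>" "\<And>w. w \<in> path_image \<Delta> ==> Re w > x1" "path_image \<Delta> \<inter> of_real ` X ` {1..n} = {}"
    and wn: "\<And>j. j \<in> {1..n} ==> winding_number \<Gamma> (of_real (X j)) + winding_number \<Delta> (of_real (X j)) = 1"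
  defines "f1 \<equiv> \<lambda>r. A (l (R+1) r) * p (l (R+1) r) * contour_integral (circlepath 0 R) (\<lambda>w. F w / (p w * (l (R+1) r - w)))"
    and "f2 \<equiv> \<lambda>r. A (l x1 r) * p (l x1 r) * (contour_integral \<Gamma> (\<lambda>w. F w / (p w * (l x1 r - w)))
                 + contour_integral \<Delta> (\<lambda>w. F w / (p w * (l x1 r - w))))"
  shows "integrable lborel f2" "(LINT r|lborel. f1 r) = (LINT r|lborel. f2 r)"
proof -
  define P where "P = complex_of_real ` X ` {1..n}"
  have finP: "finite P" by (simp add: P_def)
  have p0: "p w = 0 \<longleftrightarrow> w \<in> P" for w by (auto simp: p_def P_def)
  have holp: "p holomorphic_on S" for S unfolding p_def by (intro holomorphic_intros)
  \<comment> \<open>The telescoped difference quotient q z w: \<open>Z k\<close> holds the factors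
    in z and \<open>W k\<close> those in w, so integration in w leaves a polynomial \<open>V\<close>
    in z with constants \<open>c k\<close>.\<close>
  define Z where "Z = (\<lambda>k z. \<Prod>j=1..<k. z - complex_of_real (X j))"
  define W where "W = (\<lambda>k w. \<Prod>j\<in>{k<..n}. w - complex_of_real (X j))"
  define q where "q = (\<lambda>z w. \<Sum>k=1..n. Z k z * W k w)"
  have q: "p z - p w = (z - w) * q z w" for z w
    unfolding p_def q_def Z_def W_def sum_distrib_left
    by (subst prod_diff_telescope) (auto intro!: sum.cong)
  define c where "c = (\<lambda>k. contour_integral (circlepath 0 R) (\<lambda>w. F w / p w * W k w))"
  define V where "V = (\<lambda>z. \<Sum>k=1..n. Z k z * c k)"
  have holW: "W k holomorphic_on S" for k S unfolding W_def by (intro holomorphic_intros)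
  have holG: "(\<lambda>w. F w / p w * q z w) holomorphic_on UNIV - P" for z
    unfolding q_def by (intro holomorphic_intros holomorphic_on_subset[OF F] holp holW) (auto simp: p0)
  have cR: "path_image (circlepath 0 R) \<subseteq> UNIV - P"
    using X R by (force simp: P_def sphere_def)
  have V: "V z = contour_integral (circlepath 0 R) (\<lambda>w. F w / p w * q z w)" for z
  proof -
    have "((\<lambda>w. \<Sum>k=1..n. Z k z * (F w / p w * W k w)) has_contour_integral V z) (circlepath 0 R)"
      unfolding V_def c_def
    proof (intro has_contour_integral_sum has_contour_integral_lmul has_contour_integral_integral)
      fix k
      show "(\<lambda>w. F w / p w * W k w) contour_integrable_on circlepath 0 R"
        by (rule contour_integrable_holomorphic_simple[of _ "UNIV - P"])
           (use cR finP p0 in \<open>auto intro!: holomorphic_intros holomorphic_on_subset[OF F] holp holW simp: open_Diff finite_imp_closed\<close>)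
    qed auto
    moreover have "(\<lambda>w. \<Sum>k=1..n. Z k z * (F w / p w * W k w)) = (\<lambda>w. F w / p w * q z w)"
      unfolding q_def by (auto simp: sum_distrib_left algebra_simps)
    ultimately show ?thesis using contour_integral_unique by metis
  qed
  \<comment> \<open>Since q z w = (p z - p w) / (z - w), the p w part leaves F w / (z - w), which is
    holomorphic in w on a convex set containing the loop but not z; Cauchy's theorem removes
    it.\<close>
  have split: "contour_integral g (\<lambda>w. F w / p w * q z w) = p z * contour_integral g (\<lambda>w. F w / (p w * (z - w)))"
    if g: "valid_path g" "pathfinish g = pathstart g" "path_image g \<subseteq> UNIV - P"
      and C: "convex C" "path_image g \<subseteq> C" "z \<notin> C" for g C z
  proof -
    have h0: "((\<lambda>w. F w / (z - w)) has_contour_integral 0) g"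
      by (rule Cauchy_theorem_convex_simple[OF _ C(1) g(1) C(2) g(2)])
         (use C in \<open>auto intro!: holomorphic_intros holomorphic_on_subset[OF F]\<close>)
    have zg: "z \<notin> path_image g" using C by auto
    have "(\<lambda>w. F w / (p w * (z - w))) contour_integrable_on g"
      by (rule contour_integrable_holomorphic_simple[of _ "UNIV - insert z P"])
         (use g zg finP p0 in \<open>auto intro!: holomorphic_intros holomorphic_on_subset[OF F] holp simp: open_Diff finite_imp_closed\<close>)
    then have "((\<lambda>w. p z * (F w / (p w * (z - w)))) has_contour_integral p z * contour_integral g (\<lambda>w. F w / (p w * (z - w)))) g"
      by (intro has_contour_integral_lmul has_contour_integral_integral)
    from has_contour_integral_diff[OF this h0]
    have "((\<lambda>w. p z * (F w / (p w * (z - w))) - F w / (z - w)) has_contour_integral p z * contour_integral g (\<lambda>w. F w / (p w * (z - w)))) g"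
      by simp
    moreover have "p z * (F w / (p w * (z - w))) - F w / (z - w) = F w / p w * q z w" if "w \<in> path_image g" for w
    proof -
      have "w \<noteq> z" "p w \<noteq> 0" using that zg g p0 by auto
      moreover have "p z = p w + (z - w) * q z w" unfolding q[of z w, symmetric] by simp
      ultimately show ?thesis by (simp add: divide_simps) (simp add: algebra_simps)
    qed
    ultimately show ?thesis by (metis (no_types, lifting) contour_integral_unique has_contour_integral_eq)
  qed
  have V1: "V (l (R+1) r) = p (l (R+1) r) * contour_integral (circlepath 0 R) (\<lambda>w. F w / (p w * (l (R+1) r - w)))" for r
  proof -
    have "R + 1 <= cmod (l (R+1) r)" using complex_Re_le_cmod[of "l (R+1) r"] by (simp add: l_def)
    then have "l (R+1) r \<notin> cball 0 R" by auto
    then show ?thesis unfolding V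
      by (intro split[of _ "cball 0 R"]) (use cR R in auto)
  qed
  \<comment> \<open>The integrand with q has poles only at the initial points, so a loop enters only
    through its winding numbers there; by \<open>wn\<close> the circle and the pair of loops give
    the same sum.\<close>
  have res: "contour_integral g (\<lambda>w. F w / p w * q z w) = 2 * pi * \<i> * (\<Sum>x\<in>P. winding_number g x * residue (\<lambda>w. F w / p w * q z w) x)"
    if g: "valid_path g" "pathfinish g = pathstart g" "path_image g \<subseteq> UNIV - P" for g z
    by (rule Residue_theorem[OF open_UNIV _ finP holG]) (use g in auto)
  have \<Gamma>P: "path_image \<Gamma> \<subseteq> UNIV - P" and \<Delta>P: "path_image \<Delta> \<subseteq> UNIV - P" using \<Gamma>(4) \<Delta>(4) by (auto simp: P_def)
  have V2: "V (l x1 r) = p (l x1 r) * (contour_integral \<Gamma> (\<lambda>w. F w / (p w * (l x1 r - w))) + contour_integral \<Delta> (\<lambda>w. F w / (p w * (l x1 r - w))))" for r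
  proof -
    let ?z = "l x1 r"
    have "V ?z = 2 * pi * \<i> * (\<Sum>x\<in>P. residue (\<lambda>w. F w / p w * q ?z w) x)"
    proof -
      have "winding_number (circlepath 0 R) x = 1" if "x \<in> P" for x
        by (rule winding_number_circlepath) (use that X in \<open>auto simp: P_def\<close>)
      then show ?thesis unfolding V using res[of "circlepath 0 R" ?z] cR by simp
    qed
    also have "\<dots> = 2 * pi * \<i> * (\<Sum>x\<in>P. (winding_number \<Gamma> x + winding_number \<Delta> x) * residue (\<lambda>w. F w / p w * q ?z w) x)"
    proof -
      have "winding_number \<Gamma> x + winding_number \<Delta> x = 1" if "x \<in> P" for x using wn that by (auto simp: P_def)
      then show ?thesis by simp
    qed
    also have "\<dots> = contour_integral \<Gamma> (\<lambda>w. F w / p w * q ?z w) + contour_integral \<Delta> (\<lambda>w. F w / p w * q ?z w)"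
      using res[OF \<Gamma>(1,2) \<Gamma>P] res[OF \<Delta>(1,2) \<Delta>P] by (simp add: sum.distrib algebra_simps)
    also have "\<dots> = p ?z * contour_integral \<Gamma> (\<lambda>w. F w / (p w * (?z - w))) + p ?z * contour_integral \<Delta> (\<lambda>w. F w / (p w * (?z - w)))"
      using split[OF \<Gamma>(1,2) \<Gamma>P, of "{w. Re w < x1}" ?z] split[OF \<Delta>(1,2) \<Delta>P, of "{w. Re w > x1}" ?z] \<Gamma>(3) \<Delta>(3)
      by (auto simp: l_def convex_halfspace_Re_lt convex_halfspace_Re_gt subset_iff)
    finally show ?thesis by (simp add: algebra_simps)
  qed
  have f1: "f1 r = A (l (R+1) r) * V (l (R+1) r)" for r by (simp add: f1_def V1)
  have f2: "f2 r = A (l x1 r) * V (l x1 r)" for r by (simp add: f2_def V2)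
  have holV: "V holomorphic_on S" for S unfolding V_def Z_def by (intro holomorphic_intros)
  have holAV: "(\<lambda>z. A z * V z) holomorphic_on S" for S unfolding A_def by (intro holomorphic_intros holV)
  define B where "B = max \<bar>x1\<bar> (R+1)"
  define C where "C = (\<Sum>k=1..n. cmod (c k))"
  \<comment> \<open>Crude exponential growth suffices, since the Gaussian in \<open>A\<close> beats
    it along vertical lines.\<close>
  have Vb: "cmod (V z) <= exp (real n * (cmod z + R)) * C" for z
  proof -
    have "cmod (Z k z) <= exp (real n * (cmod z + R))" if k: "k \<in> {1..n}" for k
    proof -
      have "cmod (Z k z) <= (\<Prod>j=1..<k. exp (cmod z + R))"
        unfolding Z_def prod_norm[symmetric]
      proof (rule prod_mono)
        fix j assume "j \<in> {1..<k}"
        then have "\<bar>X j\<bar> < R" using X k by auto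
        then have "cmod (z - complex_of_real (X j)) <= cmod z + R"
          using norm_triangle_ineq4[of z "complex_of_real (X j)"] by simp
        also have "\<dots> <= exp (cmod z + R)" using exp_ge_add_one_self[of "cmod z + R"] by linarith
        finally show "0 <= cmod (z - complex_of_real (X j)) \<and> cmod (z - complex_of_real (X j)) <= exp (cmod z + R)" by simp
      qed
      also have "\<dots> = exp (real (k-1) * (cmod z + R))" by (simp add: exp_of_nat_mult)
      also have "\<dots> <= exp (real n * (cmod z + R))" using k R by (auto intro!: mult_right_mono)
      finally show ?thesis .
    qed
    then have "cmod (Z k z * c k) <= exp (real n * (cmod z + R)) * cmod (c k)" if "k \<in> {1..n}" for k
      using that unfolding norm_mult by (intro mult_right_mono) auto
    then show ?thesis unfolding V_def C_def sum_distrib_left by (intro sum_norm_le) auto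
  qed
  have "C >= 0" by (auto simp: C_def intro: sum_nonneg)
  obtain K where K: "\<And>b. b >= 0 ==> real n * b - \<alpha> * b^2 <= K - b"
    using quadratic_exp_bound[OF \<alpha>, of "real n"] by blast
  define K' where "K' = exp (\<alpha> * B^2 + \<bar>\<beta>\<bar> * B + real n * (B + R) + K) * C"
  have decay: "cmod (A (l x r) * V (l x r)) <= K' * exp (- \<bar>r\<bar>)" if x: "\<bar>x\<bar> <= B" for x r
  proof -
    have "B >= 0" using x by linarith
    have "cmod (l x r) <= B + \<bar>r\<bar>" using norm_triangle_ineq[of "of_real x" "\<i> * of_real r"] x
      by (simp add: l_def norm_mult)
    then have n1: "real n * (cmod (l x r) + R) <= real n * (B + R) + real n * \<bar>r\<bar>"
      using mult_left_mono[of "cmod (l x r) + R" "B + \<bar>r\<bar> + R" "real n"] by (simp add: algebra_simps)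
    have A1: "cmod (A (l x r)) = exp (\<alpha> * (x^2 - r^2) + \<beta> * x)"
      by (simp add: A_def l_def power2_eq_square algebra_simps)
    have "\<alpha> * x^2 <= \<alpha> * B^2" using \<alpha> x by (simp add: abs_le_square_iff[symmetric])
    moreover have "\<beta> * x <= \<bar>\<beta>\<bar> * B" using mult_left_mono[OF x abs_ge_zero[of \<beta>]] abs_ge_self[of "\<beta> * x"] unfolding abs_mult by linarith
    moreover have "real n * \<bar>r\<bar> - \<alpha> * r^2 <= K - \<bar>r\<bar>" using K[of "\<bar>r\<bar>"] by simp
    ultimately have "\<alpha> * (x^2 - r^2) + \<beta> * x + real n * (cmod (l x r) + R) <= (\<alpha> * B^2 + \<bar>\<beta>\<bar> * B + real n * (B + R) + K) + (- \<bar>r\<bar>)"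
      using n1 by (simp add: algebra_simps)
    then have "exp (\<alpha> * (x^2 - r^2) + \<beta> * x + real n * (cmod (l x r) + R)) * C <= exp ((\<alpha> * B^2 + \<bar>\<beta>\<bar> * B + real n * (B + R) + K) + (- \<bar>r\<bar>)) * C"
      using \<open>C >= 0\<close> by (intro mult_right_mono) auto
    moreover have "cmod (A (l x r) * V (l x r)) <= exp (\<alpha> * (x^2 - r^2) + \<beta> * x) * (exp (real n * (cmod (l x r) + R)) * C)"
      unfolding norm_mult A1 by (intro mult_left_mono Vb) auto
    ultimately show ?thesis unfolding K'_def exp_add by (simp add: algebra_simps)
  qed
  have int: "integrable lborel (\<lambda>r. A (l x r) * V (l x r))" if "\<bar>x\<bar> <= B" for x
  proof (rule integrable_exp_decay[OF _ decay[OF that]])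
    have "continuous_on UNIV (\<lambda>r. A (l x r) * V (l x r))"
      by (rule continuous_on_compose2[OF holomorphic_on_imp_continuous_on[OF holAV[of UNIV]]])
         (auto simp: l_def intro!: continuous_intros)
    then show "(\<lambda>r. A (l x r) * V (l x r)) \<in> borel_measurable borel" by (rule borel_measurable_continuous_onI)
  qed
  have Bx: "\<bar>x1\<bar> <= B" "\<bar>R+1\<bar> <= B" using R by (auto simp: B_def)
  show "integrable lborel f2" using int[OF Bx(1)] by (simp add: f2[abs_def])
  have "(LINT r|lborel. A (l (R+1) r) * V (l (R+1) r) * \<i>) = (LINT r|lborel. A (l x1 r) * V (l x1 r) * \<i>)"
  proof (rule contour_shift[OF convex_UNIV open_UNIV holAV])
    show "continuous_on UNIV (l (R+1))" "continuous_on UNIV (l x1)" by (auto simp: l_def intro!: continuous_intros)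
    have d: "(l x has_vector_derivative \<i>) (at y)" for x y
      unfolding l_def by (auto intro!: derivative_eq_intros has_vector_derivative_real_field)
    show "(l (R+1) has_vector_derivative \<i>) (at y)" "(l x1 has_vector_derivative \<i>) (at y)" for y by (rule d)+
    show "integrable lborel (\<lambda>y. A (l x1 y) * V (l x1 y) * \<i>)" "integrable lborel (\<lambda>y. A (l (R+1) y) * V (l (R+1) y) * \<i>)"
      using int Bx by auto
    fix e :: real assume e: "e > 0"
    define N where "N = cmod (l x1 0 - l (R+1) 0)"
    have "((\<lambda>h. K' * exp (- h) * N) \<longlongrightarrow> K' * 0 * N) at_top"
      by (intro tendsto_intros filterlim_compose[OF exp_at_bot] filterlim_uminus_at_bot_at_top)
    then have "\<forall>\<^sub>F h in at_top. K' * exp (- h) * N < e" using e by (simp add: order_tendsto_iff)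
    then obtain H0 where H0: "\<And>h. h >= H0 ==> K' * exp (- h) * N < e" by (auto simp: eventually_at_top_linorder)
    show "\<exists>H0. \<forall>H. H0 <= \<bar>H\<bar> --> (\<forall>z\<in>closed_segment (l (R + 1) H) (l x1 H). cmod (A z * V z) * cmod (l x1 H - l (R + 1) H) <= e)"
    proof (intro exI allI impI ballI)
      fix H z assume H: "H0 <= \<bar>H\<bar>" and z: "z \<in> closed_segment (l (R + 1) H) (l x1 H)"
      then obtain u where u: "0 <= u" "u <= 1" "z = (1-u) *\<^sub>R l (R+1) H + u *\<^sub>R l x1 H" by (auto simp: closed_segment_def)
      define x where "x = (1-u) * (R+1) + u * x1"
      have "z = l x H" unfolding u(3) x_def l_def by (simp add: complex_eq_iff algebra_simps)
      moreover have "\<bar>x\<bar> <= (1-u) * \<bar>R+1\<bar> + u * \<bar>x1\<bar>" unfolding x_def using u(1,2) abs_triangle_ineq[of "(1-u) * (R+1)" "u*x1"]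
        by (simp add: abs_mult)
      moreover have "(1-u) * \<bar>R+1\<bar> + u * \<bar>x1\<bar> <= (1-u) * B + u * B" using Bx u by (intro add_mono mult_left_mono) auto
      ultimately have "cmod (A z * V z) <= K' * exp (- \<bar>H\<bar>)" using decay[of x H] by (simp add: algebra_simps)
      moreover have "cmod (l x1 H - l (R + 1) H) = N" by (simp add: N_def l_def)
      ultimately show "cmod (A z * V z) * cmod (l x1 H - l (R + 1) H) <= e"
        using H0[OF H] mult_right_mono[of "cmod (A z * V z)" "K' * exp (- \<bar>H\<bar>)" N] by (simp add: N_def)
    qed
  qed (auto simp: l_def)
  then show "(LINT r|lborel. f1 r) = (LINT r|lborel. f2 r)" by (simp add: f1 f2)
qed

section \<open>The extended Airy kernel on shifted contours\<close>

lemma exp_diff_eq_mult: "exp (a - b) = exp a * exp (- b)" for a b :: real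
  by (simp add: exp_diff exp_minus divide_inverse)

lemma rayp_vector_derivative:
  assumes "r \<noteq> 0" shows "(rayp \<theta> has_vector_derivative rayp' \<theta> r) (at r)"
proof (cases "r < 0")
  case True
  have "((\<lambda>r. of_real (- r) * cis (- \<theta>)) has_vector_derivative rayp' \<theta> r) (at r)"
    using True by (auto intro!: derivative_eq_intros has_vector_derivative_real_field simp: rayp'_def)
  then show ?thesis
    by (rule has_vector_derivative_transform_within_open[of _ _ _ "{..<0}"]) (use True in \<open>auto simp: rayp_def\<close>)
next
  case False
  have "((\<lambda>r. of_real r * cis \<theta>) has_vector_derivative rayp' \<theta> r) (at r)"
    using False by (auto intro!: derivative_eq_intros has_vector_derivative_real_field simp: rayp'_def)
  then show ?thesis
    by (rule has_vector_derivative_transform_within_open[of _ _ _ "{0<..}"]) (use False assms in \<open>auto simp: rayp_def\<close>)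
qed

lemma rayp_conv: "rayp \<theta> r = of_real (\<bar>r\<bar> * cos \<theta>) + \<i> * of_real (r * sin \<theta>)"
  by (auto simp: rayp_def complex_eq_iff)

lemma continuous_rayp: "continuous_on UNIV (rayp \<theta>)"
  unfolding rayp_conv[abs_def] by (intro continuous_intros)

lemma measurable_rayp [measurable]: "rayp \<theta> \<in> borel_measurable borel" "rayp' \<theta> \<in> borel_measurable borel"
  by (auto intro: borel_measurable_continuous_onI continuous_rayp) (auto simp: rayp'_def[abs_def])

lemma norm_rayp' [simp]: "cmod (rayp' \<theta> r) = 1" by (simp add: rayp'_def)

text \<open>Together with \<open>wvee\<close> this is a pair of disjoint replacements for the two
  Airy contours, which touch at the origin. The abscissa s is later taken large: it supplies the
  factor exp (- \<sigma> v) and the Gaussian decay in y.\<close>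

definition zline :: "real \<Rightarrow> real \<Rightarrow> complex" where
  "zline s y = of_real s + \<i> * of_real y"

text \<open>A vee opening to the left with arms at angles 3 pi / 4 and - 3 pi / 4, parametrised by
  height. On it Re (\<omega>^3) grows like 2 |q|^3, and reflection in the real axis is the change of
  q to - q.\<close>

definition wvee :: "real \<Rightarrow> real \<Rightarrow> complex" where
  "wvee s q = of_real (- s - \<bar>q\<bar>) + \<i> * of_real q"

definition wvee' :: "real \<Rightarrow> complex" where
  "wvee' q = (if q < 0 then 1 + \<i> else \<i> - 1)"

text \<open>One half of the Airy integrand, which is
  \<open>eAi \<tau>2 v \<zeta> / eAi \<tau>1 u \<omega>\<close> divided by \<zeta> -
  \<omega>.\<close>

definition eAi :: "real \<Rightarrow> real \<Rightarrow> complex \<Rightarrow> complex" where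
  "eAi \<tau> v \<zeta> = exp (\<zeta>^3/3 - \<zeta> * of_real v - of_real \<tau> * \<zeta>^2)"

lemma zline_simps [simp]: "Re (zline s y) = s" "Im (zline s y) = y"
  and wvee_simps [simp]: "Re (wvee s q) = - s - \<bar>q\<bar>" "Im (wvee s q) = q"
  by (simp_all add: zline_def wvee_def)

lemma zline_vector_derivative: "(zline s has_vector_derivative \<i>) (at y)"
  unfolding zline_def by (auto intro!: derivative_eq_intros has_vector_derivative_real_field)

lemma wvee_vector_derivative:
  assumes "q \<noteq> 0" shows "(wvee s has_vector_derivative wvee' q) (at q)"
proof (cases "q < 0")
  case True
  have "((\<lambda>q. of_real (- s + q) + \<i> * of_real q) has_vector_derivative wvee' q) (at q)"
    using True by (auto intro!: derivative_eq_intros has_vector_derivative_real_field simp: wvee'_def)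
  then show ?thesis
    by (rule has_vector_derivative_transform_within_open[of _ _ _ "{..<0}"]) (use True in \<open>auto simp: wvee_def\<close>)
next
  case False
  have "((\<lambda>q. of_real (- s - q) + \<i> * of_real q) has_vector_derivative wvee' q) (at q)"
    using False by (auto intro!: derivative_eq_intros has_vector_derivative_real_field simp: wvee'_def)
  then show ?thesis
    by (rule has_vector_derivative_transform_within_open[of _ _ _ "{0<..}"]) (use False assms in \<open>auto simp: wvee_def\<close>)
qed

lemma continuous_zline: "continuous_on UNIV (zline s)" and continuous_wvee: "continuous_on UNIV (wvee s)"
  unfolding zline_def[abs_def] wvee_def[abs_def] by (intro continuous_intros)+

lemma measurable_lines [measurable]: "zline s \<in> borel_measurable borel" "wvee s \<in> borel_measurable borel" "wvee' \<in> borel_measurable borel"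
  by (auto intro: borel_measurable_continuous_onI continuous_zline continuous_wvee) (auto simp: wvee'_def[abs_def])

lemma norm_wvee' [simp]: "cmod (wvee' q) = sqrt 2" by (simp add: wvee'_def cmod_def)

lemma continuous_eAi: "continuous_on S (eAi \<tau> v)" and holomorphic_eAi: "eAi \<tau> v holomorphic_on S"
  unfolding eAi_def[abs_def] by (auto intro!: continuous_intros holomorphic_intros)

lemma measurable_eAi [measurable]: "eAi \<tau> v \<in> borel_measurable borel"
  by (intro borel_measurable_continuous_onI continuous_eAi)

lemma eAi_nonzero [simp]: "eAi \<tau> v \<zeta> \<noteq> 0" by (simp add: eAi_def)

lemma Re_cube: "Re (z^3) = Re z^3 - 3 * Re z * Im z^2" and Re_square: "Re (z^2) = Re z^2 - Im z^2"
  by (simp_all add: power2_eq_square power3_eq_cube algebra_simps)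

lemma norm_eAi: "cmod (eAi \<tau> v \<zeta>) = exp ((Re \<zeta>^3 - 3 * Re \<zeta> * Im \<zeta>^2) / 3 - Re \<zeta> * v - \<tau> * (Re \<zeta>^2 - Im \<zeta>^2))"
proof -
  have "Re (\<zeta>^3/3 - \<zeta> * of_real v - of_real \<tau> * \<zeta>^2) = Re (\<zeta>^3) / 3 - Re \<zeta> * v - \<tau> * Re (\<zeta>^2)"
    by simp
  then show ?thesis unfolding eAi_def norm_exp_eq_Re Re_cube Re_square by simp
qed

lemma norm_eAi_inverse: "cmod (1 / eAi \<tau> v \<zeta>) = exp (- ((Re \<zeta>^3 - 3 * Re \<zeta> * Im \<zeta>^2) / 3 - Re \<zeta> * v - \<tau> * (Re \<zeta>^2 - Im \<zeta>^2)))"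
  by (simp only: norm_divide norm_eAi norm_one exp_minus inverse_eq_divide)

lemma exp_decay_small:
  fixes K H1 e :: real
  assumes "e > 0"
  shows "\<exists>H0\<ge>H1. \<forall>h\<ge>H0. K * exp (- h) <= e"
proof -
  have "((\<lambda>h. K * exp (- h)) \<longlongrightarrow> K * 0) at_top"
    by (intro tendsto_intros filterlim_compose[OF exp_at_bot] filterlim_uminus_at_bot_at_top)
  then have "\<forall>\<^sub>F h in at_top. K * exp (- h) < e" using assms by (simp add: order_tendsto_iff)
  then obtain H0 where "\<And>h. h >= H0 ==> K * exp (- h) < e" by (auto simp: eventually_at_top_linorder)
  then show ?thesis by (intro exI[of _ "max H0 H1"]) (auto intro: less_imp_le)
qed

lemma rayp_pi3: "Re (rayp (pi/3) r) = \<bar>r\<bar> / 2" "Im (rayp (pi/3) r) = r * (sqrt 3 / 2)"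
  and rayp_2pi3: "Re (rayp (2*pi/3) r) = - \<bar>r\<bar> / 2" "Im (rayp (2*pi/3) r) = r * (sqrt 3 / 2)"
  by (simp_all add: rayp_conv cos_60 sin_60 cos_120 sin_120)

text \<open>On the ray \<zeta>^3 = - |r|^3, a full cubic decay that absorbs the linear and quadratic
  terms.\<close>

lemma eAi_ray_decay: "\<exists>K. \<forall>r. cmod (eAi \<tau> v (rayp (pi/3) r)) <= K * exp (- \<bar>r\<bar>)"
proof -
  obtain K where K: "\<And>b. b >= 0 ==> (- v/2) * b + (\<tau>/2) * b^2 - (1/3) * b^3 <= K - b"
    using cubic_exp_bound[of "1/3" "- v/2" "\<tau>/2"] by auto
  show ?thesis
  proof (intro exI allI)
    fix r
    have "cmod (eAi \<tau> v (rayp (pi/3) r)) = exp ((- v/2) * \<bar>r\<bar> + (\<tau>/2) * \<bar>r\<bar>^2 - (1/3) * \<bar>r\<bar>^3)"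
      unfolding norm_eAi rayp_pi3 by (simp add: power_mult_distrib power_divide power2_eq_square power3_eq_cube field_simps)
    also have "\<dots> <= exp (K - \<bar>r\<bar>)" using K[of "\<bar>r\<bar>"] by simp
    finally show "cmod (eAi \<tau> v (rayp (pi/3) r)) <= exp K * exp (- \<bar>r\<bar>)" by (simp only: exp_diff_eq_mult)
  qed
qed

lemma eAi_inverse_ray_decay: "\<exists>K. \<forall>r. cmod (1 / eAi \<tau> u (rayp (2*pi/3) r)) <= K * exp (- \<bar>r\<bar>)"
proof -
  obtain K where K: "\<And>b. b >= 0 ==> (- u/2) * b + (-\<tau>/2) * b^2 - (1/3) * b^3 <= K - b"
    using cubic_exp_bound[of "1/3" "- u/2" "-\<tau>/2"] by auto
  show ?thesis
  proof (intro exI allI)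
    fix r
    have "cmod (1 / eAi \<tau> u (rayp (2*pi/3) r)) = exp ((- u/2) * \<bar>r\<bar> + (-\<tau>/2) * \<bar>r\<bar>^2 - (1/3) * \<bar>r\<bar>^3)"
      unfolding norm_eAi_inverse rayp_2pi3
      by (simp add: power_mult_distrib power_divide power2_eq_square power3_eq_cube field_simps)
    also have "\<dots> <= exp (K - \<bar>r\<bar>)" using K[of "\<bar>r\<bar>"] by simp
    finally show "cmod (1 / eAi \<tau> u (rayp (2*pi/3) r)) <= exp K * exp (- \<bar>r\<bar>)" by (simp only: exp_diff_eq_mult)
  qed
qed

text \<open>On a vertical line the cube only yields the Gaussian exp (- s y^2), while - \<tau>
  \<zeta>^2 contributes exp (\<tau> y^2); hence the condition s > \<tau>.\<close>

lemma eAi_zline_decay: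
  assumes "s > \<tau>" shows "\<exists>K. \<forall>y. cmod (eAi \<tau> v (zline s y)) <= K * exp (- \<bar>y\<bar>)"
proof -
  obtain K where K: "\<And>b. b >= 0 ==> 0 * b - (s - \<tau>) * b^2 <= K - b"
    using quadratic_exp_bound[of "s - \<tau>" 0] assms by auto
  show ?thesis
  proof (intro exI allI)
    fix y
    have "cmod (eAi \<tau> v (zline s y)) = exp ((s^3/3 - s * v - \<tau> * s^2) + (0 * \<bar>y\<bar> - (s - \<tau>) * \<bar>y\<bar>^2))"
      unfolding norm_eAi zline_simps by (simp add: field_simps)
    also have "\<dots> <= exp ((s^3/3 - s * v - \<tau> * s^2 + K) + (- \<bar>y\<bar>))" using K[of "\<bar>y\<bar>"] by simp
    finally show "cmod (eAi \<tau> v (zline s y)) <= exp (s^3/3 - s * v - \<tau> * s^2 + K) * exp (- \<bar>y\<bar>)" by (simp only: exp_add)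
  qed
qed

lemma norm_eAi_inverse_wvee:
  "cmod (1 / eAi \<tau> u (wvee s q)) = exp (s^3/3 + s^2 * \<bar>q\<bar> - (2/3) * \<bar>q\<bar>^3 - (s + \<bar>q\<bar>) * u + \<tau> * (s^2 + 2 * s * \<bar>q\<bar>))"
proof -
  have c: "(- s - \<bar>q\<bar>)^3 - 3 * (- s - \<bar>q\<bar>) * q^2 = 2 * \<bar>q\<bar>^3 - 3 * s^2 * \<bar>q\<bar> - s^3"
    by (cases "q >= 0") (simp_all add: power2_eq_square power3_eq_cube algebra_simps)
  have d: "(- s - \<bar>q\<bar>)^2 - q^2 = s^2 + 2 * s * \<bar>q\<bar>" by (simp add: power2_eq_square algebra_simps)
  show ?thesis
    unfolding norm_eAi_inverse wvee_simps c d
    by (simp add: field_simps)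
qed

lemma eAi_inverse_wvee_decay: "\<exists>K. \<forall>q. cmod (1 / eAi \<tau> u (wvee s q)) <= K * exp (- \<bar>q\<bar>)"
proof -
  obtain K where K: "\<And>b. b >= 0 ==> (s^2 - u + 2 * \<tau> * s) * b + 0 * b^2 - (2/3) * b^3 <= K - b"
    using cubic_exp_bound[of "2/3" "s^2 - u + 2 * \<tau> * s" 0] by auto
  show ?thesis
  proof (intro exI allI)
    fix q
    have "cmod (1 / eAi \<tau> u (wvee s q)) = exp ((s^3/3 - s * u + \<tau> * s^2) + ((s^2 - u + 2 * \<tau> * s) * \<bar>q\<bar> + 0 * \<bar>q\<bar>^2 - (2/3) * \<bar>q\<bar>^3))"
      unfolding norm_eAi_inverse_wvee by (simp add: algebra_simps)
    also have "\<dots> <= exp ((s^3/3 - s * u + \<tau> * s^2 + K) + (- \<bar>q\<bar>))" using K[of "\<bar>q\<bar>"] by simp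
    finally show "cmod (1 / eAi \<tau> u (wvee s q)) <= exp (s^3/3 - s * u + \<tau> * s^2 + K) * exp (- \<bar>q\<bar>)" by (simp only: exp_add)
  qed
qed

lemma closed_segment_Re_Im:
  assumes "z \<in> closed_segment a b"
  shows "min (Re a) (Re b) <= Re z" "Re z <= max (Re a) (Re b)" "min (Im a) (Im b) <= Im z" "Im z <= max (Im a) (Im b)"
proof -
  have "closed_segment a b \<subseteq> {z. min (Re a) (Re b) <= Re z} \<inter> {z. Re z <= max (Re a) (Re b)} \<inter> {z. min (Im a) (Im b) <= Im z} \<inter> {z. Im z <= max (Im a) (Im b)}"
    by (intro closed_segment_subset convex_Int convex_halfspace_Re_ge convex_halfspace_Re_le convex_halfspace_Im_ge convex_halfspace_Im_le) auto
  with assms show "min (Re a) (Re b) <= Re z" "Re z <= max (Re a) (Re b)" "min (Im a) (Im b) <= Im z" "Im z <= max (Im a) (Im b)" by auto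
qed

text \<open>The height varies along the segments because the rays are parametrised by arc length.\<close>

lemma segment_height:
  assumes z: "min (H * (sqrt 3/2)) H <= Im z" "Im z <= max (H * (sqrt 3/2)) H"
  shows "(3/4) * H^2 <= Im z^2" "Im z^2 <= H^2"
proof -
  have s3: "sqrt 3 / 2 >= 0" "sqrt 3 / 2 <= 1" by (auto intro!: real_le_lsqrt simp: power2_eq_square)
  have a: "\<bar>H\<bar> * (sqrt 3/2) <= \<bar>Im z\<bar>" "\<bar>Im z\<bar> <= \<bar>H\<bar>"
  proof -
    have "\<bar>H\<bar> * (sqrt 3/2) <= \<bar>Im z\<bar> \<and> \<bar>Im z\<bar> <= \<bar>H\<bar>"
    proof (cases "H >= 0")
      case True
      have "H * (sqrt 3/2) <= H" "H * (sqrt 3/2) >= 0" using mult_left_mono[OF s3(2) True] mult_nonneg_nonneg[OF True s3(1)] by simp_all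
      with z True show ?thesis by simp
    next
      case False
      then have H: "H <= 0" by simp
      have "H <= H * (sqrt 3/2)" "H * (sqrt 3/2) <= 0" using mult_left_mono_neg[OF s3(2) H] mult_nonpos_nonneg[OF H s3(1)] by simp_all
      with z H show ?thesis by simp
    qed
    then show "\<bar>H\<bar> * (sqrt 3/2) <= \<bar>Im z\<bar>" "\<bar>Im z\<bar> <= \<bar>H\<bar>" by auto
  qed
  have "(\<bar>H\<bar> * (sqrt 3/2))^2 <= \<bar>Im z\<bar>^2" by (intro power_mono a) (use s3 in auto)
  then show "(3/4) * H^2 <= Im z^2" by (simp add: power_mult_distrib power_divide)
  show "Im z^2 <= H^2" using a(2) by (simp add: abs_le_square_iff)
qed

text \<open>On the segment s <= Re z <= |H| / 2 and (Im z)^2 >= (3/4) H^2, so Re (z^3) / 3 <= -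
  (2/3) s H^2. Only quadratic decay is left, and s >= 2 |\<tau>| + 1 makes it win over the term
  \<tau> z^2, whose real part is at most |\<tau>| H^2.\<close>

lemma eAi_right_segment:
  assumes s: "s >= 2 * \<bar>\<tau>\<bar> + 1"
  shows "\<exists>K. \<forall>H z. \<bar>H\<bar> >= 2 * s --> z \<in> closed_segment (rayp (pi/3) H) (zline s H) -->
           Re z >= s \<and> cmod (eAi \<tau> v z) * cmod (zline s H - rayp (pi/3) H) <= K * exp (- \<bar>H\<bar>)"
proof -
  have s1: "s >= 1" using s by linarith
  obtain K where K: "\<And>b. b >= 0 ==> (\<bar>v\<bar> + 2) * b - (1/6) * b^2 <= K - b"
    using quadratic_exp_bound[of "1/6" "\<bar>v\<bar> + 2"] by auto
  show ?thesis
  proof (intro exI allI impI conjI)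
    fix H z assume H: "\<bar>H\<bar> >= 2 * s" and z: "z \<in> closed_segment (rayp (pi/3) H) (zline s H)"
    note zb = closed_segment_Re_Im[OF z, unfolded rayp_pi3 zline_simps]
    define x y where "x = Re z" "y = Im z"
    have x: "s <= x" "x <= \<bar>H\<bar> / 2" using zb(1,2) H by (auto simp: x_y_def)
    show "Re z >= s" using x by (simp add: x_y_def)
    have y: "(3/4) * H^2 <= y^2" "y^2 <= H^2" unfolding x_y_def by (rule segment_height[OF zb(3,4)])+
    have x0: "x >= 0" using x s1 by linarith
    have x2: "x^2 <= H^2 / 4" using power_mono[OF x(2) x0, of 2] by (simp add: power_divide)
    have "x * (x^2 - 3 * y^2) <= x * (- 2 * H^2)" by (intro mult_left_mono) (use x2 y x0 in auto)
    also have "\<dots> <= s * (- 2 * H^2)" by (intro mult_right_mono_neg x) auto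
    finally have 1: "(x^3 - 3 * x * y^2) / 3 <= - (2/3) * s * H^2" by (simp add: power2_eq_square power3_eq_cube algebra_simps)
    have 2: "- x * v <= \<bar>v\<bar> * \<bar>H\<bar>"
    proof -
      have "- x * v <= x * \<bar>v\<bar>" using mult_left_mono[OF abs_ge_minus_self x0] by simp
      also have "\<dots> <= \<bar>H\<bar> * \<bar>v\<bar>" by (intro mult_right_mono) (use x in auto)
      finally show ?thesis by (simp add: mult.commute)
    qed
    have "\<bar>x^2 - y^2\<bar> <= H^2" using x2 y zero_le_power2[of x] zero_le_power2[of y] zero_le_power2[of H] by (intro abs_leI) linarith+
    then have "\<bar>\<tau>\<bar> * \<bar>x^2 - y^2\<bar> <= \<bar>\<tau>\<bar> * H^2" by (intro mult_left_mono) auto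
    then have 3: "- \<tau> * (x^2 - y^2) <= \<bar>\<tau>\<bar> * H^2"
      using abs_ge_minus_self[of "\<tau> * (x^2 - y^2)"] unfolding abs_mult by linarith
    have "((2/3) * s - \<bar>\<tau>\<bar>) * H^2 >= (1/6) * H^2" by (intro mult_right_mono) (use s in auto)
    with 1 2 3 have "(x^3 - 3 * x * y^2) / 3 - x * v - \<tau> * (x^2 - y^2) <= \<bar>v\<bar> * \<bar>H\<bar> - (1/6) * H^2"
      unfolding left_diff_distrib by linarith
    then have A: "cmod (eAi \<tau> v z) <= exp (\<bar>v\<bar> * \<bar>H\<bar> - (1/6) * H^2)" unfolding norm_eAi x_y_def by simp
    have "cmod (zline s H - rayp (pi/3) H) <= \<bar>s - \<bar>H\<bar>/2\<bar> + \<bar>H - H * (sqrt 3/2)\<bar>"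
      using cmod_le[of "zline s H - rayp (pi/3) H"] by (simp add: rayp_pi3)
    also have "\<bar>H - H * (sqrt 3/2)\<bar> <= \<bar>H\<bar>"
    proof -
      have "H - H * (sqrt 3/2) = H * (1 - sqrt 3/2)" by (simp add: algebra_simps)
      moreover have "\<bar>1 - sqrt 3/2\<bar> <= 1" by (auto simp: abs_le_iff intro!: real_le_lsqrt)
      ultimately show ?thesis by (metis abs_ge_zero abs_mult mult_left_le)
    qed
    finally have "cmod (zline s H - rayp (pi/3) H) <= 2 * \<bar>H\<bar>" using H s1 by linarith
    also have "\<dots> <= exp (2 * \<bar>H\<bar>)" using exp_ge_add_one_self[of "2 * \<bar>H\<bar>"] by linarith
    finally have "cmod (eAi \<tau> v z) * cmod (zline s H - rayp (pi/3) H) <= exp (\<bar>v\<bar> * \<bar>H\<bar> - (1/6) * H^2) * exp (2 * \<bar>H\<bar>)"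
      by (intro mult_mono A) auto
    also have "\<dots> = exp ((\<bar>v\<bar> + 2) * \<bar>H\<bar> - (1/6) * \<bar>H\<bar>^2)" by (simp add: exp_add[symmetric] algebra_simps)
    also have "\<dots> <= exp (K - \<bar>H\<bar>)" using K[of "\<bar>H\<bar>"] by simp
    finally show "cmod (eAi \<tau> v z) * cmod (zline s H - rayp (pi/3) H) <= exp K * exp (- \<bar>H\<bar>)" by (simp only: exp_diff_eq_mult)
  qed
qed

text \<open>Unlike on the right side, the real part here is itself of order |H|, between |H| / 2 and
  5 |H| / 4 in modulus, and the decay stays cubic: x (x^2 / 3 - y^2) <= - (11/96) |H|^3 for x = - Re
  z and y = Im z.\<close>

lemma eAi_left_segment:
  assumes s: "s > 0"
  shows "\<exists>K. \<forall>H z. \<bar>H\<bar> >= 4 * s --> z \<in> closed_segment (rayp (2*pi/3) H) (wvee s H) -->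
           Re z <= 0 \<and> cmod (1 / eAi \<tau> u z) * cmod (wvee s H - rayp (2*pi/3) H) <= K * exp (- \<bar>H\<bar>)"
proof -
  obtain K where K: "\<And>b. b >= 0 ==> (2 * \<bar>u\<bar> + 4) * b + (4 * \<bar>\<tau>\<bar>) * b^2 - (1/10) * b^3 <= K - b"
    using cubic_exp_bound[of "1/10"] by fastforce
  show ?thesis
  proof (intro exI allI impI conjI)
    fix H z assume H: "\<bar>H\<bar> >= 4 * s" and z: "z \<in> closed_segment (rayp (2*pi/3) H) (wvee s H)"
    note zb = closed_segment_Re_Im[OF z, unfolded rayp_2pi3 wvee_simps]
    define x y where "x = - Re z" "y = Im z"
    have x: "\<bar>H\<bar> / 2 <= x" "x <= (5/4) * \<bar>H\<bar>" using zb(1,2) H s by (auto simp: x_y_def)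
    have x0: "x >= 0" using x by linarith
    then show "Re z <= 0" by (simp add: x_y_def)
    have y: "(3/4) * H^2 <= y^2" "y^2 <= H^2" unfolding x_y_def by (rule segment_height[OF zb(3,4)])+
    have x2: "x^2 <= (25/16) * H^2" using power_mono[OF x(2) x0, of 2] by (simp add: power_mult_distrib power_divide)
    have "x * (x^2/3 - y^2) <= x * (- (11/48) * H^2)" by (intro mult_left_mono) (use x2 y x0 in auto)
    also have "\<dots> <= (\<bar>H\<bar>/2) * (- (11/48) * H^2)" by (intro mult_right_mono_neg x) auto
    also have "\<dots> = - (11/96) * \<bar>H\<bar>^3" by (simp add: power3_eq_cube power2_eq_square)
    finally have 1: "x^3 / 3 - x * y^2 <= - (1/10) * \<bar>H\<bar>^3"
      using zero_le_power[of "\<bar>H\<bar>" 3] by (simp add: power2_eq_square power3_eq_cube algebra_simps)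
    have 2: "- x * u <= 2 * \<bar>u\<bar> * \<bar>H\<bar>"
    proof -
      have "- x * u <= x * \<bar>u\<bar>" using mult_left_mono[OF abs_ge_minus_self x0] by simp
      also have "\<dots> <= (2 * \<bar>H\<bar>) * \<bar>u\<bar>" by (intro mult_right_mono) (use x in auto)
      finally show ?thesis by (simp add: mult_ac)
    qed
    have "\<bar>x^2 - y^2\<bar> <= 4 * H^2" using x2 y zero_le_power2[of x] zero_le_power2[of y] zero_le_power2[of H] by (intro abs_leI) linarith+
    then have "\<bar>\<tau>\<bar> * \<bar>x^2 - y^2\<bar> <= \<bar>\<tau>\<bar> * (4 * H^2)" by (intro mult_left_mono) auto
    then have 3: "\<tau> * (x^2 - y^2) <= 4 * \<bar>\<tau>\<bar> * H^2"
      using order_trans[OF abs_ge_self[of "\<tau> * (x^2 - y^2)"]] by (simp add: abs_mult)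
    have B: "cmod (1 / eAi \<tau> u z) = exp (x^3 / 3 - x * y^2 - x * u + \<tau> * (x^2 - y^2))"
    proof -
      have e: "- (((- x)^3 - 3 * (- x) * y^2) / 3 - (- x) * u - \<tau> * ((- x)^2 - y^2)) = x^3 / 3 - x * y^2 - x * u + \<tau> * (x^2 - y^2)" for x y :: real
        by (simp add: field_simps)
      have "Re z = - x" "Im z = y" by (simp_all add: x_y_def)
      then show ?thesis by (simp only: norm_eAi_inverse e)
    qed
    have A: "cmod (1 / eAi \<tau> u z) <= exp (2 * \<bar>u\<bar> * \<bar>H\<bar> + 4 * \<bar>\<tau>\<bar> * H^2 - (1/10) * \<bar>H\<bar>^3)" unfolding B using 1 2 3 by simp
    have "cmod (wvee s H - rayp (2*pi/3) H) <= cmod (wvee s H) + cmod (rayp (2*pi/3) H)" by (rule norm_triangle_ineq4)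
    also have "cmod (wvee s H) <= s + 2 * \<bar>H\<bar>" using cmod_le[of "wvee s H"] s by simp
    also have "cmod (rayp (2*pi/3) H) = \<bar>H\<bar>" by (simp add: rayp_def norm_mult)
    finally have "cmod (wvee s H - rayp (2*pi/3) H) <= 4 * \<bar>H\<bar>" using H s by linarith
    also have "\<dots> <= exp (4 * \<bar>H\<bar>)" using exp_ge_add_one_self[of "4 * \<bar>H\<bar>"] by linarith
    finally have "cmod (1 / eAi \<tau> u z) * cmod (wvee s H - rayp (2*pi/3) H) <= exp (2 * \<bar>u\<bar> * \<bar>H\<bar> + 4 * \<bar>\<tau>\<bar> * H^2 - (1/10) * \<bar>H\<bar>^3) * exp (4 * \<bar>H\<bar>)"
      by (intro mult_mono A) auto
    also have "\<dots> = exp ((2 * \<bar>u\<bar> + 4) * \<bar>H\<bar> + (4 * \<bar>\<tau>\<bar>) * \<bar>H\<bar>^2 - (1/10) * \<bar>H\<bar>^3)" by (simp add: exp_add[symmetric] algebra_simps)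
    also have "\<dots> <= exp (K - \<bar>H\<bar>)" using K[of "\<bar>H\<bar>"] by simp
    finally show "cmod (1 / eAi \<tau> u z) * cmod (wvee s H - rayp (2*pi/3) H) <= exp K * exp (- \<bar>H\<bar>)" by (simp only: exp_diff_eq_mult)
  qed
qed

lemma Fubini_Cauchy_kernel:
  fixes a b z w :: "real \<Rightarrow> complex"
  assumes [measurable]: "a \<in> borel_measurable borel" "b \<in> borel_measurable borel" "z \<in> borel_measurable borel" "w \<in> borel_measurable borel"
    and a: "\<And>r. cmod (a r) <= K * exp (- \<bar>r\<bar>)" and b: "\<And>q. cmod (b q) <= L * exp (- \<bar>q\<bar>)"
    and s: "s > 0" "\<And>r q. cmod (z r - w q) >= s"
  shows "(LINT r|lborel. LINT q|lborel. a r * b q / (z r - w q)) = (LINT q|lborel. LINT r|lborel. a r * b q / (z r - w q))"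
    and "integrable lborel (\<lambda>r. LINT q|lborel. a r * b q / (z r - w q))"
proof -
  have K0: "K >= 0" "L >= 0" using order_trans[OF norm_ge_zero a[of 0]] order_trans[OF norm_ge_zero b[of 0]] by auto
  have i: "integrable (lborel \<Otimes>\<^sub>M lborel) (\<lambda>(r::real, q::real). exp (- \<bar>r\<bar>) * exp (- \<bar>q\<bar>))"
    by (rule lborel_pair.Fubini_integrable) (auto intro!: AE_I2 integrable_exp_minus_abs)
  have I: "integrable (lborel \<Otimes>\<^sub>M lborel) (\<lambda>(r, q). a r * b q / (z r - w q))"
  proof (rule Bochner_Integration.integrable_bound[OF integrable_mult_right[OF i, of "K * L / s"]])
    show "(\<lambda>(r, q). a r * b q / (z r - w q)) \<in> borel_measurable (lborel \<Otimes>\<^sub>M lborel)" by measurable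
    have "cmod (a r * b q / (z r - w q)) <= K * L / s * (exp (- \<bar>r\<bar>) * exp (- \<bar>q\<bar>))" for r q
    proof -
      have "cmod (a r * b q / (z r - w q)) <= (K * exp (- \<bar>r\<bar>)) * (L * exp (- \<bar>q\<bar>)) / s"
        unfolding norm_mult norm_divide using K0 s by (intro frac_le mult_mono a b s) auto
      then show ?thesis by (simp add: field_simps)
    qed
    then show "AE x in lborel \<Otimes>\<^sub>M lborel. cmod (case x of (r, q) \<Rightarrow> a r * b q / (z r - w q))
        <= norm (K * L / s * (case x of (r, q) \<Rightarrow> exp (- \<bar>r\<bar>) * exp (- \<bar>q\<bar>)))"
      by (intro AE_I2) (auto split: prod.split intro: order_trans[OF _ abs_ge_self] simp del: abs_divide abs_mult times_divide_eq_left)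
  qed
  show "(LINT r|lborel. LINT q|lborel. a r * b q / (z r - w q)) = (LINT q|lborel. LINT r|lborel. a r * b q / (z r - w q))"
    by (rule lborel_pair.Fubini_integral[OF I, symmetric])
  show "integrable lborel (\<lambda>r. LINT q|lborel. a r * b q / (z r - w q))"
    using lborel_pair.integrable_fst[OF I] by simp
qed

abbreviation airy_gauss :: "real \<Rightarrow> real \<Rightarrow> real \<Rightarrow> real \<Rightarrow> complex" where
  "airy_gauss \<tau>1 \<tau>2 u v \<equiv> (if \<tau>1 > \<tau>2 then of_real (1 / sqrt (4 * pi * (\<tau>1 - \<tau>2)) * exp (- ((u - v)^2) / (4 * (\<tau>1 - \<tau>2)))) else 0)"

text \<open>The original contours meet at the origin, where the Cauchy kernel is singular, so the
  order matters. Moving the \<omega> contour for fixed \<zeta> separates the two contours; only then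
  are the integrals exchanged and the \<zeta> contour moved for fixed \<omega>.\<close>

lemma KAiry_shifted:
  fixes s \<tau>1 \<tau>2 u v :: real
  assumes s: "s >= 2 * \<bar>\<tau>2\<bar> + 1"
  defines "g \<equiv> \<lambda>y. LINT q|lborel. (eAi \<tau>2 v (zline s y) * \<i>) * (wvee' q / eAi \<tau>1 u (wvee s q)) / (zline s y - wvee s q)"
  shows "integrable lborel g"
    and "KAiry \<tau>1 \<tau>2 u v = 1 / (2 * of_real pi * \<i>)^2 * (LINT y|lborel. g y)
     - airy_gauss \<tau>1 \<tau>2 u v"
proof -
  have s1: "s >= 1" "s > \<tau>2" using s by linarith+
  obtain K1 where K1: "\<And>r. cmod (eAi \<tau>2 v (rayp (pi/3) r)) <= K1 * exp (- \<bar>r\<bar>)" using eAi_ray_decay by blast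
  obtain K2 where K2: "\<And>q. cmod (1 / eAi \<tau>1 u (rayp (2*pi/3) q)) <= K2 * exp (- \<bar>q\<bar>)" using eAi_inverse_ray_decay by blast
  obtain K3 where K3: "\<And>y. cmod (eAi \<tau>2 v (zline s y)) <= K3 * exp (- \<bar>y\<bar>)" using eAi_zline_decay[OF s1(2)] by blast
  obtain K4 where K4: "\<And>q. cmod (1 / eAi \<tau>1 u (wvee s q)) <= K4 * exp (- \<bar>q\<bar>)" using eAi_inverse_wvee_decay by blast
  have Kn: "K1 >= 0" "K2 >= 0" "K3 >= 0" "K4 >= 0"
    using order_trans[OF norm_ge_zero K1[of 0]] order_trans[OF norm_ge_zero K2[of 0]] order_trans[OF norm_ge_zero K3[of 0]] order_trans[OF norm_ge_zero K4[of 0]] by auto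
  have quot: "cmod (a / (b - c)) <= K * exp (- h) / d" if "cmod a <= K * exp (- h)" "d > 0" "Re b - Re c >= d" for a b c K h d
  proof -
    have "d <= cmod (b - c)" using complex_Re_le_cmod[of "b - c"] that by simp
    then show ?thesis unfolding norm_divide by (intro frac_le) (use that order_trans[OF norm_ge_zero] in auto)
  qed
  have ndiv: "cmod (a * of_real (cmod d) / b) = cmod (a / b) * cmod d" for a b d :: complex
    by (simp add: norm_mult norm_divide)
  have step1: "(LINT q|lborel. 1 / eAi \<tau>1 u (rayp (2*pi/3) q) / (\<zeta> - rayp (2*pi/3) q) * rayp' (2*pi/3) q)
      = (LINT q|lborel. 1 / eAi \<tau>1 u (wvee s q) / (\<zeta> - wvee s q) * wvee' q)" if \<zeta>: "Re \<zeta> > 0" for \<zeta>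
  proof (rule contour_shift[where S="{w. Re w < Re \<zeta>}" and f="\<lambda>w. 1 / eAi \<tau>1 u w / (\<zeta> - w)"
        and p="rayp (2*pi/3)" and p'="rayp' (2*pi/3)" and q="wvee s" and q'=wvee'])
    show "convex {w. Re w < Re \<zeta>}" "open {w. Re w < Re \<zeta>}" by (rule convex_halfspace_Re_lt open_halfspace_Re_lt)+
    show "(\<lambda>w. 1 / eAi \<tau>1 u w / (\<zeta> - w)) holomorphic_on {w. Re w < Re \<zeta>}"
      by (auto intro!: holomorphic_intros holomorphic_eAi)
    show "integrable lborel (\<lambda>q. 1 / eAi \<tau>1 u (rayp (2*pi/3) q) / (\<zeta> - rayp (2*pi/3) q) * rayp' (2*pi/3) q)"
    proof (rule integrable_exp_decay)
      fix q
      show "cmod (1 / eAi \<tau>1 u (rayp (2*pi/3) q) / (\<zeta> - rayp (2*pi/3) q) * rayp' (2*pi/3) q) <= (K2 / Re \<zeta>) * exp (- \<bar>q\<bar>)"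
        unfolding norm_mult norm_rayp' by (rule order_trans[OF mult_right_mono[OF quot[OF K2 \<zeta>]]]) (auto simp: rayp_2pi3)
    qed measurable
    show "integrable lborel (\<lambda>q. 1 / eAi \<tau>1 u (wvee s q) / (\<zeta> - wvee s q) * wvee' q)"
    proof (rule integrable_exp_decay)
      fix q
      show "cmod (1 / eAi \<tau>1 u (wvee s q) / (\<zeta> - wvee s q) * wvee' q) <= (K4 / Re \<zeta> * sqrt 2) * exp (- \<bar>q\<bar>)"
        unfolding norm_mult norm_wvee' by (rule order_trans[OF mult_right_mono[OF quot[OF K4 \<zeta>]]]) (use s1 in \<open>auto simp: mult_ac\<close>)
    qed measurable
    show "\<exists>H0. \<forall>H. H0 <= \<bar>H\<bar> --> (\<forall>z\<in>closed_segment (rayp (2 * pi / 3) H) (wvee s H).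
              cmod (1 / eAi \<tau>1 u z / (\<zeta> - z)) * cmod (wvee s H - rayp (2 * pi / 3) H) <= e)" if e: "e > 0" for e
    proof -
      have "s > 0" using s1 by simp
      from eAi_left_segment[OF this, of \<tau>1 u]
      obtain K where K: "\<forall>H z. \<bar>H\<bar> >= 4 * s --> z \<in> closed_segment (rayp (2*pi/3) H) (wvee s H) -->
           Re z <= 0 \<and> cmod (1 / eAi \<tau>1 u z) * cmod (wvee s H - rayp (2*pi/3) H) <= K * exp (- \<bar>H\<bar>)" ..
      obtain H0 where H0: "H0 >= 4 * s" "\<And>h. h >= H0 ==> (K / Re \<zeta>) * exp (- h) <= e"
        using exp_decay_small[OF e] by blast
      show ?thesis
      proof (intro exI allI impI ballI)
        fix H z assume H: "H0 <= \<bar>H\<bar>" and z: "z \<in> closed_segment (rayp (2 * pi / 3) H) (wvee s H)"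
        have "cmod ((1 / eAi \<tau>1 u z * of_real (cmod (wvee s H - rayp (2*pi/3) H))) / (\<zeta> - z)) <= K * exp (- \<bar>H\<bar>) / Re \<zeta>"
          by (rule quot) (use K[rule_format, OF _ z] H H0 \<zeta> in \<open>auto simp: norm_mult norm_divide\<close>)
        also have "\<dots> <= e" using H0(2)[OF H] by simp
        finally show "cmod (1 / eAi \<tau>1 u z / (\<zeta> - z)) * cmod (wvee s H - rayp (2 * pi / 3) H) <= e"
          unfolding ndiv .
      qed
    qed
  qed (use s1 \<zeta> in \<open>auto intro: continuous_rayp continuous_wvee rayp_vector_derivative wvee_vector_derivative simp: rayp_2pi3\<close>)
  have step2: "(LINT r|lborel. eAi \<tau>2 v (rayp (pi/3) r) / (rayp (pi/3) r - w) * rayp' (pi/3) r)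
      = (LINT y|lborel. eAi \<tau>2 v (zline s y) / (zline s y - w) * \<i>)" if w: "Re w <= - s" for w
  proof (rule contour_shift[where S="{z. Re z > - s}" and f="\<lambda>z. eAi \<tau>2 v z / (z - w)"
        and p="rayp (pi/3)" and p'="rayp' (pi/3)" and q="zline s" and q'="\<lambda>_. \<i>"])
    show "convex {z. Re z > - s}" "open {z. Re z > - s}" by (rule convex_halfspace_Re_gt open_halfspace_Re_gt)+
    show "(\<lambda>z. eAi \<tau>2 v z / (z - w)) holomorphic_on {z. Re z > - s}"
      using w by (auto intro!: holomorphic_intros holomorphic_eAi)
    show "integrable lborel (\<lambda>r. eAi \<tau>2 v (rayp (pi/3) r) / (rayp (pi/3) r - w) * rayp' (pi/3) r)"
    proof (rule integrable_exp_decay)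
      fix r
      show "cmod (eAi \<tau>2 v (rayp (pi/3) r) / (rayp (pi/3) r - w) * rayp' (pi/3) r) <= (K1 / s) * exp (- \<bar>r\<bar>)"
        unfolding norm_mult norm_rayp' by (rule order_trans[OF mult_right_mono[OF quot[OF K1, of s]]]) (use s1 w in \<open>auto simp: rayp_pi3\<close>)
    qed measurable
    show "integrable lborel (\<lambda>y. eAi \<tau>2 v (zline s y) / (zline s y - w) * \<i>)"
    proof (rule integrable_exp_decay)
      fix y
      show "cmod (eAi \<tau>2 v (zline s y) / (zline s y - w) * \<i>) <= (K3 / s) * exp (- \<bar>y\<bar>)"
        unfolding norm_mult by (rule order_trans[OF mult_right_mono[OF quot[OF K3, of s]]]) (use s1 w in auto)
    qed measurable
    show "\<exists>H0. \<forall>H. H0 <= \<bar>H\<bar> --> (\<forall>z\<in>closed_segment (rayp (pi / 3) H) (zline s H).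
              cmod (eAi \<tau>2 v z / (z - w)) * cmod (zline s H - rayp (pi / 3) H) <= e)" if e: "e > 0" for e
    proof -
      from eAi_right_segment[OF s, of v]
      obtain K where K: "\<forall>H z. \<bar>H\<bar> >= 2 * s --> z \<in> closed_segment (rayp (pi/3) H) (zline s H) -->
           Re z >= s \<and> cmod (eAi \<tau>2 v z) * cmod (zline s H - rayp (pi/3) H) <= K * exp (- \<bar>H\<bar>)" ..
      obtain H0 where H0: "H0 >= 2 * s" "\<And>h. h >= H0 ==> (K / s) * exp (- h) <= e"
        using exp_decay_small[OF e] by blast
      show ?thesis
      proof (intro exI allI impI ballI)
        fix H z assume H: "H0 <= \<bar>H\<bar>" and z: "z \<in> closed_segment (rayp (pi / 3) H) (zline s H)"
        have "cmod ((eAi \<tau>2 v z * of_real (cmod (zline s H - rayp (pi/3) H))) / (z - w)) <= K * exp (- \<bar>H\<bar>) / s"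
          by (rule quot) (use K[rule_format, OF _ z] H H0 w s1 in \<open>auto simp: norm_mult\<close>)
        also have "\<dots> <= e" using H0(2)[OF H] by simp
        finally show "cmod (eAi \<tau>2 v z / (z - w)) * cmod (zline s H - rayp (pi / 3) H) <= e"
          unfolding ndiv .
      qed
    qed
  qed (use s1 in \<open>auto intro: continuous_rayp continuous_zline rayp_vector_derivative zline_vector_derivative simp: rayp_pi3\<close>)
  have dist: "s <= cmod (z - w)" if "Re z >= 0" "Re w <= - s" for z w
    using complex_Re_le_cmod[of "z - w"] that by simp
  have wb: "cmod (wvee' q / eAi \<tau>1 u (wvee s q)) <= (sqrt 2 * K4) * exp (- \<bar>q\<bar>)" for q
    using mult_left_mono[OF K4[of q], of "sqrt 2"] by (simp add: norm_divide)
  note F2 = Fubini_Cauchy_kernel[where a="\<lambda>y. eAi \<tau>2 v (zline s y) * \<i>" and b="\<lambda>q. wvee' q / eAi \<tau>1 u (wvee s q)" and z="zline s" and w="wvee s"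
    and K=K3 and L="sqrt 2 * K4" and s=s]
  show "integrable lborel g" unfolding g_def
    by (rule F2(2)) (use K3 wb s1 dist in \<open>auto simp: norm_mult\<close>)
  have "(LINT r|lborel. LINT q|lborel.
          (let \<zeta> = rayp (pi/3) r; \<omega> = rayp (2*pi/3) q in
            exp (\<zeta>^3/3 - \<zeta> * of_real v - of_real \<tau>2 * \<zeta>^2 - \<omega>^3/3 + \<omega> * of_real u + of_real \<tau>1 * \<omega>^2) / (\<zeta> - \<omega>)
            * rayp' (pi/3) r * rayp' (2*pi/3) q))
     = (LINT r|lborel. eAi \<tau>2 v (rayp (pi/3) r) * rayp' (pi/3) r * (LINT q|lborel. 1 / eAi \<tau>1 u (rayp (2*pi/3) q) / (rayp (pi/3) r - rayp (2*pi/3) q) * rayp' (2*pi/3) q))"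
  proof -
    have "exp (\<zeta>^3/3 - \<zeta> * of_real v - of_real \<tau>2 * \<zeta>^2 - \<omega>^3/3 + \<omega> * of_real u + of_real \<tau>1 * \<omega>^2) / (\<zeta> - \<omega>) * a * b
       = eAi \<tau>2 v \<zeta> * a * (1 / eAi \<tau>1 u \<omega> / (\<zeta> - \<omega>) * b)" for \<zeta> \<omega> a b :: complex
    proof -
      have "exp (\<zeta>^3/3 - \<zeta> * of_real v - of_real \<tau>2 * \<zeta>^2 - \<omega>^3/3 + \<omega> * of_real u + of_real \<tau>1 * \<omega>^2) = eAi \<tau>2 v \<zeta> / eAi \<tau>1 u \<omega>"
        unfolding eAi_def exp_diff[symmetric] by (simp add: algebra_simps)
      then show ?thesis by simp
    qed
    note eq = this
    show ?thesis by (simp only: Let_def eq integral_mult_right_zero)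
  qed
  also have "\<dots> = (LINT r|lborel. eAi \<tau>2 v (rayp (pi/3) r) * rayp' (pi/3) r * (LINT q|lborel. 1 / eAi \<tau>1 u (wvee s q) / (rayp (pi/3) r - wvee s q) * wvee' q))"
  proof (rule integral_cong_AE)
    \<comment> \<open>At r = 0 the ray reaches the boundary Re \<zeta> = 0, which
      \<open>step1\<close> excludes; this single parameter is a null set.\<close>
    show "AE r in lborel. eAi \<tau>2 v (rayp (pi/3) r) * rayp' (pi/3) r * (LINT q|lborel. 1 / eAi \<tau>1 u (rayp (2*pi/3) q) / (rayp (pi/3) r - rayp (2*pi/3) q) * rayp' (2*pi/3) q)
       = eAi \<tau>2 v (rayp (pi/3) r) * rayp' (pi/3) r * (LINT q|lborel. 1 / eAi \<tau>1 u (wvee s q) / (rayp (pi/3) r - wvee s q) * wvee' q)"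
      using AE_lborel_singleton[of 0] by eventually_elim (use step1 in \<open>auto simp: rayp_pi3\<close>)
  qed measurable
  also have "\<dots> = (LINT r|lborel. LINT q|lborel. (eAi \<tau>2 v (rayp (pi/3) r) * rayp' (pi/3) r) * (wvee' q / eAi \<tau>1 u (wvee s q)) / (rayp (pi/3) r - wvee s q))"
    unfolding integral_mult_right_zero[symmetric] by (simp add: mult_ac)
  also have "\<dots> = (LINT q|lborel. LINT r|lborel. (eAi \<tau>2 v (rayp (pi/3) r) * rayp' (pi/3) r) * (wvee' q / eAi \<tau>1 u (wvee s q)) / (rayp (pi/3) r - wvee s q))"
    by (rule Fubini_Cauchy_kernel(1)[where K=K1 and L="sqrt 2 * K4" and s=s])
       (use K1 wb s1 dist in \<open>auto simp: norm_mult rayp_pi3\<close>)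
  also have "\<dots> = (LINT q|lborel. LINT y|lborel. (eAi \<tau>2 v (zline s y) * \<i>) * (wvee' q / eAi \<tau>1 u (wvee s q)) / (zline s y - wvee s q))"
  proof (rule Bochner_Integration.integral_cong[OF refl])
    fix q
    have "(LINT r|lborel. (wvee' q / eAi \<tau>1 u (wvee s q)) * (eAi \<tau>2 v (rayp (pi/3) r) / (rayp (pi/3) r - wvee s q) * rayp' (pi/3) r))
       = (LINT y|lborel. (wvee' q / eAi \<tau>1 u (wvee s q)) * (eAi \<tau>2 v (zline s y) / (zline s y - wvee s q) * \<i>))"
      unfolding integral_mult_right_zero using step2[of "wvee s q"] by simp
    then show "(LINT r|lborel. (eAi \<tau>2 v (rayp (pi/3) r) * rayp' (pi/3) r) * (wvee' q / eAi \<tau>1 u (wvee s q)) / (rayp (pi/3) r - wvee s q))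
       = (LINT y|lborel. (eAi \<tau>2 v (zline s y) * \<i>) * (wvee' q / eAi \<tau>1 u (wvee s q)) / (zline s y - wvee s q))"
      by (simp add: mult_ac)
  qed
  also have "\<dots> = (LINT y|lborel. g y)" unfolding g_def
    by (rule F2(1)[symmetric]) (use K3 wb s1 dist in \<open>auto simp: norm_mult\<close>)
  finally show "KAiry \<tau>1 \<tau>2 u v = 1 / (2 * of_real pi * \<i>)^2 * (LINT y|lborel. g y)
     - airy_gauss \<tau>1 \<tau>2 u v"
    unfolding KAiry_def by simp
qed

section \<open>Moments of the initial configuration\<close>

text \<open>Writes s^(-p) - L^(-p) as a superposition of indicators of {r >= s}; the cut-off at g
  keeps the weight integrable near 0. Sums of negative powers thereby become integrals of counting
  functions.\<close>

lemma powr_layer_integral: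
  fixes g s L p :: real
  assumes "0 < g" "g <= s" "s <= L" "p > 0"
  defines "h \<equiv> \<lambda>r. indicator {g..L} r * (p * r powr (- p - 1))"
  shows "integrable lborel (\<lambda>r. h r * indicator {s..} r)" "(LINT r|lborel. h r * indicator {s..} r) = s powr - p - L powr - p"
proof -
  let ?f = "\<lambda>r. p * r powr (- p - 1)"
  have "(?f has_integral (- (L powr - p) - (- (s powr - p)))) {s..L}"
    using assms by (intro fundamental_theorem_of_calculus)
      (auto intro!: derivative_eq_intros simp: has_real_derivative_iff_has_vector_derivative[symmetric] powr_diff)
  then have I: "integral {s..L} ?f = - (L powr - p) - (- (s powr - p))" by (rule integral_unique)
  have "continuous_on {s..L} ?f" using assms by (intro continuous_intros) auto
  then have S: "set_integrable lborel {s..L} ?f" by (rule borel_integrable_atLeastAtMost')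
  have e: "h r * indicator {s..} r = indicator {s..L} r *\<^sub>R ?f r" for r using assms(2) by (auto simp: h_def indicator_def)
  show "integrable lborel (\<lambda>r. h r * indicator {s..} r)" using S unfolding e set_integrable_def .
  show "(LINT r|lborel. h r * indicator {s..} r) = s powr - p - L powr - p"
    using set_borel_integral_eq_integral(2)[OF S] unfolding I e set_lebesgue_integral_def by simp
qed

text \<open>Layer-cake comparison of an empirical and an absolutely continuous measure.\<close>

lemma quadrature_powr:
  fixes Y :: "'a \<Rightarrow> real" and w :: "real \<Rightarrow> real" and n g L p D :: real
  assumes J: "finite J" and n: "n > 0" and g: "0 < g" "g <= L" and p: "p > 0" and w: "integrable lborel w"
    and D: "\<And>r. r \<in> {g..L} ==> \<bar>real (card {j\<in>J. g < Y j \<and> Y j <= r}) / n - (LINT s|lborel. indicator {g<..r} s * w s)\<bar> <= D"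
  shows "\<bar>(\<Sum>j | j \<in> J \<and> g < Y j \<and> Y j <= L. Y j powr - p) / n - (LINT s|lborel. indicator {g<..L} s * (w s * s powr - p))\<bar> <= D * g powr - p"
proof -
  define h where "h = (\<lambda>r::real. indicator {g..L} r * (p * r powr (- p - 1)))"
  have h0: "h r >= 0" for r using p by (simp add: h_def)
  have [measurable]: "h \<in> borel_measurable borel" unfolding h_def by measurable
  have [measurable]: "w \<in> borel_measurable borel" using w by auto
  have hs: "integrable lborel (\<lambda>r. h r * indicator {s..} r)" "(LINT r|lborel. h r * indicator {s..} r) = s powr - p - L powr - p" if "g <= s" "s <= L" for s
    using powr_layer_integral[of g s L p] that g p by (simp_all add: h_def)
  have ind: "h r * indicator {g..} r = h r" for r by (simp add: h_def indicator_def)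
  have hi: "integrable lborel h" "(LINT r|lborel. h r) = g powr - p - L powr - p"
    using hs[of g] g unfolding ind by simp_all
  define J' where "J' = {j. j \<in> J \<and> g < Y j \<and> Y j <= L}"
  have finJ: "finite J'" using J by (auto simp: J'_def)
  define N where "N = (\<lambda>r. real (card {j\<in>J. g < Y j \<and> Y j <= r}) / n)"
  define W where "W = (\<lambda>r. LINT s|lborel. indicator {g<..r} s * w s)"
  \<comment> \<open>Exchanging the sum with the layer integral: at level r the indicators count the
    points up to r, which is the counting function \<open>N\<close> times n.\<close>
  have hN: "h r * (\<Sum>j\<in>J'. indicator {Y j..} r) = h r * (n * N r)" for r
  proof (cases "r \<in> {g..L}")
    case True
    have "(\<Sum>j\<in>J'. indicator {Y j..} r) = real (card {j\<in>J'. Y j <= r})"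
      using finJ by (simp add: indicator_def of_bool_def sum.If_cases Int_def)
    also have "{j\<in>J'. Y j <= r} = {j\<in>J. g < Y j \<and> Y j <= r}" using True by (auto simp: J'_def)
    finally show ?thesis using n by (simp add: N_def)
  qed (simp add: h_def)
  have intN: "integrable lborel (\<lambda>r. h r * N r)"
  proof -
    have "integrable lborel (\<lambda>r. \<Sum>j\<in>J'. h r * indicator {Y j..} r)" using hs by (auto simp: J'_def less_imp_le)
    then have "integrable lborel (\<lambda>r. (1 / n) * (h r * (n * N r)))" unfolding sum_distrib_left[symmetric] hN by (rule integrable_mult_right)
    moreover have "(1 / n) * (h r * (n * N r)) = h r * N r" for r using n by simp
    ultimately show ?thesis by simp
  qed
  have sumN: "(\<Sum>j\<in>J'. Y j powr - p) / n = L powr - p * N L + (LINT r|lborel. h r * N r)"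
  proof -
    have "(\<Sum>j\<in>J'. Y j powr - p) = (\<Sum>j\<in>J'. L powr - p + (LINT r|lborel. h r * indicator {Y j..} r))"
      by (intro sum.cong) (auto simp: hs J'_def less_imp_le)
    also have "\<dots> = real (card J') * L powr - p + (LINT r|lborel. (\<Sum>j\<in>J'. h r * indicator {Y j..} r))"
      by (subst Bochner_Integration.integral_sum) (auto simp: hs J'_def sum.distrib sum_subtractf less_imp_le)
    also have "\<dots> = real (card J') * L powr - p + (LINT r|lborel. n * (h r * N r))"
      unfolding sum_distrib_left[symmetric] hN by (simp add: mult_ac)
    finally have "(\<Sum>j\<in>J'. Y j powr - p) = real (card J') * L powr - p + n * (LINT r|lborel. h r * N r)" by simp
    then show ?thesis using n by (simp add: N_def J'_def add_divide_distrib)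
  qed
  define F where "F = (\<lambda>s r. (indicator {g<..L} s * w s) * (h r * indicator {s..} r))"
  have iw: "integrable lborel (\<lambda>s. indicator {g<..r} s * w s)" for r
    using integrable_mult_indicator[of "{g<..r}" lborel w] w by simp
  have iF: "integrable (lborel \<Otimes>\<^sub>M lborel) (\<lambda>(s, r). F s r)"
  proof (rule Bochner_Integration.integrable_bound)
    show "integrable (lborel \<Otimes>\<^sub>M lborel) (\<lambda>(s, r). w s * h r)"
      by (rule lborel_pair.Fubini_integrable) (use w hi in \<open>auto simp: abs_mult\<close>)
    have [measurable]: "(\<lambda>x::real\<times>real. indicator {fst x..} (snd x) :: real) \<in> borel_measurable (lborel \<Otimes>\<^sub>M lborel)"
    proof -
      have "(\<lambda>x::real\<times>real. indicator {fst x..} (snd x) :: real) = indicator {x. fst x <= snd x}" by (auto simp: indicator_def fun_eq_iff)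
      note e = this
      have m: "{x::real\<times>real. fst x <= snd x} \<in> sets (lborel \<Otimes>\<^sub>M lborel)"
      proof -
        have "closed {x::real\<times>real. fst x <= snd x}" by (intro closed_Collect_le continuous_intros)
        then have "{x::real\<times>real. fst x <= snd x} \<in> sets (borel \<Otimes>\<^sub>M borel)" unfolding borel_prod by (rule borel_closed)
        then show ?thesis by (simp cong: sets_pair_measure_cong)
      qed
      show ?thesis unfolding e by (rule borel_measurable_indicator[OF m])
    qed
    show "(\<lambda>(s, r). F s r) \<in> borel_measurable (lborel \<Otimes>\<^sub>M lborel)" unfolding F_def split_beta by measurable
  qed (auto simp: F_def indicator_def abs_mult)
  have W: "(LINT s|lborel. indicator {g<..L} s * (w s * s powr - p)) = L powr - p * W L + (LINT r|lborel. h r * W r)"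
    and intW: "integrable lborel (\<lambda>r. h r * W r)"
  proof -
    have inner: "(LINT s|lborel. F s r) = h r * W r" for r
    proof -
      have "F s r = h r * (indicator {g<..r} s * w s)" for s by (auto simp: F_def h_def indicator_def)
      then show ?thesis by (simp add: W_def)
    qed
    show "integrable lborel (\<lambda>r. h r * W r)" using lborel_pair.integrable_snd[OF iF] by (simp add: inner)
    have pt: "(LINT r|lborel. F s r) = indicator {g<..L} s * (w s * s powr - p) - L powr - p * (indicator {g<..L} s * w s)" for s
    proof (cases "s \<in> {g<..L}")
      case True
      then have "F s r = w s * (h r * indicator {s..} r)" for r by (simp add: F_def)
      then have "(LINT r|lborel. F s r) = w s * (s powr - p - L powr - p)" using True hs(2)[of s] by simp
      then show ?thesis using True by (simp add: algebra_simps)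
    qed (simp add: F_def)
    have e: "indicator {g<..L} s * (w s * s powr - p) = (LINT r|lborel. F s r) + L powr - p * (indicator {g<..L} s * w s)" for s
      unfolding pt by simp
    have "(LINT s|lborel. indicator {g<..L} s * (w s * s powr - p)) = (LINT s|lborel. LINT r|lborel. F s r) + L powr - p * W L"
      unfolding e W_def using lborel_pair.integrable_fst[OF iF] iw by simp
    also have "(LINT s|lborel. LINT r|lborel. F s r) = (LINT r|lborel. LINT s|lborel. F s r)"
      by (rule lborel_pair.Fubini_integral[OF iF, symmetric])
    finally show "(LINT s|lborel. indicator {g<..L} s * (w s * s powr - p)) = L powr - p * W L + (LINT r|lborel. h r * W r)" by (simp add: inner)
  qed
  have "\<bar>LINT r|lborel. h r * (N r - W r)\<bar> <= (LINT r|lborel. h r * D)"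
  proof (rule integral_abs_bound[THEN order_trans], rule integral_mono)
    show "integrable lborel (\<lambda>r. \<bar>h r * (N r - W r)\<bar>)" using intN intW by (simp add: right_diff_distrib)
    show "\<bar>h r * (N r - W r)\<bar> <= h r * D" for r
    proof (cases "r \<in> {g..L}")
      case True
      then show ?thesis using D[of r] h0[of r] by (simp add: N_def W_def abs_mult mult_left_mono)
    qed (simp add: h_def)
  qed (use hi in simp)
  moreover have "\<bar>L powr - p * (N L - W L)\<bar> <= L powr - p * D"
    unfolding abs_mult using D[of L] g by (simp add: N_def W_def mult_left_mono)
  ultimately have "\<bar>L powr - p * (N L - W L) + (LINT r|lborel. h r * (N r - W r))\<bar> <= L powr - p * D + (LINT r|lborel. h r * D)" by linarith
  \<comment> \<open>The layers together weigh g^(-p) - L^(-p) and the boundary term at L restores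
    L^(-p), so the discrepancy D is multiplied by exactly g^(-p).\<close>
  moreover have "L powr - p * D + (LINT r|lborel. h r * D) = D * g powr - p" using hi(1) by (simp add: hi(2) algebra_simps)
  moreover have "L powr - p * (N L - W L) + (LINT r|lborel. h r * (N r - W r))
     = (\<Sum>j\<in>J'. Y j powr - p) / n - (LINT s|lborel. indicator {g<..L} s * (w s * s powr - p))"
    unfolding sumN W using intN intW by (simp add: algebra_simps)
  ultimately show ?thesis by (simp add: J'_def)
qed

lemma real_card_Diff: "finite A ==> B \<subseteq> A ==> real (card (A - B)) = real (card A) - real (card B)"
  by (simp add: card_Diff_subset finite_subset of_nat_diff card_mono)

section \<open>Standing assumptions, with their constants fixed once and for all\<close>

locale nibm =
  fixes X0 :: "nat \<Rightarrow> nat \<Rightarrow> real" and psi :: "real \<Rightarrow> real" and xs c \<kappa> \<epsilon> \<sigma> :: real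
  assumes bounded_supp: "\<exists>B. \<forall>n j. 1 <= j \<and> j <= n --> \<bar>X0 n j\<bar> <= B"
    and psi_nonneg: "\<And>x. psi x >= 0"
    and psi_int: "integrable lborel psi"
    and psi_prob: "(LINT s|lborel. psi s) = 1"
    and weak_conv: "\<And>f :: real \<Rightarrow> real. continuous_on UNIV f ==> bounded (range f) ==>
          (\<lambda>n. (\<Sum>j=1..n. f (X0 n j)) / real n) \<longlonglongrightarrow> (LINT s|lborel. f s * psi s)"
    and c_pos: "c > 0" and kappa: "\<kappa> > 2"
    and psi_asymp: "psi \<sim>[at xs] (\<lambda>x. c * \<bar>x - xs\<bar> powr \<kappa>)"
    and assm2: "\<exists>M0>0. \<exists>n0. \<forall>n\<ge>n0. \<forall>x. \<bar>Fn X0 n x - Fmu psi x\<bar> <= M0 / real n"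
    and assm3: "\<exists>m>0. \<exists>n0. \<forall>n\<ge>n0. \<forall>j. 1 <= j \<and> j <= n -->
          X0 n j \<notin> {xs - m * real n powr (-1/(\<kappa>+1)) .. xs + m * real n powr (-1/(\<kappa>+1))}"
    and G2_pos: "Gder psi xs 2 > 0"
    and eps: "0 < \<epsilon>" "\<epsilon> < min ((\<kappa> - 2) / (6 * (\<kappa> + 1))) (1/15)"
    and sigma: "\<sigma> > 0"
begin

definition \<gamma> where "\<gamma> = 1 / (\<kappa> + 1)"

definition bd where "bd = (SOME B. \<forall>n j. 1 <= j \<and> j <= n --> \<bar>X0 n j\<bar> <= B)"

definition M0 where "M0 = (SOME M0. M0 > 0 \<and> (\<exists>n0. \<forall>n\<ge>n0. \<forall>x. \<bar>Fn X0 n x - Fmu psi x\<bar> <= M0 / real n))"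

definition mm where "mm = (SOME m. m > 0 \<and> (\<exists>n0. \<forall>n\<ge>n0. \<forall>j. 1 <= j \<and> j <= n -->
          X0 n j \<notin> {xs - m * real n powr (-1/(\<kappa>+1)) .. xs + m * real n powr (-1/(\<kappa>+1))}))"

definition gap where "gap n = mm * real n powr - \<gamma>"

lemma bd: "1 <= j ==> j <= n ==> \<bar>X0 n j\<bar> <= bd"
  using someI_ex[OF bounded_supp] unfolding bd_def by blast

lemma M0: "M0 > 0" "EV n. \<forall>x. \<bar>Fn X0 n x - Fmu psi x\<bar> <= M0 / real n"
proof -
  have "M0 > 0 \<and> (\<exists>n0. \<forall>n\<ge>n0. \<forall>x. \<bar>Fn X0 n x - Fmu psi x\<bar> <= M0 / real n)"
    unfolding M0_def by (rule someI_ex) (use assm2 in blast)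
  then show "M0 > 0" "EV n. \<forall>x. \<bar>Fn X0 n x - Fmu psi x\<bar> <= M0 / real n"
    by (auto simp: eventually_sequentially)
qed

lemma gap: "mm > 0" "EV n. \<forall>j\<in>{1..n}. \<bar>X0 n j - xs\<bar> > gap n"
proof -
  have "mm > 0 \<and> (\<exists>n0. \<forall>n\<ge>n0. \<forall>j. 1 <= j \<and> j <= n -->
          X0 n j \<notin> {xs - mm * real n powr (-1/(\<kappa>+1)) .. xs + mm * real n powr (-1/(\<kappa>+1))})"
    unfolding mm_def by (rule someI_ex) (use assm3 in blast)
  then obtain n0 where mm: "mm > 0" and n0: "\<And>n j. n >= n0 ==> 1 <= j \<and> j <= n ==>
          X0 n j \<notin> {xs - mm * real n powr (-1/(\<kappa>+1)) .. xs + mm * real n powr (-1/(\<kappa>+1))}" by blast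
  show "mm > 0" by (rule mm)
  have e: "- \<gamma> = -1/(\<kappa>+1)" by (simp add: \<gamma>_def)
  show "EV n. \<forall>j\<in>{1..n}. \<bar>X0 n j - xs\<bar> > gap n"
  proof (rule eventually_sequentiallyI[of n0], rule ballI)
    fix n j assume "n0 <= n" "j \<in> {1..n}"
    with n0[of n j] have "X0 n j \<notin> {xs - gap n .. xs + gap n}" by (simp add: gap_def e)
    then show "\<bar>X0 n j - xs\<bar> > gap n" by (auto simp: abs_if)
  qed
qed

lemma gam: "0 < \<gamma>" "\<gamma> < 1/3" "(\<kappa> + 1) * \<gamma> = 1"
  using kappa by (auto simp: \<gamma>_def field_simps)

text \<open>The first bound on \<epsilon> is (1/3 - \<gamma>) / 2 in disguise: half the exponent by
  which the Airy scale n^(-1/3) is finer than the gap n^(-\<gamma>).\<close>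

lemma eps': "\<epsilon> < 1/15" "2 * \<epsilon> < 1/3 - \<gamma>"
proof -
  show "\<epsilon> < 1/15" using eps by simp
  have "(\<kappa> - 2) / (6 * (\<kappa> + 1)) = (1/3 - \<gamma>) / 2" using kappa by (simp add: \<gamma>_def field_simps)
  moreover have "\<epsilon> < (\<kappa> - 2) / (6 * (\<kappa> + 1))" using order_less_le_trans[OF eps(2) min.cobounded1] .
  ultimately have "\<epsilon> < (1/3 - \<gamma>) / 2" by (simp only:)
  then show "2 * \<epsilon> < 1/3 - \<gamma>" by (simp add: field_simps)
qed

lemma measurable_psi [measurable]: "psi \<in> borel_measurable borel" using psi_int by auto

lemma psi_ind: "integrable lborel (\<lambda>s. indicator A s * psi s)" if "A \<in> sets borel"
  using integrable_mult_indicator[of A lborel psi] psi_int that by simp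

lemma Fmu_eq: "Fmu psi x = (LINT s|lborel. indicator {..x} s * psi s)"
  by (simp add: Fmu_def set_lebesgue_integral_def)

lemma Fmu_diff: "a <= b ==> (LINT s|lborel. indicator {a<..b} s * psi s) = Fmu psi b - Fmu psi a"
proof -
  assume ab: "a <= b"
  have "indicator {a<..b} s * psi s = indicator {..b} s * psi s - indicator {..a} s * psi s" for s
    using ab by (auto simp: indicator_def)
  then show ?thesis unfolding Fmu_eq using psi_ind by simp
qed

lemma Fmu_left: "(LINT s|lborel. indicator {..<x} s * psi s) = Fmu psi x"
  unfolding Fmu_eq
  by (rule integral_cong_AE) (use AE_lborel_singleton[of x] in \<open>auto elim!: eventually_mono simp: indicator_def\<close>)

lemma Fmu_tendsto_left: "(\<lambda>k. Fmu psi (x - 1 / real (Suc k))) \<longlonglongrightarrow> Fmu psi x"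
proof -
  have "(\<lambda>k. LINT s|lborel. indicator {..x - 1 / real (Suc k)} s * psi s) \<longlonglongrightarrow> (LINT s|lborel. indicator {..<x} s * psi s)"
  proof (rule integral_dominated_convergence[where w=psi])
    show "AE s in lborel. (\<lambda>k. indicator {..x - 1 / real (Suc k)} s * psi s) \<longlonglongrightarrow> indicator {..<x} s * psi s"
    proof (rule always_eventually, rule allI)
      fix s
      show "(\<lambda>k. indicator {..x - 1 / real (Suc k)} s * psi s) \<longlonglongrightarrow> indicator {..<x} s * psi s"
      proof (cases "s < x")
        case True
        then obtain k0 where k0: "1 / real (Suc k0) < x - s" using nat_approx_posE[of "x - s"] by auto
        have "\<forall>\<^sub>F k in sequentially. indicator {..x - 1 / real (Suc k)} s * psi s = indicator {..<x} s * psi s"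
        proof (rule eventually_sequentiallyI[of k0])
          fix k assume "k0 <= k"
          then have "1 / real (Suc k) <= 1 / real (Suc k0)" by (intro divide_left_mono) auto
          with k0 True show "indicator {..x - 1 / real (Suc k)} s * psi s = indicator {..<x} s * psi s" by (auto simp: indicator_def)
        qed
        then show ?thesis by (rule tendsto_eventually)
      next
        case False
        moreover have "x - 1 / real (Suc k) < x" for k by simp
        ultimately have "\<not> s <= x - 1 / real (Suc k)" for k by (meson le_less_trans)
        with False show ?thesis by (simp add: indicator_def)
      qed
    qed
  qed (use psi_int psi_nonneg in \<open>auto simp: indicator_def\<close>)
  then show ?thesis unfolding Fmu_left Fmu_eq .
qed

text \<open>On the left of \<open>xs\<close> reflection turns closed half lines into open ones, so
  the points strictly below x have to be counted. The bound passes to the limit from the left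
  because the limiting distribution function is continuous.\<close>

lemma Fn_left_bound:
  assumes "\<forall>x. \<bar>Fn X0 n x - Fmu psi x\<bar> <= D"
  shows "\<bar>real (card {j\<in>{1..n}. X0 n j < x}) / real n - Fmu psi x\<bar> <= D"
proof -
  have "\<forall>\<^sub>F k in sequentially. Fn X0 n (x - 1 / real (Suc k)) = real (card {j\<in>{1..n}. X0 n j < x}) / real n"
  proof -
    have "\<forall>\<^sub>F k in sequentially. \<forall>j\<in>{1..n}. (X0 n j <= x - 1 / real (Suc k)) = (X0 n j < x)"
    proof (rule eventually_ball_finite, simp, rule ballI)
      fix j
      show "\<forall>\<^sub>F k in sequentially. (X0 n j <= x - 1 / real (Suc k)) = (X0 n j < x)"
      proof (cases "X0 n j < x")
        case True
        then obtain k0 where k0: "1 / real (Suc k0) < x - X0 n j" using nat_approx_posE[of "x - X0 n j"] by auto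
        show ?thesis
        proof (rule eventually_sequentiallyI[of k0])
          fix k assume "k0 <= k"
          then have "1 / real (Suc k) <= 1 / real (Suc k0)" by (intro divide_left_mono) auto
          with k0 True show "(X0 n j <= x - 1 / real (Suc k)) = (X0 n j < x)" by auto
        qed
      next
        case False
        moreover have "x - 1 / real (Suc k) < x" for k by simp
        ultimately have "\<not> X0 n j <= x - 1 / real (Suc k)" for k by (meson le_less_trans)
        with False show ?thesis by simp
      qed
    qed
    then show ?thesis
    proof eventually_elim
      case (elim k)
      then have "{j\<in>{1..n}. X0 n j <= x - 1 / real (Suc k)} = {j\<in>{1..n}. X0 n j < x}" by blast
      then show ?case by (simp add: Fn_def)
    qed
  qed
  then have "(\<lambda>k. Fn X0 n (x - 1 / real (Suc k))) \<longlonglongrightarrow> real (card {j\<in>{1..n}. X0 n j < x}) / real n"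
    by (rule tendsto_eventually)
  then have "(\<lambda>k. \<bar>Fn X0 n (x - 1 / real (Suc k)) - Fmu psi (x - 1 / real (Suc k))\<bar>) \<longlonglongrightarrow> \<bar>real (card {j\<in>{1..n}. X0 n j < x}) / real n - Fmu psi x\<bar>"
    by (intro tendsto_intros Fmu_tendsto_left)
  then show ?thesis by (rule LIMSEQ_le_const2) (use assms in auto)
qed

text \<open>The two sides of \<^term>\<open>xs\<close> are treated together: \<^term>\<open>sg = 1\<close> is the right side and \<^term>\<open>sg = -1\<close> the left one.\<close>

lemma side_mass:
  fixes sg :: real
  assumes sg: "sg = 1 \<or> sg = -1" and D: "\<forall>x. \<bar>Fn X0 n x - Fmu psi x\<bar> <= D" and r: "0 < g" "g <= r" and n: "n > 0"
  shows "\<bar>real (card {j\<in>{1..n}. g < sg * (X0 n j - xs) \<and> sg * (X0 n j - xs) <= r}) / real n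
     - (LINT s|lborel. indicator {g<..r} s * psi (xs + sg * s))\<bar> <= 2 * D"
  using sg
proof
  assume s: "sg = 1"
  have "(LINT s|lborel. indicator {xs+g<..xs+r} s * psi s) = \<bar>1\<bar> *\<^sub>R (LINT s|lborel. indicator {xs+g<..xs+r} (xs + 1 * s) * psi (xs + 1 * s))"
    by (rule lborel_integral_real_affine) simp
  also have "\<dots> = (LINT s|lborel. indicator {g<..r} s * psi (xs + sg * s))"
    by (auto simp: s indicator_def intro!: Bochner_Integration.integral_cong)
  finally have i: "(LINT s|lborel. indicator {g<..r} s * psi (xs + sg * s)) = Fmu psi (xs+r) - Fmu psi (xs+g)"
    using Fmu_diff[of "xs+g" "xs+r"] r by simp
  have "{j\<in>{1..n}. g < sg * (X0 n j - xs) \<and> sg * (X0 n j - xs) <= r} = {j\<in>{1..n}. X0 n j <= xs + r} - {j\<in>{1..n}. X0 n j <= xs + g}"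
    by (auto simp: s)
  note e = this
  have "real (card {j\<in>{1..n}. g < sg * (X0 n j - xs) \<and> sg * (X0 n j - xs) <= r}) = real (card {j\<in>{1..n}. X0 n j <= xs + r}) - real (card {j\<in>{1..n}. X0 n j <= xs + g})"
    unfolding e by (rule real_card_Diff) (use r in auto)
  then have "real (card {j\<in>{1..n}. g < sg * (X0 n j - xs) \<and> sg * (X0 n j - xs) <= r}) / real n = Fn X0 n (xs + r) - Fn X0 n (xs + g)"
    by (simp add: Fn_def diff_divide_distrib)
  then show ?thesis using i D[rule_format, of "xs+r"] D[rule_format, of "xs+g"] by linarith
next
  assume s: "sg = -1"
  have "(LINT s|lborel. indicator {xs-r..<xs-g} s * psi s) = \<bar>-1\<bar> *\<^sub>R (LINT s|lborel. indicator {xs-r..<xs-g} (xs + (-1) * s) * psi (xs + (-1) * s))"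
    by (rule lborel_integral_real_affine) simp
  also have "\<dots> = (LINT s|lborel. indicator {g<..r} s * psi (xs + sg * s))"
    by (auto simp: s indicator_def intro!: Bochner_Integration.integral_cong)
  \<comment> \<open>The reflected interval is closed at its other end; the two end points are
    null.\<close>
  also have "(LINT s|lborel. indicator {xs-r..<xs-g} s * psi s) = (LINT s|lborel. indicator {xs-r<..xs-g} s * psi s)"
    by (rule integral_cong_AE) (use AE_lborel_singleton[of "xs-r"] AE_lborel_singleton[of "xs-g"] in \<open>auto simp: indicator_def\<close>)
  finally have i: "(LINT s|lborel. indicator {g<..r} s * psi (xs + sg * s)) = Fmu psi (xs-g) - Fmu psi (xs-r)"
    using Fmu_diff[of "xs-r" "xs-g"] r by simp
  have "{j\<in>{1..n}. g < sg * (X0 n j - xs) \<and> sg * (X0 n j - xs) <= r} = {j\<in>{1..n}. X0 n j < xs - g} - {j\<in>{1..n}. X0 n j < xs - r}"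
    by (auto simp: s)
  note e = this
  have "real (card {j\<in>{1..n}. g < sg * (X0 n j - xs) \<and> sg * (X0 n j - xs) <= r}) = real (card {j\<in>{1..n}. X0 n j < xs - g}) - real (card {j\<in>{1..n}. X0 n j < xs - r})"
    unfolding e by (rule real_card_Diff) (use r in auto)
  then have "real (card {j\<in>{1..n}. g < sg * (X0 n j - xs) \<and> sg * (X0 n j - xs) <= r}) / real n
     = real (card {j\<in>{1..n}. X0 n j < xs - g}) / real n - real (card {j\<in>{1..n}. X0 n j < xs - r}) / real n"
    by (simp add: diff_divide_distrib)
  then show ?thesis using i Fn_left_bound[OF D, of "xs-g"] Fn_left_bound[OF D, of "xs-r"] by linarith
qed

definition wside where "wside sg s = psi (xs + sg * s)" for sg s :: real

lemma wside_int: "sg = 1 \<or> sg = -1 ==> integrable lborel (wside sg)"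
  unfolding wside_def using lborel_integrable_real_affine[of psi sg xs] psi_int by auto

lemma wside_measurable [measurable]: "wside sg \<in> borel_measurable borel"
  unfolding wside_def by measurable

lemma wside_nonneg: "wside sg s >= 0" by (simp add: wside_def psi_nonneg)

lemma wside_near:
  obtains K \<rho> where "K > 0" "\<rho> > 0" "\<And>sg s. \<bar>sg\<bar> = 1 ==> 0 < s ==> s < \<rho> ==> wside sg s <= K * s powr \<kappa>"
proof -
  have "psi \<in> O[at xs](\<lambda>x. c * \<bar>x - xs\<bar> powr \<kappa>)" using psi_asymp by (rule asymp_equiv_imp_bigo)
  then obtain K where K: "K > 0" "\<forall>\<^sub>F x in at xs. norm (psi x) <= K * norm (c * \<bar>x - xs\<bar> powr \<kappa>)" by (elim landau_o.bigE)
  then obtain \<rho> where \<rho>: "\<rho> > 0" "\<And>x. x \<noteq> xs ==> dist x xs < \<rho> ==> norm (psi x) <= K * norm (c * \<bar>x - xs\<bar> powr \<kappa>)"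
    unfolding eventually_at by auto
  show thesis
  proof (rule that[of "K * c" \<rho>])
    show "K * c > 0" using K c_pos by simp
    fix sg s :: real assume s: "\<bar>sg\<bar> = 1" "0 < s" "s < \<rho>"
    then have "xs + sg * s \<noteq> xs" "dist (xs + sg * s) xs < \<rho>" by (auto simp: dist_real_def abs_mult)
    from \<rho>(2)[OF this] s show "wside sg s <= K * c * s powr \<kappa>"
      using c_pos psi_nonneg by (simp add: wside_def abs_mult)
  qed (rule \<rho>)
qed

lemma integrable_powr_0:
  fixes q r :: real
  assumes "q > -1" "r >= 0"
  shows "integrable lborel (\<lambda>s. indicator {0<..r} s * s powr q)" "(LINT s|lborel. indicator {0<..r} s * s powr q) = r powr (q+1) / (q+1)"
proof -
  have h: "((\<lambda>x. x powr q) has_integral (r powr (q+1) / (q+1))) {0..r}" by (rule has_integral_powr_from_0) fact+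
  then have "(\<lambda>x. x powr q) absolutely_integrable_on {0..r}"
    by (intro nonnegative_absolutely_integrable_1) (auto simp: integrable_on_def)
  then have S: "set_integrable lborel {0..r} (\<lambda>x. x powr q)"
    unfolding absolutely_integrable_on_def set_integrable_def by (subst integrable_completion[symmetric]) auto
  have e: "indicator {0<..r} s * s powr q = indicator {0..r} s *\<^sub>R s powr q" for s :: real
    by (auto simp: indicator_def)
  show "integrable lborel (\<lambda>s. indicator {0<..r} s * s powr q)" using S unfolding e set_integrable_def .
  have "integral {0..r} (\<lambda>x. x powr q) = r powr (q+1) / (q+1)" using h by (rule integral_unique)
  then show "(LINT s|lborel. indicator {0<..r} s * s powr q) = r powr (q+1) / (q+1)"
    using set_borel_integral_eq_integral(2)[OF S] unfolding e set_lebesgue_integral_def by simp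
qed

text \<open>Near 0 the integrand is at most a multiple of s^(\<kappa> - p), which is integrable
  exactly when p < \<kappa> + 1. The second claim measures what the limit puts inside the gap, where
  no initial point lies.\<close>

lemma wside_powr:
  fixes p sg :: real
  assumes sg: "sg = 1 \<or> sg = -1" and p: "0 < p" "p < \<kappa> + 1"
  shows "integrable lborel (\<lambda>s. indicator {0<..} s * (wside sg s * s powr - p))"
    and "\<exists>C\<ge>0. \<exists>\<rho>>0. \<forall>g. 0 < g \<and> g < \<rho> --> (LINT s|lborel. indicator {0<..g} s * (wside sg s * s powr - p)) <= C * g powr (\<kappa> + 1 - p)"
proof -
  obtain K \<rho> where K: "K > 0" "\<rho> > 0" "\<And>sg s. \<bar>sg\<bar> = 1 ==> 0 < s ==> s < \<rho> ==> wside sg s <= K * s powr \<kappa>" by (rule wside_near) (rule that)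
  have sg1: "\<bar>sg\<bar> = 1" using sg by auto
  have q: "\<kappa> - p > -1" using p by simp
  have near: "wside sg s * s powr - p <= K * s powr (\<kappa> - p)" if "0 < s" "s < \<rho>" for s
    using mult_right_mono[OF K(3)[OF sg1 that], of "s powr - p"] by (simp add: powr_diff powr_minus divide_inverse)
  define H where "H = (\<lambda>s. K * (indicator {0<..\<rho>} s * s powr (\<kappa> - p)) + \<rho> powr - p * wside sg s)"
  have H: "integrable lborel H" unfolding H_def
    using integrable_powr_0(1)[OF q] K wside_int[OF sg] by auto
  show I: "integrable lborel (\<lambda>s. indicator {0<..} s * (wside sg s * s powr - p))"
  proof (rule Bochner_Integration.integrable_bound[OF H])
    show "AE s in lborel. norm (indicator {0<..} s * (wside sg s * s powr - p)) <= norm (H s)"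
    proof (rule AE_I2)
      fix s
      have H0: "H s >= 0" using K wside_nonneg by (auto simp: H_def)
      have "indicator {0<..} s * (wside sg s * s powr - p) <= H s"
      proof (cases "s > 0")
        case True
        show ?thesis
        proof (cases "s < \<rho>")
          case T: True
          have "\<rho> powr - p * wside sg s >= 0" using wside_nonneg by simp
          then show ?thesis using near[OF True T] True T by (simp add: H_def)
        next
          case False
          have "s powr - p <= \<rho> powr - p" using False K(2) p by (intro powr_mono2') auto
          then have "wside sg s * s powr - p <= \<rho> powr - p * wside sg s"
            using wside_nonneg by (metis mult.commute mult_left_mono)
          moreover have "K * (indicator {0<..\<rho>} s * s powr (\<kappa> - p)) >= 0" using K by simp
          ultimately show ?thesis using True unfolding H_def by simp
        qed
      qed (use H0 in simp)
      then show "norm (indicator {0<..} s * (wside sg s * s powr - p)) <= norm (H s)"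
        using H0 wside_nonneg by simp
    qed
  qed measurable
  show "\<exists>C\<ge>0. \<exists>\<rho>>0. \<forall>g. 0 < g \<and> g < \<rho> --> (LINT s|lborel. indicator {0<..g} s * (wside sg s * s powr - p)) <= C * g powr (\<kappa> + 1 - p)"
  proof (intro exI conjI allI impI)
    show "K / (\<kappa> + 1 - p) >= 0" using K p by simp
    show "\<rho> > 0" by (rule K)
    fix g assume g: "0 < g \<and> g < \<rho>"
    have "(LINT s|lborel. indicator {0<..g} s * (wside sg s * s powr - p)) <= (LINT s|lborel. K * (indicator {0<..g} s * s powr (\<kappa> - p)))"
    proof (rule integral_mono)
      have "indicator {0<..g} s * (wside sg s * s powr - p) = indicator {0<..g} s *\<^sub>R (indicator {0<..} s * (wside sg s * s powr - p))" for s
        by (auto simp: indicator_def)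
      note e = this
      show "integrable lborel (\<lambda>s. indicator {0<..g} s * (wside sg s * s powr - p))"
        unfolding e by (rule integrable_mult_indicator[OF _ I]) simp
      show "integrable lborel (\<lambda>s. K * (indicator {0<..g} s * s powr (\<kappa> - p)))" using integrable_powr_0(1)[OF q] g by auto
      show "indicator {0<..g} s * (wside sg s * s powr - p) <= K * (indicator {0<..g} s * s powr (\<kappa> - p))" for s
        using near[of s] g by (auto simp: indicator_def)
    qed
    also have "\<dots> = K / (\<kappa> + 1 - p) * g powr (\<kappa> + 1 - p)"
      using integrable_powr_0(2)[OF q, of g] g by (simp add: algebra_simps)
    finally show "(LINT s|lborel. indicator {0<..g} s * (wside sg s * s powr - p)) <= K / (\<kappa> + 1 - p) * g powr (\<kappa> + 1 - p)" .
  qed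
qed

definition Iside where "Iside sg p = (LINT s|lborel. indicator {0<..} s * (wside sg s * s powr - p))" for sg p :: real

definition Sside where "Sside sg p n = (\<Sum>j | j \<in> {1..n} \<and> 0 < sg * (X0 n j - xs). (sg * (X0 n j - xs)) powr - p) / real n" for sg p :: real

lemma gap_tendsto_0: "gap \<longlonglongrightarrow> 0"
  unfolding gap_def using gam(1)
  by (intro tendsto_mult_right_zero tendsto_neg_powr filterlim_real_sequentially) auto

lemma gap_pos: "n > 0 ==> gap n > 0"
  using gap(1) by (simp add: gap_def)

text \<open>Two errors arise: the discrepancy 2 \<open>M0\<close> / n of the distribution functions,
  amplified by gap^(-p), and the part of the limit inside the gap, of size gap^(\<kappa> + 1 - p).
  Since (\<kappa> + 1) \<gamma> = 1, both are of order n^(p \<gamma> - 1).\<close>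

lemma moment_side:
  fixes p sg :: real
  assumes sg: "sg = 1 \<or> sg = -1" and p: "0 < p" "p < \<kappa> + 1"
  shows "\<exists>C. EV n. \<bar>Sside sg p n - Iside sg p\<bar> <= C * real n powr (p * \<gamma> - 1)"
proof -
  note I = wside_powr(1)[OF sg p]
  from wside_powr(2)[OF sg p] obtain C \<rho> where C: "C >= 0" "\<rho> > 0"
    "\<And>g. 0 < g ==> g < \<rho> ==> (LINT s|lborel. indicator {0<..g} s * (wside sg s * s powr - p)) <= C * g powr (\<kappa> + 1 - p)" by blast
  \<comment> \<open>All initial points lie within distance L of \<open>xs\<close>, so cutting off
    the sum at any L' >= L changes nothing; the integral to infinity is then reached by letting L'
    grow.\<close>
  define L where "L = \<bar>xs\<bar> + \<bar>bd\<bar> + 1"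
  have "EV n. gap n < min \<rho> L"
    using gap_tendsto_0 C(2) by (intro order_tendstoD) (auto simp: L_def)
  then have "EV n. \<bar>Sside sg p n - Iside sg p\<bar> <= (2 * M0 * mm powr - p + C * mm powr (\<kappa> + 1 - p)) * real n powr (p * \<gamma> - 1)"
    using M0(2) gap(2) eventually_gt_at_top[of 0]
  proof eventually_elim
    case (elim n)
    have n: "real n > 0" using elim by simp
    have g: "0 < gap n" "gap n < \<rho>" "gap n < L" using elim gap_pos by auto
    define g where "g = gap n"
    define J where "J = {1..n}"
    define Y where "Y = (\<lambda>j. sg * (X0 n j - xs))"
    have Yg: "(g < Y j \<and> Y j <= L') \<longleftrightarrow> 0 < Y j" if "j \<in> J" "L' >= L" for j L'
    proof -
      have "\<bar>Y j\<bar> > g" using elim(3) that(1) sg by (auto simp: g_def J_def Y_def abs_mult)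
      moreover have "\<bar>Y j\<bar> <= L" using bd[of j n] that(1) sg by (auto simp: J_def Y_def L_def)
      ultimately show ?thesis using that(2) g by (auto simp: g_def)
    qed
    have b: "\<bar>Sside sg p n - (LINT s|lborel. indicator {g<..L'} s * (wside sg s * s powr - p))\<bar> <= (2 * (M0 / real n)) * g powr - p" if L': "L' >= L" for L'
    proof -
      have "{j. j \<in> J \<and> g < Y j \<and> Y j <= L'} = {j. j \<in> J \<and> 0 < Y j}" using Yg L' by blast
      then have "Sside sg p n = (\<Sum>j | j \<in> J \<and> g < Y j \<and> Y j <= L'. Y j powr - p) / real n" by (simp add: Sside_def J_def Y_def)
      then show ?thesis
        using quadrature_powr[of J "real n" g L' p "wside sg" Y "2 * (M0 / real n)"] side_mass[OF sg elim(2), of g] n g L' p wside_int[OF sg]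
        by (auto simp: J_def Y_def g_def wside_def)
    qed
    have "(\<lambda>k. LINT s|lborel. indicator {g<..L + real k} s * (wside sg s * s powr - p)) \<longlonglongrightarrow> (LINT s|lborel. indicator {g<..} s * (wside sg s * s powr - p))"
    proof (rule integral_dominated_convergence[where w="\<lambda>s. indicator {0<..} s * (wside sg s * s powr - p)"])
      show "AE s in lborel. (\<lambda>k. indicator {g<..L + real k} s * (wside sg s * s powr - p)) \<longlonglongrightarrow> indicator {g<..} s * (wside sg s * s powr - p)"
      proof (rule AE_I2)
        fix s
        obtain k0 :: nat where "s - L <= real k0" using real_arch_simple by blast
        then have "\<forall>\<^sub>F k in sequentially. indicator {g<..L + real k} s * (wside sg s * s powr - p) = indicator {g<..} s * (wside sg s * s powr - p)"
          by (intro eventually_sequentiallyI[of k0]) (auto simp: indicator_def)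
        then show "(\<lambda>k. indicator {g<..L + real k} s * (wside sg s * s powr - p)) \<longlonglongrightarrow> indicator {g<..} s * (wside sg s * s powr - p)"
          by (rule tendsto_eventually)
      qed
      show "AE s in lborel. norm (indicator {g<..L + real k} s * (wside sg s * s powr - p)) <= indicator {0<..} s * (wside sg s * s powr - p)" for k
        using g wside_nonneg by (intro AE_I2) (auto simp: indicator_def g_def)
    qed (use I in auto)
    then have "(\<lambda>k. \<bar>Sside sg p n - (LINT s|lborel. indicator {g<..L + real k} s * (wside sg s * s powr - p))\<bar>) \<longlonglongrightarrow> \<bar>Sside sg p n - (LINT s|lborel. indicator {g<..} s * (wside sg s * s powr - p))\<bar>"
      by (intro tendsto_intros)
    then have b1: "\<bar>Sside sg p n - (LINT s|lborel. indicator {g<..} s * (wside sg s * s powr - p))\<bar> <= (2 * (M0 / real n)) * g powr - p"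
      by (rule LIMSEQ_le_const2) (use b in auto)
    have Ia: "integrable lborel (\<lambda>s. indicator A s * (wside sg s * s powr - p))" if "A \<in> sets borel" "A \<subseteq> {0<..}" for A
    proof -
      have "indicator A s * (wside sg s * s powr - p) = indicator A s *\<^sub>R (indicator {0<..} s * (wside sg s * s powr - p))" for s
        using that(2) by (auto simp: indicator_def)
      note e = this
      show ?thesis unfolding e by (rule integrable_mult_indicator[OF _ I]) (use that in simp)
    qed
    have "indicator {0<..} s * (wside sg s * s powr - p) = indicator {0<..g} s * (wside sg s * s powr - p) + indicator {g<..} s * (wside sg s * s powr - p)" for s
      using g by (auto simp: indicator_def g_def)
    then have "Iside sg p = (LINT s|lborel. indicator {0<..g} s * (wside sg s * s powr - p)) + (LINT s|lborel. indicator {g<..} s * (wside sg s * s powr - p))"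
      unfolding Iside_def using Ia[of "{0<..g}"] Ia[of "{g<..}"] g by (simp add: g_def subset_iff)
    moreover have "(LINT s|lborel. indicator {0<..g} s * (wside sg s * s powr - p)) <= C * g powr (\<kappa> + 1 - p)" using C(3) g by (simp add: g_def)
    moreover have "(LINT s|lborel. indicator {0<..g} s * (wside sg s * s powr - p)) >= 0" by (intro integral_nonneg_AE AE_I2) (simp add: wside_nonneg)
    ultimately have "\<bar>Sside sg p n - Iside sg p\<bar> <= (2 * (M0 / real n)) * g powr - p + C * g powr (\<kappa> + 1 - p)" using b1 by linarith
    also have "g powr - p = mm powr - p * real n powr (p * \<gamma>)"
      using n gap(1) by (simp add: g_def gap_def powr_mult powr_powr mult.commute)
    also have "g powr (\<kappa> + 1 - p) = mm powr (\<kappa> + 1 - p) * real n powr (p * \<gamma> - 1)"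
    proof -
      have "- \<gamma> * (\<kappa> + 1 - p) = p * \<gamma> - 1" using gam(3) by (simp add: algebra_simps)
      then show ?thesis using n gap(1) by (simp add: g_def gap_def powr_mult powr_powr)
    qed
    also have "2 * (M0 / real n) * (mm powr - p * real n powr (p * \<gamma>)) = 2 * M0 * mm powr - p * real n powr (p * \<gamma> - 1)"
      using n by (simp add: powr_diff)
    finally show ?case by (simp add: algebra_simps)
  qed
  then show ?thesis by blast
qed

definition a where "a n j = 1 / (xs - X0 n j)" for n j :: nat
definition S where "S k n = (\<Sum>j=1..n. a n j ^ k) / real n" for k n :: nat
definition Mom where "Mom k = (LINT s|lborel. psi s / (xs - s) ^ k)" for k :: nat

lemma sum_split_sides:
  assumes "\<And>j. j \<in> {1..n} ==> X0 n j \<noteq> xs"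
  shows "(\<Sum>j=1..n. f j) = (\<Sum>j | j \<in> {1..n} \<and> 0 < 1 * (X0 n j - xs). f j) + (\<Sum>j | j \<in> {1..n} \<and> 0 < -1 * (X0 n j - xs). f j)"
proof -
  have "{1..n} = {j. j \<in> {1..n} \<and> 0 < 1 * (X0 n j - xs)} \<union> {j. j \<in> {1..n} \<and> 0 < -1 * (X0 n j - xs)}"
  proof -
    have "0 < 1 * (X0 n j - xs) \<or> 0 < -1 * (X0 n j - xs)" if "j \<in> {1..n}" for j using assms[OF that] by (cases "X0 n j > xs") auto
    then show ?thesis by blast
  qed
  then have "(\<Sum>j=1..n. f j) = sum f ({j. j \<in> {1..n} \<and> 0 < 1 * (X0 n j - xs)} \<union> {j. j \<in> {1..n} \<and> 0 < -1 * (X0 n j - xs)})" by (rule arg_cong)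
  also have "\<dots> = (\<Sum>j | j \<in> {1..n} \<and> 0 < 1 * (X0 n j - xs). f j) + (\<Sum>j | j \<in> {1..n} \<and> 0 < -1 * (X0 n j - xs). f j)"
    by (rule sum.union_disjoint) auto
  finally show ?thesis .
qed

lemma eventually_X0_ne: "EV n. \<forall>j\<in>{1..n}. X0 n j \<noteq> xs"
  using gap(2) eventually_gt_at_top[of 0]
proof eventually_elim
  case (elim n)
  then show ?case using gap_pos[of n] by force
qed

lemma powr_minus_nat: "y > 0 ==> y powr - real k = (1 / y) ^ k" for y :: real
  by (simp add: powr_minus powr_realpow power_one_over inverse_eq_divide)

lemma S_sides: "EV n. S k n = (-1)^k * Sside 1 k n + Sside (-1) k n"
  using eventually_X0_ne
proof eventually_elim
  case (elim n)
  have "(\<Sum>j | j \<in> {1..n} \<and> 0 < 1 * (X0 n j - xs). a n j ^ k) = (\<Sum>j | j \<in> {1..n} \<and> 0 < 1 * (X0 n j - xs). (-1)^k * (1 * (X0 n j - xs)) powr - real k)"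
  proof (rule sum.cong[OF refl])
    fix j assume "j \<in> {j. j \<in> {1..n} \<and> 0 < 1 * (X0 n j - xs)}"
    then have "X0 n j - xs > 0" by simp
    moreover have "a n j = (-1) * (1 / (X0 n j - xs))" by (simp add: a_def minus_divide_right)
    ultimately show "a n j ^ k = (-1)^k * (1 * (X0 n j - xs)) powr - real k" by (simp only: power_mult_distrib powr_minus_nat mult_1)
  qed
  moreover have "(\<Sum>j | j \<in> {1..n} \<and> 0 < -1 * (X0 n j - xs). a n j ^ k) = (\<Sum>j | j \<in> {1..n} \<and> 0 < -1 * (X0 n j - xs). (-1 * (X0 n j - xs)) powr - real k)"
    by (rule sum.cong[OF refl]) (simp add: a_def powr_minus_nat)
  ultimately show ?case
    using sum_split_sides[of n "\<lambda>j. a n j ^ k"] elim by (simp add: S_def Sside_def sum_distrib_left[symmetric] add_divide_distrib)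
qed

text \<open>Orders up to 3 are admissible because \<kappa> > 2; the sign (-1)^k comes from xs - s
  being negative on the right side.\<close>

lemma Mom_sides:
  assumes k: "k > 0" "k <= 3"
  shows "Mom k = (-1)^k * Iside 1 k + Iside (-1) k" "integrable lborel (\<lambda>s. psi s / (xs - s) ^ k)"
proof -
  have p: "0 < real k" "real k < \<kappa> + 1" using k kappa by auto
  let ?f = "\<lambda>s. psi s / (xs - s) ^ k"
  have e1: "indicator {xs<..} (xs + 1 * s) * ?f (xs + 1 * s) = (-1)^k * (indicator {0<..} s * (wside 1 s * s powr - real k))" for s
  proof (cases "s > 0")
    case True
    have "(- s) ^ k = (-1)^k * s^k" by (metis mult_minus1 power_mult_distrib)
    then show ?thesis using True by (simp add: wside_def powr_minus_nat power_one_over) (simp add: field_simps flip: power_mult_distrib)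
  qed simp
  have e2: "indicator {..<xs} (xs + (-1) * s) * ?f (xs + (-1) * s) = indicator {0<..} s * (wside (-1) s * s powr - real k)" for s
    by (cases "s > 0") (simp_all add: wside_def powr_minus_nat power_one_over)
  have i1: "integrable lborel (\<lambda>s. indicator {xs<..} s * ?f s)"
    by (subst lborel_integrable_real_affine_iff[where c=1 and t=xs, symmetric], simp, unfold e1)
       (use wside_powr(1)[of 1 "real k"] p in auto)
  have i2: "integrable lborel (\<lambda>s. indicator {..<xs} s * ?f s)"
    by (subst lborel_integrable_real_affine_iff[where c="-1" and t=xs, symmetric], simp, unfold e2)
       (use wside_powr(1)[of "-1" "real k"] p in auto)
  \<comment> \<open>At s = xs the quotient is 0 by the convention for division by zero, so the two
    open half lines suffice.\<close>
  have f: "?f s = indicator {xs<..} s * ?f s + indicator {..<xs} s * ?f s" for s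
    using k by (cases s xs rule: linorder_cases) auto
  show "integrable lborel ?f" by (subst f) (use i1 i2 in auto)
  have "Mom k = (LINT s|lborel. indicator {xs<..} s * ?f s) + (LINT s|lborel. indicator {..<xs} s * ?f s)"
    unfolding Mom_def Bochner_Integration.integral_add[OF i1 i2, symmetric] by (rule Bochner_Integration.integral_cong[OF refl f])
  also have "(LINT s|lborel. indicator {xs<..} s * ?f s) = \<bar>1\<bar> *\<^sub>R (LINT s|lborel. indicator {xs<..} (xs + 1 * s) * ?f (xs + 1 * s))"
    by (rule lborel_integral_real_affine) simp
  also have "(LINT s|lborel. indicator {..<xs} s * ?f s) = \<bar>-1\<bar> *\<^sub>R (LINT s|lborel. indicator {..<xs} (xs + (-1) * s) * ?f (xs + (-1) * s))"
    by (rule lborel_integral_real_affine) simp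
  finally show "Mom k = (-1)^k * Iside 1 k + Iside (-1) k" unfolding e1 e2 Iside_def by simp
qed

lemma S_asymp:
  assumes k: "k > 0" "k <= 3"
  shows "\<exists>C. EV n. \<bar>S k n - Mom k\<bar> <= C * real n powr (real k * \<gamma> - 1)"
proof -
  have p: "0 < real k" "real k < \<kappa> + 1" using k kappa by auto
  obtain C1 where C1: "EV n. \<bar>Sside 1 k n - Iside 1 k\<bar> <= C1 * real n powr (real k * \<gamma> - 1)"
    using moment_side[of 1 "real k"] p by auto
  obtain C2 where C2: "EV n. \<bar>Sside (-1) k n - Iside (-1) k\<bar> <= C2 * real n powr (real k * \<gamma> - 1)"
    using moment_side[of "-1" "real k"] p by auto
  have "EV n. \<bar>S k n - Mom k\<bar> <= (C1 + C2) * real n powr (real k * \<gamma> - 1)"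
    using C1 C2 S_sides[of k]
  proof eventually_elim
    case (elim n)
    have "\<bar>S k n - Mom k\<bar> = \<bar>(-1)^k * (Sside 1 k n - Iside 1 k) + (Sside (-1) k n - Iside (-1) k)\<bar>"
      unfolding elim(3) Mom_sides(1)[OF k] by (simp add: algebra_simps)
    also have "\<dots> <= \<bar>(-1)^k * (Sside 1 k n - Iside 1 k)\<bar> + \<bar>Sside (-1) k n - Iside (-1) k\<bar>" by (rule abs_triangle_ineq)
    also have "\<bar>(-1)^k * (Sside 1 k n - Iside 1 k)\<bar> = \<bar>Sside 1 k n - Iside 1 k\<bar>" by (simp add: abs_mult power_abs)
    finally show ?case using elim by (simp add: algebra_simps)
  qed
  then show ?thesis by blast
qed

lemma abs_moment_bounded:
  assumes p: "0 < p" "p < \<kappa> + 1"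
  shows "\<exists>C. EV n. (\<Sum>j=1..n. \<bar>a n j\<bar> powr p) / real n <= C"
proof -
  obtain C1 where C1: "EV n. \<bar>Sside 1 p n - Iside 1 p\<bar> <= C1 * real n powr (p * \<gamma> - 1)"
    using moment_side[of 1 p] p by auto
  obtain C2 where C2: "EV n. \<bar>Sside (-1) p n - Iside (-1) p\<bar> <= C2 * real n powr (p * \<gamma> - 1)"
    using moment_side[of "-1" p] p by auto
  have pg: "p * \<gamma> - 1 <= 0" using mult_strict_right_mono[OF p(2) gam(1)] gam(3) by simp
  have "EV n. (\<Sum>j=1..n. \<bar>a n j\<bar> powr p) / real n <= Iside 1 p + \<bar>C1\<bar> + Iside (-1) p + \<bar>C2\<bar>"
    using C1 C2 eventually_X0_ne eventually_ge_at_top[of 1]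
  proof eventually_elim
    case (elim n)
    have "\<bar>a n j\<bar> powr p = \<bar>X0 n j - xs\<bar> powr - p" if "j \<in> {1..n}" for j
      by (simp add: a_def powr_minus powr_divide abs_minus_commute inverse_eq_divide)
    then have "(\<Sum>j=1..n. \<bar>a n j\<bar> powr p) = (\<Sum>j=1..n. \<bar>X0 n j - xs\<bar> powr - p)" by simp
    also have "\<dots> = (\<Sum>j | j \<in> {1..n} \<and> 0 < 1 * (X0 n j - xs). \<bar>X0 n j - xs\<bar> powr - p) + (\<Sum>j | j \<in> {1..n} \<and> 0 < -1 * (X0 n j - xs). \<bar>X0 n j - xs\<bar> powr - p)"
      by (rule sum_split_sides) (use elim in auto)
    also have "(\<Sum>j | j \<in> {1..n} \<and> 0 < 1 * (X0 n j - xs). \<bar>X0 n j - xs\<bar> powr - p) = (\<Sum>j | j \<in> {1..n} \<and> 0 < 1 * (X0 n j - xs). (1 * (X0 n j - xs)) powr - p)"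
      by (rule sum.cong) auto
    also have "(\<Sum>j | j \<in> {1..n} \<and> 0 < -1 * (X0 n j - xs). \<bar>X0 n j - xs\<bar> powr - p) = (\<Sum>j | j \<in> {1..n} \<and> 0 < -1 * (X0 n j - xs). (-1 * (X0 n j - xs)) powr - p)"
      by (rule sum.cong) auto
    finally have e: "(\<Sum>j=1..n. \<bar>a n j\<bar> powr p) / real n = Sside 1 p n + Sside (-1) p n" by (simp add: Sside_def add_divide_distrib)
    have n1: "real n powr (p * \<gamma> - 1) <= 1" using powr_mono[OF pg, of "real n"] elim by simp
    have "C1 * real n powr (p * \<gamma> - 1) <= \<bar>C1\<bar>" "C2 * real n powr (p * \<gamma> - 1) <= \<bar>C2\<bar>"
      using mult_mono[OF abs_ge_self n1, of C1] mult_mono[OF abs_ge_self n1, of C2] by auto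
    then show ?case unfolding e using elim by linarith
  qed
  then show ?thesis by blast
qed

end

section \<open>Expansion at the critical point\<close>

text \<open>Either |u| is small, or its imaginary part is at least |u| / 4. The bound 1/5 is the
  minimum of the larger of 1 - t and t / 4 for t = |u|, attained at t = 4/5; it keeps the whole
  segment away from the singularity of the logarithm.\<close>

lemma norm_one_plus_ge:
  fixes q u :: complex
  assumes q: "cmod q <= 1/2 \<or> \<bar>Im q\<bar> >= cmod q / 4" and u: "u \<in> closed_segment 0 q"
  shows "cmod (1 + u) >= 1/5" "1 + u \<notin> \<real>\<^sub>\<le>\<^sub>0"
proof -
  obtain s where s: "0 <= s" "s <= 1" "u = of_real s * q" using u by (auto simp: closed_segment_def scaleR_conv_of_real)
  have nu: "cmod u = s * cmod q" using s by (simp add: norm_mult)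
  have t1: "cmod (1 + u) >= 1 - cmod u" using norm_triangle_ineq2[of 1 "- u"] by simp
  have "cmod (1 + u) >= 1/5 \<and> 1 + u \<notin> \<real>\<^sub>\<le>\<^sub>0"
  proof (cases "cmod q <= 1/2")
    case True
    have "s * cmod q <= 1 * (1/2)" using s True by (intro mult_mono) auto
    then have u2: "cmod u <= 1/2" by (simp add: nu)
    moreover have "Re (1 + u) > 0" using abs_Re_le_cmod[of u] u2 by simp
    ultimately show ?thesis using t1 by (auto simp: complex_nonpos_Reals_iff)
  next
    case False
    with q have im: "\<bar>Im q\<bar> >= cmod q / 4" by auto
    have "\<bar>Im u\<bar> = s * \<bar>Im q\<bar>" using s by (simp add: abs_mult)
    then have iu: "\<bar>Im u\<bar> >= cmod u / 4" using mult_left_mono[OF im s(1)] by (simp add: nu)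
    have "cmod (1 + u) >= \<bar>Im u\<bar>" using abs_Im_le_cmod[of "1+u"] by simp
    then have "cmod (1 + u) >= 1/5" using iu t1 by linarith
    moreover have "1 + u \<notin> \<real>\<^sub>\<le>\<^sub>0"
    proof
      assume "1 + u \<in> \<real>\<^sub>\<le>\<^sub>0"
      then have "Im u = 0" "Re u <= -1" by (auto simp: complex_nonpos_Reals_iff)
      with iu have "cmod u = 0" by simp
      with \<open>Re u <= -1\<close> show False by simp
    qed
    ultimately show ?thesis by blast
  qed
  then show "cmod (1 + u) >= 1/5" "1 + u \<notin> \<real>\<^sub>\<le>\<^sub>0" by auto
qed

lemma inverse_power_derivative:
  fixes c u :: complex
  assumes "1 + u \<noteq> 0"
  shows "((\<lambda>u. c / (1 + u)^k) has_field_derivative - (of_nat k * c) / (1 + u)^(Suc k)) (at u within A)"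
proof -
  have e: "(0 * w^k - c * (of_nat k * w^(k-1))) / (w^k * w^k) = - (of_nat k * c) / w^(Suc k)" if "w \<noteq> 0" for w :: complex
    using that by (cases k) (auto simp: field_simps)
  have "((\<lambda>u. c / (1 + u)^k) has_field_derivative (0 * (1 + u)^k - c * (of_nat k * (1 + u)^(k-1))) / ((1 + u)^k * (1 + u)^k)) (at u within A)"
    using assms by (auto intro!: derivative_eq_intros)
  then show ?thesis unfolding e[OF assms] .
qed

text \<open>Taylor's formula with third and with fourth derivative gives errors of order |q|^3 and
  |q|^4; the first is used for |q| > 1 and the second for |q| <= 1, which covers every exponent p in
  between. Such p are needed because only the inverse moments of order below \<kappa> + 1 are
  bounded, and \<kappa> + 1 may be less than 4. The constant is 6 * 5^4 / 3! = 625.\<close>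

lemma Ln_one_plus_cubic:
  fixes q :: complex and p :: real
  assumes q: "cmod q <= 1/2 \<or> \<bar>Im q\<bar> >= cmod q / 4" and p: "3 <= p" "p <= 4"
  shows "cmod (Ln (1 + q) - (q - q^2/2 + q^3/3)) <= 625 * cmod q powr p" "1 + q \<noteq> 0"
proof -
  note b = norm_one_plus_ge[OF q]
  have ne: "1 + u \<noteq> 0" if "u \<in> closed_segment 0 q" for u using b(2)[OF that] by force
  show "1 + q \<noteq> 0" using ne by simp
  define f :: "nat \<Rightarrow> complex \<Rightarrow> complex" where
    "f = (\<lambda>i u. if i = 0 then Ln (1 + u) else if i = 1 then 1 / (1 + u) else if i = 2 then - 1 / (1 + u)^2
       else if i = 3 then 2 / (1 + u)^3 else - 6 / (1 + u)^4)"
  have df: "(f i has_field_derivative f (Suc i) u) (at u within closed_segment 0 q)" if "u \<in> closed_segment 0 q" "i <= 3" for i u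
  proof -
    have "i = 0 \<or> i = 1 \<or> i = 2 \<or> i = 3" using that by auto
    moreover have "((\<lambda>u. Ln (1 + u)) has_field_derivative 1 / (1 + u)) (at u within closed_segment 0 q)"
      using b(2)[OF that(1)] ne[OF that(1)] by (auto intro!: derivative_eq_intros simp: divide_inverse)
    ultimately show ?thesis
      using inverse_power_derivative[OF ne[OF that(1)], of 1 1] inverse_power_derivative[OF ne[OF that(1)], of "-1" 2]
        inverse_power_derivative[OF ne[OF that(1)], of 2 3]
      by (elim disjE) (simp_all add: f_def numeral_2_eq_2 numeral_3_eq_3 eval_nat_numeral)
  qed
  have inv: "1 / cmod (1 + u) <= 5" if "u \<in> closed_segment 0 q" for u
    using b(1)[OF that] by (subst divide_le_eq) auto
  have "cmod (f 0 q - (\<Sum>i\<le>3. f i 0 * (q - 0)^i / fact i)) <= 3750 * cmod (q - 0) ^ Suc 3 / fact 3"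
  proof (rule complex_Taylor[where S="closed_segment 0 q" and f=f])
    show "(f i has_field_derivative f (Suc i) u) (at u within closed_segment 0 q)" if "u \<in> closed_segment 0 q" "i <= 3" for i u
      using df[OF that(1)] that(2) by simp
    fix u assume u: "u \<in> closed_segment 0 q"
    have "cmod (f (Suc 3) u) = 6 * (1 / cmod (1 + u))^4" by (simp add: f_def norm_divide norm_power power_divide)
    also have "\<dots> <= 6 * 5^4" by (intro mult_left_mono power_mono inv[OF u]) auto
    finally show "cmod (f (Suc 3) u) <= 3750" by simp
  qed auto
  moreover have "(\<Sum>i\<le>3. f i 0 * (q - 0)^i / fact i) = q - q^2/2 + q^3/3"
    by (simp add: f_def eval_nat_numeral field_simps)
  ultimately have A: "cmod (Ln (1 + q) - (q - q^2/2 + q^3/3)) <= 625 * cmod q ^ 4" by (simp add: f_def eval_nat_numeral)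
  have "cmod (f 0 q - (\<Sum>i\<le>2. f i 0 * (q - 0)^i / fact i)) <= 250 * cmod (q - 0) ^ Suc 2 / fact 2"
  proof (rule complex_Taylor[where S="closed_segment 0 q" and f=f])
    show "(f i has_field_derivative f (Suc i) u) (at u within closed_segment 0 q)" if "u \<in> closed_segment 0 q" "i <= 2" for i u
      using df[OF that(1)] that(2) by simp
    fix u assume u: "u \<in> closed_segment 0 q"
    have "cmod (f (Suc 2) u) = 2 * (1 / cmod (1 + u))^3" by (simp add: f_def norm_divide norm_power power_divide)
    also have "\<dots> <= 2 * 5^3" by (intro mult_left_mono power_mono inv[OF u]) auto
    finally show "cmod (f (Suc 2) u) <= 250" by simp
  qed auto
  moreover have "(\<Sum>i\<le>2. f i 0 * (q - 0)^i / fact i) = q - q^2/2"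
    by (simp add: f_def eval_nat_numeral field_simps)
  ultimately have "cmod (Ln (1 + q) - (q - q^2/2)) <= 125 * cmod q ^ 3" by (simp add: f_def eval_nat_numeral)
  moreover have "cmod (Ln (1 + q) - (q - q^2/2 + q^3/3)) <= cmod (Ln (1 + q) - (q - q^2/2)) + cmod (q^3/3)"
    using norm_triangle_ineq4[of "Ln (1 + q) - (q - q^2/2)" "q^3/3"] by (simp add: algebra_simps)
  moreover have "cmod (q^3/3) = cmod q ^ 3 / 3" by (simp add: norm_divide norm_power)
  ultimately have B: "cmod (Ln (1 + q) - (q - q^2/2 + q^3/3)) <= 625 * cmod q ^ 3" using zero_le_power[OF norm_ge_zero, of q 3] by linarith
  show "cmod (Ln (1 + q) - (q - q^2/2 + q^3/3)) <= 625 * cmod q powr p"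
  proof (cases "q = 0")
    case False
    then have q0: "cmod q > 0" by simp
    show ?thesis
    proof (cases "cmod q <= 1")
      case True
      have "cmod q powr 4 <= cmod q powr p" using True q0 p by (intro powr_mono') auto
      then show ?thesis using A q0 by (simp add: powr_numeral)
    next
      case False
      have "cmod q powr 3 <= cmod q powr p" using False p by (intro powr_mono) auto
      then show ?thesis using B q0 by (simp add: powr_numeral)
    qed
  qed simp
qed

context nibm begin

definition t0 where "t0 = tcr psi xs"
definition G0 where "G0 = Gder psi xs 0"
text \<open>Chosen so that n * \<open>Mom 3\<close> * \<open>hs n\<close>^3 = 1, which turns the
  cubic term of the exponent into \<zeta>^3 / 3.\<close>

definition cc where "cc = c2 psi xs * t0"
definition hs where "hs n = cc * real n powr (-1/3)" for n :: nat
text \<open>Any positive margin with 3 + \<open>be\<close> < \<kappa> + 1 and 3 + \<open>be\<close>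
  <= 4 would do: the moment of order 3 + \<open>be\<close> is then bounded, and the remainder is of
  slightly higher order than the cubic term.\<close>

definition be where "be = min (1/2) ((\<kappa> - 2) / 2)"

lemma Mom2_pos: "Mom 2 > 0"
proof -
  have "Mom 2 >= 0" unfolding Mom_def by (intro integral_nonneg_AE AE_I2) (simp add: psi_nonneg)
  moreover have "Mom 2 \<noteq> 0"
  proof
    assume "Mom 2 = 0"
    then have "AE s in lborel. psi s / (xs - s)^2 = 0"
      unfolding Mom_def using Mom_sides(2)[of 2] psi_nonneg by (subst (asm) integral_nonneg_eq_0_iff_AE) auto
    then have "AE s in lborel. psi s = 0" using AE_lborel_singleton[of xs] by eventually_elim auto
    then have "(LINT s|lborel. psi s) = 0" by (rule integral_eq_zero_AE)
    then show False using psi_prob by simp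
  qed
  ultimately show ?thesis by simp
qed

lemma t0: "t0 > 0" "1 / t0 = Mom 2" using Mom2_pos by (simp_all add: t0_def tcr_def Mom_def)
lemma G0: "G0 = Mom 1" by (simp add: G0_def Gder_def Mom_def)
lemma Mom3: "Gder psi xs 2 = 2 * Mom 3" "Mom 3 > 0" using G2_pos by (simp_all add: Gder_def Mom_def)

lemma cc: "cc > 0" "cc^3 * Mom 3 = 1" "c2 psi xs > 0"
proof -
  have e: "cc = 2 powr (1/3) / Gder psi xs 2 powr (1/3)" using t0 by (simp add: cc_def c2_def t0_def)
  show "cc > 0" using e G2_pos by simp
  have p3: "(x powr (1/3))^3 = x" if "x > 0" for x :: real using that by (simp add: powr_power)
  have "cc^3 = 2 / Gder psi xs 2" unfolding e power_divide using G2_pos by (simp add: p3)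
  then show "cc^3 * Mom 3 = 1" using Mom3 by simp
  show "c2 psi xs > 0" using t0(1) G2_pos by (simp add: c2_def t0_def)
qed

lemma be: "0 < be" "be <= 1" "3 + be < \<kappa> + 1" using kappa by (auto simp: be_def min_def field_simps)

lemma hs_pos: "n > 0 ==> hs n > 0" using cc by (simp add: hs_def)

lemma hs_cube: "n > 0 ==> real n * hs n ^ 3 = cc^3"
  by (simp add: hs_def power_mult_distrib powr_power powr_minus divide_simps)

text \<open>The weight of the kernel at xs + h relative to its value at h = 0, at the critical time
  and for v = 0. Writing it with a product instead of the logarithmic potential makes it entire in
  h, with no branch to follow.\<close>

definition E0 :: "nat \<Rightarrow> complex \<Rightarrow> complex" where
  "E0 n h = exp (of_nat n * (h^2 / of_real (2 * t0) - of_real G0 * h)) * (\<Prod>j=1..n. 1 + of_real (a n j) * h)"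

lemma E0_0 [simp]: "E0 n 0 = 1" by (simp add: E0_def)

lemma holomorphic_E0: "E0 n holomorphic_on A" unfolding E0_def[abs_def] using t0 by (intro holomorphic_intros) auto

lemma E0_cnj: "E0 n (cnj h) = cnj (E0 n h)" by (simp add: E0_def exp_cnj)

lemma a_bound: "EV n. \<forall>j\<in>{1..n}. \<bar>a n j\<bar> * gap n < 1 \<and> a n j \<noteq> 0"
  using gap(2) eventually_gt_at_top[of 0]
proof eventually_elim
  case (elim n)
  then show ?case using gap_pos[of n] by (auto simp: a_def abs_minus_commute divide_simps)
qed

text \<open>The linear and quadratic parts of the logarithms cancel against the exponential factor
  because \<open>G0\<close> = \<open>Mom 1\<close> and 1 / \<open>t0\<close> = \<open>Mom 2\<close>;
  what survives is the cubic term and the differences between empirical and limiting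
  moments.\<close>

lemma E0_log:
  assumes h: "\<And>j. j \<in> {1..n} ==> cmod (of_real (a n j) * h) <= 1/2 \<or> \<bar>Im (of_real (a n j) * h)\<bar> >= cmod (of_real (a n j) * h) / 4"
    and n: "n > 0"
  shows "\<exists>L. E0 n h = exp L \<and> (\<forall>p. 3 <= p \<and> p <= 4 --> cmod (L - of_real (real n * Mom 3 / 3) * h^3) <=
     real n * (\<bar>S 1 n - Mom 1\<bar> * cmod h + \<bar>S 2 n - Mom 2\<bar> * cmod h^2 + \<bar>S 3 n - Mom 3\<bar> * cmod h^3)
     + 625 * (\<Sum>j=1..n. \<bar>a n j\<bar> powr p) * cmod h powr p)"
proof -
  define q where "q = (\<lambda>j. of_real (a n j) * h)"
  define L where "L = of_nat n * (h^2 / of_real (2 * t0) - of_real G0 * h) + (\<Sum>j=1..n. Ln (1 + q j))"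
  have "E0 n h = exp L"
  proof -
    have "(\<Prod>j=1..n. 1 + q j) = (\<Prod>j=1..n. exp (Ln (1 + q j)))"
      using Ln_one_plus_cubic(2)[of "q j" 3 for j] h by (intro prod.cong) (auto simp: q_def)
    then show ?thesis by (simp add: E0_def L_def exp_add exp_sum q_def)
  qed
  moreover have "cmod (L - of_real (real n * Mom 3 / 3) * h^3) <=
     real n * (\<bar>S 1 n - Mom 1\<bar> * cmod h + \<bar>S 2 n - Mom 2\<bar> * cmod h^2 + \<bar>S 3 n - Mom 3\<bar> * cmod h^3)
     + 625 * (\<Sum>j=1..n. \<bar>a n j\<bar> powr p) * cmod h powr p" if p: "3 <= p" "p <= 4" for p
  proof -
    define R where "R = (\<Sum>j=1..n. Ln (1 + q j) - (q j - q j^2/2 + q j^3/3))"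
    have sk: "(\<Sum>j=1..n. q j ^ k) = of_real (real n * S k n) * h^k" for k
      using n by (simp add: q_def S_def power_mult_distrib sum_distrib_right)
    have "(\<Sum>j=1..n. q j - q j^2/2 + q j^3/3) = (\<Sum>j=1..n. q j ^ 1) - (\<Sum>j=1..n. q j^2) / 2 + (\<Sum>j=1..n. q j^3) / 3"
      by (simp add: sum.distrib sum_subtractf sum_divide_distrib)
    then have "(\<Sum>j=1..n. Ln (1 + q j)) = R + (of_real (real n * S 1 n) * h^1 - of_real (real n * S 2 n) * h^2 / 2 + of_real (real n * S 3 n) * h^3 / 3)"
      unfolding R_def sum_subtractf sk by simp
    moreover have "h^2 / of_real (2 * t0) = of_real (Mom 2) * h^2 / 2"
      unfolding t0(2)[symmetric] by simp
    ultimately have "L = of_nat n * (of_real (Mom 2) * h^2 / 2 - of_real (Mom 1) * h)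
        + (R + (of_real (real n * S 1 n) * h^1 - of_real (real n * S 2 n) * h^2 / 2 + of_real (real n * S 3 n) * h^3 / 3))"
      unfolding L_def G0 by simp
    note Leq = this
    have "L - of_real (real n * Mom 3 / 3) * h^3 = R + of_nat n * (of_real (S 1 n - Mom 1) * h - of_real (S 2 n - Mom 2) * h^2 / 2 + of_real (S 3 n - Mom 3) * h^3 / 3)"
      unfolding Leq by (simp add: field_simps)
    also have "cmod \<dots> <= cmod R + real n * (\<bar>S 1 n - Mom 1\<bar> * cmod h + \<bar>S 2 n - Mom 2\<bar> * cmod h^2 + \<bar>S 3 n - Mom 3\<bar> * cmod h^3)"
    proof -
      have "cmod (of_real (S 1 n - Mom 1) * h - of_real (S 2 n - Mom 2) * h^2 / 2 + of_real (S 3 n - Mom 3) * h^3 / 3)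
         <= cmod (of_real (S 1 n - Mom 1) * h) + cmod (of_real (S 2 n - Mom 2) * h^2 / 2) + cmod (of_real (S 3 n - Mom 3) * h^3 / 3)"
        using norm_triangle_ineq norm_triangle_ineq4 by (meson add_mono_thms_linordered_semiring(3) order_trans)
      also have "\<dots> <= \<bar>S 1 n - Mom 1\<bar> * cmod h + \<bar>S 2 n - Mom 2\<bar> * cmod h^2 + \<bar>S 3 n - Mom 3\<bar> * cmod h^3"
      proof -
        have "x / 2 <= x" "x / 3 <= x" if "x >= 0" for x :: real using that by auto
        then show ?thesis unfolding norm_mult norm_divide norm_power norm_of_real by (intro add_mono) auto
      qed
      finally have "cmod (of_nat n * (of_real (S 1 n - Mom 1) * h - of_real (S 2 n - Mom 2) * h^2 / 2 + of_real (S 3 n - Mom 3) * h^3 / 3))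
         <= real n * (\<bar>S 1 n - Mom 1\<bar> * cmod h + \<bar>S 2 n - Mom 2\<bar> * cmod h^2 + \<bar>S 3 n - Mom 3\<bar> * cmod h^3)"
        unfolding norm_mult norm_of_nat by (intro mult_left_mono) auto
      then show ?thesis by (intro order_trans[OF norm_triangle_ineq] add_left_mono)
    qed
    also have "cmod R <= 625 * (\<Sum>j=1..n. \<bar>a n j\<bar> powr p) * cmod h powr p"
    proof -
      have "cmod R <= (\<Sum>j=1..n. 625 * (\<bar>a n j\<bar> powr p * cmod h powr p))"
        unfolding R_def
      proof (rule sum_norm_le)
        fix j assume "j \<in> {1..n}"
        from Ln_one_plus_cubic(1)[OF h[OF this] p] show "cmod (Ln (1 + q j) - (q j - q j^2/2 + q j^3/3)) <= 625 * (\<bar>a n j\<bar> powr p * cmod h powr p)"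
          unfolding q_def by (simp add: norm_mult powr_mult)
      qed
      then show ?thesis by (simp add: sum_distrib_left sum_distrib_right mult.assoc)
    qed
    finally show ?thesis by simp
  qed
  ultimately show ?thesis by blast
qed

text \<open>The scale \<^term>\<open>real n powr - \<gamma>\<close> is that of the gap around \<^term>\<open>xs\<close>.\<close>

lemma fourth_moment_bound:
  "\<exists>D\<ge>0. EV n. (\<Sum>j=1..n. \<bar>a n j\<bar> powr 4) <= D * (real n * real n powr \<gamma>)"
proof -
  obtain D2 where D2: "EV n. (\<Sum>j=1..n. \<bar>a n j\<bar> powr 3) / real n <= D2" using abs_moment_bounded[of 3] kappa by auto
  have "EV n. (\<Sum>j=1..n. \<bar>a n j\<bar> powr 4) <= \<bar>D2\<bar> / mm * (real n * real n powr \<gamma>)"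
    using D2 a_bound eventually_gt_at_top[of 0]
  proof eventually_elim
    case (elim n)
    have n: "real n > 0" using elim by simp
    have g: "gap n > 0" using elim gap_pos by simp
        have "(\<Sum>j=1..n. \<bar>a n j\<bar> powr 4) <= (\<Sum>j=1..n. \<bar>a n j\<bar> powr 3 * (1 / gap n))"
        proof (rule sum_mono)
          fix j assume j: "j \<in> {1..n}"
          then have "\<bar>a n j\<bar> <= 1 / gap n" using elim(2) g by (simp add: field_simps less_imp_le)
          then have "\<bar>a n j\<bar> powr 3 * \<bar>a n j\<bar> <= \<bar>a n j\<bar> powr 3 * (1 / gap n)" by (intro mult_left_mono) auto
          moreover have "\<bar>a n j\<bar> powr 4 = \<bar>a n j\<bar> powr 3 * \<bar>a n j\<bar>" using powr_add[of "\<bar>a n j\<bar>" 3 1] by simp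
          ultimately show "\<bar>a n j\<bar> powr 4 <= \<bar>a n j\<bar> powr 3 * (1 / gap n)" by simp
        qed
        also have "\<dots> = (\<Sum>j=1..n. \<bar>a n j\<bar> powr 3) * (1 / gap n)" by (simp only: sum_distrib_right)
        also have "\<dots> <= (\<bar>D2\<bar> * real n) * (1 / gap n)"
        proof (rule mult_right_mono)
          have "(\<Sum>j=1..n. \<bar>a n j\<bar> powr 3) <= D2 * real n" using elim(1) n by (subst (asm) pos_divide_le_eq)
          also have "\<dots> <= \<bar>D2\<bar> * real n" by (intro mult_right_mono) auto
          finally show "(\<Sum>j=1..n. \<bar>a n j\<bar> powr 3) <= \<bar>D2\<bar> * real n" .
        qed (use g in simp)
        also have "\<dots> = \<bar>D2\<bar> / mm * (real n * real n powr \<gamma>)" using gap(1) by (simp add: gap_def powr_minus field_simps)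
        finally show ?case .
  qed
  moreover have "\<bar>D2\<bar> / mm >= 0" using gap(1) by simp
  ultimately show ?thesis by blast
qed

text \<open>With r = n^\<gamma> |h|, the size of h relative to the gap up to a constant, the moment
  errors are multiples of r, r^2 and r^3. Of the two remainder bounds the first is small relative to
  n |h|^3 and serves up to a small macroscopic distance; the second has a full fourth power at the
  price n^\<gamma> and gives the rate on the Airy scale. The condition on h keeps every 1 +
  \<open>a n j\<close> * h away from 0.\<close>

lemma E0_asymp:
  "\<exists>C>0. EV n. \<forall>h. cmod h <= gap n / 2 \<or> \<bar>Im h\<bar> >= cmod h / 4 -->
     (\<exists>L. E0 n h = exp L \<and>
       (let d = cmod (L - of_real (real n * Mom 3 / 3) * h^3); r = real n powr \<gamma> * cmod h in
         d <= C * (r + r^2 + r^3 + real n * cmod h powr (3 + be)) \<and>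
         d <= C * (r + r^2 + r^3 + real n * real n powr \<gamma> * cmod h^4)))"
proof -
  obtain C1 where C1: "EV n. \<bar>S 1 n - Mom 1\<bar> <= C1 * real n powr (1 * \<gamma> - 1)" using S_asymp[of 1] by auto
  obtain C2 where C2: "EV n. \<bar>S 2 n - Mom 2\<bar> <= C2 * real n powr (2 * \<gamma> - 1)" using S_asymp[of 2] by auto
  obtain C3 where C3: "EV n. \<bar>S 3 n - Mom 3\<bar> <= C3 * real n powr (3 * \<gamma> - 1)" using S_asymp[of 3] by auto
  obtain D1 where D1: "EV n. (\<Sum>j=1..n. \<bar>a n j\<bar> powr (3 + be)) / real n <= D1" using abs_moment_bounded[of "3 + be"] be by auto
  obtain D2 where D2: "D2 >= 0" "EV n. (\<Sum>j=1..n. \<bar>a n j\<bar> powr 4) <= D2 * (real n * real n powr \<gamma>)" using fourth_moment_bound by blast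
  define C where "C = 1 + \<bar>C1\<bar> + \<bar>C2\<bar> + \<bar>C3\<bar> + 625 * \<bar>D1\<bar> + 625 * D2"
  have Cp: "C > 0" unfolding C_def using D2(1) by (intro add_pos_nonneg) auto
  have "EV n. \<forall>h. cmod h <= gap n / 2 \<or> \<bar>Im h\<bar> >= cmod h / 4 -->
     (\<exists>L. E0 n h = exp L \<and>
       (let d = cmod (L - of_real (real n * Mom 3 / 3) * h^3); r = real n powr \<gamma> * cmod h in
         d <= C * (r + r^2 + r^3 + real n * cmod h powr (3 + be)) \<and>
         d <= C * (r + r^2 + r^3 + real n * real n powr \<gamma> * cmod h^4)))"
    using C1 C2 C3 D1 D2(2) a_bound eventually_gt_at_top[of 0]
  proof eventually_elim
    case (elim n)
    show ?case
    proof (intro allI impI)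
      fix h assume h: "cmod h <= gap n / 2 \<or> \<bar>Im h\<bar> >= cmod h / 4"
      have n: "real n > 0" using elim by simp
      have g: "gap n > 0" using elim gap_pos by simp
      have cond: "cmod (of_real (a n j) * h) <= 1/2 \<or> \<bar>Im (of_real (a n j) * h)\<bar> >= cmod (of_real (a n j) * h) / 4" if j: "j \<in> {1..n}" for j
        using h
      proof
        assume "cmod h <= gap n / 2"
        then have "\<bar>a n j\<bar> * cmod h <= \<bar>a n j\<bar> * (gap n / 2)" by (intro mult_left_mono) auto
        also have "\<dots> <= 1/2" using elim(6) j by fastforce
        finally show ?thesis by (simp add: norm_mult)
      next
        assume "\<bar>Im h\<bar> >= cmod h / 4"
        then have "\<bar>a n j\<bar> * \<bar>Im h\<bar> >= \<bar>a n j\<bar> * (cmod h / 4)" by (intro mult_left_mono) auto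
        then show ?thesis by (simp add: norm_mult abs_mult)
      qed
      define r where "r = real n powr \<gamma> * cmod h"
      have r0: "r >= 0" by (simp add: r_def)
      obtain L where L: "E0 n h = exp L" and Lb: "\<And>p. 3 <= p ==> p <= 4 ==> cmod (L - of_real (real n * Mom 3 / 3) * h^3) <=
         real n * (\<bar>S 1 n - Mom 1\<bar> * cmod h + \<bar>S 2 n - Mom 2\<bar> * cmod h^2 + \<bar>S 3 n - Mom 3\<bar> * cmod h^3)
         + 625 * (\<Sum>j=1..n. \<bar>a n j\<bar> powr p) * cmod h powr p"
        using E0_log[of n h, OF cond] elim by blast
      have tm: "real n * (\<bar>S k n - Mom k\<bar> * cmod h^k) <= \<bar>D\<bar> * r^k" if "\<bar>S k n - Mom k\<bar> <= D * real n powr (real k * \<gamma> - 1)" for k D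
      proof -
        have "\<bar>S k n - Mom k\<bar> <= \<bar>D\<bar> * real n powr (real k * \<gamma> - 1)"
          using that by (rule order_trans) (intro mult_right_mono, auto)
        then have "real n * (\<bar>S k n - Mom k\<bar> * cmod h^k) <= real n * ((\<bar>D\<bar> * real n powr (real k * \<gamma> - 1)) * cmod h^k)"
          by (intro mult_left_mono mult_right_mono) auto
        also have "\<dots> = \<bar>D\<bar> * r^k" using n
          by (simp add: r_def power_mult_distrib powr_power powr_diff mult.commute)
        finally show ?thesis .
      qed
      have T: "real n * (\<bar>S 1 n - Mom 1\<bar> * cmod h + \<bar>S 2 n - Mom 2\<bar> * cmod h^2 + \<bar>S 3 n - Mom 3\<bar> * cmod h^3) <= (\<bar>C1\<bar> + \<bar>C2\<bar> + \<bar>C3\<bar>) * (r + r^2 + r^3)"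
      proof -
        have "real n * (\<bar>S 1 n - Mom 1\<bar> * cmod h^1) <= \<bar>C1\<bar> * r^1" "real n * (\<bar>S 2 n - Mom 2\<bar> * cmod h^2) <= \<bar>C2\<bar> * r^2"
          "real n * (\<bar>S 3 n - Mom 3\<bar> * cmod h^3) <= \<bar>C3\<bar> * r^3"
          by (rule tm; use elim in simp)+
        moreover have "\<bar>C1\<bar> * r^1 + \<bar>C2\<bar> * r^2 + \<bar>C3\<bar> * r^3 <= (\<bar>C1\<bar> + \<bar>C2\<bar> + \<bar>C3\<bar>) * (r + r^2 + r^3)"
          using r0 by (simp add: algebra_simps add_nonneg_nonneg)
        ultimately show ?thesis by (simp add: algebra_simps)
      qed
      have A1: "(\<Sum>j=1..n. \<bar>a n j\<bar> powr (3 + be)) <= \<bar>D1\<bar> * real n"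
      proof -
        have "(\<Sum>j=1..n. \<bar>a n j\<bar> powr (3 + be)) <= D1 * real n" using elim(4) n by (subst (asm) pos_divide_le_eq)
        also have "\<dots> <= \<bar>D1\<bar> * real n" by (intro mult_right_mono) auto
        finally show ?thesis .
      qed
      have e1: "(\<bar>C1\<bar> + \<bar>C2\<bar> + \<bar>C3\<bar>) * (r + r^2 + r^3) <= C * (r + r^2 + r^3)"
        using r0 D2(1) by (intro mult_right_mono) (auto simp: C_def)
      have e2: "625 * (\<Sum>j=1..n. \<bar>a n j\<bar> powr (3+be)) * cmod h powr (3+be) <= C * (real n * cmod h powr (3+be))"
      proof -
        have "625 * (\<Sum>j=1..n. \<bar>a n j\<bar> powr (3+be)) * cmod h powr (3+be) <= 625 * (\<bar>D1\<bar> * real n) * cmod h powr (3+be)"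
          by (intro mult_right_mono mult_left_mono A1) auto
        also have "\<dots> = (625 * \<bar>D1\<bar>) * (real n * cmod h powr (3+be))" by simp
        also have "\<dots> <= C * (real n * cmod h powr (3+be))" using D2(1) by (intro mult_right_mono) (auto simp: C_def)
        finally show ?thesis .
      qed
      have e3: "625 * (\<Sum>j=1..n. \<bar>a n j\<bar> powr 4) * cmod h powr 4 <= C * (real n * real n powr \<gamma> * cmod h^4)"
      proof -
        have "625 * (\<Sum>j=1..n. \<bar>a n j\<bar> powr 4) * cmod h powr 4 <= 625 * (D2 * (real n * real n powr \<gamma>)) * cmod h powr 4"
          by (intro mult_right_mono mult_left_mono elim(5)) auto
        also have "\<dots> = (625 * D2) * (real n * real n powr \<gamma> * cmod h^4)" by (simp add: powr_numeral)
        also have "\<dots> <= C * (real n * real n powr \<gamma> * cmod h^4)" using D2(1) by (intro mult_right_mono) (auto simp: C_def)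
        finally show ?thesis .
      qed
      have "cmod (L - of_real (real n * Mom 3 / 3) * h^3) <= C * (r + r^2 + r^3 + real n * cmod h powr (3 + be))"
        unfolding distrib_left[of C "r + r^2 + r^3"]
        by (rule order_trans[OF Lb add_mono[OF order_trans[OF T e1] e2]]) (use be in auto)
      moreover have "cmod (L - of_real (real n * Mom 3 / 3) * h^3) <= C * (r + r^2 + r^3 + real n * real n powr \<gamma> * cmod h^4)"
        unfolding distrib_left[of C "r + r^2 + r^3"]
        by (rule order_trans[OF Lb add_mono[OF order_trans[OF T e1] e3]]) auto
      ultimately show "\<exists>L. E0 n h = exp L \<and>
       (let d = cmod (L - of_real (real n * Mom 3 / 3) * h^3); r = real n powr \<gamma> * cmod h in
         d <= C * (r + r^2 + r^3 + real n * cmod h powr (3 + be)) \<and>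
         d <= C * (r + r^2 + r^3 + real n * real n powr \<gamma> * cmod h^4))"
        using L unfolding Let_def r_def by blast
    qed
  qed
  with Cp show ?thesis by blast
qed

text \<open>Each factor satisfies |1 + a (x + i y)|^2 = (1 + a x)^2 (1 + d y^2) with d = a^2 / (1 +
  a x)^2, and 1 + t <= exp t. No expansion in y is made, so the Gaussian bound holds on the whole
  line; only d is expanded in x, which brings in the second and third moments.\<close>

lemma E0_vertical:
  assumes x: "\<And>j. j \<in> {1..n} ==> \<bar>a n j * x\<bar> <= 1/2"
  shows "cmod (E0 n (Complex x y)) <= cmod (E0 n (of_real x)) *
     exp (- (real n * (1/t0 - S 2 n + 2 * x * S 3 n) - 8 * x^2 * (\<Sum>j=1..n. \<bar>a n j\<bar> powr 4)) * y^2 / 2)"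
proof -
  define d where "d = (\<lambda>j. a n j ^ 2 / (1 + a n j * x)^2)"
  have f: "cmod (1 + of_real (a n j) * Complex x y) <= cmod (1 + of_real (a n j) * of_real x) * exp (d j * y^2 / 2)" if j: "j \<in> {1..n}" for j
  proof -
    have p: "1 + a n j * x > 0" using x[OF j] by (simp add: abs_le_iff)
    have "(cmod (1 + of_real (a n j) * Complex x y))^2 = (1 + a n j * x)^2 + (a n j * y)^2"
      by (simp add: cmod_power2)
    also have "\<dots> = (1 + a n j * x)^2 * (1 + d j * y^2)" using p by (simp add: d_def field_simps)
    also have "\<dots> <= (1 + a n j * x)^2 * exp (d j * y^2)"
      by (intro mult_left_mono exp_ge_add_one_self) auto
    also have "exp (d j * y^2) = (exp (d j * y^2 / 2))^2" by (simp add: power2_eq_square exp_add[symmetric])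
    also have "(1 + a n j * x)^2 * (exp (d j * y^2 / 2))^2 = ((1 + a n j * x) * exp (d j * y^2 / 2))^2" by (simp add: power_mult_distrib)
    finally have "cmod (1 + of_real (a n j) * Complex x y) <= (1 + a n j * x) * exp (d j * y^2 / 2)"
      by (rule power2_le_imp_le) (use p in simp)
    moreover have "cmod (1 + of_real (a n j) * of_real x) = 1 + a n j * x"
      using p by (metis abs_of_pos norm_of_real of_real_1 of_real_add of_real_mult)
    ultimately show ?thesis by simp
  qed
  have dj: "d j <= a n j^2 - 2 * x * a n j^3 + 8 * x^2 * \<bar>a n j\<bar> powr 4" if j: "j \<in> {1..n}" for j
  proof -
    define q where "q = a n j * x"
    have q: "\<bar>q\<bar> <= 1/2" using x[OF j] by (simp add: q_def)
    \<comment> \<open>This exact difference yields 1 / (1 + q)^2 <= 1 - 2 q + 8 q^2: both linear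
      factors are nonnegative for |q| <= 1/2.\<close>
    have "(1 + q)^2 * (1 - 2 * q + 8 * q^2) - 1 = q^2 * ((2 * q + 1) * (4 * q + 5))"
      by (simp add: power2_eq_square algebra_simps)
    moreover have "q^2 * ((2 * q + 1) * (4 * q + 5)) >= 0" using q by (intro mult_nonneg_nonneg) (auto simp: abs_le_iff)
    ultimately have "1 <= (1 + q)^2 * (1 - 2 * q + 8 * q^2)" by linarith
    moreover have "(1 + q)^2 > 0" using q by (auto simp: abs_le_iff)
    ultimately have "1 / (1 + q)^2 <= 1 - 2 * q + 8 * q^2" by (simp add: pos_divide_le_eq mult.commute)
    then have "a n j^2 * (1 / (1 + q)^2) <= a n j^2 * (1 - 2 * q + 8 * q^2)" by (intro mult_left_mono) auto
    moreover have "\<bar>a n j\<bar> powr 4 = a n j^4"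
    proof (cases "a n j = 0")
      case False
      then have "\<bar>a n j\<bar> powr 4 = \<bar>a n j\<bar>^4" by (subst powr_numeral) auto
      then show ?thesis by simp
    qed simp
    ultimately show ?thesis by (simp add: d_def q_def power_mult_distrib algebra_simps power2_eq_square power3_eq_cube eval_nat_numeral)
  qed
  have "cmod (\<Prod>j=1..n. 1 + of_real (a n j) * Complex x y) <= (\<Prod>j=1..n. cmod (1 + of_real (a n j) * of_real x) * exp (d j * y^2 / 2))"
    unfolding prod_norm[symmetric] by (intro prod_mono conjI f) auto
  also have "\<dots> = cmod (\<Prod>j=1..n. 1 + of_real (a n j) * of_real x) * exp (\<Sum>j=1..n. d j * y^2 / 2)"
    by (simp add: prod.distrib exp_sum prod_norm)
  also have "\<dots> <= cmod (\<Prod>j=1..n. 1 + of_real (a n j) * of_real x) * exp ((real n * (S 2 n - 2 * x * S 3 n) + 8 * x^2 * (\<Sum>j=1..n. \<bar>a n j\<bar> powr 4)) * y^2 / 2)"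
  proof -
    have "(\<Sum>j=1..n. d j) <= (\<Sum>j=1..n. a n j^2 - 2 * x * a n j^3 + 8 * x^2 * \<bar>a n j\<bar> powr 4)" by (intro sum_mono dj)
    also have "\<dots> = real n * (S 2 n - 2 * x * S 3 n) + 8 * x^2 * (\<Sum>j=1..n. \<bar>a n j\<bar> powr 4)"
      by (cases "n = 0") (simp_all add: sum.distrib sum_subtractf sum_distrib_left[symmetric] S_def field_simps)
    finally have "(\<Sum>j=1..n. d j) * (y^2 / 2) <= (real n * (S 2 n - 2 * x * S 3 n) + 8 * x^2 * (\<Sum>j=1..n. \<bar>a n j\<bar> powr 4)) * (y^2 / 2)"
      by (intro mult_right_mono) auto
    moreover have "(\<Sum>j=1..n. d j * y^2 / 2) = (\<Sum>j=1..n. d j) * (y^2 / 2)" by (simp only: sum_distrib_right sum_divide_distrib times_divide_eq_right)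
    ultimately have "(\<Sum>j=1..n. d j * y^2 / 2) <= (real n * (S 2 n - 2 * x * S 3 n) + 8 * x^2 * (\<Sum>j=1..n. \<bar>a n j\<bar> powr 4)) * y^2 / 2"
      by (simp only: times_divide_eq_right)
    then show ?thesis by (intro mult_left_mono) auto
  qed
  finally have P: "cmod (\<Prod>j=1..n. 1 + of_real (a n j) * Complex x y) <= \<dots>" .
  have e: "cmod (exp (of_nat n * (Complex x y^2 / of_real (2 * t0) - of_real G0 * Complex x y))) =
     cmod (exp (of_nat n * (of_real x^2 / of_real (2 * t0) - of_real G0 * of_real x))) * exp (- (real n * (1 / t0)) * y^2 / 2)"
  proof -
    have "Re (of_nat n * (Complex x y^2 / of_real (2 * t0) - of_real G0 * Complex x y)) = real n * ((x^2 - y^2) / (2 * t0) - G0 * x)"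
      using Re_divide_of_real[of "Complex x y^2" "2*t0"] by (simp add: power2_eq_square)
    moreover have "Re (of_nat n * (of_real x^2 / of_real (2 * t0) - of_real G0 * of_real x)) = real n * (x^2 / (2 * t0) - G0 * x)"
      using Re_divide_of_real[of "of_real x^2" "2*t0"] by (simp add: power2_eq_square)
    moreover have "real n * ((x^2 - y^2) / (2 * t0) - G0 * x) = real n * (x^2 / (2 * t0) - G0 * x) + - (real n * (1 / t0)) * y^2 / 2"
      by (simp add: diff_divide_distrib algebra_simps)
    ultimately show ?thesis by (simp only: norm_exp_eq_Re exp_add)
  qed
  have "cmod (E0 n (Complex x y)) <= cmod (exp (of_nat n * (of_real x^2 / of_real (2 * t0) - of_real G0 * of_real x))) * exp (- (real n * (1 / t0)) * y^2 / 2) *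
     (cmod (\<Prod>j=1..n. 1 + of_real (a n j) * of_real x) * exp ((real n * (S 2 n - 2 * x * S 3 n) + 8 * x^2 * (\<Sum>j=1..n. \<bar>a n j\<bar> powr 4)) * y^2 / 2))"
    unfolding E0_def norm_mult e by (intro mult_left_mono P) auto
  also have "\<dots> = cmod (E0 n (of_real x)) * (exp (- (real n * (1 / t0)) * y^2 / 2) * exp ((real n * (S 2 n - 2 * x * S 3 n) + 8 * x^2 * (\<Sum>j=1..n. \<bar>a n j\<bar> powr 4)) * y^2 / 2))"
    unfolding E0_def norm_mult by simp
  also have "exp (- (real n * (1 / t0)) * y^2 / 2) * exp ((real n * (S 2 n - 2 * x * S 3 n) + 8 * x^2 * (\<Sum>j=1..n. \<bar>a n j\<bar> powr 4)) * y^2 / 2)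
     = exp (- (real n * (1/t0 - S 2 n + 2 * x * S 3 n) - 8 * x^2 * (\<Sum>j=1..n. \<bar>a n j\<bar> powr 4)) * y^2 / 2)"
    unfolding exp_add[symmetric] by (simp add: field_simps)
  finally show ?thesis .
qed

lemma powr_tendsto_0: "q < 0 ==> (\<lambda>n. real n powr q) \<longlonglongrightarrow> 0"
  by (intro tendsto_neg_powr filterlim_real_sequentially)

lemma powr_eventually_le: "q < 0 ==> e > 0 ==> EV n. D * real n powr q <= e"
proof -
  assume "q < 0" "e > 0"
  have "(\<lambda>n. D * real n powr q) \<longlonglongrightarrow> D * 0" by (intro tendsto_intros powr_tendsto_0 \<open>q < 0\<close>)
  from order_tendstoD(2)[OF this, of e] \<open>e > 0\<close> have "EV n. D * real n powr q < e" by simp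
  then show ?thesis by eventually_elim simp
qed

text \<open>The Airy scale n^(-1/3) is finer than the gap n^(-\<gamma>), as \<gamma> < 1/3.\<close>

lemma hs_le_gap: "EV n. D * hs n <= gap n / 2"
proof -
  have "EV n. (2 * D * cc / mm) * real n powr (\<gamma> - 1/3) <= 1"
    using gam by (intro powr_eventually_le) auto
  then show ?thesis using eventually_gt_at_top[of 0]
  proof eventually_elim
    case (elim n)
    then have n: "real n > 0" by simp
    have "mm * real n powr - \<gamma> > 0" using gap(1) n by simp
    from mult_right_mono[OF elim(1) less_imp_le[OF this]]
    have "(2 * D * cc) * (real n powr (\<gamma> - 1/3) * real n powr - \<gamma>) <= mm * real n powr - \<gamma>" using gap(1) by (simp add: field_simps)
    also have "real n powr (\<gamma> - 1/3) * real n powr - \<gamma> = real n powr (-1/3)" unfolding powr_add[symmetric] by simp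
    finally show ?case by (simp add: hs_def gap_def)
  qed
qed

text \<open>At x = \<open>hs n\<close> * s the limiting third moment contributes exactly s to the
  Gaussian rate. The second moment error, the third moment error and the fourth moment term, of
  orders n^(2 \<gamma> - 2/3), n^(3 \<gamma> - 1) and n^(\<gamma> - 1/3), are each eventually at
  most 1/3, whence the rate s - 1.\<close>

lemma E0_zline:
  assumes s: "s > 0"
  shows "EV n. \<forall>y. cmod (E0 n (of_real (hs n) * zline s y)) <= cmod (E0 n (of_real (hs n * s))) * exp (- (s - 1) * y^2)"
proof -
  obtain C2 where C2: "EV n. \<bar>S 2 n - Mom 2\<bar> <= C2 * real n powr (2 * \<gamma> - 1)" using S_asymp[of 2] by auto
  obtain C3 where C3: "EV n. \<bar>S 3 n - Mom 3\<bar> <= C3 * real n powr (3 * \<gamma> - 1)" using S_asymp[of 3] by auto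
  obtain D where D: "D >= 0" "EV n. (\<Sum>j=1..n. \<bar>a n j\<bar> powr 4) <= D * (real n * real n powr \<gamma>)" using fourth_moment_bound by blast
  have e1: "EV n. (cc^2 / 2 * C2) * real n powr (2 * \<gamma> - 2/3) <= 1/3" using gam by (intro powr_eventually_le) auto
  have e2: "EV n. (cc^3 * s * C3) * real n powr (3 * \<gamma> - 1) <= 1/3" using gam by (intro powr_eventually_le) auto
  have e3: "EV n. (4 * cc^4 * s^2 * D) * real n powr (\<gamma> - 1/3) <= 1/3" using gam by (intro powr_eventually_le) auto
  show ?thesis
    using C2 C3 D(2) e1 e2 e3 a_bound hs_le_gap[of s] eventually_gt_at_top[of 0]
  proof eventually_elim
    case (elim n)
    have n: "real n > 0" "n > 0" using elim by simp_all
    define x where "x = hs n * s"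
    have x0: "x > 0" using hs_pos n s by (simp add: x_def)
    have xb: "\<bar>a n j * x\<bar> <= 1/2" if j: "j \<in> {1..n}" for j
    proof -
      have "\<bar>a n j * x\<bar> = \<bar>a n j\<bar> * x" using x0 by (simp add: abs_mult)
      also have "\<dots> <= \<bar>a n j\<bar> * (gap n / 2)" using elim(8) by (intro mult_left_mono) (simp_all add: x_def mult.commute)
      also have "\<dots> <= 1/2" using elim(7) j by fastforce
      finally show ?thesis .
    qed
    have nh: "real n * hs n^2 = cc^2 * real n powr (1/3)"
    proof -
      have "real n * hs n^2 = cc^2 * (real n powr 1 * real n powr (-2/3))" using n by (simp add: hs_def power_mult_distrib powr_power)
      then show ?thesis unfolding powr_add[symmetric] by simp
    qed
    define W where "W = real n * (1/t0 - S 2 n + 2 * x * S 3 n) - 8 * x^2 * (\<Sum>j=1..n. \<bar>a n j\<bar> powr 4)"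
    have W: "W * (hs n)^2 / 2 >= s - 1"
    proof -
      have t1: "real n * hs n^2 / 2 * \<bar>S 2 n - Mom 2\<bar> <= 1/3"
      proof -
        have "real n * hs n^2 / 2 * \<bar>S 2 n - Mom 2\<bar> <= cc^2 * real n powr (1/3) / 2 * (C2 * real n powr (2 * \<gamma> - 1))"
          unfolding nh by (intro mult_left_mono elim(1)) auto
        also have "\<dots> = (cc^2 / 2 * C2) * (real n powr (1/3) * real n powr (2 * \<gamma> - 1))" by simp
        also have "real n powr (1/3) * real n powr (2 * \<gamma> - 1) = real n powr (2 * \<gamma> - 2/3)" unfolding powr_add[symmetric] by (simp add: algebra_simps)
        finally show ?thesis using elim(4) by linarith
      qed
      have t2: "cc^3 * s * \<bar>S 3 n - Mom 3\<bar> <= 1/3"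
      proof -
        have "cc^3 * s * \<bar>S 3 n - Mom 3\<bar> <= cc^3 * s * (C3 * real n powr (3 * \<gamma> - 1))" using cc s by (intro mult_left_mono elim(2)) auto
        then show ?thesis using elim(5) by (simp add: mult.assoc)
      qed
      have t3: "4 * hs n^4 * s^2 * (\<Sum>j=1..n. \<bar>a n j\<bar> powr 4) <= 1/3"
      proof -
        have "hs n^4 * real n = cc^4 * (real n powr (-4/3) * real n powr 1)" using n by (simp add: hs_def power_mult_distrib powr_power)
        then have h4: "hs n^4 * real n = cc^4 * real n powr (-1/3)" unfolding powr_add[symmetric] by simp
        have "4 * hs n^4 * s^2 * (\<Sum>j=1..n. \<bar>a n j\<bar> powr 4) <= 4 * hs n^4 * s^2 * (D * (real n * real n powr \<gamma>))"
          by (intro mult_left_mono elim(3)) auto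
        also have "\<dots> = 4 * s^2 * D * (hs n^4 * real n) * real n powr \<gamma>" by simp
        also have "\<dots> = (4 * cc^4 * s^2 * D) * (real n powr (-1/3) * real n powr \<gamma>)" unfolding h4 by simp
        also have "real n powr (-1/3) * real n powr \<gamma> = real n powr (\<gamma> - 1/3)" unfolding powr_add[symmetric] by simp
        finally show ?thesis using elim(6) by linarith
      qed
      have "W * (hs n)^2 / 2 = real n * hs n^2 / 2 * (Mom 2 - S 2 n) + (real n * hs n^3) * s * S 3 n - 4 * hs n^4 * s^2 * (\<Sum>j=1..n. \<bar>a n j\<bar> powr 4)"
        unfolding W_def x_def t0(2) by (simp add: field_simps power2_eq_square power3_eq_cube eval_nat_numeral)
      also have "(real n * hs n^3) * s * S 3 n = s + cc^3 * s * (S 3 n - Mom 3)"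
        using hs_cube[OF n(2)] cc(2) by (simp add: algebra_simps)
      finally have "W * (hs n)^2 / 2 = real n * hs n^2 / 2 * (Mom 2 - S 2 n) + (s + cc^3 * s * (S 3 n - Mom 3)) - 4 * hs n^4 * s^2 * (\<Sum>j=1..n. \<bar>a n j\<bar> powr 4)" .
      moreover have "real n * hs n^2 / 2 * (Mom 2 - S 2 n) >= - (real n * hs n^2 / 2 * \<bar>S 2 n - Mom 2\<bar>)"
        unfolding mult_minus_right[symmetric] by (intro mult_left_mono) auto
      moreover have "cc^3 * s * (S 3 n - Mom 3) >= - (cc^3 * s * \<bar>S 3 n - Mom 3\<bar>)"
        unfolding mult_minus_right[symmetric] using cc s by (intro mult_left_mono) auto
      ultimately show ?thesis using t1 t2 t3 by linarith
    qed
    show ?case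
    proof
      fix y
      have z: "of_real (hs n) * zline s y = Complex x (hs n * y)" by (simp add: zline_def x_def complex_eq_iff)
      have "- W * (hs n * y)^2 / 2 = - (W * (hs n)^2 / 2) * y^2" by (simp add: power_mult_distrib)
      also have "\<dots> <= - (s - 1) * y^2" using W by (intro mult_right_mono) auto
      finally have "exp (- W * (hs n * y)^2 / 2) <= exp (- (s - 1) * y^2)" by simp
      then have "cmod (E0 n (of_real x)) * exp (- W * (hs n * y)^2 / 2) <= cmod (E0 n (of_real x)) * exp (- (s - 1) * y^2)"
        by (intro mult_left_mono) auto
      moreover have "cmod (E0 n (Complex x (hs n * y))) <= cmod (E0 n (of_real x)) * exp (- W * (hs n * y)^2 / 2)"
        using E0_vertical[OF xb, of "hs n * y"] unfolding W_def by simp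
      ultimately show "cmod (E0 n (of_real (hs n) * zline s y)) <= cmod (E0 n (of_real (hs n * s))) * exp (- (s - 1) * y^2)"
        unfolding z x_def[symmetric] by linarith
    qed
  qed
qed

end

section \<open>Macroscopic contours\<close>

text \<open>A locally constant predicate on U is constant on each fibre, hence a function of the
  real part. As U is open, a horizontal segment around any of its points stays in U, so this
  function is locally constant on the connected set I.\<close>

lemma connected_vertical_fibres:
  fixes U :: "complex set"
  assumes U: "open U" and I: "connected I" "\<And>h. h \<in> U ==> Re h \<in> I"
    and ne: "\<And>x. x \<in> I ==> \<exists>y. Complex x y \<in> U"
    and fib: "\<And>x y1 y2 y. Complex x y1 \<in> U ==> Complex x y2 \<in> U ==> y1 <= y ==> y <= y2 ==> Complex x y \<in> U"
  shows "connected U"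
proof (rule connectedI_const)
  fix P :: "complex \<Rightarrow> bool" assume P: "continuous_on U P"
  have const: "P (f s) = P (f t)" if "connected T" "continuous_on T f" "f ` T \<subseteq> U" "s \<in> T" "t \<in> T" for f :: "real \<Rightarrow> complex" and T s t
  proof -
    have "continuous_on T (\<lambda>y. P (f y))" by (rule continuous_on_compose2[OF P that(2,3)])
    with that(1) obtain c where "\<forall>s\<in>T. P (f s) = c" unfolding connected_iff_const by blast
    with that show ?thesis by auto
  qed
  have cx: "continuous_on T (\<lambda>y. Complex x y)" and cy: "continuous_on T (\<lambda>x. Complex x y)" for x y T
    by (auto simp: Complex_eq intro!: continuous_intros)
  have vert: "P (Complex x y1) = P (Complex x y2)" if "Complex x y1 \<in> U" "Complex x y2 \<in> U" for x y1 y2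
  proof (cases "y1 <= y2")
    case True
    show ?thesis by (rule const[of "{y1..y2}" "\<lambda>y. Complex x y"]) (use that True fib[of x y1 y2] in \<open>auto intro: cx\<close>)
  next
    case False
    show ?thesis by (rule const[of "{y2..y1}" "\<lambda>y. Complex x y"]) (use that False fib[of x y2 y1] in \<open>auto intro: cx\<close>)
  qed
  define Q where "Q = (\<lambda>x. P (Complex x (SOME y. Complex x y \<in> U)))"
  have Q: "P h = Q (Re h)" if "h \<in> U" for h
  proof -
    have h: "Complex (Re h) (Im h) \<in> U" using that by simp
    then have "Complex (Re h) (SOME y. Complex (Re h) y \<in> U) \<in> U" by (rule someI)
    from vert[OF h this] show ?thesis by (simp add: Q_def)
  qed
  have "Q a = Q b" if "a \<in> I" "b \<in> I" for a b
  proof (rule connected_local_const[OF I(1) that], rule ballI)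
    fix x assume "x \<in> I"
    then obtain y where y: "Complex x y \<in> U" using ne by blast
    then obtain e where e: "e > 0" "ball (Complex x y) e \<subseteq> U" using U open_contains_ball by blast
    have sub: "Complex t y \<in> U" if "\<bar>t - x\<bar> < e" for t
    proof -
      have "dist (Complex x y) (Complex t y) = \<bar>t - x\<bar>" by (simp add: dist_norm cmod_def)
      then show ?thesis using e that by auto
    qed
    show "\<forall>\<^sub>F b in at x within I. Q x = Q b"
      unfolding eventually_at
    proof (intro exI[of _ e] conjI ballI impI e)
      fix b assume "b \<in> I" "b \<noteq> x \<and> dist b x < e"
      then have b: "\<bar>b - x\<bar> < e" by (simp add: dist_real_def)
      have "P (Complex x y) = P (Complex b y)"
        by (rule const[of "{x-e<..<x+e}" "\<lambda>x. Complex x y"]) (use b e(1) sub in \<open>auto intro!: cy simp: abs_less_iff\<close>)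
      moreover have "P (Complex x y) = Q x" using Q[OF y] by simp
      moreover have "P (Complex b y) = Q b" using Q[OF sub[OF b]] by simp
      ultimately show "Q x = Q b" by simp
    qed
  qed
  then show "\<exists>c. \<forall>s\<in>U. P s = c" using Q I(2) by metis
qed

section \<open>Exponential growth and decay of the weight at macroscopic distance\<close>

context nibm begin

lemma cmod_E0: "cmod (E0 n (Complex x y)) = exp (real n * ((x^2 - y^2) / (2 * t0) - G0 * x)) * (\<Prod>j=1..n. cmod (1 + of_real (a n j) * Complex x y))"
proof -
  have "Re (of_nat n * (Complex x y^2 / of_real (2 * t0) - of_real G0 * Complex x y)) = real n * ((x^2 - y^2) / (2 * t0) - G0 * x)"
    using Re_divide_of_real[of "Complex x y^2" "2*t0"] by (simp add: power2_eq_square)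
  then show ?thesis unfolding E0_def norm_mult norm_exp_eq_Re prod_norm by simp
qed

text \<open>Division by zero gives 0, so a point at \<open>xs\<close> would contribute the harmless
  factor 1; this lets \<open>E0_far\<close> and \<open>E0_perturb\<close> hold without excluding
  such points.\<close>

lemma a_eq_0: "xs = X0 n j ==> a n j = 0"
  unfolding a_def by simp

lemma cmod_factor: "cmod (1 + of_real (a n j) * Complex x y) = sqrt ((1 + a n j * x)^2 + (a n j)^2 * y^2)"
  by (simp add: cmod_def power_mult_distrib)

text \<open>Uses only 1 + t <= exp t and a bounded first absolute moment. Its point is the term -
  y^2, which wins for large |y| at a height that does not depend on n.\<close>

lemma E0_upper: "\<exists>K\<ge>0. EV n. \<forall>x y. cmod (E0 n (Complex x y)) <= exp (real n * ((x^2 - y^2) / (2 * t0) + K * (\<bar>x\<bar> + \<bar>y\<bar>)))"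
proof -
  obtain D where D: "EV n. (\<Sum>j=1..n. \<bar>a n j\<bar> powr 1) / real n <= D" using abs_moment_bounded[of 1] kappa by auto
  have "EV n. \<forall>x y. cmod (E0 n (Complex x y)) <= exp (real n * ((x^2 - y^2) / (2 * t0) + (\<bar>G0\<bar> + \<bar>D\<bar>) * (\<bar>x\<bar> + \<bar>y\<bar>)))"
    using D eventually_gt_at_top[of 0]
  proof eventually_elim
    case (elim n)
    show ?case
    proof (intro allI)
      fix x y
      have n: "real n > 0" using elim by simp
      have s: "(\<Sum>j=1..n. \<bar>a n j\<bar>) <= \<bar>D\<bar> * real n"
      proof -
        have "(\<Sum>j=1..n. \<bar>a n j\<bar>) <= D * real n" using elim(1) n by (simp add: pos_divide_le_eq)
        also have "\<dots> <= \<bar>D\<bar> * real n" by (intro mult_right_mono) auto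
        finally show ?thesis .
      qed
      have "(\<Prod>j=1..n. cmod (1 + of_real (a n j) * Complex x y)) <= (\<Prod>j=1..n. exp (\<bar>a n j\<bar> * (\<bar>x\<bar> + \<bar>y\<bar>)))"
      proof (intro prod_mono conjI)
        fix j
        have "cmod (1 + of_real (a n j) * Complex x y) <= 1 + \<bar>a n j\<bar> * cmod (Complex x y)"
          using norm_triangle_ineq[of 1 "of_real (a n j) * Complex x y"] by (simp add: norm_mult)
        also have "\<dots> <= 1 + \<bar>a n j\<bar> * (\<bar>x\<bar> + \<bar>y\<bar>)" using cmod_le[of "Complex x y"] by (intro add_left_mono mult_left_mono) auto
        also have "\<dots> <= exp (\<bar>a n j\<bar> * (\<bar>x\<bar> + \<bar>y\<bar>))" by (rule exp_ge_add_one_self)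
        finally show "cmod (1 + of_real (a n j) * Complex x y) <= exp (\<bar>a n j\<bar> * (\<bar>x\<bar> + \<bar>y\<bar>))" .
      qed auto
      also have "\<dots> = exp ((\<Sum>j=1..n. \<bar>a n j\<bar>) * (\<bar>x\<bar> + \<bar>y\<bar>))" by (simp add: exp_sum sum_distrib_right)
      also have "\<dots> <= exp ((\<bar>D\<bar> * real n) * (\<bar>x\<bar> + \<bar>y\<bar>))" using s by (simp add: mult_right_mono)
      finally have "cmod (E0 n (Complex x y)) <= exp (real n * ((x^2 - y^2) / (2 * t0) - G0 * x)) * exp ((\<bar>D\<bar> * real n) * (\<bar>x\<bar> + \<bar>y\<bar>))"
        unfolding cmod_E0 by (intro mult_left_mono) auto
      also have "\<dots> = exp (real n * ((x^2 - y^2) / (2 * t0) - G0 * x + \<bar>D\<bar> * (\<bar>x\<bar> + \<bar>y\<bar>)))" unfolding exp_add[symmetric] by (simp add: algebra_simps)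
      also have "\<dots> <= exp (real n * ((x^2 - y^2) / (2 * t0) + (\<bar>G0\<bar> + \<bar>D\<bar>) * (\<bar>x\<bar> + \<bar>y\<bar>)))"
      proof -
        have "- (G0 * x) <= \<bar>G0\<bar> * \<bar>x\<bar>" using abs_ge_minus_self[of "G0 * x"] by (simp add: abs_mult)
        moreover have "0 <= \<bar>G0\<bar> * \<bar>y\<bar>" by simp
        ultimately have "(x^2 - y^2) / (2 * t0) - G0 * x + \<bar>D\<bar> * (\<bar>x\<bar> + \<bar>y\<bar>) <= (x^2 - y^2) / (2 * t0) + (\<bar>G0\<bar> + \<bar>D\<bar>) * (\<bar>x\<bar> + \<bar>y\<bar>)"
          unfolding distrib_left distrib_right by linarith
        then show ?thesis unfolding exp_le_cancel_iff by (intro mult_left_mono) auto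
      qed
      finally show "cmod (E0 n (Complex x y)) <= exp (real n * ((x^2 - y^2) / (2 * t0) + (\<bar>G0\<bar> + \<bar>D\<bar>) * (\<bar>x\<bar> + \<bar>y\<bar>)))" .
    qed
  qed
  then show ?thesis by (intro exI[of _ "\<bar>G0\<bar> + \<bar>D\<bar>"]) auto
qed

text \<open>On the imaginary axis the Gaussian rate of \<open>E0_vertical\<close> is n (1 / t0 - S 2
  n) / 2, and 1 / t0 is exactly the limit \<open>Mom 2\<close> of S 2 n; hence E0 has no exponential
  growth on bounded segments. Criticality of the time t0 enters here.\<close>

lemma E0_imag_axis:
  assumes "H > 0" "\<eta> > 0"
  shows "EV n. \<forall>y. \<bar>y\<bar> <= H --> cmod (E0 n (Complex 0 y)) <= exp (real n * \<eta>)"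
proof -
  obtain C2 where C2: "EV n. \<bar>S 2 n - Mom 2\<bar> <= C2 * real n powr (2 * \<gamma> - 1)" using S_asymp[of 2] by auto
  have e: "EV n. (C2 * H^2) * real n powr (2 * \<gamma> - 1) <= \<eta>" using gam assms by (intro powr_eventually_le) auto
  show ?thesis using C2 e
  proof eventually_elim
    case (elim n)
    show ?case
    proof (intro allI impI)
      fix y assume y: "\<bar>y\<bar> <= H"
      have "y^2 <= H^2" using y by (simp add: abs_le_square_iff[symmetric])
      then have "\<bar>S 2 n - Mom 2\<bar> * y^2 <= (C2 * real n powr (2 * \<gamma> - 1)) * H^2"
        by (intro mult_mono) (use elim(1) in \<open>auto intro: order_trans[OF abs_ge_zero]\<close>)
      also have "\<dots> <= \<eta>" using elim(2) by (simp add: mult_ac)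
      finally have 1: "\<bar>S 2 n - Mom 2\<bar> * y^2 <= \<eta>" .
      have "(S 2 n - Mom 2) * y^2 <= \<bar>S 2 n - Mom 2\<bar> * y^2" by (intro mult_right_mono) auto
      with 1 assms(2) have "(S 2 n - Mom 2) * y^2 / 2 <= \<eta>" by simp
      then have "real n * ((S 2 n - Mom 2) * y^2 / 2) <= real n * \<eta>" by (intro mult_left_mono) auto
      then have "- (real n * (1/t0 - S 2 n + 2 * 0 * S 3 n) - 8 * 0^2 * (\<Sum>j=1..n. \<bar>a n j\<bar> powr 4)) * y^2 / 2 <= real n * \<eta>"
        unfolding t0(2) by (simp add: algebra_simps)
      then have "exp (- (real n * (1/t0 - S 2 n + 2 * 0 * S 3 n) - 8 * 0^2 * (\<Sum>j=1..n. \<bar>a n j\<bar> powr 4)) * y^2 / 2) <= exp (real n * \<eta>)"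
        unfolding exp_le_cancel_iff .
      note X = this
      have "cmod (E0 n (Complex 0 y)) <= cmod (E0 n (of_real 0)) * exp (- (real n * (1/t0 - S 2 n + 2 * 0 * S 3 n) - 8 * 0^2 * (\<Sum>j=1..n. \<bar>a n j\<bar> powr 4)) * y^2 / 2)"
        by (rule E0_vertical) simp
      also have "cmod (E0 n (of_real 0)) = 1" by simp
      also have "1 * exp (- (real n * (1/t0 - S 2 n + 2 * 0 * S 3 n) - 8 * 0^2 * (\<Sum>j=1..n. \<bar>a n j\<bar> powr 4)) * y^2 / 2) <= exp (real n * \<eta>)"
        unfolding mult_1 by (rule X)
      finally show "cmod (E0 n (Complex 0 y)) <= exp (real n * \<eta>)" .
    qed
  qed
qed

text \<open>The product grows with |y| and only the Gaussian factor decreases, by an explicit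
  amount. Upper bounds at finitely many heights thus control a whole vertical segment.\<close>

lemma E0_vertical_mono:
  assumes "\<bar>y\<bar> <= y'"
  shows "cmod (E0 n (Complex x y)) <= cmod (E0 n (Complex x y')) * exp (real n * ((y'^2 - y^2) / (2 * t0)))"
proof -
  have y2: "y^2 <= y'^2" using power_mono[OF assms abs_ge_zero, of 2] by simp
  have "(\<Prod>j=1..n. cmod (1 + of_real (a n j) * Complex x y)) <= (\<Prod>j=1..n. cmod (1 + of_real (a n j) * Complex x y'))"
    unfolding cmod_factor using y2 by (intro prod_mono conjI real_sqrt_le_mono add_left_mono mult_left_mono) auto
  then have "cmod (E0 n (Complex x y)) <= exp (real n * ((x^2 - y^2) / (2 * t0) - G0 * x)) * (\<Prod>j=1..n. cmod (1 + of_real (a n j) * Complex x y'))"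
    unfolding cmod_E0 by (intro mult_left_mono) auto
  also have "exp (real n * ((x^2 - y^2) / (2 * t0) - G0 * x)) = exp (real n * ((x^2 - y'^2) / (2 * t0) - G0 * x)) * exp (real n * ((y'^2 - y^2) / (2 * t0)))"
    unfolding exp_add[symmetric] by (simp add: diff_divide_distrib algebra_simps)
  finally show ?thesis unfolding cmod_E0 by (simp add: mult_ac)
qed

text \<open>The logarithm of \<^term>\<open>\<lambda>y. cmod (E0 n (Complex x y))\<close> is a concave function of \<^term>\<open>y^2\<close>.\<close>

lemma E0_vertical_quasiconcave:
  assumes y: "0 < y1" "y1 <= y" "y <= y2" and m: "m <= cmod (E0 n (Complex x y1))" "m <= cmod (E0 n (Complex x y2))"
    and a0: "\<And>j. j \<in> {1..n} ==> a n j \<noteq> 0"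
  shows "m <= cmod (E0 n (Complex x y))"
proof (cases "y1 = y2")
  case False
  define T where "T = (\<lambda>Y. real n * ((x^2 - Y) / (2 * t0) - G0 * x) + (\<Sum>j=1..n. ln ((1 + a n j * x)^2 + (a n j)^2 * Y) / 2))"
  have pos: "(1 + a n j * x)^2 + (a n j)^2 * Y > 0" if "Y > 0" "j \<in> {1..n}" for Y j
    using that a0[OF that(2)] by (intro add_nonneg_pos) auto
  have ET: "cmod (E0 n (Complex x y)) = exp (T (y^2))" if "y > 0" for y
  proof -
    have "(\<Prod>j=1..n. cmod (1 + of_real (a n j) * Complex x y)) = (\<Prod>j=1..n. exp (ln ((1 + a n j * x)^2 + (a n j)^2 * y^2) / 2))"
      unfolding cmod_factor
    proof (rule prod.cong[OF refl])
      fix j assume j: "j \<in> {1..n}"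
      have "sqrt B = exp (ln B / 2)" if "B > 0" for B proof -
        have "exp (ln (sqrt B)) = sqrt B" using that by simp
        then show ?thesis using that by (simp add: ln_sqrt)
      qed
      then show "sqrt ((1 + a n j * x)^2 + (a n j)^2 * y^2) = exp (ln ((1 + a n j * x)^2 + (a n j)^2 * y^2) / 2)"
        using pos[OF _ j, of "y^2"] \<open>y > 0\<close> by simp
    qed
    then show ?thesis unfolding cmod_E0 T_def exp_add by (simp add: exp_sum)
  qed
  have sq: "y1^2 <= y^2" "y^2 <= y2^2" "y1^2 < y2^2" using y False by (auto intro!: power_mono power_strict_mono)
  define u where "u = (y^2 - y1^2) / (y2^2 - y1^2)"
  have u: "0 <= u" "u <= 1" "y^2 = (1 - u) * y1^2 + u * y2^2"
  proof -
    show "0 <= u" "u <= 1" using sq by (auto simp: u_def divide_simps)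
    have "u * (y2^2 - y1^2) = y^2 - y1^2" using sq by (simp add: u_def)
    then show "y^2 = (1 - u) * y1^2 + u * y2^2" by (simp add: algebra_simps)
  qed
  \<comment> \<open>Concavity of the logarithm, from ln t <= t - 1 at t = p / w and t = q / w, with
    w the convex combination.\<close>
  have conc: "(1 - u) * ln p + u * ln q <= ln ((1 - u) * p + u * q)" if pq: "p > 0" "q > 0" for p q :: real
  proof -
    define w where "w = (1 - u) * p + u * q"
    have w: "w > 0" unfolding w_def
    proof (cases "u = 0")
      case False
      then have "u * q > 0" "(1 - u) * p >= 0" using u pq by auto
      then show "0 < (1 - u) * p + u * q" by linarith
    qed (use pq in simp)
    have "ln p <= ln w + (p / w - 1)" using ln_le_minus_one[of "p / w"] pq w by (simp add: ln_div)
    then have "(1 - u) * ln p <= (1 - u) * (ln w + (p / w - 1))" using u by (intro mult_left_mono) auto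
    moreover have "ln q <= ln w + (q / w - 1)" using ln_le_minus_one[of "q / w"] pq w by (simp add: ln_div)
    then have "u * ln q <= u * (ln w + (q / w - 1))" using u by (intro mult_left_mono) auto
    ultimately have "(1 - u) * ln p + u * ln q <= (1 - u) * (ln w + (p / w - 1)) + u * (ln w + (q / w - 1))" by (rule add_mono)
    also have "\<dots> = ln w + (((1 - u) * p + u * q) / w - 1)" by (simp add: algebra_simps add_divide_distrib diff_divide_distrib)
    also have "\<dots> = ln w" using w by (simp add: w_def[symmetric])
    finally show ?thesis by (simp add: w_def)
  qed
  have "(1 - u) * T (y1^2) + u * T (y2^2) <= T (y^2)"
  proof -
    have "(1 - u) * ln ((1 + a n j * x)^2 + (a n j)^2 * y1^2) + u * ln ((1 + a n j * x)^2 + (a n j)^2 * y2^2)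
       <= ln ((1 + a n j * x)^2 + (a n j)^2 * y^2)" if j: "j \<in> {1..n}" for j
    proof -
      have "(1 - u) * ((1 + a n j * x)^2 + (a n j)^2 * y1^2) + u * ((1 + a n j * x)^2 + (a n j)^2 * y2^2) = (1 + a n j * x)^2 + (a n j)^2 * y^2"
        unfolding u(3) by (simp add: algebra_simps)
      then show ?thesis using conc[OF pos[OF _ j, of "y1^2"] pos[OF _ j, of "y2^2"]] y by simp
    qed
    then have "(\<Sum>j=1..n. ((1 - u) * ln ((1 + a n j * x)^2 + (a n j)^2 * y1^2) + u * ln ((1 + a n j * x)^2 + (a n j)^2 * y2^2)) / 2)
       <= (\<Sum>j=1..n. ln ((1 + a n j * x)^2 + (a n j)^2 * y^2) / 2)"
      by (intro sum_mono divide_right_mono) auto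
    then have "(1 - u) * (\<Sum>j=1..n. ln ((1 + a n j * x)^2 + (a n j)^2 * y1^2) / 2) + u * (\<Sum>j=1..n. ln ((1 + a n j * x)^2 + (a n j)^2 * y2^2) / 2)
       <= (\<Sum>j=1..n. ln ((1 + a n j * x)^2 + (a n j)^2 * y^2) / 2)"
      by (simp add: sum_distrib_left add_divide_distrib sum.distrib)
    moreover have "real n * ((x^2 - y^2) / (2 * t0) - G0 * x) = (1 - u) * (real n * ((x^2 - y1^2) / (2 * t0) - G0 * x)) + u * (real n * ((x^2 - y2^2) / (2 * t0) - G0 * x))"
      unfolding u(3) by (simp add: diff_divide_distrib add_divide_distrib algebra_simps)
    ultimately show ?thesis unfolding T_def distrib_left by linarith
  qed
  moreover have "min (T (y1^2)) (T (y2^2)) <= (1 - u) * T (y1^2) + u * T (y2^2)"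
  proof -
    have "(1 - u) * min (T (y1^2)) (T (y2^2)) + u * min (T (y1^2)) (T (y2^2)) <= (1 - u) * T (y1^2) + u * T (y2^2)"
      using u by (intro add_mono mult_left_mono) auto
    then show ?thesis by (simp add: algebra_simps)
  qed
  ultimately have "min (T (y1^2)) (T (y2^2)) <= T (y^2)" by linarith
  then have "exp (T (y1^2)) <= exp (T (y^2)) \<or> exp (T (y2^2)) <= exp (T (y^2))" by (auto simp: min_le_iff_disj)
  moreover have "m <= exp (T (y1^2))" "m <= exp (T (y2^2))" using m ET[of y1] ET[of y2] y by auto
  ultimately have "m <= exp (T (y^2))" by (meson order_trans)
  then show ?thesis using ET[of y] y by simp
qed (use assms in auto)

text \<open>Once |Re h| is at least twice every |xs - X0 n j|, all factors have modulus at least 1,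
  and the quadratic exponent, with |Im h| <= 2, exceeds any prescribed rate K.\<close>

lemma E0_far:
  "\<exists>L0>0. \<forall>n\<ge>1. \<forall>h. \<bar>Re h\<bar> >= L0 \<and> \<bar>Im h\<bar> <= 2 --> cmod (E0 n h) >= exp (real n * K)"
proof -
  \<comment> \<open>The 5 leaves room for (|x| - 5) |x| <= x^2 - 4, where 4 bounds y^2; the other
    terms dominate the linear part of the exponent, K and the distances to the initial
    points.\<close>
  define L0 where "L0 = 2 * (\<bar>xs\<bar> + \<bar>bd\<bar>) + 2 * t0 * \<bar>G0\<bar> + 2 * t0 * \<bar>K\<bar> + 5"
  have t0p: "t0 > 0" by (rule t0)
  have L5: "L0 >= 5" using t0p by (simp add: L0_def)
  have "cmod (E0 n h) >= exp (real n * K)" if h: "\<bar>Re h\<bar> >= L0" "\<bar>Im h\<bar> <= 2" and n: "n >= 1" for n h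
  proof -
    define x y where "x = Re h" "y = Im h"
    have hxy: "h = Complex x y" by (simp add: x_y_def)
    have f1: "1 <= cmod (1 + of_real (a n j) * h)" if j: "j \<in> {1..n}" for j
    proof (cases "xs = X0 n j")
      case False
      have d: "\<bar>xs - X0 n j\<bar> <= \<bar>xs\<bar> + \<bar>bd\<bar>" using bd[of j n] j by simp
      have "1 + of_real (a n j) * h = (of_real (xs - X0 n j) + h) / of_real (xs - X0 n j)" using False by (simp add: a_def field_simps)
      then have "cmod (1 + of_real (a n j) * h) = cmod (of_real (xs - X0 n j) + h) / \<bar>xs - X0 n j\<bar>" by (simp add: norm_divide del: of_real_diff)
      moreover have "cmod (of_real (xs - X0 n j) + h) >= \<bar>xs - X0 n j\<bar>"
      proof -
        have "\<bar>x\<bar> >= 2 * (\<bar>xs\<bar> + \<bar>bd\<bar>)" using h(1) t0p by (simp add: x_y_def L0_def) (smt (verit) mult_nonneg_nonneg abs_ge_zero)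
        with d have "2 * \<bar>xs - X0 n j\<bar> <= \<bar>x\<bar>" by (meson mult_left_mono order_trans zero_le_numeral)
        moreover have "\<bar>x\<bar> <= \<bar>xs - X0 n j + x\<bar> + \<bar>xs - X0 n j\<bar>" using abs_triangle_ineq4[of "xs - X0 n j + x" "xs - X0 n j"] by simp
        moreover have "2 * p <= q ==> q <= r + p ==> p <= r" for p q r :: real by simp
        ultimately have "\<bar>xs - X0 n j + x\<bar> >= \<bar>xs - X0 n j\<bar>" by blast
        moreover have "\<bar>xs - X0 n j + x\<bar> <= cmod (of_real (xs - X0 n j) + h)" using abs_Re_le_cmod[of "of_real (xs - X0 n j) + h"] by (simp add: x_y_def)
        ultimately show ?thesis by linarith
      qed
      moreover have "\<bar>xs - X0 n j\<bar> > 0" using False by simp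
      ultimately show ?thesis by (simp only: pos_le_divide_eq mult_1)
    next
      case True
      show ?thesis by (simp add: a_eq_0[OF True])
    qed
    have "K <= (x^2 - y^2) / (2 * t0) - G0 * x"
    proof -
      have xL: "\<bar>x\<bar> >= L0" using h by (simp add: x_y_def)
      have "y^2 <= 4" using power_mono[OF h(2) abs_ge_zero, of 2] by (simp add: x_y_def)
      moreover have "2 * t0 * (K + G0 * x) <= x^2 - 4"
      proof -
        have "2 * t0 * (K + G0 * x) <= 2 * t0 * (\<bar>K\<bar> + \<bar>G0\<bar> * \<bar>x\<bar>)" using t0p abs_ge_self[of "G0 * x"] abs_ge_self[of K] by (intro mult_left_mono) (auto simp: abs_mult)
        also have "\<dots> <= (2 * t0 * \<bar>K\<bar> + 2 * t0 * \<bar>G0\<bar>) * \<bar>x\<bar>"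
        proof -
          have "2 * t0 * \<bar>K\<bar> * 1 <= 2 * t0 * \<bar>K\<bar> * \<bar>x\<bar>" using xL L5 t0p by (intro mult_left_mono) auto
          then show ?thesis by (simp add: algebra_simps)
        qed
        also have "\<dots> <= (\<bar>x\<bar> - 5) * \<bar>x\<bar>" using xL by (intro mult_right_mono) (auto simp: L0_def)
        also have "\<dots> <= x^2 - 4"
        proof -
          have "\<bar>x\<bar> >= 1" using xL L5 by linarith
          moreover have "\<bar>x\<bar> * \<bar>x\<bar> = x^2" by (simp add: power2_eq_square)
          ultimately show ?thesis unfolding left_diff_distrib by linarith
        qed
        finally show ?thesis .
      qed
      ultimately have "2 * t0 * (K + G0 * x) <= x^2 - y^2" by linarith
      then have "K + G0 * x <= (x^2 - y^2) / (2 * t0)" using t0p by (simp add: pos_le_divide_eq mult.commute)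
      then show ?thesis by linarith
    qed
    then have "exp (real n * K) <= exp (real n * ((x^2 - y^2) / (2 * t0) - G0 * x))" unfolding exp_le_cancel_iff by (intro mult_left_mono) auto
    moreover have "1 <= (\<Prod>j=1..n. cmod (1 + of_real (a n j) * h))" using f1 by (rule prod_ge_1)
    ultimately show ?thesis unfolding hxy cmod_E0 using mult_mono[of "exp (real n * K)" _ 1] by fastforce
  qed
  with L5 show ?thesis by (intro exI[of _ L0]) auto
qed

text \<open>The radius must not depend on n. Each factor is a multiple of xs - X0 n j + h, of
  modulus at least Im h, so moving h by d changes it by a relative amount of at most d / Im h. The n
  factors together and the exponent each cost at most n \<delta> / 2.\<close>

lemma E0_perturb:
  assumes h: "Im h > 0" and \<delta>: "\<delta> > 0"
  shows "\<exists>e>0. \<forall>n. \<forall>h'\<in>ball h e. cmod (E0 n h') >= cmod (E0 n h) * exp (- (real n * \<delta>))"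
proof -
  define B where "B = (cmod h + 1) / t0 + \<bar>G0\<bar>"
  have t0p: "t0 > 0" by (rule t0)
  have B0: "B >= 0" using t0p by (simp add: B_def)
  \<comment> \<open>The bound \<delta> Im h / 4 serves the factors and \<delta> / (2 (B + 1)) the
    exponent, whose increment per n is at most e * B; Im h / 2 keeps the relative change of a factor
    below 1/2.\<close>
  define e where "e = min 1 (min (Im h / 2) (min (\<delta> / (2 * (B + 1))) (\<delta> * Im h / 4)))"
  have e: "e > 0" "e <= 1" "e <= Im h / 2" "e <= \<delta> / (2 * (B + 1))" "e <= \<delta> * Im h / 4"
  proof -
    show "e > 0" using h \<delta> B0 by (auto simp: e_def)
    show "e <= 1" by (simp add: e_def)
    show "e <= Im h / 2" unfolding e_def by (rule min.coboundedI2, rule min.coboundedI1, rule order_refl)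
    show "e <= \<delta> / (2 * (B + 1))" unfolding e_def by (rule min.coboundedI2, rule min.coboundedI2, rule min.coboundedI1, rule order_refl)
    show "e <= \<delta> * Im h / 4" unfolding e_def by (rule min.coboundedI2, rule min.coboundedI2, rule min.coboundedI2, rule order_refl)
  qed
  have "cmod (E0 n h') >= cmod (E0 n h) * exp (- (real n * \<delta>))" if h': "h' \<in> ball h e" for n h'
  proof -
    define d where "d = cmod (h' - h)"
    have d: "d < e" using h' by (simp add: d_def dist_norm norm_minus_commute)
    have d0: "d >= 0" by (simp add: d_def)
    have f: "cmod (1 + of_real (a n j) * h') >= cmod (1 + of_real (a n j) * h) * exp (- (\<delta> / 2))" for j
    proof (cases "xs = X0 n j")
      case False
      define A where "A = of_real (xs - X0 n j) + h"
      have e1: "1 + of_real (a n j) * h = A / of_real (xs - X0 n j)" "1 + of_real (a n j) * h' = (A + (h' - h)) / of_real (xs - X0 n j)"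
        using False by (simp_all add: a_def A_def field_simps)
      have A: "cmod A >= Im h" using abs_Im_le_cmod[of A] h by (simp add: A_def)
      have dA: "d <= \<delta> / 4 * cmod A" "d <= cmod A / 2"
      proof -
        have "d <= \<delta> / 4 * Im h" using d e by simp
        also have "\<dots> <= \<delta> / 4 * cmod A" using A \<delta> by (intro mult_left_mono) auto
        finally show "d <= \<delta> / 4 * cmod A" .
        show "d <= cmod A / 2" using d e A by linarith
      qed
      have "exp (- (\<delta> / 2)) * cmod A <= cmod A - d"
      proof -
        define q where "q = d / cmod A"
        have Ap: "cmod A > 0" using A h by linarith
        have q: "0 <= q" "q <= \<delta> / 4" "q <= 1/2" using d0 dA Ap by (auto simp: q_def pos_divide_le_eq)
        have "0 <= q * (1 - 2 * q)" using q by (intro mult_nonneg_nonneg) auto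
        then have "1 <= (1 - q) * (1 + 2 * q)" by (simp add: algebra_simps)
        also have "\<dots> <= (1 - q) * exp (2 * q)" using q exp_ge_add_one_self[of "2 * q"] by (intro mult_left_mono) auto
        finally have "exp (- (2 * q)) <= 1 - q" by (simp add: exp_minus field_simps)
        moreover have "exp (- (\<delta> / 2)) <= exp (- (2 * q))" using q(2) by simp
        ultimately have "exp (- (\<delta> / 2)) <= 1 - q" by (rule order_trans[rotated])
        then have "exp (- (\<delta> / 2)) * cmod A <= (1 - q) * cmod A" by (intro mult_right_mono) auto
        also have "\<dots> = cmod A - d" using Ap by (simp add: q_def field_simps)
        finally show ?thesis .
      qed
      also have "cmod A - d <= cmod (A + (h' - h))" using norm_diff_ineq[of A "h' - h"] by (simp add: d_def)
      finally have "exp (- (\<delta> / 2)) * cmod A <= cmod (A + (h' - h))" .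
      then have "exp (- (\<delta> / 2)) * cmod A / \<bar>xs - X0 n j\<bar> <= cmod (A + (h' - h)) / \<bar>xs - X0 n j\<bar>" by (intro divide_right_mono) auto
      then show ?thesis unfolding e1 norm_divide norm_of_real by (simp add: mult.commute)
    next
      case True
      show ?thesis using \<delta> by (simp add: a_eq_0[OF True])
    qed
    have P: "(\<Prod>j=1..n. cmod (1 + of_real (a n j) * h')) >= (\<Prod>j=1..n. cmod (1 + of_real (a n j) * h)) * exp (- (real n * (\<delta> / 2)))"
    proof -
      have "(\<Prod>j=1..n. cmod (1 + of_real (a n j) * h) * exp (- (\<delta> / 2))) <= (\<Prod>j=1..n. cmod (1 + of_real (a n j) * h'))"
        by (intro prod_mono conjI f) auto
      moreover have "(\<Prod>j=1..n. cmod (1 + of_real (a n j) * h) * exp (- (\<delta> / 2))) = (\<Prod>j=1..n. cmod (1 + of_real (a n j) * h)) * exp (- (real n * (\<delta> / 2)))"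
        by (simp add: prod.distrib exp_of_nat_mult[symmetric])
      ultimately show ?thesis by simp
    qed
    define W where "W = (\<lambda>h. Re (h^2 / of_real (2 * t0) - of_real G0 * h))"
    have W: "W h - W h' <= \<delta> / 2"
    proof -
      have "h^2 / of_real (2 * t0) - of_real G0 * h - (h'^2 / of_real (2 * t0) - of_real G0 * h') = (h - h') * ((h + h') / of_real (2 * t0) - of_real G0)"
        by (simp add: algebra_simps power2_eq_square diff_divide_distrib)
      then have "W h - W h' <= cmod ((h - h') * ((h + h') / of_real (2 * t0) - of_real G0))"
        unfolding W_def by (metis complex_Re_le_cmod minus_complex.simps(1))
      also have "\<dots> = d * cmod ((h + h') / of_real (2 * t0) - of_real G0)" by (simp add: norm_mult d_def norm_minus_commute)
      also have "\<dots> <= d * B"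
      proof (rule mult_left_mono[OF _ d0])
        have "cmod (h + h') <= 2 * (cmod h + 1)"
        proof -
          have "h' = h + (h' - h)" by simp
          then have "cmod h' <= cmod h + d" unfolding d_def by (metis norm_triangle_ineq)
          also have "\<dots> <= cmod h + 1" using d e(2) by simp
          finally have "cmod h + cmod h' <= cmod h + (cmod h + 1)" by simp
          then have "cmod (h + h') <= cmod h + (cmod h + 1)" by (rule order_trans[OF norm_triangle_ineq])
          then show ?thesis by simp
        qed
        then have "cmod ((h + h') / of_real (2 * t0)) <= 2 * (cmod h + 1) / (2 * t0)" unfolding norm_divide norm_of_real using t0p by (intro frac_le) auto
        also have "\<dots> = (cmod h + 1) / t0" using t0p by (simp add: field_simps)
        finally show "cmod ((h + h') / of_real (2 * t0) - of_real G0) <= B"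
          using norm_triangle_ineq4[of "(h + h') / of_real (2 * t0)" "of_real G0"] by (simp add: B_def)
      qed
      also have "\<dots> <= e * (B + 1)" using d d0 B0 e(1) by (intro mult_mono) auto
      also have "\<dots> <= \<delta> / 2"
      proof -
        have "e * (B + 1) <= \<delta> / (2 * (B + 1)) * (B + 1)" using e(4) B0 by (intro mult_right_mono) auto
        moreover have "\<delta> / (2 * b) * b = \<delta> / 2" if "b \<noteq> 0" for b :: real using that by simp
        ultimately show ?thesis using B0 by (simp del: distrib_left_numeral)
      qed
      finally show ?thesis .
    qed
    have E: "cmod (E0 n h) = exp (real n * W h) * (\<Prod>j=1..n. cmod (1 + of_real (a n j) * h))" for h
    proof -
      have "Re (of_nat n * (h^2 / of_real (2 * t0) - of_real G0 * h)) = real n * W h" by (simp add: W_def)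
      then show ?thesis unfolding E0_def norm_mult norm_exp_eq_Re prod_norm by simp
    qed
    have "cmod (E0 n h) * exp (- (real n * \<delta>)) = (exp (real n * W h) * exp (- (real n * (\<delta> / 2)))) * ((\<Prod>j=1..n. cmod (1 + of_real (a n j) * h)) * exp (- (real n * (\<delta> / 2))))"
    proof -
      have "exp (- (real n * \<delta>)) = exp (- (real n * (\<delta> / 2))) * exp (- (real n * (\<delta> / 2)))" unfolding exp_add[symmetric] by simp
      then show ?thesis unfolding E by (simp add: mult_ac)
    qed
    also have "\<dots> <= exp (real n * W h') * (\<Prod>j=1..n. cmod (1 + of_real (a n j) * h'))"
    proof (intro mult_mono P)
      have "real n * (W h - \<delta> / 2) <= real n * W h'" using W by (intro mult_left_mono) auto
      then show "exp (real n * W h) * exp (- (real n * (\<delta> / 2))) <= exp (real n * W h')" unfolding exp_add[symmetric] by (simp add: algebra_simps)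
    qed (auto intro!: mult_nonneg_nonneg prod_nonneg)
    finally show ?thesis unfolding E[of h'] .
  qed
  with e(1) show ?thesis by blast
qed

text \<open>The logarithm of the ratio divided by n is, up to an explicit term, the average of a
  bounded continuous function over the initial points, so weak convergence applies. A ratio is taken
  because the normalising product of |xs - X0 n j| cancels in it; the logarithm of that product
  would call for an unbounded test function.\<close>

lemma E0_ratio_converges:
  assumes h: "Im h > 0" "Im h' > 0"
  shows "\<exists>l. \<forall>\<eta>>0. EV n. cmod (E0 n h') * exp (real n * (l - \<eta>)) <= cmod (E0 n h) \<and> cmod (E0 n h) <= cmod (E0 n h') * exp (real n * (l + \<eta>))"
proof -
  \<comment> \<open>Clamping s to [- |bd|, |bd|] makes the logarithm bounded and continuous on the
    whole line without changing it at any initial point.\<close>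
  define k where "k = (\<lambda>h s. ln (cmod (of_real (xs - max (- \<bar>bd\<bar>) (min \<bar>bd\<bar> s)) + h)))"
  have pos: "cmod (of_real r + h) > 0" if "Im h > 0" for r h
    using that by (auto simp: complex_eq_iff)
  have conv: "(\<lambda>n. (\<Sum>j=1..n. k h (X0 n j)) / real n) \<longlonglongrightarrow> (LINT s|lborel. k h s * psi s)" if "Im h > 0" for h
  proof (rule weak_conv)
    have c: "continuous_on UNIV (\<lambda>r::real. ln (cmod (of_real (xs - r) + h)))"
      using pos[OF that] by (auto intro!: continuous_intros simp del: of_real_diff)
    have c2: "continuous_on UNIV (\<lambda>s. max (- \<bar>bd\<bar>) (min \<bar>bd\<bar> s))" by (intro continuous_intros)
    show "continuous_on UNIV (k h)" unfolding k_def using continuous_on_compose2[OF c c2] by simp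
    have "compact ((\<lambda>r::real. ln (cmod (of_real (xs - r) + h))) ` {- \<bar>bd\<bar>..\<bar>bd\<bar>})"
      by (intro compact_continuous_image continuous_on_subset[OF c]) auto
    moreover have "range (k h) \<subseteq> (\<lambda>r::real. ln (cmod (of_real (xs - r) + h))) ` {- \<bar>bd\<bar>..\<bar>bd\<bar>}"
      unfolding k_def by (auto intro!: imageI)
    ultimately show "bounded (range (k h))" using compact_imp_bounded bounded_subset by blast
  qed
  define W where "W = (\<lambda>h. Re (h^2 / of_real (2 * t0) - of_real G0 * h))"
  define l where "l = W h - W h' + ((LINT s|lborel. k h s * psi s) - (LINT s|lborel. k h' s * psi s))"
  define r where "r = (\<lambda>n. W h - W h' + ((\<Sum>j=1..n. k h (X0 n j)) / real n - (\<Sum>j=1..n. k h' (X0 n j)) / real n))"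
  have r: "r \<longlonglongrightarrow> l" unfolding r_def l_def by (intro tendsto_intros conv h)
  have E: "cmod (E0 n h) = exp (real n * W h + (\<Sum>j=1..n. k h (X0 n j))) / (\<Prod>j=1..n. \<bar>xs - X0 n j\<bar>)" if "Im h > 0" "\<forall>j\<in>{1..n}. X0 n j \<noteq> xs" for n h
  proof -
    have "cmod (1 + of_real (a n j) * h) = exp (k h (X0 n j)) / \<bar>xs - X0 n j\<bar>" if j: "j \<in> {1..n}" for j
    proof -
      have "\<bar>X0 n j\<bar> <= \<bar>bd\<bar>" using bd[of j n] j by simp
      then have "max (- \<bar>bd\<bar>) (min \<bar>bd\<bar> (X0 n j)) = X0 n j" by auto
      then have "exp (k h (X0 n j)) = cmod (of_real (xs - X0 n j) + h)" using pos[OF \<open>Im h > 0\<close>] by (simp add: k_def del: of_real_diff)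
      moreover have "1 + of_real (a n j) * h = (of_real (xs - X0 n j) + h) / of_real (xs - X0 n j)"
      proof -
        have "X0 n j \<noteq> xs" using j \<open>\<forall>j\<in>{1..n}. X0 n j \<noteq> xs\<close> by blast
        then have "complex_of_real (xs - X0 n j) \<noteq> 0" by auto
        then show ?thesis by (simp add: a_def add_divide_distrib del: of_real_diff)
      qed
      ultimately show ?thesis by (simp add: norm_divide del: of_real_diff)
    qed
    then have "(\<Prod>j=1..n. cmod (1 + of_real (a n j) * h)) = exp (\<Sum>j=1..n. k h (X0 n j)) / (\<Prod>j=1..n. \<bar>xs - X0 n j\<bar>)"
      by (simp add: prod_dividef exp_sum)
    moreover have "Re (of_nat n * (h^2 / of_real (2 * t0) - of_real G0 * h)) = real n * W h" by (simp add: W_def)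
    ultimately show ?thesis unfolding E0_def norm_mult norm_exp_eq_Re prod_norm exp_add by simp
  qed
  have "EV n. cmod (E0 n h') * exp (real n * (l - \<eta>)) <= cmod (E0 n h) \<and> cmod (E0 n h) <= cmod (E0 n h') * exp (real n * (l + \<eta>))" if \<eta>: "\<eta> > 0" for \<eta>
  proof -
    have "EV n. l - \<eta> < r n" "EV n. r n < l + \<eta>"
      using order_tendstoD[OF r] \<eta> by simp_all
    then show ?thesis using eventually_X0_ne eventually_gt_at_top[of 0]
  proof eventually_elim
    case (elim n)
    have n: "real n > 0" using elim by simp
    have "real n * r n = real n * W h + (\<Sum>j=1..n. k h (X0 n j)) - (real n * W h' + (\<Sum>j=1..n. k h' (X0 n j)))" using n by (simp add: r_def field_simps)
    then have eq: "cmod (E0 n h) = cmod (E0 n h') * exp (real n * r n)" unfolding E[OF h(1) elim(3)] E[OF h(2) elim(3)] by (simp add: exp_add[symmetric])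
    show ?case unfolding eq using elim n by (auto intro!: mult_left_mono)
  qed
  qed
  then show ?thesis by blast
qed

end

section \<open>Paths with a length constant\<close>

text \<open>K plays the role of the length of g when a contour integral is estimated by length times
  maximum. Defining it through this very estimate makes it pass to joins and reflections at
  once.\<close>

definition path_bound :: "(real \<Rightarrow> complex) \<Rightarrow> real \<Rightarrow> bool" where
  "path_bound g K \<longleftrightarrow> valid_path g \<and> K >= 0 \<and> (\<forall>f B. f contour_integrable_on g \<and> (\<forall>w\<in>path_image g. cmod (f w) <= B) --> cmod (contour_integral g f) <= K * B)"

lemma path_bound_linepath: "path_bound (linepath a b) (cmod (b - a))"
  unfolding path_bound_def
proof (intro conjI allI impI)
  fix f :: "complex \<Rightarrow> complex" and B
  assume f: "f contour_integrable_on linepath a b \<and> (\<forall>w\<in>path_image (linepath a b). cmod (f w) <= B)"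
  have "cmod (f a) <= B" using f by simp
  then have "B >= 0" by (rule order_trans[OF norm_ge_zero])
  then have "cmod (contour_integral (linepath a b) f) <= B * cmod (b - a)"
    by (intro has_contour_integral_bound_linepath[OF has_contour_integral_integral]) (use f in auto)
  then show "cmod (contour_integral (linepath a b) f) <= cmod (b - a) * B" by (simp add: mult.commute)
qed auto

lemma path_bound_polynomial:
  assumes "polynomial_function g" shows "\<exists>K. path_bound g K"
proof -
  obtain g' where g': "polynomial_function g'" "\<And>t. (g has_vector_derivative g' t) (at t)"
    using has_vector_derivative_polynomial_function[OF assms] by blast
  have "compact (g' ` {0..1})" by (intro compact_continuous_image continuous_on_polymonial_function g') auto
  then have "bounded (g' ` {0..1})" by (rule compact_imp_bounded)
  then obtain K where "\<forall>w\<in>g' ` {0..1}. cmod w <= K" unfolding bounded_iff by blast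
  then have K: "cmod (g' t) <= K" if "t \<in> {0..1}" for t using that by blast
  have K0: "K >= 0" by (rule order_trans[OF norm_ge_zero K[of 0]]) simp
  have "path_bound g K" unfolding path_bound_def
  proof (intro conjI allI impI K0)
    show "valid_path g" using assms by (rule valid_path_polynomial_function)
    fix f :: "complex \<Rightarrow> complex" and B
    assume f: "f contour_integrable_on g \<and> (\<forall>w\<in>path_image g. cmod (f w) <= B)"
    have "g 0 \<in> path_image g" by (simp add: path_image_def)
    then have "cmod (f (g 0)) <= B" using f by blast
    then have B: "B >= 0" by (rule order_trans[OF norm_ge_zero])
    have vd: "vector_derivative g (at t) = g' t" for t using g'(2) by (rule vector_derivative_at)
    have "((\<lambda>t. f (g t) * vector_derivative g (at t)) has_integral contour_integral g f) {0..1}"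
      using has_contour_integral_integral f by (simp add: has_contour_integral)
    then have "((\<lambda>t. f (g t) * g' t) has_integral contour_integral g f) (cbox 0 1)" by (simp add: vd)
    then have "cmod (contour_integral g f) <= (B * K) * Henstock_Kurzweil_Integration.content (cbox 0 (1::real))"
    proof (rule has_integral_bound[rotated])
      fix t :: real assume t: "t \<in> cbox 0 1"
      then have "g t \<in> path_image g" by (auto simp: path_image_def)
      then show "cmod (f (g t) * g' t) <= B * K" unfolding norm_mult using f K t B by (intro mult_mono) auto
    qed (use B K0 in auto)
    then show "cmod (contour_integral g f) <= K * B" by (simp add: mult.commute)
  qed
  then show ?thesis by blast
qed

lemma path_bound_join:
  assumes "path_bound g K" "path_bound h L" "pathfinish g = pathstart h"
  shows "path_bound (g +++ h) (K + L)"
  unfolding path_bound_def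
proof (intro conjI allI impI)
  show "valid_path (g +++ h)" "K + L >= 0" using assms by (auto simp: path_bound_def intro: valid_path_join)
  fix f :: "complex \<Rightarrow> complex" and B
  assume f: "f contour_integrable_on g +++ h \<and> (\<forall>w\<in>path_image (g +++ h). cmod (f w) <= B)"
  have v: "valid_path g" "valid_path h" using assms by (auto simp: path_bound_def)
  have i: "f contour_integrable_on g" "f contour_integrable_on h" using f v by auto
  have im: "path_image (g +++ h) = path_image g \<union> path_image h" by (rule path_image_join[OF assms(3)])
  have "cmod (contour_integral g f) <= K * B" "cmod (contour_integral h f) <= L * B"
    using assms i f im unfolding path_bound_def by auto
  then show "cmod (contour_integral (g +++ h) f) <= (K + L) * B"
    using norm_triangle_ineq[of "contour_integral g f" "contour_integral h f"] i v
    by (simp add: contour_integral_join algebra_simps)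
qed

lemma path_bound_cnj:
  assumes "path_bound g K" shows "path_bound (cnj \<circ> g) K"
  unfolding path_bound_def
proof (intro conjI allI impI)
  have v: "valid_path g" using assms by (auto simp: path_bound_def)
  then show "valid_path (cnj \<circ> g)" using valid_path_cnj by blast
  show "K >= 0" using assms by (auto simp: path_bound_def)
  fix f :: "complex \<Rightarrow> complex" and B
  assume f: "f contour_integrable_on (cnj \<circ> g) \<and> (\<forall>w\<in>path_image (cnj \<circ> g). cmod (f w) <= B)"
  have "(cnj \<circ> f \<circ> cnj) contour_integrable_on g" using f contour_integrable_on_compose_cnj_iff[OF v] by auto
  moreover have "\<forall>w\<in>path_image g. cmod ((cnj \<circ> f \<circ> cnj) w) <= B" using f by (auto simp: path_image_compose)
  ultimately have "cmod (contour_integral g (cnj \<circ> f \<circ> cnj)) <= K * B" using assms unfolding path_bound_def by blast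
  then show "cmod (contour_integral (cnj \<circ> g) f) <= K * B" by (simp add: contour_integral_cnj[OF v])
qed

lemma path_bound_mono: "path_bound g K ==> K <= L ==> path_bound g L"
  unfolding path_bound_def
proof (intro conjI allI impI; (elim conjE)?)
  fix f :: "complex \<Rightarrow> complex" and B
  assume *: "K <= L" "\<forall>f B. f contour_integrable_on g \<and> (\<forall>w\<in>path_image g. cmod (f w) <= B) --> cmod (contour_integral g f) <= K * B"
    "f contour_integrable_on g" "\<forall>w\<in>path_image g. cmod (f w) <= B"
  have "g 0 \<in> path_image g" by (simp add: path_image_def)
  then have "cmod (f (g 0)) <= B" using * by blast
  then have "B >= 0" by (rule order_trans[OF norm_ge_zero])
  then have "K * B <= L * B" using * by (intro mult_right_mono) auto
  then show "cmod (contour_integral g f) <= L * B" using * by (meson order_trans)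
qed auto

context nibm begin

text \<open>If \<^term>\<open>E0 n\<close> were small along a whole vertical line, the maximum modulus principle on the strip
  between that line and the imaginary axis would make it small at \<^term>\<open>P\<close>.\<close>

lemma fibre_nonempty:
  fixes P :: complex and x1 sg c0 :: real
  assumes sg: "sg = 1 \<or> sg = -1" and P: "0 < sg * Re P" "0 < Im P" and x1: "sg * Re P < sg * x1"
    and c0: "c0 > 0" "EV n. cmod (E0 n P) >= exp (real n * c0)"
  shows "\<exists>y>0. \<exists>e>0. EV n. \<forall>h'\<in>ball (Complex x1 y) e. cmod (E0 n h') >= cmod (E0 n P) * exp (- (real n * (c0 / 2)))"
proof (rule ccontr)
  assume neg: "\<not> ?thesis"
  \<comment> \<open>The ratio of E0 at the point and at P has an exponential rate l. If l > - c0 /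
    2, perturbation would give the lower bound on a ball around the point, against the assumption.
    So l <= - c0 / 2, and eventually the value is smaller than at P by the factor exp (- 3 n c0 /
    8).\<close>
  have small: "EV n. cmod (E0 n (Complex x1 y)) <= cmod (E0 n P) * exp (- (real n * (3 * c0 / 8)))" if y: "y > 0" for y
  proof -
    obtain l where l: "\<And>\<eta>. \<eta> > 0 ==> EV n. cmod (E0 n P) * exp (real n * (l - \<eta>)) <= cmod (E0 n (Complex x1 y)) \<and> cmod (E0 n (Complex x1 y)) <= cmod (E0 n P) * exp (real n * (l + \<eta>))"
      using E0_ratio_converges[of "Complex x1 y" P] y P by auto
    have "l <= - c0 / 2"
    proof (rule ccontr)
      assume "\<not> l <= - c0 / 2"
      define \<eta> where "\<eta> = (l + c0 / 2) / 2"
      have \<eta>: "\<eta> > 0" using \<open>\<not> l <= - c0 / 2\<close> by (simp add: \<eta>_def field_simps)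
      obtain e where e: "e > 0" "\<And>n h'. h' \<in> ball (Complex x1 y) e ==> cmod (E0 n h') >= cmod (E0 n (Complex x1 y)) * exp (- (real n * \<eta>))"
        using E0_perturb[of "Complex x1 y" \<eta>] y \<eta> by auto
      have "EV n. \<forall>h'\<in>ball (Complex x1 y) e. cmod (E0 n h') >= cmod (E0 n P) * exp (- (real n * (c0 / 2)))"
        using l[OF \<eta>]
      proof eventually_elim
        case (elim n)
        show ?case
        proof
          fix h' assume h': "h' \<in> ball (Complex x1 y) e"
          have "cmod (E0 n P) * exp (- (real n * (c0 / 2))) = (cmod (E0 n P) * exp (real n * (l - \<eta>))) * exp (- (real n * \<eta>))"
          proof -
            have "exp (real n * (l - \<eta>)) * exp (- (real n * \<eta>)) = exp (- (real n * (c0 / 2)))"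
              unfolding exp_add[symmetric] by (simp add: \<eta>_def field_simps)
            then show ?thesis by (simp add: mult.assoc)
          qed
          also have "\<dots> <= cmod (E0 n (Complex x1 y)) * exp (- (real n * \<eta>))" using elim by (intro mult_right_mono) auto
          also have "\<dots> <= cmod (E0 n h')" using e(2)[OF h'] .
          finally show "cmod (E0 n h') >= cmod (E0 n P) * exp (- (real n * (c0 / 2)))" .
        qed
      qed
      with neg y e(1) show False by blast
    qed
    then have le: "l + c0 / 8 <= - (3 * c0 / 8)" by simp
    have "EV n. cmod (E0 n P) * exp (real n * (l - c0/8)) <= cmod (E0 n (Complex x1 y)) \<and> cmod (E0 n (Complex x1 y)) <= cmod (E0 n P) * exp (real n * (l + c0/8))"
      using l[of "c0/8"] c0 by simp
    then show ?thesis
    proof eventually_elim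
      case (elim n)
      have "real n * (l + c0 / 8) <= real n * (- (3 * c0 / 8))" using le by (intro mult_left_mono) auto
      then have "exp (real n * (l + c0 / 8)) <= exp (- (real n * (3 * c0 / 8)))" by simp
      then have "cmod (E0 n P) * exp (real n * (l + c0/8)) <= cmod (E0 n P) * exp (- (real n * (3 * c0 / 8)))" by (intro mult_left_mono) auto
      with elim show ?case by linarith
    qed
  qed
  have t0p: "t0 > 0" by (rule t0)
  obtain K where K: "K >= 0" "EV n. \<forall>x y. cmod (E0 n (Complex x y)) <= exp (real n * ((x^2 - y^2) / (2 * t0) + K * (\<bar>x\<bar> + \<bar>y\<bar>)))"
    using E0_upper by blast
  \<comment> \<open>Tall enough that \<open>E0_upper\<close> gives |E0| <= 1 on the horizontal edges
    of the rectangle.\<close>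
  define H where "H = \<bar>x1\<bar> + Im P + 4 * t0 * K + 1"
  have t0K: "t0 * K >= 0" using t0p K by simp
  have H: "H > 0" "H > Im P" "H >= \<bar>x1\<bar>" using P t0K by (auto simp: H_def)
  have top: "(x^2 - H^2) / (2 * t0) + K * (\<bar>x\<bar> + \<bar>H\<bar>) <= 0" if x: "\<bar>x\<bar> <= \<bar>x1\<bar>" for x
  proof -
    have "2 * t0 * K = 2 * (t0 * K)" "4 * t0 * K = 4 * (t0 * K)" by simp_all
    then have "2 * t0 * K <= H - \<bar>x1\<bar>" unfolding H_def using P(2) t0K by linarith
    then have "2 * t0 * K * (H + \<bar>x\<bar>) <= (H - \<bar>x\<bar>) * (H + \<bar>x\<bar>)" using x H by (intro mult_right_mono) auto
    also have "\<dots> = H^2 - x^2" by (simp add: power2_eq_square algebra_simps)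
    finally have "K * (\<bar>x\<bar> + \<bar>H\<bar>) <= (H^2 - x^2) / (2 * t0)" using t0p H by (simp add: pos_le_divide_eq mult_ac add.commute)
    then show ?thesis by (simp add: diff_divide_distrib)
  qed
  \<comment> \<open>Grid spacing H / N: moving up to the next grid height costs at most the factor
    exp (n c0 / 8) in \<open>E0_vertical_mono\<close>.\<close>
  obtain N :: nat where N: "N > 0" "8 * H^2 / (t0 * c0) <= real N"
  proof -
    obtain N where "8 * H^2 / (t0 * c0) <= real N" using real_arch_simple by blast
    then show thesis by (intro that[of "Suc N"]) auto
  qed
  define yk where "yk = (\<lambda>k. real k * (H / real N))"
  have "EV n. \<forall>k\<in>{1..N}. cmod (E0 n (Complex x1 (yk k))) <= cmod (E0 n P) * exp (- (real n * (3 * c0 / 8)))"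
    by (rule eventually_ball_finite) (use small H N in \<open>auto simp: yk_def\<close>)
  moreover have "EV n. \<forall>y. \<bar>y\<bar> <= H --> cmod (E0 n (Complex 0 y)) <= exp (real n * (c0/4))"
    by (rule E0_imag_axis) (use H c0 in auto)
  ultimately have "EV n. False" using c0(2) K(2) eventually_gt_at_top[of 0]
  proof eventually_elim
    case (elim n)
    have n: "real n > 0" using elim by simp
    \<comment> \<open>Target for the maximum on the boundary, strictly below |E0 n P|. The line Re =
      x1 has exp (- n c0 / 4) |E0 n P| after the grid loss, the imaginary axis exp (n c0 / 4), the
      horizontal edges 1; all are at most m since |E0 n P| >= exp (n c0).\<close>
    define m where "m = cmod (E0 n P) * exp (- (real n * (c0 / 8)))"
    have EP: "cmod (E0 n P) >= exp (real n * c0)" by (rule elim(3))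
    have EPp: "cmod (E0 n P) > 0" using EP by (rule less_le_trans[rotated]) simp
    have m1: "m >= exp (real n * (c0/4))" "m >= 1"
    proof -
      have "exp (real n * c0) * exp (- (real n * (c0 / 8))) <= m" unfolding m_def by (intro mult_right_mono EP) auto
      then have A: "exp (real n * (7 * c0 / 8)) <= m" unfolding exp_add[symmetric] by (simp add: field_simps)
      have "exp (real n * (c0/4)) <= exp (real n * (7 * c0 / 8))" using n c0 by simp
      with A show "m >= exp (real n * (c0/4))" by linarith
      moreover have "exp (real n * (c0/4)) >= 1" using n c0 by simp
      ultimately show "m >= 1" by linarith
    qed
    have left: "cmod (E0 n (Complex x1 y)) <= m" if y: "\<bar>y\<bar> <= H" for y
    proof -
      define k where "k = max 1 (nat \<lceil>\<bar>y\<bar> * real N / H\<rceil>)"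
      have yN: "\<bar>y\<bar> * real N / H <= real N" using y H N by (simp add: pos_divide_le_eq)
      have k1: "k \<in> {1..N}" using yN N by (auto simp: k_def nat_le_iff ceiling_le_iff)
      have ky: "\<bar>y\<bar> <= yk k"
      proof -
        have "\<bar>y\<bar> * real N / H <= real k" unfolding k_def by linarith
        then have "\<bar>y\<bar> * real N <= real k * H" using H by (simp add: pos_divide_le_eq)
        then show ?thesis using N by (simp add: yk_def pos_le_divide_eq)
      qed
      have step: "(yk k)^2 - y^2 <= 2 * H * (H / real N)"
      proof -
        have "yk k - \<bar>y\<bar> <= H / real N"
        proof -
          have "real k <= \<bar>y\<bar> * real N / H + 1"
          proof -
            have "0 <= \<bar>y\<bar> * real N / H" using H by simp
            then show ?thesis unfolding k_def by linarith
          qed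
          then have "real k * (H / real N) <= (\<bar>y\<bar> * real N / H + 1) * (H / real N)" using H by (intro mult_right_mono) auto
          also have "\<dots> = \<bar>y\<bar> + H / real N" using H N by (simp add: field_simps)
          finally show ?thesis by (simp add: yk_def)
        qed
        moreover have "yk k + \<bar>y\<bar> <= 2 * H"
        proof -
          have "yk k <= real N * (H / real N)" unfolding yk_def using k1 H by (intro mult_right_mono) auto
          then show ?thesis using y N by simp
        qed
        ultimately have "(yk k + \<bar>y\<bar>) * (yk k - \<bar>y\<bar>) <= (2 * H) * (H / real N)" using ky H by (intro mult_mono) auto
        moreover have "(yk k + \<bar>y\<bar>) * (yk k - \<bar>y\<bar>) = (yk k)^2 - y^2" by (simp add: power2_eq_square algebra_simps)
        ultimately show ?thesis by simp
      qed
      have "((yk k)^2 - y^2) / (2 * t0) <= c0 / 8"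
      proof -
        have "8 * H^2 <= real N * (t0 * c0)" using N t0p c0 by (simp add: pos_divide_le_eq)
        then have "2 * H * (H / real N) <= c0 / 8 * (2 * t0)" using N by (simp add: divide_simps power2_eq_square mult_ac)
        with step have "(yk k)^2 - y^2 <= c0 / 8 * (2 * t0)" by linarith
        then show ?thesis using t0p by (simp add: pos_divide_le_eq)
      qed
      then have e8: "exp (real n * (((yk k)^2 - y^2) / (2 * t0))) <= exp (real n * (c0 / 8))" unfolding exp_le_cancel_iff by (intro mult_left_mono) auto
      have "cmod (E0 n (Complex x1 y)) <= cmod (E0 n (Complex x1 (yk k))) * exp (real n * (((yk k)^2 - y^2) / (2 * t0)))"
        by (rule E0_vertical_mono[OF ky])
      also have "\<dots> <= (cmod (E0 n P) * exp (- (real n * (3 * c0 / 8)))) * exp (real n * (c0 / 8))"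
        by (intro mult_mono e8 elim(1)[rule_format, OF k1]) auto
      also have "\<dots> = cmod (E0 n P) * exp (- (real n * (c0 / 4)))"
        unfolding mult.assoc exp_add[symmetric] by (simp add: field_simps)
      also have "\<dots> <= m" unfolding m_def using n c0 by (intro mult_left_mono) auto
      finally show ?thesis .
    qed
    \<comment> \<open>E0 is entire, so the rectangle may cross the real axis and the initial points
      on it; its lower half is covered by the same bounds, which involve only |y|.\<close>
    define a b where "a = Complex (min 0 x1) (- H)" and "b = Complex (max 0 x1) H"
    have sP: "min 0 x1 < Re P" "Re P < max 0 x1" using sg P x1 by auto
    have "cmod (E0 n P) <= m"
    proof (rule maximum_modulus_frontier[where S="cbox a b" and f="E0 n" and \<xi>=P])
      show "E0 n holomorphic_on interior (cbox a b)" "bounded (cbox a b)" by (auto intro: holomorphic_E0)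
      show "continuous_on (closure (cbox a b)) (E0 n)" by (intro holomorphic_on_imp_continuous_on holomorphic_E0)
      show "P \<in> cbox a b" using sP P H by (auto simp: in_cbox_complex_iff a_def b_def)
      fix z assume "z \<in> frontier (cbox a b)"
      then have z: "z \<in> cbox a b" "z \<notin> box a b" by (auto simp: frontier_cbox)
      obtain x y where zxy: "z = Complex x y" by (cases z)
      have zb: "min 0 x1 <= x" "x <= max 0 x1" "\<bar>y\<bar> <= H" using z(1) by (auto simp: in_cbox_complex_iff a_def b_def zxy)
      then have xb: "\<bar>x\<bar> <= \<bar>x1\<bar>" by (auto simp: min_def max_def split: if_splits)
      have "x = 0 \<or> x = x1 \<or> \<bar>y\<bar> = H" using z(2) zb by (auto simp: in_box_complex_iff a_def b_def zxy min_def max_def abs_if split: if_splits)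
      then show "cmod (E0 n z) <= m"
      proof (elim disjE)
        assume "x = 0" then show ?thesis using elim(2) zb m1(1) unfolding zxy by (auto intro: order_trans)
      next
        assume "x = x1" then show ?thesis using left zb unfolding zxy by auto
      next
        assume yH: "\<bar>y\<bar> = H"
        then have "y^2 = H^2" "\<bar>y\<bar> = \<bar>H\<bar>" by (auto simp: power2_eq_iff abs_if split: if_splits)
        then have "(x^2 - y^2) / (2 * t0) + K * (\<bar>x\<bar> + \<bar>y\<bar>) <= 0" using top[OF xb] by simp
        then have "real n * ((x^2 - y^2) / (2 * t0) + K * (\<bar>x\<bar> + \<bar>y\<bar>)) <= 0" using n by (simp add: mult_nonneg_nonpos)
        then have "exp (real n * ((x^2 - y^2) / (2 * t0) + K * (\<bar>x\<bar> + \<bar>y\<bar>))) <= 1" by simp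
        then show ?thesis using elim(4)[rule_format, of x y] m1(2) unfolding zxy by linarith
      qed
    qed
    moreover have "m < cmod (E0 n P) * 1" unfolding m_def using EPp n c0 by (intro mult_strict_left_mono) auto
    ultimately show False by simp
  qed
  then show False by (simp add: eventually_False)
qed

text \<open>The lower bound must hold along the whole path from one n on. Goodness of a point
  therefore asks for the bound on a ball, so that compactness of the path leaves finitely many
  conditions on n. At the far abscissa \<open>E0_far\<close> keeps the bound all the way down to the
  real axis.\<close>

lemma macro_path:
  fixes P :: complex and sg c0 Lmin :: real
  assumes sg: "sg = 1 \<or> sg = -1" and P: "0 < sg * Re P" "0 < Im P"
    and c0: "c0 > 0" "EV n. cmod (E0 n P) >= exp (real n * c0)"
  shows "\<exists>g V L. polynomial_function g \<and> pathstart g = P \<and> pathfinish g = Complex (sg * L) 1 \<and> L > Lmin \<and> L > sg * Re P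
     \<and> open V \<and> bounded V \<and> path_image g \<subseteq> V \<and> (\<forall>h\<in>V. Im h > 0 \<and> sg * Re h > sg * Re P / 2)
     \<and> (EV n. \<forall>h. (h \<in> V \<or> h \<in> closed_segment (Complex (sg * L) 1) (of_real (sg * L))) --> cmod (E0 n h) >= exp (real n * (c0 / 2)))"
proof -
  define good where "good = (\<lambda>h e. e > 0 \<and> (EV n. \<forall>h'\<in>ball h e. cmod (E0 n h') >= cmod (E0 n P) * exp (- (real n * (c0 / 2)))))"
  have good_sub: "good h' e'" if "good h e" "ball h' e' \<subseteq> ball h e" "e' > 0" for h e h' e'
    using that unfolding good_def by (auto elim!: eventually_mono)
  have "c0 / 2 > 0" using c0(1) by simp
  from E0_perturb[OF P(2) this] obtain e0 where e0p: "e0 > 0"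
    and e0': "\<forall>n. \<forall>h'\<in>ball P e0. cmod (E0 n h') >= cmod (E0 n P) * exp (- (real n * (c0 / 2)))" by blast
  have e0: "good P e0" unfolding good_def using e0p e0' by (intro conjI always_eventually) blast+
  \<comment> \<open>U begins slightly on the near side of P: over the abscissas between r and P the
    ball of radius e0 around P provides a point of the fibre, while r >= sg * Re P / 2 keeps the
    path away from the imaginary axis.\<close>
  define r where "r = sg * Re P - min (e0 / 2) (sg * Re P / 2)"
  have r: "r < sg * Re P" "sg * Re P / 2 <= r" "r >= sg * Re P - e0 / 2" using e0p P by (auto simp: r_def min_def)
  define U where "U = {h. Im h > 0 \<and> sg * Re h > r \<and> (\<exists>e. good h e)}"
  have PU: "P \<in> U" using P r e0 by (auto simp: U_def)
  have openU: "open U"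
  proof -
    have "open {h. \<exists>e. good h e}"
      unfolding open_contains_ball
    proof (rule ballI)
      fix h assume "h \<in> {h. \<exists>e. good h e}"
      then obtain e where e: "good h e" by auto
      then have ep: "e > 0" by (simp add: good_def)
      have "ball h (e/2) \<subseteq> {h. \<exists>e. good h e}"
      proof
        fix h' assume h': "h' \<in> ball h (e/2)"
        have "ball h' (e/2) \<subseteq> ball h e"
        proof
          fix w assume "w \<in> ball h' (e/2)"
          with h' show "w \<in> ball h e" using dist_triangle[of h w h'] by simp
        qed
        then have "good h' (e/2)" using good_sub[OF e] ep by simp
        then show "h' \<in> {h. \<exists>e. good h e}" by auto
      qed
      then show "\<exists>e>0. ball h e \<subseteq> {h. \<exists>e. good h e}" using ep by (intro exI[of _ "e/2"]) auto
    qed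
    moreover have "open {h. Im h > 0}" by (rule open_halfspace_Im_gt)
    moreover have "open {h. sg * Re h > r}" by (intro open_Collect_less continuous_intros)
    moreover have "U = {h. Im h > 0} \<inter> {h. sg * Re h > r} \<inter> {h. \<exists>e. good h e}" by (auto simp: U_def)
    ultimately show ?thesis by (auto intro!: open_Int)
  qed
  have connU: "connected U"
  proof (rule connected_vertical_fibres[where I="{x. sg * x > r}", OF openU])
    have "is_interval {x. sg * x > r}" using sg by (auto simp: is_interval_1)
    then show "connected {x. sg * x > r}" by (rule is_interval_connected)
    show "Re h \<in> {x. sg * x > r}" if "h \<in> U" for h using that by (simp add: U_def)
    show "\<exists>y. Complex x y \<in> U" if x: "x \<in> {x. sg * x > r}" for x
    proof (cases "sg * x > sg * Re P")
      case True
      from fibre_nonempty[OF sg P True c0] obtain y e where "y > 0" "good (Complex x y) e" unfolding good_def by blast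
      then show ?thesis using x by (intro exI[of _ y]) (auto simp: U_def)
    next
      case False
      have "\<bar>Re P - x\<bar> < e0" using False x r e0p sg by auto
      moreover have "dist P (Complex x (Im P)) = \<bar>Re P - x\<bar>" by (simp add: dist_norm cmod_def)
      ultimately have "Complex x (Im P) \<in> ball P e0" by simp
      then obtain e where "e > 0" "ball (Complex x (Im P)) e \<subseteq> ball P e0" using open_contains_ball open_ball by blast
      then have "good (Complex x (Im P)) e" using good_sub[OF e0] by blast
      then show ?thesis using x P by (intro exI[of _ "Im P"]) (auto simp: U_def)
    qed
    fix x y1 y2 y assume U12: "Complex x y1 \<in> U" "Complex x y2 \<in> U" and y: "y1 <= y" "y <= y2"
    from U12 obtain e1 e2 where e12: "good (Complex x y1) e1" "good (Complex x y2) e2" and yp: "y1 > 0" "y2 > 0" "sg * x > r" by (auto simp: U_def)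
    \<comment> \<open>A point of the ball is a translate of \<open>Complex x y\<close> by some d;
      the same d moves both ends of the fibre within their own balls, and quasiconcavity is applied
      between the translated ends. The bound y1 / 2 keeps them in the upper half plane.\<close>
    define e where "e = min (y1 / 2) (min e1 e2)"
    have e: "e > 0" "e <= y1 / 2" "e <= e1" "e <= e2" using e12 yp by (auto simp: e_def good_def)
    have "good (Complex x y) e" unfolding good_def
    proof (intro conjI e)
      have "EV n. \<forall>h'\<in>ball (Complex x y1) e1. cmod (E0 n h') >= cmod (E0 n P) * exp (- (real n * (c0 / 2)))"
        "EV n. \<forall>h'\<in>ball (Complex x y2) e2. cmod (E0 n h') >= cmod (E0 n P) * exp (- (real n * (c0 / 2)))"
        using e12 by (auto simp: good_def)
      then show "EV n. \<forall>h'\<in>ball (Complex x y) e. cmod (E0 n h') >= cmod (E0 n P) * exp (- (real n * (c0 / 2)))"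
        using a_bound
      proof eventually_elim
        case (elim n)
        show ?case
        proof
          fix h' assume h': "h' \<in> ball (Complex x y) e"
          define d where "d = h' - Complex x y"
          have d: "cmod d < e" using h' by (simp add: d_def dist_norm norm_minus_commute)
          have h'e: "h' = Complex (Re h') (y + Im d)" by (simp add: d_def complex_eq_iff)
          have s: "Complex (Re h') (yi + Im d) = Complex x yi + d" for yi by (simp add: d_def complex_eq_iff)
          have b1: "Complex (Re h') (y1 + Im d) \<in> ball (Complex x y1) e1" "Complex (Re h') (y2 + Im d) \<in> ball (Complex x y2) e2"
            unfolding s using d e by (auto simp: dist_norm)
          have "\<bar>Im d\<bar> < y1" using abs_Im_le_cmod[of d] d e yp by linarith
          then have "cmod (E0 n P) * exp (- (real n * (c0 / 2))) <= cmod (E0 n (Complex (Re h') (y + Im d)))"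
            using y elim b1 by (intro E0_vertical_quasiconcave[of "y1 + Im d" "y + Im d" "y2 + Im d"]) auto
          then show "cmod (E0 n h') >= cmod (E0 n P) * exp (- (real n * (c0 / 2)))" by (simp only: h'e[symmetric])
        qed
      qed
    qed
    then show "Complex x y \<in> U" using yp y by (auto simp: U_def)
  qed
  obtain K where K: "K >= 0" "EV n. \<forall>x y. cmod (E0 n (Complex x y)) <= exp (real n * ((x^2 - y^2) / (2 * t0) + K * (\<bar>x\<bar> + \<bar>y\<bar>)))"
    using E0_upper by blast
  \<comment> \<open>An upper bound for the exponential rate of E0 at P; far out E0 exceeds both this
    rate and c0 / 2.\<close>
  define KP where "KP = ((Re P)^2 - (Im P)^2) / (2 * t0) + K * (\<bar>Re P\<bar> + \<bar>Im P\<bar>)"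
  obtain L0 where L0: "L0 > 0" "\<And>n h. n >= 1 ==> \<bar>Re h\<bar> >= L0 ==> \<bar>Im h\<bar> <= 2 ==> cmod (E0 n h) >= exp (real n * max KP (c0 / 2))"
    using E0_far[of "max KP (c0 / 2)"] by blast
  define L where "L = max (L0 + 1) (max (\<bar>Lmin\<bar> + 1) (sg * Re P + 1))"
  have L: "L >= L0 + 1" "L > Lmin" "L > sg * Re P" by (auto simp: L_def)
  have Lp: "L > 0" using L L0 by linarith
  define Q where "Q = Complex (sg * L) 1"
  have sgL: "sg * (sg * L) = L" "\<bar>sg * L\<bar> = L" using sg Lp by auto
  have QU: "Q \<in> U"
  proof -
    have "good Q 1" unfolding good_def
    proof (intro conjI)
      show "EV n. \<forall>h'\<in>ball Q 1. cmod (E0 n h') >= cmod (E0 n P) * exp (- (real n * (c0 / 2)))"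
        using K(2) eventually_ge_at_top[of 1]
      proof eventually_elim
        case (elim n)
        show ?case
        proof
          fix h' assume "h' \<in> ball Q 1"
          then have d: "cmod (Q - h') < 1" by (simp add: dist_norm)
          have "\<bar>Re Q - Re h'\<bar> < 1" "\<bar>Im Q - Im h'\<bar> < 1" using abs_Re_le_cmod[of "Q - h'"] abs_Im_le_cmod[of "Q - h'"] d by auto
          then have "\<bar>Re h'\<bar> >= L0" "\<bar>Im h'\<bar> <= 2" using L sgL(2) by (auto simp: Q_def)
          from L0(2)[OF elim(2) this] have A: "exp (real n * max KP (c0/2)) <= cmod (E0 n h')" .
          have "cmod (E0 n P) <= exp (real n * KP)" using elim(1)[rule_format, of "Re P" "Im P"] by (simp add: KP_def)
          also have "\<dots> <= exp (real n * max KP (c0/2))" by (simp add: mult_left_mono)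
          finally have "cmod (E0 n P) <= cmod (E0 n h')" using A by linarith
          moreover have "cmod (E0 n P) * exp (- (real n * (c0 / 2))) <= cmod (E0 n P) * 1" using c0 by (intro mult_left_mono) auto
          ultimately show "cmod (E0 n h') >= cmod (E0 n P) * exp (- (real n * (c0 / 2)))" by linarith
        qed
      qed
    qed auto
    moreover have "sg * Re Q > r" unfolding Q_def complex.sel sgL(1) using L(3) r(1) by linarith
    moreover have "Im Q > 0" by (simp add: Q_def)
    ultimately show ?thesis unfolding U_def by blast
  qed
  obtain g where g: "polynomial_function g" "path_image g \<subseteq> U" "pathstart g = P" "pathfinish g = Q"
    using connected_open_polynomial_connected[OF openU connU PU QU] by blast
  have vg: "valid_path g" using g(1) by (rule valid_path_polynomial_function)
  have cg: "compact (path_image g)" by (intro compact_path_image valid_path_imp_path vg)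
  have "\<exists>e. good h e" if "h \<in> path_image g" for h using g(2) that by (auto simp: U_def)
  then obtain ee where ee: "\<And>h. h \<in> path_image g ==> good h (ee h)" by metis
  have "path_image g \<subseteq> (\<Union>h\<in>path_image g. ball h (ee h))" using ee by (force simp: good_def)
  then obtain F where F: "F \<subseteq> path_image g" "finite F" "path_image g \<subseteq> (\<Union>h\<in>F. ball h (ee h))"
    using compactE_image[OF cg, of "path_image g" "\<lambda>h. ball h (ee h)"] by (metis open_ball)
  define V where "V = U \<inter> (\<Union>h\<in>F. ball h (ee h))"
  have "EV n. \<forall>h\<in>F. \<forall>h'\<in>ball h (ee h). cmod (E0 n h') >= cmod (E0 n P) * exp (- (real n * (c0 / 2)))"
    by (rule eventually_ball_finite[OF F(2)]) (use ee F(1) in \<open>auto simp: good_def\<close>)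
  then have ev: "EV n. \<forall>h. (h \<in> V \<or> h \<in> closed_segment Q (of_real (sg * L))) --> cmod (E0 n h) >= exp (real n * (c0 / 2))"
    using c0(2) eventually_ge_at_top[of 1]
  proof eventually_elim
    case (elim n)
    show ?case
    proof (intro allI impI)
      fix h assume "h \<in> V \<or> h \<in> closed_segment Q (of_real (sg * L))"
      then show "cmod (E0 n h) >= exp (real n * (c0 / 2))"
      proof
        assume "h \<in> V"
        then have "cmod (E0 n h) >= cmod (E0 n P) * exp (- (real n * (c0 / 2)))" using elim(1) by (auto simp: V_def)
        moreover have "cmod (E0 n P) * exp (- (real n * (c0 / 2))) >= exp (real n * c0) * exp (- (real n * (c0 / 2)))"
          using elim(2) by (intro mult_right_mono) auto
        moreover have "exp (real n * c0) * exp (- (real n * (c0 / 2))) = exp (real n * (c0 / 2))" unfolding exp_add[symmetric] by (simp add: field_simps)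
        ultimately show ?thesis by linarith
      next
        assume "h \<in> closed_segment Q (of_real (sg * L))"
        from closed_segment_Re_Im[OF this] have "Re h = sg * L" "0 <= Im h" "Im h <= 1" by (auto simp: Q_def)
        then have "cmod (E0 n h) >= exp (real n * max KP (c0 / 2))" using L0(2)[OF elim(3), of h] sgL L by auto
        moreover have "exp (real n * (c0 / 2)) <= exp (real n * max KP (c0 / 2))" unfolding exp_le_cancel_iff by (intro mult_left_mono) auto
        ultimately show ?thesis by linarith
      qed
    qed
  qed
  have "open V" unfolding V_def by (intro open_Int openU open_UN) auto
  moreover have "bounded V" unfolding V_def by (rule bounded_subset[of "\<Union>h\<in>F. ball h (ee h)"]) (use F in auto)
  moreover have "path_image g \<subseteq> V" using g F by (auto simp: V_def)
  moreover have "\<forall>h\<in>V. Im h > 0 \<and> sg * Re h > sg * Re P / 2" using r by (auto simp: V_def U_def)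
  ultimately show ?thesis using g L ev unfolding Q_def by blast
qed

end

section \<open>Estimates on the local scale\<close>

lemma powr_add_eq: "x powr a * x powr b = x powr (a + b)" for x a b :: real
  by (simp add: powr_add)

lemma cube_sum_le: "0 <= x ==> 0 <= y ==> (x + y)^3 <= 4 * x^3 + 4 * y^3" for x y :: real
proof -
  assume xy: "0 <= x" "0 <= y"
  have "4 * x^3 + 4 * y^3 - (x + y)^3 = 3 * (x + y) * (x - y)^2" by (simp add: power2_eq_square power3_eq_cube algebra_simps)
  moreover have "3 * (x + y) * (x - y)^2 >= 0" using xy by (intro mult_nonneg_nonneg) auto
  ultimately show ?thesis by linarith
qed

lemma sum_powers_le_cube:
  fixes r m :: real
  assumes "r >= m" "m > 0"
  shows "r + r^2 + r^3 <= (1 + 1 / m + 1 / m^2) * r^3"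
proof -
  have r: "r > 0" using assms by linarith
  have "r * m^2 <= r * r^2" using assms r by (intro mult_left_mono power_mono) auto
  then have 1: "r <= 1 / m^2 * r^3" using assms by (simp add: field_simps power3_eq_cube power2_eq_square)
  have "r^2 * m <= r^2 * r" using assms r by (intro mult_left_mono) auto
  then have 2: "r^2 <= 1 / m * r^3" using assms by (simp add: field_simps power3_eq_cube power2_eq_square)
  show ?thesis using 1 2 by (simp add: algebra_simps)
qed

context nibm begin

lemma Re_L_ge: "cmod (L - of_real A * h^3) <= B ==> Re L >= A * Re (h^3) - B"
  using abs_Re_le_cmod[of "L - of_real A * h^3"] by simp

text \<open>With T = n |h|^3 the main term n \<open>Mom 3\<close> Re (h^3) / 3 is at least 3 c1 T,
  where c1 = \<open>Mom 3\<close> / 72. The moment errors cost at most c1 T because r is bounded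
  below for |h| >= gap / 8 and n^(3 \<gamma> - 1) tends to 0; the remainder costs at most c1 T by
  the choice of \<rho>0.\<close>

lemma cone_bound:
  "\<exists>\<rho>0>0. \<exists>c1>0. EV n. \<forall>h. (cmod h <= gap n / 2 \<or> \<bar>Im h\<bar> >= cmod h / 4) \<and> Re (h^3) >= cmod h^3 / 8
     \<and> gap n / 8 <= cmod h \<and> cmod h <= \<rho>0 --> cmod (E0 n h) >= exp (c1 * (real n * cmod h^3))"
proof -
  obtain C where C: "C > 0" and ev: "EV n. \<forall>h. cmod h <= gap n / 2 \<or> \<bar>Im h\<bar> >= cmod h / 4 -->
     (\<exists>L. E0 n h = exp L \<and>
       (let d = cmod (L - of_real (real n * Mom 3 / 3) * h^3); r = real n powr \<gamma> * cmod h in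
         d <= C * (r + r^2 + r^3 + real n * cmod h powr (3 + be)) \<and>
         d <= C * (r + r^2 + r^3 + real n * real n powr \<gamma> * cmod h^4)))"
    using E0_asymp by blast
  define c1 where "c1 = Mom 3 / 72"
  have c1: "c1 > 0" using Mom3 by (simp add: c1_def)
  define \<rho>0 where "\<rho>0 = (c1 / C) powr (1 / be)"
  have \<rho>0: "\<rho>0 > 0" "C * \<rho>0 powr be = c1" using c1 C be by (auto simp: \<rho>0_def powr_powr)
  define m where "m = mm / 8"
  have m: "m > 0" using gap(1) by (simp add: m_def)
  define D where "D = 1 + 1 / m + 1 / m^2"
  have "EV n. (C * D) * real n powr (3 * \<gamma> - 1) <= c1" using gam c1 by (intro powr_eventually_le) auto
  then have "EV n. \<forall>h. (cmod h <= gap n / 2 \<or> \<bar>Im h\<bar> >= cmod h / 4) \<and> Re (h^3) >= cmod h^3 / 8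
     \<and> gap n / 8 <= cmod h \<and> cmod h <= \<rho>0 --> cmod (E0 n h) >= exp (c1 * (real n * cmod h^3))"
    using ev eventually_gt_at_top[of 0]
  proof eventually_elim
    case (elim n)
    have n: "real n > 0" using elim by simp
    show ?case
    proof (intro allI impI, elim conjE)
      fix h assume h: "cmod h <= gap n / 2 \<or> \<bar>Im h\<bar> >= cmod h / 4" "Re (h^3) >= cmod h^3 / 8" "gap n / 8 <= cmod h" "cmod h <= \<rho>0"
      define r where "r = real n powr \<gamma> * cmod h"
      define T where "T = real n * cmod h^3"
      have hp: "cmod h > 0" using h(3) gap_pos[of n] elim(3) by linarith
      have T0: "T >= 0" by (simp add: T_def)
      obtain L where L: "E0 n h = exp L" "cmod (L - of_real (real n * Mom 3 / 3) * h^3) <= C * (r + r^2 + r^3 + real n * cmod h powr (3 + be))"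
        using elim(2)[rule_format, OF h(1)] by (auto simp: Let_def r_def)
      have rm: "r >= m"
      proof -
        have "real n powr \<gamma> * (gap n / 8) = m" using n by (simp add: gap_def m_def powr_minus field_simps)
        moreover have "real n powr \<gamma> * (gap n / 8) <= r" unfolding r_def by (intro mult_left_mono h) auto
        ultimately show ?thesis by simp
      qed
      have r3: "r^3 = real n powr (3 * \<gamma> - 1) * T"
      proof -
        have "real n powr (3 * \<gamma> - 1) * real n = real n powr (3 * \<gamma>)" using n by (simp add: powr_diff)
        then show ?thesis using n by (simp add: r_def T_def power_mult_distrib powr_power mult.assoc[symmetric] mult.commute)
      qed
      have b1: "C * (r + r^2 + r^3) <= c1 * T"
      proof -
        have "C * (r + r^2 + r^3) <= C * (D * r^3)" unfolding D_def using sum_powers_le_cube[OF rm m] C by (intro mult_left_mono) auto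
        also have "\<dots> = (C * D) * real n powr (3 * \<gamma> - 1) * T" unfolding r3 by simp
        also have "\<dots> <= c1 * T" by (intro mult_right_mono elim(1) T0)
        finally show ?thesis .
      qed
      have b2: "C * (real n * cmod h powr (3 + be)) <= c1 * T"
      proof -
        have "cmod h powr (3 + be) = cmod h^3 * cmod h powr be" using hp by (simp add: powr_add powr_numeral)
        moreover have "cmod h powr be <= \<rho>0 powr be" using h(4) be by (intro powr_mono2) auto
        ultimately have "C * (real n * cmod h powr (3 + be)) <= C * (real n * (cmod h^3 * \<rho>0 powr be))"
          using C by (auto intro!: mult_left_mono)
        also have "\<dots> = (C * \<rho>0 powr be) * T" by (simp add: T_def)
        finally show ?thesis unfolding \<rho>0(2) .
      qed
      have "real n * Mom 3 / 3 * Re (h^3) >= real n * Mom 3 / 3 * (cmod h^3 / 8)" using Mom3 by (intro mult_left_mono h) auto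
      moreover have "real n * Mom 3 / 3 * (cmod h^3 / 8) = 3 * (c1 * T)" by (simp add: c1_def T_def)
      moreover have "Re L >= real n * Mom 3 / 3 * Re (h^3) - C * (r + r^2 + r^3 + real n * cmod h powr (3 + be))" by (rule Re_L_ge[OF L(2)])
      moreover have "C * (r + r^2 + r^3 + real n * cmod h powr (3 + be)) = C * (r + r^2 + r^3) + C * (real n * cmod h powr (3 + be))" by (simp only: distrib_left)
      ultimately have "Re L >= c1 * T" using b1 b2 by linarith
      then show "cmod (E0 n h) >= exp (c1 * (real n * cmod h^3))" unfolding L(1) norm_exp_eq_Re T_def by simp
    qed
  qed
  with \<rho>0 c1 show ?thesis by blast
qed

lemma norm_wvee: "s > 0 ==> cmod (wvee s q) <= s + 2 * \<bar>q\<bar>"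
  using cmod_le[of "wvee s q"] by simp

lemma hs_scale: "n > 0 ==> of_real (real n * Mom 3 / 3) * (of_real (hs n) * \<zeta>)^3 = (\<zeta>^3 / 3 :: complex)"
proof -
  assume n: "n > 0"
  have "real n * Mom 3 * hs n^3 = (real n * hs n^3) * Mom 3" by simp
  then have "real n * Mom 3 * hs n^3 = 1" unfolding hs_cube[OF n] cc(2) .
  then have "of_real (real n * Mom 3 * hs n^3) = (1::complex)" by simp
  then have "of_real (real n * Mom 3 / 3) * (of_real (hs n) * \<zeta>)^3 = of_real (real n * Mom 3 * hs n^3) * \<zeta>^3 / 3" by (simp add: power_mult_distrib mult.assoc del: mult_cancel_left mult_cancel_right)
  then show ?thesis using \<open>of_real (real n * Mom 3 * hs n^3) = 1\<close> by (simp only: mult_1)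
qed

lemma r_scale: "n > 0 ==> real n powr \<gamma> * (hs n * x) = cc * real n powr (\<gamma> - 1/3) * x"
  by (simp add: hs_def powr_add_eq[symmetric] diff_conv_add_uminus del: add_uminus_conv_diff)

text \<open>Here Re (\<omega>^3) / 3 = (2/3) |q|^3 - s^2 |q| - s^3 / 3. The errors sum to at most
  1/400 + w^3 / 200 for w = |\<omega>|, and w^3 <= 4 s^3 + 32 |q|^3; the constant 800 is chosen so
  that 32 / 200 stays below 2/3 - 1/2.\<close>

lemma vee_bound:
  assumes s: "s > 0"
  shows "\<exists>\<rho>1>0. EV n. \<forall>q. hs n * \<bar>q\<bar> <= \<rho>1 --> cmod (E0 n (of_real (hs n) * wvee s q)) >= exp (\<bar>q\<bar>^3 / 2 - s^2 * \<bar>q\<bar> - s^3 - 1)"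
proof -
  obtain C where C: "C > 0" and ev: "EV n. \<forall>h. cmod h <= gap n / 2 \<or> \<bar>Im h\<bar> >= cmod h / 4 -->
     (\<exists>L. E0 n h = exp L \<and>
       (let d = cmod (L - of_real (real n * Mom 3 / 3) * h^3); r = real n powr \<gamma> * cmod h in
         d <= C * (r + r^2 + r^3 + real n * cmod h powr (3 + be)) \<and>
         d <= C * (r + r^2 + r^3 + real n * real n powr \<gamma> * cmod h^4)))"
    using E0_asymp by blast
  define \<rho>2 where "\<rho>2 = (Mom 3 / (800 * C)) powr (1 / be)"
  have \<rho>2: "\<rho>2 > 0" "C * \<rho>2 powr be = Mom 3 / 800" using Mom3 C be by (auto simp: \<rho>2_def powr_powr)
  define \<rho>1 where "\<rho>1 = \<rho>2 / 4"
  have \<rho>1: "\<rho>1 > 0" using \<rho>2 by (simp add: \<rho>1_def)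
  have ev1: "EV n. cc * real n powr (\<gamma> - 1/3) <= 1" using gam by (intro powr_eventually_le) auto
  have ev2: "EV n. (C * cc) * real n powr (\<gamma> - 1/3) <= 1/800" using gam by (intro powr_eventually_le) auto
  have ev3: "EV n. (cc * s) * real n powr (-1/3) <= \<rho>2 / 2" using \<rho>2 by (intro powr_eventually_le) auto
  have "EV n. \<forall>q. hs n * \<bar>q\<bar> <= \<rho>1 --> cmod (E0 n (of_real (hs n) * wvee s q)) >= exp (\<bar>q\<bar>^3 / 2 - s^2 * \<bar>q\<bar> - s^3 - 1)"
    using ev ev1 ev2 ev3 hs_le_gap[of "2 * s"] eventually_gt_at_top[of 0]
  proof eventually_elim
    case (elim n)
    have n: "real n > 0" "n > 0" using elim by simp_all
    have hp: "hs n > 0" using hs_pos n by simp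
    show ?case
    proof (intro allI impI)
      fix q assume q: "hs n * \<bar>q\<bar> <= \<rho>1"
      define \<omega> where "\<omega> = wvee s q"
      define w where "w = cmod \<omega>"
      define h where "h = of_real (hs n) * \<omega>"
      have w: "0 <= w" "w <= s + 2 * \<bar>q\<bar>" using norm_wvee[OF s] by (auto simp: w_def \<omega>_def)
      have ch: "cmod h = hs n * w" using hp by (simp add: h_def w_def norm_mult)
      \<comment> \<open>Near the vertex, where |q| < w / 4 forces w <= 2 s, the point lies well
        inside the gap; elsewhere the vee is steep enough.\<close>
      have cond: "cmod h <= gap n / 2 \<or> \<bar>Im h\<bar> >= cmod h / 4"
      proof (cases "\<bar>q\<bar> >= w / 4")
        case True
        have "\<bar>Im h\<bar> = hs n * \<bar>q\<bar>" using hp by (simp add: h_def \<omega>_def abs_mult)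
        moreover have "hs n * (w / 4) <= hs n * \<bar>q\<bar>" using True hp by (intro mult_left_mono) auto
        ultimately show ?thesis unfolding ch by simp
      next
        case False
        then have "w <= 2 * s" using w by simp
        then have "hs n * w <= 2 * s * hs n" using hp by (simp add: mult.commute)
        then show ?thesis using elim(5) unfolding ch by linarith
      qed
      obtain L where L: "E0 n h = exp L" "cmod (L - of_real (real n * Mom 3 / 3) * h^3) <= C * ((real n powr \<gamma> * cmod h) + (real n powr \<gamma> * cmod h)^2 + (real n powr \<gamma> * cmod h)^3 + real n * cmod h powr (3 + be))"
        using elim(1)[rule_format, OF cond] by (auto simp: Let_def)
      define d where "d = cc * real n powr (\<gamma> - 1/3)"
      have d: "0 <= d" "d <= 1" "C * d <= 1/800" using elim(2,3) cc by (auto simp: d_def mult.assoc)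
      have r: "real n powr \<gamma> * cmod h = d * w" unfolding ch d_def by (rule r_scale[OF n(2)])
      have L2: "cmod (L - \<omega>^3 / 3) <= C * (d * w + (d * w)^2 + (d * w)^3 + real n * cmod h powr (3 + be))"
        using L(2) unfolding r unfolding h_def hs_scale[OF n(2)] .
      have w3: "w <= 1 + w^3" "w^2 <= 1 + w^3"
      proof -
        have "w <= w^3 \<and> w^2 <= w^3" if "w >= 1" using that power_increasing[of 1 3 w] power_increasing[of 2 3 w] by simp
        moreover have "w <= 1 \<and> w^2 <= 1" if "w <= 1" using that w by (simp add: power_le_one)
        moreover have "w^3 >= 0" using w by simp
        ultimately show "w <= 1 + w^3" "w^2 <= 1 + w^3" by (cases "w >= 1"; simp; linarith)+
      qed
      have e1: "C * (d * w + (d * w)^2 + (d * w)^3) <= (1/800) * (2 + 3 * w^3)"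
      proof -
        have "d^2 <= d" "d^3 <= d" using d power_decreasing[of 1 2 d] power_decreasing[of 1 3 d] by auto
        then have "(d * w)^2 <= d * w^2" "(d * w)^3 <= d * w^3" using w unfolding power_mult_distrib by (auto intro!: mult_right_mono)
        moreover have "d * w <= d * (1 + w^3)" "d * w^2 <= d * (1 + w^3)" using w3 d by (auto intro!: mult_left_mono)
        ultimately have "d * w + (d * w)^2 + (d * w)^3 <= d * (1 + w^3) + d * (1 + w^3) + d * w^3" by linarith
        also have "\<dots> = d * (2 + 3 * w^3)" by (simp add: algebra_simps)
        finally have "C * (d * w + (d * w)^2 + (d * w)^3) <= C * (d * (2 + 3 * w^3))" using C by (intro mult_left_mono) auto
        also have "\<dots> = (C * d) * (2 + 3 * w^3)" by simp
        also have "\<dots> <= (1/800) * (2 + 3 * w^3)" using d w by (intro mult_right_mono) auto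
        finally show ?thesis .
      qed
      have e2: "C * (real n * cmod h powr (3 + be)) <= (1/800) * w^3"
      proof (cases "w = 0")
        case False
        then have wp: "w > 0" using w by simp
        have hle: "cmod h <= \<rho>2"
        proof -
          have "hs n * w <= hs n * (s + 2 * \<bar>q\<bar>)" using w hp by (intro mult_left_mono) auto
          also have "\<dots> = hs n * s + 2 * (hs n * \<bar>q\<bar>)" by (simp add: algebra_simps)
          also have "hs n * s = (cc * s) * real n powr (-1/3)" by (simp add: hs_def)
          finally show ?thesis using elim(4) q unfolding ch \<rho>1_def by linarith
        qed
        have "cmod h powr (3 + be) = cmod h^3 * cmod h powr be" using hp wp by (simp add: ch powr_add powr_numeral)
        moreover have "cmod h powr be <= \<rho>2 powr be" using hle be by (intro powr_mono2) auto
        ultimately have "C * (real n * cmod h powr (3 + be)) <= C * (real n * (cmod h^3 * \<rho>2 powr be))"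
          using C by (auto intro!: mult_left_mono)
        also have "\<dots> = (C * \<rho>2 powr be) * ((real n * hs n^3) * w^3)" by (simp add: ch power_mult_distrib)
        also have "\<dots> = (1/800) * (Mom 3 * cc^3) * w^3" unfolding \<rho>2(2) hs_cube[OF n(2)] by simp
        also have "Mom 3 * cc^3 = 1" using cc(2) by (simp add: mult.commute)
        finally show ?thesis by simp
      qed (simp add: ch)
      have "w^3 <= (s + 2 * \<bar>q\<bar>)^3" using w by (intro power_mono) auto
      also have "\<dots> <= 4 * s^3 + 4 * (2 * \<bar>q\<bar>)^3" using s by (intro cube_sum_le) auto
      finally have w3b: "w^3 <= 4 * s^3 + 32 * \<bar>q\<bar>^3" by (simp add: power_mult_distrib)
      have Re3: "Re (\<omega>^3 / 3) = (2 * \<bar>q\<bar>^3 - 3 * s^2 * \<bar>q\<bar> - s^3) / 3"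
      proof -
        have "(- s - \<bar>q\<bar>)^3 - 3 * (- s - \<bar>q\<bar>) * q^2 = 2 * \<bar>q\<bar>^3 - 3 * s^2 * \<bar>q\<bar> - s^3"
          by (cases "q >= 0") (simp_all add: power2_eq_square power3_eq_cube algebra_simps)
        then show ?thesis by (simp add: Re_cube \<omega>_def)
      qed
      have "Re L >= Re (\<omega>^3 / 3) - C * (d * w + (d * w)^2 + (d * w)^3 + real n * cmod h powr (3 + be))"
        using abs_Re_le_cmod[of "L - \<omega>^3 / 3"] L2 by simp
      moreover have "C * (d * w + (d * w)^2 + (d * w)^3 + real n * cmod h powr (3 + be)) = C * (d * w + (d * w)^2 + (d * w)^3) + C * (real n * cmod h powr (3 + be))"
        by (simp only: distrib_left)
      moreover have "(2 * \<bar>q\<bar>^3 - 3 * s^2 * \<bar>q\<bar> - s^3) / 3 = (2/3) * \<bar>q\<bar>^3 - s^2 * \<bar>q\<bar> - s^3 / 3" by (simp add: field_simps)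
      moreover have "(1/800) * (2 + 3 * w^3) = 1/400 + (3/800) * w^3" by (simp add: field_simps)
      moreover have "\<bar>q\<bar>^3 >= 0" "s^3 >= 0" using s by auto
      ultimately have "Re L >= \<bar>q\<bar>^3 / 2 - s^2 * \<bar>q\<bar> - s^3 - 1" using e1 e2 w3b Re3 by linarith
      then show "cmod (E0 n (of_real (hs n) * wvee s q)) >= exp (\<bar>q\<bar>^3 / 2 - s^2 * \<bar>q\<bar> - s^3 - 1)"
        using L(1) by (simp add: h_def \<omega>_def)
    qed
  qed
  with \<rho>1 show ?thesis by blast
qed

text \<open>Uses the fourth power remainder. The restriction \<eta> < 1/3 - \<gamma> keeps h =
  \<open>hs n\<close> * \<zeta> within half the gap, so that no condition on the argument of \<zeta>
  arises.\<close>

lemma E0_local: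
  assumes \<eta>: "0 < \<eta>" "\<eta> < 1/3 - \<gamma>"
  shows "\<exists>C>0. EV n. \<forall>\<zeta>. cmod \<zeta> <= real n powr \<eta> --> (\<exists>R. E0 n (of_real (hs n) * \<zeta>) = exp (\<zeta>^3 / 3 + R) \<and> cmod R <= C * real n powr (\<gamma> - 1/3) * (1 + cmod \<zeta>)^4)"
proof -
  obtain C where C: "C > 0" and ev: "EV n. \<forall>h. cmod h <= gap n / 2 \<or> \<bar>Im h\<bar> >= cmod h / 4 -->
     (\<exists>L. E0 n h = exp L \<and>
       (let d = cmod (L - of_real (real n * Mom 3 / 3) * h^3); r = real n powr \<gamma> * cmod h in
         d <= C * (r + r^2 + r^3 + real n * cmod h powr (3 + be)) \<and>
         d <= C * (r + r^2 + r^3 + real n * real n powr \<gamma> * cmod h^4)))"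
    using E0_asymp by blast
  have ev1: "EV n. cc * real n powr (\<gamma> - 1/3) <= 1" using gam by (intro powr_eventually_le) auto
  have ev2: "EV n. (2 * cc / mm) * real n powr (\<eta> + \<gamma> - 1/3) <= 1" using \<eta> by (intro powr_eventually_le) auto
  have "EV n. \<forall>\<zeta>. cmod \<zeta> <= real n powr \<eta> --> (\<exists>R. E0 n (of_real (hs n) * \<zeta>) = exp (\<zeta>^3 / 3 + R) \<and> cmod R <= (C * (3 * cc + cc^4)) * real n powr (\<gamma> - 1/3) * (1 + cmod \<zeta>)^4)"
    using ev ev1 ev2 eventually_gt_at_top[of 0]
  proof eventually_elim
    case (elim n)
    have n: "real n > 0" "n > 0" using elim by simp_all
    have hp: "hs n > 0" using hs_pos n by simp
    show ?case
    proof (intro allI impI)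
      fix \<zeta> assume \<zeta>: "cmod \<zeta> <= real n powr \<eta>"
      define w where "w = cmod \<zeta>"
      have w: "w >= 0" by (simp add: w_def)
      define h where "h = of_real (hs n) * \<zeta>"
      have ch: "cmod h = hs n * w" using hp by (simp add: h_def w_def norm_mult)
      have "hs n * w <= hs n * real n powr \<eta>" using \<zeta> hp by (intro mult_left_mono) (auto simp: w_def)
      also have "\<dots> = (cc * real n powr (\<eta> + \<gamma> - 1/3)) * real n powr - \<gamma>"
      proof -
        have "real n powr (-1/3) * real n powr \<eta> = real n powr (\<eta> + \<gamma> - 1/3) * real n powr - \<gamma>" unfolding powr_add_eq by (simp add: algebra_simps)
        then show ?thesis by (simp add: hs_def)
      qed
      also have "\<dots> <= (mm / 2) * real n powr - \<gamma>" using elim(3) gap(1) by (intro mult_right_mono) (auto simp: field_simps)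
      finally have cond: "cmod h <= gap n / 2 \<or> \<bar>Im h\<bar> >= cmod h / 4" unfolding ch gap_def by simp
      obtain L where L: "E0 n h = exp L" "cmod (L - of_real (real n * Mom 3 / 3) * h^3) <= C * ((real n powr \<gamma> * cmod h) + (real n powr \<gamma> * cmod h)^2 + (real n powr \<gamma> * cmod h)^3 + real n * real n powr \<gamma> * cmod h^4)"
        using elim(1)[rule_format, OF cond] by (auto simp: Let_def)
      define N where "N = real n powr (\<gamma> - 1/3)"
      define d where "d = cc * N"
      have N0: "N >= 0" by (simp add: N_def)
      have d: "0 <= d" "d <= 1" using elim(2) cc by (auto simp: d_def N_def)
      have r: "real n powr \<gamma> * cmod h = d * w" unfolding ch d_def N_def by (rule r_scale[OF n(2)])
      have f4: "real n * real n powr \<gamma> * cmod h^4 = cc^4 * N * w^4"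
      proof -
        have "hs n^4 = cc^4 * real n powr (-4/3)" using n by (simp add: hs_def power_mult_distrib powr_power)
        then have "real n * real n powr \<gamma> * cmod h^4 = cc^4 * (real n powr 1 * real n powr \<gamma> * real n powr (-4/3)) * w^4" using n by (simp add: ch power_mult_distrib)
        also have "real n powr 1 * real n powr \<gamma> * real n powr (-4/3) = N" unfolding powr_add_eq N_def by (simp add: algebra_simps)
        finally show ?thesis .
      qed
      have L2: "cmod (L - \<zeta>^3 / 3) <= C * (d * w + (d * w)^2 + (d * w)^3 + cc^4 * N * w^4)"
        using L(2) unfolding r f4 unfolding h_def hs_scale[OF n(2)] .
      have pw: "w^k <= (1 + w)^4" if "k <= 4" for k
      proof -
        have "w^k <= (1 + w)^k" using w by (intro power_mono) auto
        also have "\<dots> <= (1 + w)^4" using w that by (intro power_increasing) auto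
        finally show ?thesis .
      qed
      have dk: "(d * w)^k <= d * (1 + w)^4" if "1 <= k" "k <= 4" for k
      proof -
        have "d^k <= d^1" using d that by (intro power_decreasing) auto
        then have "d^k * w^k <= d * (1 + w)^4" using pw[OF that(2)] d w by (intro mult_mono) auto
        then show ?thesis by (simp add: power_mult_distrib)
      qed
      have "d * w + (d * w)^2 + (d * w)^3 + cc^4 * N * w^4 <= d * (1 + w)^4 + d * (1 + w)^4 + d * (1 + w)^4 + cc^4 * N * (1 + w)^4"
        using dk[of 1] dk[of 2] dk[of 3] pw[of 4] N0 by (intro add_mono) (auto intro!: mult_left_mono)
      also have "\<dots> = (3 * cc + cc^4) * N * (1 + w)^4" by (simp add: d_def algebra_simps)
      finally have "C * (d * w + (d * w)^2 + (d * w)^3 + cc^4 * N * w^4) <= C * ((3 * cc + cc^4) * N * (1 + w)^4)" using C by (intro mult_left_mono) auto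
      with L2 have "cmod (L - \<zeta>^3 / 3) <= (C * (3 * cc + cc^4)) * N * (1 + w)^4" by (simp add: mult.assoc)
      then show "\<exists>R. E0 n (of_real (hs n) * \<zeta>) = exp (\<zeta>^3 / 3 + R) \<and> cmod R <= (C * (3 * cc + cc^4)) * real n powr (\<gamma> - 1/3) * (1 + cmod \<zeta>)^4"
        using L(1) by (intro exI[of _ "L - \<zeta>^3/3"]) (simp add: h_def N_def w_def)
    qed
  qed
  moreover have "C * (3 * cc + cc^4) > 0" using C cc by (intro mult_pos_pos add_pos_pos) auto
  ultimately show ?thesis by blast
qed

end

text \<open>The envelope exp (- 2 |y|) has twice the decay that is claimed. Where the expansion p
  holds, A - B = B (exp X - 1) carries the rate N; elsewhere A and B are estimated separately and
  one of the two factors exp (- |y|) is traded for N.\<close>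

lemma exp_perturb_diff:
  fixes A B X :: complex and K N :: real
  assumes close: "p ==> A = B * exp X \<and> cmod X <= C * N \<and> C * N <= 1/2"
    and A: "cmod A <= K * E * exp (- 2 * \<bar>y\<bar>)" and B: "cmod B <= K * E * exp (- 2 * \<bar>y\<bar>)"
    and far: "\<not> p ==> exp (- \<bar>y\<bar>) <= C' * N" and pos: "K >= 0" "E >= 0" "C >= 0" "C' >= 0" "N >= 0"
  shows "cmod (A - B) <= K * (2 * C + 2 * C') * N * E * exp (- \<bar>y\<bar>)"
proof (cases p)
  case True
  have X: "cmod X <= C * N" "cmod X <= 1/2" using close[OF True] by auto
  have "A - B = B * (exp X - 1)" using close[OF True] by (simp add: algebra_simps)
  then have "cmod (A - B) = cmod B * cmod (exp X - 1)" by (simp add: norm_mult)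
  also have "\<dots> <= (K * E * exp (- 2 * \<bar>y\<bar>)) * (3/2 * (C * N))"
    using norm_exp_bounds(2)[OF X(2)] X(1) pos by (intro mult_mono B) auto
  also have "\<dots> <= (K * E * exp (- \<bar>y\<bar>)) * ((2 * C + 2 * C') * N)"
  proof (rule mult_mono)
    have "(3/2 * C) * N <= (2 * C + 2 * C') * N" using pos by (intro mult_right_mono) auto
    then show "3/2 * (C * N) <= (2 * C + 2 * C') * N" by simp
    show "K * E * exp (- 2 * \<bar>y\<bar>) <= K * E * exp (- \<bar>y\<bar>)" using pos by (intro mult_left_mono) auto
  qed (use pos in auto)
  finally show ?thesis by (simp add: mult_ac)
next
  case False
  have "exp (- 2 * \<bar>y\<bar>) = exp (- \<bar>y\<bar>) * exp (- \<bar>y\<bar>)" unfolding exp_add[symmetric] by simp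
  also have "\<dots> <= (C' * N) * exp (- \<bar>y\<bar>)" by (intro mult_right_mono far[OF False]) auto
  finally have "K * E * exp (- 2 * \<bar>y\<bar>) <= K * E * ((C' * N) * exp (- \<bar>y\<bar>))" using pos by (intro mult_left_mono) auto
  moreover have "cmod (A - B) <= 2 * (K * E * exp (- 2 * \<bar>y\<bar>))" using norm_triangle_ineq4[of A B] A B by linarith
  ultimately have "cmod (A - B) <= 2 * (K * E * ((C' * N) * exp (- \<bar>y\<bar>)))" by linarith
  also have "\<dots> <= K * (2 * C + 2 * C') * N * E * exp (- \<bar>y\<bar>)"
  proof -
    have "2 * (K * E * ((C' * N) * exp (- \<bar>y\<bar>))) = (2 * C') * (K * N * E * exp (- \<bar>y\<bar>))" by simp
    also have "\<dots> <= (2 * C + 2 * C') * (K * N * E * exp (- \<bar>y\<bar>))" using pos by (intro mult_right_mono) auto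
    finally show ?thesis by (simp add: mult_ac)
  qed
  finally show ?thesis .
qed

text \<open>From t <= exp t at t = m / 16, raised to the eighth power; the exponent e / 8 matches
  the range |\<zeta>| <= n^(\<epsilon> / 8) on which the local expansion is used.\<close>

lemma exp_half_decay: "n > 0 ==> exp (- (real n powr (e / 8)) / 2) <= 16^8 * real n powr - e"
proof -
  assume n: "n > 0"
  define m where "m = real n powr (e / 8)"
  have m: "m > 0" using n by (simp add: m_def)
  have "m / 16 <= exp (m / 16)" using exp_ge_add_one_self[of "m/16"] by linarith
  then have "(m / 16)^8 <= exp (m / 16)^8" using m by (intro power_mono) auto
  also have "\<dots> = exp (m / 2)" by (simp add: exp_of_nat_mult[symmetric])
  finally have "m^8 / 16^8 <= exp (m / 2)" by (simp add: power_divide)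
  then have "m^8 * exp (- m / 2) <= 16^8" by (simp add: exp_minus field_simps)
  moreover have "m^8 = real n powr e" using n by (simp add: m_def powr_power)
  ultimately have "real n powr e * exp (- m / 2) <= 16^8" by simp
  then show ?thesis using n unfolding m_def by (simp add: powr_minus field_simps)
qed

lemma exp_far_decay:
  assumes "cmod \<zeta> <= s + 2 * \<bar>y\<bar>" "\<not> cmod \<zeta> <= real n powr (e / 8)" "n > 0"
  shows "exp (- \<bar>y\<bar>) <= (exp (s / 2) * 16^8) * real n powr - e"
proof -
  have "- \<bar>y\<bar> <= s / 2 + - (real n powr (e / 8)) / 2" using assms by linarith
  then have "exp (- \<bar>y\<bar>) <= exp (s / 2) * exp (- (real n powr (e / 8)) / 2)" unfolding exp_add[symmetric] exp_le_cancel_iff .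
  also have "\<dots> <= exp (s / 2) * (16^8 * real n powr - e)" by (intro mult_left_mono exp_half_decay assms) auto
  finally show ?thesis by simp
qed

section \<open>The rescaled weight and its Airy limit\<close>

context nibm begin

definition th where "th n \<tau> = t0 / tAi psi xs n \<tau>" for n \<tau>

text \<open>What completing the square leaves over: constant in \<zeta>, quadratic in v, and of
  order n^(2 \<epsilon> - 1/3) for v up to M n^\<epsilon>.\<close>

definition kk where "kk n \<tau> v = v^2 / (2 * tAi psi xs n \<tau> * (c2 psi xs)^2 * real n powr (1/3))" for n \<tau> v

text \<open>The conjugated weight in the Airy variable, stripped of the factor \<open>Cn\<close>
  common to numerator and denominator. Formally \<open>th\<close> tends to 1, \<open>kk\<close> to 0
  and E0 to exp (\<zeta>^3 / 3), which gives \<open>eAi\<close>.\<close>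

definition EE where "EE n \<tau> v \<zeta> = E0 n (of_real (hs n) * \<zeta>) * exp (of_real (kk n \<tau> v) - of_real (th n \<tau>) * (of_real \<tau> * \<zeta>^2 + of_real v * \<zeta>))"
  for n \<tau> v \<zeta>

lemma cmod_EE: "cmod (EE n \<tau> v \<zeta>) = cmod (E0 n (of_real (hs n) * \<zeta>)) * exp (kk n \<tau> v - th n \<tau> * (\<tau> * (Re \<zeta>^2 - Im \<zeta>^2) + v * Re \<zeta>))"
proof -
  have "Re (of_real (kk n \<tau> v) - of_real (th n \<tau>) * (of_real \<tau> * \<zeta>^2 + of_real v * \<zeta>)) = kk n \<tau> v - th n \<tau> * (\<tau> * Re (\<zeta>^2) + v * Re \<zeta>)" by simp
  then show ?thesis unfolding EE_def norm_mult norm_exp_eq_Re Re_square by simp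
qed

lemma tAi_asymp: "\<exists>C\<ge>0. EV n. \<forall>\<tau>. \<bar>\<tau>\<bar> <= Tm --> tAi psi xs n \<tau> >= t0 / 2 \<and> tAi psi xs n \<tau> > 0 \<and> \<bar>th n \<tau> - 1\<bar> <= C * real n powr (-1/3)"
proof -
  define D where "D = 2 * \<bar>Tm\<bar> / (c2 psi xs)^2"
  have D: "D >= 0" by (simp add: D_def)
  have t0p: "t0 > 0" by (rule t0)
  have e: "EV n. D * real n powr (-1/3) <= t0 / 2" using t0p by (intro powr_eventually_le) auto
  have "EV n. \<forall>\<tau>. \<bar>\<tau>\<bar> <= Tm --> tAi psi xs n \<tau> >= t0 / 2 \<and> tAi psi xs n \<tau> > 0 \<and> \<bar>th n \<tau> - 1\<bar> <= (2 * D / t0) * real n powr (-1/3)"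
    using e eventually_gt_at_top[of 0]
  proof eventually_elim
    case (elim n)
    then have n: "real n > 0" by simp
    show ?case
    proof (intro allI impI)
      fix \<tau> assume \<tau>: "\<bar>\<tau>\<bar> <= Tm"
      have "tAi psi xs n \<tau> - t0 = (2 * \<tau> / (c2 psi xs)^2) * real n powr (-1/3)"
        using n powr_minus_divide[of "real n" "1/3"] by (simp add: tAi_def t0_def)
      then have "\<bar>tAi psi xs n \<tau> - t0\<bar> = (2 * \<bar>\<tau>\<bar> / (c2 psi xs)^2) * real n powr (-1/3)" by (simp add: abs_mult)
      also have "\<dots> <= D * real n powr (-1/3)" unfolding D_def using \<tau> by (intro mult_right_mono divide_right_mono) auto
      finally have d: "\<bar>tAi psi xs n \<tau> - t0\<bar> <= D * real n powr (-1/3)" .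
      have d2: "\<bar>tAi psi xs n \<tau> - t0\<bar> <= t0 / 2" using d elim(1) by (rule order_trans)
      then have lb: "tAi psi xs n \<tau> >= t0 / 2" by linarith
      have tp: "tAi psi xs n \<tau> > 0" using lb t0p by linarith
      have "th n \<tau> - 1 = - (tAi psi xs n \<tau> - t0) / tAi psi xs n \<tau>" using tp by (simp add: th_def field_simps)
      then have "\<bar>th n \<tau> - 1\<bar> = \<bar>tAi psi xs n \<tau> - t0\<bar> / tAi psi xs n \<tau>" using tp by (simp add: abs_divide abs_minus_commute)
      also have "\<dots> <= (D * real n powr (-1/3)) / (t0 / 2)" using d lb t0p by (intro frac_le) auto
      finally show "tAi psi xs n \<tau> >= t0 / 2 \<and> tAi psi xs n \<tau> > 0 \<and> \<bar>th n \<tau> - 1\<bar> <= (2 * D / t0) * real n powr (-1/3)"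
        using lb tp by (simp add: mult_ac)
    qed
  qed
  moreover have "2 * D / t0 >= 0" using D t0p by simp
  ultimately show ?thesis by blast
qed

lemma th_bounds: "EV n. \<forall>\<tau>. \<bar>\<tau>\<bar> <= Tm --> tAi psi xs n \<tau> > 0 \<and> 1/2 <= th n \<tau> \<and> th n \<tau> <= 2"
proof -
  obtain C where C: "EV n. \<forall>\<tau>. \<bar>\<tau>\<bar> <= Tm --> tAi psi xs n \<tau> >= t0 / 2 \<and> tAi psi xs n \<tau> > 0 \<and> \<bar>th n \<tau> - 1\<bar> <= C * real n powr (-1/3)"
    using tAi_asymp by blast
  have "EV n. C * real n powr (-1/3) <= 1/2" by (intro powr_eventually_le) auto
  with C show ?thesis
  proof eventually_elim
    case (elim n)
    show ?case
    proof (intro allI impI)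
      fix \<tau> assume "\<bar>\<tau>\<bar> <= Tm"
      with elim(1) have "tAi psi xs n \<tau> > 0" "\<bar>th n \<tau> - 1\<bar> <= C * real n powr (-1/3)" by auto
      moreover from this(2) elim(2) have "\<bar>th n \<tau> - 1\<bar> <= 1/2" by (rule order_trans)
      ultimately show "tAi psi xs n \<tau> > 0 \<and> 1/2 <= th n \<tau> \<and> th n \<tau> <= 2" by linarith
    qed
  qed
qed

definition vrange where "vrange M n = {- M .. M * real n powr \<epsilon>}" for M n

lemma vrange_abs: "M > 0 ==> n >= 1 ==> v \<in> vrange M n ==> \<bar>v\<bar> <= M * real n powr \<epsilon> \<and> v >= - M"
proof -
  assume a: "M > 0" "n >= 1" "v \<in> vrange M n"
  have "1 <= real n powr \<epsilon>" using a(2) eps(1) by (intro ge_one_powr_ge_zero) auto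
  then have "M * 1 <= M * real n powr \<epsilon>" using a(1) by (intro mult_left_mono) auto
  then show ?thesis using a(3) by (auto simp: vrange_def)
qed

lemma kk_bound:
  assumes M: "M > 0"
  shows "\<exists>C\<ge>0. EV n. \<forall>\<tau> v. \<bar>\<tau>\<bar> <= Tm --> v \<in> vrange M n --> 0 <= kk n \<tau> v \<and> kk n \<tau> v <= C * real n powr (2 * \<epsilon> - 1/3)"
proof -
  obtain C where C: "EV n. \<forall>\<tau>. \<bar>\<tau>\<bar> <= Tm --> tAi psi xs n \<tau> >= t0 / 2 \<and> tAi psi xs n \<tau> > 0 \<and> \<bar>th n \<tau> - 1\<bar> <= C * real n powr (-1/3)"
    using tAi_asymp by blast
  have t0p: "t0 > 0" by (rule t0)
  define D where "D = M^2 / (t0 * (c2 psi xs)^2)"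
  have "EV n. \<forall>\<tau> v. \<bar>\<tau>\<bar> <= Tm --> v \<in> vrange M n --> 0 <= kk n \<tau> v \<and> kk n \<tau> v <= D * real n powr (2 * \<epsilon> - 1/3)"
    using C eventually_ge_at_top[of 1]
  proof eventually_elim
    case (elim n)
    have n: "real n > 0" using elim by simp
    show ?case
    proof (intro allI impI)
      fix \<tau> v assume \<tau>: "\<bar>\<tau>\<bar> <= Tm" and v: "v \<in> vrange M n"
      have t: "tAi psi xs n \<tau> >= t0 / 2" "tAi psi xs n \<tau> > 0" using elim(1) \<tau> by auto
      have "\<bar>v\<bar>^2 <= (M * real n powr \<epsilon>)^2" using vrange_abs[OF M elim(2) v] by (intro power_mono) auto
      then have v2: "v^2 <= M^2 * real n powr (2 * \<epsilon>)" using n by (simp add: power_mult_distrib powr_power mult.commute)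
      have "kk n \<tau> v <= (M^2 * real n powr (2 * \<epsilon>)) / (2 * (t0 / 2) * (c2 psi xs)^2 * real n powr (1/3))"
        unfolding kk_def using v2 t t0p cc(3) n by (intro frac_le mult_right_mono mult_left_mono mult_pos_pos) auto
      also have "\<dots> = D * (real n powr (2 * \<epsilon>) * real n powr (-1/3))" using n powr_minus_divide[of "real n" "1/3"] by (simp add: D_def)
      also have "\<dots> = D * real n powr (2 * \<epsilon> - 1/3)" unfolding powr_add_eq by simp
      finally show "0 <= kk n \<tau> v \<and> kk n \<tau> v <= D * real n powr (2 * \<epsilon> - 1/3)" using t by (simp add: kk_def)
    qed
  qed
  moreover have "D >= 0" using t0p by (simp add: D_def)
  ultimately show ?thesis by blast
qed

lemma kk_le_1:
  assumes "M > 0"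
  shows "EV n. \<forall>\<tau> v. \<bar>\<tau>\<bar> <= Tm --> v \<in> vrange M n --> 0 <= kk n \<tau> v \<and> kk n \<tau> v <= 1"
proof -
  obtain C where C: "EV n. \<forall>\<tau> v. \<bar>\<tau>\<bar> <= Tm --> v \<in> vrange M n --> 0 <= kk n \<tau> v \<and> kk n \<tau> v <= C * real n powr (2 * \<epsilon> - 1/3)"
    using kk_bound[OF assms] by blast
  have "EV n. C * real n powr (2 * \<epsilon> - 1/3) <= 1" using eps' by (intro powr_eventually_le) auto
  with C show ?thesis by eventually_elim (blast intro: order_trans)
qed

text \<open>For |\<zeta>| <= n^(\<epsilon> / 8) the three deviations are of orders n^(\<gamma> - 1/3
  + \<epsilon> / 2) from E0, n^(2 \<epsilon> - 1/3) from \<open>kk\<close> and n^(9 \<epsilon> / 8 -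
  1/3) from \<open>th\<close>; the bounds on \<epsilon> bring each of them to n^(-
  \<epsilon>).\<close>

lemma EE_local:
  assumes M: "M > 0"
  shows "\<exists>C>0. EV n. \<forall>\<tau> v \<zeta>. \<bar>\<tau>\<bar> <= Tm --> v \<in> vrange M n --> cmod \<zeta> <= real n powr (\<epsilon>/8) -->
     (\<exists>X. EE n \<tau> v \<zeta> = eAi \<tau> v \<zeta> * exp X \<and> cmod X <= C * real n powr - \<epsilon>)"
proof -
  obtain C1 where C1: "C1 > 0" "EV n. \<forall>\<zeta>. cmod \<zeta> <= real n powr (\<epsilon>/8) --> (\<exists>R. E0 n (of_real (hs n) * \<zeta>) = exp (\<zeta>^3 / 3 + R) \<and> cmod R <= C1 * real n powr (\<gamma> - 1/3) * (1 + cmod \<zeta>)^4)"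
    using E0_local[of "\<epsilon>/8"] eps(1) eps' by auto
  obtain C2 where C2: "C2 >= 0" "EV n. \<forall>\<tau> v. \<bar>\<tau>\<bar> <= Tm --> v \<in> vrange M n --> 0 <= kk n \<tau> v \<and> kk n \<tau> v <= C2 * real n powr (2 * \<epsilon> - 1/3)"
    using kk_bound[OF M] by blast
  obtain C3 where C3: "C3 >= 0" "EV n. \<forall>\<tau>. \<bar>\<tau>\<bar> <= Tm --> tAi psi xs n \<tau> >= t0 / 2 \<and> tAi psi xs n \<tau> > 0 \<and> \<bar>th n \<tau> - 1\<bar> <= C3 * real n powr (-1/3)"
    using tAi_asymp by blast
  define C where "C = 16 * C1 + C2 + C3 * (\<bar>Tm\<bar> + M)"
  have "EV n. \<forall>\<tau> v \<zeta>. \<bar>\<tau>\<bar> <= Tm --> v \<in> vrange M n --> cmod \<zeta> <= real n powr (\<epsilon>/8) -->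
     (\<exists>X. EE n \<tau> v \<zeta> = eAi \<tau> v \<zeta> * exp X \<and> cmod X <= C * real n powr - \<epsilon>)"
    using C1(2) C2(2) C3(2) eventually_ge_at_top[of 1]
  proof eventually_elim
    case (elim n)
    have n: "real n >= 1" "real n > 0" using elim by simp_all
    show ?case
    proof (intro allI impI)
      fix \<tau> v \<zeta> assume \<tau>: "\<bar>\<tau>\<bar> <= Tm" and v: "v \<in> vrange M n" and \<zeta>: "cmod \<zeta> <= real n powr (\<epsilon>/8)"
      obtain R where R: "E0 n (of_real (hs n) * \<zeta>) = exp (\<zeta>^3 / 3 + R)" "cmod R <= C1 * real n powr (\<gamma> - 1/3) * (1 + cmod \<zeta>)^4"
        using elim(1) \<zeta> by blast
      define m where "m = real n powr (\<epsilon>/8)"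
      have m1: "m >= 1" unfolding m_def using n eps(1) by (intro ge_one_powr_ge_zero) auto
      define Y where "Y = of_real \<tau> * \<zeta>^2 + of_real v * \<zeta>"
      define X where "X = R + of_real (kk n \<tau> v) + of_real (1 - th n \<tau>) * Y"
      have pm: "real n powr x <= real n powr - \<epsilon>" if "x <= - \<epsilon>" for x using that n by (intro powr_mono) auto
      have "EE n \<tau> v \<zeta> = exp (\<zeta>^3 / 3 + R + (of_real (kk n \<tau> v) - of_real (th n \<tau>) * Y))" unfolding EE_def R(1) Y_def exp_add ..
      also have "\<zeta>^3 / 3 + R + (of_real (kk n \<tau> v) - of_real (th n \<tau>) * Y) = (\<zeta>^3/3 - \<zeta> * of_real v - of_real \<tau> * \<zeta>^2) + X"
        by (simp add: X_def Y_def algebra_simps)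
      finally have e: "EE n \<tau> v \<zeta> = eAi \<tau> v \<zeta> * exp X" unfolding eAi_def exp_add .
      have "cmod R <= 16 * C1 * real n powr - \<epsilon>"
      proof -
        have "(1 + cmod \<zeta>)^4 <= (2 * m)^4" using \<zeta> m1 by (intro power_mono) (auto simp: m_def)
        also have "\<dots> = 16 * real n powr (\<epsilon>/2)" using n by (simp add: power_mult_distrib m_def powr_power)
        finally have "C1 * real n powr (\<gamma> - 1/3) * (1 + cmod \<zeta>)^4 <= C1 * real n powr (\<gamma> - 1/3) * (16 * real n powr (\<epsilon>/2))" using C1(1) by (intro mult_left_mono) auto
        also have "\<dots> = 16 * C1 * (real n powr (\<gamma> - 1/3) * real n powr (\<epsilon>/2))" by simp
        also have "\<dots> <= 16 * C1 * real n powr - \<epsilon>" unfolding powr_add_eq using C1(1) eps' eps(1) by (intro mult_left_mono pm) auto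
        finally show ?thesis using R(2) by linarith
      qed
      moreover have "cmod (of_real (kk n \<tau> v)) <= C2 * real n powr - \<epsilon>"
      proof -
        have "0 <= kk n \<tau> v" "kk n \<tau> v <= C2 * real n powr (2 * \<epsilon> - 1/3)" using elim(2) \<tau> v by auto
        moreover have "C2 * real n powr (2 * \<epsilon> - 1/3) <= C2 * real n powr - \<epsilon>" using C2(1) eps' by (intro mult_left_mono pm) auto
        ultimately show ?thesis by simp
      qed
      moreover have "cmod (of_real (1 - th n \<tau>) * Y) <= C3 * (\<bar>Tm\<bar> + M) * real n powr - \<epsilon>"
      proof -
        have va: "\<bar>v\<bar> <= M * real n powr \<epsilon>" using vrange_abs[OF M elim(4) v] by simp
        have "cmod Y <= \<bar>\<tau>\<bar> * cmod \<zeta>^2 + \<bar>v\<bar> * cmod \<zeta>" unfolding Y_def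
          by (rule order_trans[OF norm_triangle_ineq]) (simp add: norm_mult norm_power)
        also have "\<dots> <= \<bar>Tm\<bar> * m^2 + (M * real n powr \<epsilon>) * m" using \<tau> va \<zeta> m1 M by (intro add_mono mult_mono power_mono) (auto simp: m_def)
        also have "\<dots> <= (\<bar>Tm\<bar> + M) * real n powr (9 * \<epsilon> / 8)"
        proof -
          have "m^2 = real n powr (\<epsilon>/4)" using n by (simp add: m_def powr_power)
          also have "\<dots> <= real n powr (9 * \<epsilon> / 8)" using n eps(1) by (intro powr_mono) auto
          finally have 1: "\<bar>Tm\<bar> * m^2 <= \<bar>Tm\<bar> * real n powr (9 * \<epsilon> / 8)" by (intro mult_left_mono) auto
          have "real n powr \<epsilon> * m = real n powr (9 * \<epsilon> / 8)" unfolding m_def powr_add_eq by (simp add: field_simps)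
          then have 2: "(M * real n powr \<epsilon>) * m = M * real n powr (9 * \<epsilon> / 8)" by simp
          show ?thesis unfolding 2 distrib_right using 1 by (rule add_right_mono)
        qed
        finally have Yb: "cmod Y <= (\<bar>Tm\<bar> + M) * real n powr (9 * \<epsilon> / 8)" .
        have "\<bar>1 - th n \<tau>\<bar> <= C3 * real n powr (-1/3)" using elim(3) \<tau> by (simp add: abs_minus_commute)
        then have "\<bar>1 - th n \<tau>\<bar> * cmod Y <= (C3 * real n powr (-1/3)) * ((\<bar>Tm\<bar> + M) * real n powr (9 * \<epsilon> / 8))"
          using Yb C3(1) by (intro mult_mono) auto
        also have "\<dots> = C3 * (\<bar>Tm\<bar> + M) * (real n powr (-1/3) * real n powr (9 * \<epsilon> / 8))" by simp
        also have "\<dots> <= C3 * (\<bar>Tm\<bar> + M) * real n powr - \<epsilon>" unfolding powr_add_eq using C3(1) M eps' by (intro mult_left_mono pm) (auto simp: field_simps)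
        finally show ?thesis by (simp only: norm_mult norm_of_real)
      qed
      ultimately have "cmod X <= 16 * C1 * real n powr - \<epsilon> + C2 * real n powr - \<epsilon> + C3 * (\<bar>Tm\<bar> + M) * real n powr - \<epsilon>"
        unfolding X_def by (meson add_mono norm_triangle_ineq order_trans)
      then have "cmod X <= C * real n powr - \<epsilon>" by (simp add: C_def algebra_simps)
      with e show "\<exists>X. EE n \<tau> v \<zeta> = eAi \<tau> v \<zeta> * exp X \<and> cmod X <= C * real n powr - \<epsilon>" by blast
    qed
  qed
  moreover have "C > 0" unfolding C_def using C1 C2 C3 M by (intro add_pos_nonneg) auto
  ultimately show ?thesis by blast
qed

text \<open>Source of the factor exp (- \<sigma> v): for v >= 0 the distance X >= 2 \<sigma> of the
  contour and \<theta> >= 1/2 give \<theta> X >= \<sigma>; for v < 0 one has |v| <= M and loses at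
  most 2 M X.\<close>

lemma linear_term_bound:
  fixes X \<theta> v M s :: real
  assumes "X >= 2 * \<sigma>" "1/2 <= \<theta>" "\<theta> <= 2" "v >= - M" "M > 0"
  shows "- (\<theta> * X * v) <= - \<sigma> * v + 2 * M * X"
proof -
  have X0: "X > 0" using assms(1) sigma by linarith
  show ?thesis
  proof (cases "v >= 0")
    case True
    have "(1/2) * (2 * \<sigma>) <= \<theta> * X" using assms sigma by (intro mult_mono) auto
    then have "\<sigma> * v <= \<theta> * X * v" using True by (intro mult_right_mono) auto
    moreover have "2 * M * X >= 0" using assms X0 by simp
    ultimately show ?thesis by simp
  next
    case False
    have "\<theta> * X * (- v) <= 2 * X * M" using assms X0 False by (intro mult_mono) auto
    moreover have "\<sigma> * (- v) >= 0" by (intro mult_nonneg_nonneg) (use sigma False in simp_all)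
    ultimately show ?thesis by (simp add: mult_ac)
  qed
qed

lemma EE_zline_bounds:
  assumes M: "M > 0" and Tm: "Tm >= 0" and s: "s >= 2 * \<sigma>" "s >= 2 * Tm + 3"
  shows "\<exists>K>0. (\<forall>\<tau> v y. \<bar>\<tau>\<bar> <= Tm --> v >= - M --> cmod (eAi \<tau> v (zline s y)) <= K * exp (- \<sigma> * v) * exp (- 2 * \<bar>y\<bar>)) \<and>
     (EV n. \<forall>\<tau> v y. \<bar>\<tau>\<bar> <= Tm --> v \<in> vrange M n --> cmod (EE n \<tau> v (zline s y)) <= K * exp (- \<sigma> * v) * exp (- 2 * \<bar>y\<bar>))"
proof -
  define K where "K = exp (s^3 / 3 + 1 + 1 + 2 * Tm * s^2 + 2 * M * s + 1)"
  have s0: "s > 0" using s Tm by linarith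
  have y2: "- (y^2) <= 1 - 2 * \<bar>y\<bar>" for y :: real
  proof -
    have "0 <= (\<bar>y\<bar> - 1)^2" by simp
    then show ?thesis by (simp add: power2_eq_square algebra_simps)
  qed
  \<comment> \<open>One inequality serves the limit, with b = s and \<theta> = 1, and the weight at
    finite n, with b = s - 1 from \<open>E0_zline\<close>. The surplus of b over 2 Tm pays for the
    term \<tau> y^2 and leaves - y^2 <= 1 - 2 |y|.\<close>
  have core: "A + B - \<theta> * (\<tau> * (s^2 - y^2) + v * s) - b * y^2 <= (s^3 / 3 + 1 + 1 + 2 * Tm * s^2 + 2 * M * s + 1) + (- \<sigma> * v) + (- 2 * \<bar>y\<bar>)"
    if "A <= s^3/3 + 1" "B <= 1" "1/2 <= \<theta>" "\<theta> <= 2" "\<bar>\<tau>\<bar> <= Tm" "v >= - M" "b >= 2 * Tm + 1" for A B \<theta> \<tau> v b y :: real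
  proof -
    have l: "- (\<theta> * s * v) <= - \<sigma> * v + 2 * M * s" by (rule linear_term_bound[OF s(1) that(3,4,6) M])
    have tt: "\<bar>\<theta> * \<tau>\<bar> <= 2 * Tm" unfolding abs_mult using that by (intro mult_mono) auto
    have "- (\<theta> * \<tau>) * s^2 <= 2 * Tm * s^2" using tt by (intro mult_right_mono) auto
    then have "- (\<theta> * \<tau> * s^2) <= 2 * Tm * s^2" by simp
    moreover have "(\<theta> * \<tau>) * y^2 <= 2 * Tm * y^2" using tt by (intro mult_right_mono) auto
    moreover have "(2 * Tm + 1) * y^2 <= b * y^2" using that by (intro mult_right_mono) auto
    then have "2 * Tm * y^2 + y^2 <= b * y^2" by (simp add: distrib_right)
    moreover have "\<theta> * (\<tau> * (s^2 - y^2) + v * s) = (\<theta> * \<tau>) * s^2 - (\<theta> * \<tau>) * y^2 + \<theta> * s * v" by (simp add: algebra_simps)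
    ultimately show ?thesis using l y2[of y] that(1,2) by linarith
  qed
  have "\<forall>\<tau> v y. \<bar>\<tau>\<bar> <= Tm --> v >= - M --> cmod (eAi \<tau> v (zline s y)) <= K * exp (- \<sigma> * v) * exp (- 2 * \<bar>y\<bar>)"
  proof (intro allI impI)
    fix \<tau> v y assume a: "\<bar>\<tau>\<bar> <= Tm" "v >= - M"
    have "cmod (eAi \<tau> v (zline s y)) = exp (s^3/3 + 0 - 1 * (\<tau> * (s^2 - y^2) + v * s) - s * y^2)"
      unfolding norm_eAi zline_simps by (simp add: field_simps)
    also have "\<dots> <= exp ((s^3 / 3 + 1 + 1 + 2 * Tm * s^2 + 2 * M * s + 1) + (- \<sigma> * v) + (- 2 * \<bar>y\<bar>))"
      unfolding exp_le_cancel_iff by (rule core) (use a s in auto)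
    finally show "cmod (eAi \<tau> v (zline s y)) <= K * exp (- \<sigma> * v) * exp (- 2 * \<bar>y\<bar>)" unfolding K_def exp_add .
  qed
  moreover have "EV n. \<forall>\<tau> v y. \<bar>\<tau>\<bar> <= Tm --> v \<in> vrange M n --> cmod (EE n \<tau> v (zline s y)) <= K * exp (- \<sigma> * v) * exp (- 2 * \<bar>y\<bar>)"
  proof -
    obtain C1 where C1: "C1 > 0" "EV n. \<forall>\<zeta>. cmod \<zeta> <= real n powr (\<epsilon>/8) --> (\<exists>R. E0 n (of_real (hs n) * \<zeta>) = exp (\<zeta>^3 / 3 + R) \<and> cmod R <= C1 * real n powr (\<gamma> - 1/3) * (1 + cmod \<zeta>)^4)"
      using E0_local[of "\<epsilon>/8"] eps(1) eps' by auto
    have e1: "EV n. (C1 * (1 + s)^4) * real n powr (\<gamma> - 1/3) <= 1" using gam by (intro powr_eventually_le) auto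
    have e2: "EV n. s * real n powr - (\<epsilon>/8) <= 1" using eps(1) by (intro powr_eventually_le) auto
    show ?thesis using C1(2) e1 e2 E0_zline[OF s0] th_bounds[of Tm] kk_le_1[OF M, of Tm] eventually_ge_at_top[of 1]
    proof eventually_elim
      case (elim n)
      have n: "real n > 0" using elim by simp
      have sn: "cmod (of_real s) <= real n powr (\<epsilon>/8)" using elim(3) s0 n by (simp add: powr_minus field_simps)
      obtain R where R: "E0 n (of_real (hs n) * of_real s) = exp ((of_real s)^3 / 3 + R)" "cmod R <= C1 * real n powr (\<gamma> - 1/3) * (1 + cmod (of_real s))^4"
        using elim(1) sn by blast
      have "cmod R <= 1" using R(2) elim(2) s0 by (simp add: mult_ac)
      then have "Re R <= 1" using complex_Re_le_cmod[of R] by linarith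
      moreover have "Re ((of_real s)^3 / 3 + R) = s^3/3 + Re R" by (simp flip: of_real_power)
      ultimately have Es: "cmod (E0 n (of_real (hs n * s))) = exp (s^3/3 + Re R)" "Re R <= 1" using R(1) by (simp_all only: of_real_mult norm_exp_eq_Re)
      show ?case
      proof (intro allI impI)
        fix \<tau> v y assume \<tau>: "\<bar>\<tau>\<bar> <= Tm" and v: "v \<in> vrange M n"
        have vM: "v >= - M" using v by (simp add: vrange_def)
        have b: "1/2 <= th n \<tau>" "th n \<tau> <= 2" "kk n \<tau> v <= 1" using elim(5,6) \<tau> v by auto
        have "cmod (EE n \<tau> v (zline s y)) <= (exp (s^3/3 + Re R) * exp (- (s - 1) * y^2)) * exp (kk n \<tau> v - th n \<tau> * (\<tau> * (s^2 - y^2) + v * s))"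
          unfolding cmod_EE zline_simps using elim(4) Es by (intro mult_right_mono) auto
        also have "\<dots> = exp ((s^3/3 + Re R) + kk n \<tau> v - th n \<tau> * (\<tau> * (s^2 - y^2) + v * s) - (s - 1) * y^2)"
          unfolding exp_add[symmetric] by (simp add: algebra_simps)
        also have "\<dots> <= exp ((s^3 / 3 + 1 + 1 + 2 * Tm * s^2 + 2 * M * s + 1) + (- \<sigma> * v) + (- 2 * \<bar>y\<bar>))"
          unfolding exp_le_cancel_iff by (rule core) (use \<tau> vM b Es(2) s in auto)
        finally show "cmod (EE n \<tau> v (zline s y)) <= K * exp (- \<sigma> * v) * exp (- 2 * \<bar>y\<bar>)" unfolding K_def exp_add .
      qed
    qed
  qed
  moreover have "K > 0" by (simp add: K_def)
  ultimately show ?thesis by blast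
qed

lemma EE_wvee_bounds:
  assumes M: "M > 0" and Tm: "Tm >= 0" and s: "s >= 2 * \<sigma>"
    and \<rho>1: "EV n. \<forall>q. hs n * \<bar>q\<bar> <= \<rho>1 --> cmod (E0 n (of_real (hs n) * wvee s q)) >= exp (\<bar>q\<bar>^3 / 2 - s^2 * \<bar>q\<bar> - s^3 - 1)"
  shows "\<exists>K>0. (\<forall>\<tau> u q. \<bar>\<tau>\<bar> <= Tm --> u >= - M --> cmod (1 / eAi \<tau> u (wvee s q)) <= K * exp (- \<sigma> * u) * exp (- 2 * \<bar>q\<bar>)) \<and>
     (EV n. \<forall>\<tau> u q. \<bar>\<tau>\<bar> <= Tm --> u \<in> vrange M n --> hs n * \<bar>q\<bar> <= \<rho>1 --> cmod (1 / EE n \<tau> u (wvee s q)) <= K * exp (- \<sigma> * u) * exp (- 2 * \<bar>q\<bar>))"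
proof -
  have s0: "s > 0" using s sigma by linarith
  obtain K0 where K0: "\<And>b. b >= 0 ==> (s^2 + 2 * M + 4 * Tm * s + 1) * b + 0 * b^2 - (1/2) * b^3 <= K0 - b"
    using cubic_exp_bound[of "1/2" "s^2 + 2 * M + 4 * Tm * s + 1" 0] by auto
  define k where "k = s^3 + 1 + 2 * M * s + 2 * Tm * s^2 + K0"
  define K where "K = exp k"
  \<comment> \<open>Again one inequality for both weights: the exponent assumed for E0 is the weaker
    one, since the limit has (2/3) |q|^3 in place of |q|^3 / 2.\<close>
  have core: "A + B + \<theta> * (\<tau> * ((s + b)^2 - b^2) - u * (s + b)) <= k + (- \<sigma> * u) + (- 2 * b)"
    if "A <= - (b^3 / 2 - s^2 * b - s^3 - 1)" "B <= 0" "1/2 <= \<theta>" "\<theta> <= 2" "\<bar>\<tau>\<bar> <= Tm" "u >= - M" "b >= 0" for A B \<theta> \<tau> u b :: real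
  proof -
    have l: "- (\<theta> * (s + b) * u) <= - \<sigma> * u + 2 * M * (s + b)" by (rule linear_term_bound[OF _ that(3,4,6) M]) (use s that in simp)
    have tt: "\<bar>\<theta> * \<tau>\<bar> <= 2 * Tm" unfolding abs_mult using that by (intro mult_mono) auto
    have "(\<theta> * \<tau>) * (s^2 + 2 * s * b) <= 2 * Tm * (s^2 + 2 * s * b)" using tt s0 that by (intro mult_right_mono) auto
    moreover have "\<theta> * (\<tau> * ((s + b)^2 - b^2) - u * (s + b)) = (\<theta> * \<tau>) * (s^2 + 2 * s * b) - \<theta> * (s + b) * u" by (simp add: power2_eq_square algebra_simps)
    moreover have "2 * Tm * (s^2 + 2 * s * b) = 2 * Tm * s^2 + 4 * Tm * s * b" "2 * M * (s + b) = 2 * M * s + 2 * M * b" by (simp_all add: algebra_simps)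
    moreover have "s^2 * b + 2 * M * b + 4 * Tm * s * b + b - (1/2) * b^3 <= K0 - b" using K0[OF that(7)] by (simp add: algebra_simps)
    moreover have "- (b^3 / 2 - s^2 * b - s^3 - 1) = - (1/2) * b^3 + s^2 * b + s^3 + 1" by simp
    ultimately show ?thesis using l that(1,2) unfolding k_def by linarith
  qed
  have "\<forall>\<tau> u q. \<bar>\<tau>\<bar> <= Tm --> u >= - M --> cmod (1 / eAi \<tau> u (wvee s q)) <= K * exp (- \<sigma> * u) * exp (- 2 * \<bar>q\<bar>)"
  proof (intro allI impI)
    fix \<tau> u q assume a: "\<bar>\<tau>\<bar> <= Tm" "u >= - M"
    have "cmod (1 / eAi \<tau> u (wvee s q)) = exp ((s^3/3 + s^2 * \<bar>q\<bar> - (2/3) * \<bar>q\<bar>^3) + 0 + 1 * (\<tau> * ((s + \<bar>q\<bar>)^2 - \<bar>q\<bar>^2) - u * (s + \<bar>q\<bar>)))"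
      unfolding norm_eAi_inverse_wvee by (simp add: power2_eq_square algebra_simps)
    also have "\<dots> <= exp (k + (- \<sigma> * u) + (- 2 * \<bar>q\<bar>))"
      unfolding exp_le_cancel_iff
    proof (rule core)
      have "s^3 >= 0" "\<bar>q\<bar>^3 >= 0" using s0 by auto
      then show "s^3/3 + s^2 * \<bar>q\<bar> - (2/3) * \<bar>q\<bar>^3 <= - (\<bar>q\<bar>^3 / 2 - s^2 * \<bar>q\<bar> - s^3 - 1)" by linarith
    qed (use a in auto)
    finally show "cmod (1 / eAi \<tau> u (wvee s q)) <= K * exp (- \<sigma> * u) * exp (- 2 * \<bar>q\<bar>)" unfolding K_def exp_add .
  qed
  moreover have "EV n. \<forall>\<tau> u q. \<bar>\<tau>\<bar> <= Tm --> u \<in> vrange M n --> hs n * \<bar>q\<bar> <= \<rho>1 --> cmod (1 / EE n \<tau> u (wvee s q)) <= K * exp (- \<sigma> * u) * exp (- 2 * \<bar>q\<bar>)"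
    using \<rho>1 th_bounds[of Tm] kk_le_1[OF M, of Tm]
  proof eventually_elim
    case (elim n)
    show ?case
    proof (intro allI impI)
      fix \<tau> u q assume \<tau>: "\<bar>\<tau>\<bar> <= Tm" and u: "u \<in> vrange M n" and q: "hs n * \<bar>q\<bar> <= \<rho>1"
      have uM: "u >= - M" using u by (simp add: vrange_def)
      have b: "1/2 <= th n \<tau>" "th n \<tau> <= 2" "kk n \<tau> u >= 0" using elim(2,3) \<tau> u by auto
      define e0 where "e0 = \<bar>q\<bar>^3 / 2 - s^2 * \<bar>q\<bar> - s^3 - 1"
      have E: "cmod (E0 n (of_real (hs n) * wvee s q)) >= exp e0" using elim(1) q by (simp add: e0_def)
      define x where "x = kk n \<tau> u - th n \<tau> * (\<tau> * ((- s - \<bar>q\<bar>)^2 - q^2) + u * (- s - \<bar>q\<bar>))"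
      have "cmod (1 / EE n \<tau> u (wvee s q)) = 1 / (cmod (E0 n (of_real (hs n) * wvee s q)) * exp x)"
        unfolding norm_divide cmod_EE wvee_simps x_def by simp
      also have "\<dots> <= 1 / (exp e0 * exp x)" using E by (intro divide_left_mono mult_right_mono mult_pos_pos) (auto intro: less_le_trans[OF exp_gt_zero])
      also have "\<dots> = exp (- e0 - x)" by (simp add: exp_add[symmetric] exp_minus[symmetric] exp_diff field_simps)
      also have "- e0 - x = - e0 + (- kk n \<tau> u) + th n \<tau> * (\<tau> * ((s + \<bar>q\<bar>)^2 - \<bar>q\<bar>^2) - u * (s + \<bar>q\<bar>))"
        by (simp add: x_def power2_eq_square algebra_simps)
      also have "exp \<dots> <= exp (k + (- \<sigma> * u) + (- 2 * \<bar>q\<bar>))"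
        unfolding exp_le_cancel_iff by (rule core) (use \<tau> uM b in \<open>auto simp: e0_def\<close>)
      finally show "cmod (1 / EE n \<tau> u (wvee s q)) <= K * exp (- \<sigma> * u) * exp (- 2 * \<bar>q\<bar>)" unfolding K_def exp_add .
    qed
  qed
  moreover have "K > 0" by (simp add: K_def)
  ultimately show ?thesis by blast
qed

lemma EE_zline_diff:
  assumes M: "M > 0" and Tm: "Tm >= 0" and s: "s >= 2 * \<sigma>" "s >= 2 * Tm + 3"
  shows "\<exists>K\<ge>0. EV n. \<forall>\<tau> v y. \<bar>\<tau>\<bar> <= Tm --> v \<in> vrange M n -->
     cmod (EE n \<tau> v (zline s y) - eAi \<tau> v (zline s y)) <= K * real n powr - \<epsilon> * exp (- \<sigma> * v) * exp (- \<bar>y\<bar>)"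
proof -
  have s0: "s > 0" using s Tm by linarith
  obtain K where K: "K > 0" "\<forall>\<tau> v y. \<bar>\<tau>\<bar> <= Tm --> v >= - M --> cmod (eAi \<tau> v (zline s y)) <= K * exp (- \<sigma> * v) * exp (- 2 * \<bar>y\<bar>)"
    "EV n. \<forall>\<tau> v y. \<bar>\<tau>\<bar> <= Tm --> v \<in> vrange M n --> cmod (EE n \<tau> v (zline s y)) <= K * exp (- \<sigma> * v) * exp (- 2 * \<bar>y\<bar>)"
    using EE_zline_bounds[OF M Tm s] by blast
  obtain C where C: "C > 0" "EV n. \<forall>\<tau> v \<zeta>. \<bar>\<tau>\<bar> <= Tm --> v \<in> vrange M n --> cmod \<zeta> <= real n powr (\<epsilon>/8) -->
     (\<exists>X. EE n \<tau> v \<zeta> = eAi \<tau> v \<zeta> * exp X \<and> cmod X <= C * real n powr - \<epsilon>)" using EE_local[OF M] by blast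
  define C' where "C' = exp (s / 2) * 16^8"
  have e: "EV n. C * real n powr - \<epsilon> <= 1/2" using eps(1) by (intro powr_eventually_le) auto
  have "EV n. \<forall>\<tau> v y. \<bar>\<tau>\<bar> <= Tm --> v \<in> vrange M n -->
     cmod (EE n \<tau> v (zline s y) - eAi \<tau> v (zline s y)) <= K * (2 * C + 2 * C') * real n powr - \<epsilon> * exp (- \<sigma> * v) * exp (- \<bar>y\<bar>)"
    using K(3) C(2) e eventually_ge_at_top[of 1]
  proof eventually_elim
    case (elim n)
    show ?case
    proof (intro allI impI)
      fix \<tau> v y assume \<tau>: "\<bar>\<tau>\<bar> <= Tm" and v: "v \<in> vrange M n"
      have vM: "v >= - M" using v by (simp add: vrange_def)
      define \<zeta> where "\<zeta> = zline s y"
      have A: "cmod (EE n \<tau> v \<zeta>) <= K * exp (- \<sigma> * v) * exp (- 2 * \<bar>y\<bar>)" using elim(1) \<tau> v unfolding \<zeta>_def by blast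
      have B: "cmod (eAi \<tau> v \<zeta>) <= K * exp (- \<sigma> * v) * exp (- 2 * \<bar>y\<bar>)" using K(2) \<tau> vM unfolding \<zeta>_def by blast
      have "cmod \<zeta> <= s + 2 * \<bar>y\<bar>"
        using cmod_le[of \<zeta>] s0 by (simp add: \<zeta>_def zline_simps)
      note far = exp_far_decay[OF this, of n \<epsilon>, folded C'_def]
      obtain X where X: "cmod \<zeta> <= real n powr (\<epsilon>/8) ==> EE n \<tau> v \<zeta> = eAi \<tau> v \<zeta> * exp X \<and> cmod X <= C * real n powr - \<epsilon>"
        using elim(2) \<tau> v by blast
      have "cmod (EE n \<tau> v \<zeta> - eAi \<tau> v \<zeta>) <= K * (2 * C + 2 * C') * real n powr - \<epsilon> * exp (- \<sigma> * v) * exp (- \<bar>y\<bar>)"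
        by (rule exp_perturb_diff[where p = "cmod \<zeta> <= real n powr (\<epsilon>/8)" and X = X, OF _ A B far])
          (use X elim(3,4) K(1) C(1) in \<open>auto simp: C'_def\<close>)
      then show "cmod (EE n \<tau> v (zline s y) - eAi \<tau> v (zline s y)) <= K * (2 * C + 2 * C') * real n powr - \<epsilon> * exp (- \<sigma> * v) * exp (- \<bar>y\<bar>)"
        unfolding \<zeta>_def .
    qed
  qed
  moreover have "K * (2 * C + 2 * C') >= 0" using K(1) C(1) by (simp add: C'_def)
  ultimately show ?thesis by blast
qed

lemma EE_wvee_diff:
  assumes M: "M > 0" and Tm: "Tm >= 0" and s: "s >= 2 * \<sigma>"
    and \<rho>1: "EV n. \<forall>q. hs n * \<bar>q\<bar> <= \<rho>1 --> cmod (E0 n (of_real (hs n) * wvee s q)) >= exp (\<bar>q\<bar>^3 / 2 - s^2 * \<bar>q\<bar> - s^3 - 1)"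
  shows "\<exists>K\<ge>0. EV n. \<forall>\<tau> u q. \<bar>\<tau>\<bar> <= Tm --> u \<in> vrange M n --> hs n * \<bar>q\<bar> <= \<rho>1 -->
     cmod (1 / EE n \<tau> u (wvee s q) - 1 / eAi \<tau> u (wvee s q)) <= K * real n powr - \<epsilon> * exp (- \<sigma> * u) * exp (- \<bar>q\<bar>)"
proof -
  have s0: "s > 0" using s sigma by linarith
  obtain K where K: "K > 0" "\<forall>\<tau> u q. \<bar>\<tau>\<bar> <= Tm --> u >= - M --> cmod (1 / eAi \<tau> u (wvee s q)) <= K * exp (- \<sigma> * u) * exp (- 2 * \<bar>q\<bar>)"
    "EV n. \<forall>\<tau> u q. \<bar>\<tau>\<bar> <= Tm --> u \<in> vrange M n --> hs n * \<bar>q\<bar> <= \<rho>1 --> cmod (1 / EE n \<tau> u (wvee s q)) <= K * exp (- \<sigma> * u) * exp (- 2 * \<bar>q\<bar>)"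
    using EE_wvee_bounds[OF M Tm s \<rho>1] by blast
  obtain C where C: "C > 0" "EV n. \<forall>\<tau> v \<zeta>. \<bar>\<tau>\<bar> <= Tm --> v \<in> vrange M n --> cmod \<zeta> <= real n powr (\<epsilon>/8) -->
     (\<exists>X. EE n \<tau> v \<zeta> = eAi \<tau> v \<zeta> * exp X \<and> cmod X <= C * real n powr - \<epsilon>)" using EE_local[OF M] by blast
  define C' where "C' = exp (s / 2) * 16^8"
  have e: "EV n. C * real n powr - \<epsilon> <= 1/2" using eps(1) by (intro powr_eventually_le) auto
  have "EV n. \<forall>\<tau> u q. \<bar>\<tau>\<bar> <= Tm --> u \<in> vrange M n --> hs n * \<bar>q\<bar> <= \<rho>1 -->
     cmod (1 / EE n \<tau> u (wvee s q) - 1 / eAi \<tau> u (wvee s q)) <= K * (2 * C + 2 * C') * real n powr - \<epsilon> * exp (- \<sigma> * u) * exp (- \<bar>q\<bar>)"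
    using K(3) C(2) e eventually_ge_at_top[of 1]
  proof eventually_elim
    case (elim n)
    show ?case
    proof (intro allI impI)
      fix \<tau> u q assume \<tau>: "\<bar>\<tau>\<bar> <= Tm" and u: "u \<in> vrange M n" and q: "hs n * \<bar>q\<bar> <= \<rho>1"
      have uM: "u >= - M" using u by (simp add: vrange_def)
      define \<zeta> where "\<zeta> = wvee s q"
      have A: "cmod (1 / EE n \<tau> u \<zeta>) <= K * exp (- \<sigma> * u) * exp (- 2 * \<bar>q\<bar>)" using elim(1) \<tau> u q unfolding \<zeta>_def by blast
      have B: "cmod (1 / eAi \<tau> u \<zeta>) <= K * exp (- \<sigma> * u) * exp (- 2 * \<bar>q\<bar>)" using K(2) \<tau> uM unfolding \<zeta>_def by blast
      have "cmod \<zeta> <= s + 2 * \<bar>q\<bar>"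
        using cmod_le[of \<zeta>] s0 by (simp add: \<zeta>_def wvee_simps)
      note far = exp_far_decay[OF this, of n \<epsilon>, folded C'_def]
      obtain X where X: "cmod \<zeta> <= real n powr (\<epsilon>/8) ==> EE n \<tau> u \<zeta> = eAi \<tau> u \<zeta> * exp X \<and> cmod X <= C * real n powr - \<epsilon>"
        using elim(2) \<tau> u by blast
      have X': "1 / EE n \<tau> u \<zeta> = 1 / eAi \<tau> u \<zeta> * exp (- X) \<and> cmod (- X) <= C * real n powr - \<epsilon> \<and> C * real n powr - \<epsilon> <= 1/2" if "cmod \<zeta> <= real n powr (\<epsilon>/8)"
      proof -
        have "1 / EE n \<tau> u \<zeta> = 1 / (eAi \<tau> u \<zeta> * exp X)" using X[OF that] by simp
        also have "\<dots> = 1 / eAi \<tau> u \<zeta> * exp (- X)" unfolding exp_minus by (simp add: field_simps)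
        finally show ?thesis using X[OF that] elim(3) by simp
      qed
      have "cmod (1 / EE n \<tau> u \<zeta> - 1 / eAi \<tau> u \<zeta>) <= K * (2 * C + 2 * C') * real n powr - \<epsilon> * exp (- \<sigma> * u) * exp (- \<bar>q\<bar>)"
        by (rule exp_perturb_diff[where p = "cmod \<zeta> <= real n powr (\<epsilon>/8)" and X = "- X", OF X' A B far])
          (use elim(4) K(1) C(1) in \<open>auto simp: C'_def\<close>)
      then show "cmod (1 / EE n \<tau> u (wvee s q) - 1 / eAi \<tau> u (wvee s q)) <= K * (2 * C + 2 * C') * real n powr - \<epsilon> * exp (- \<sigma> * u) * exp (- \<bar>q\<bar>)"
        unfolding \<zeta>_def .
    qed
  qed
  moreover have "K * (2 * C + 2 * C') >= 0" using K(1) C(1) by (simp add: C'_def)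
  ultimately show ?thesis by blast
qed

text \<open>For r = |\<zeta>| >= c0 n^\<delta> with \<delta> = 1/3 - \<gamma>, both n^\<epsilon> and
  ln n are at most multiples of r. So u, the quadratic terms and the wanted power of n cost at most
  (D1 + D2) r^2, which c1 r^3 covers. The power n^(-2) is more than enough to absorb 1 /
  \<open>hs n\<close> later.\<close>

lemma EE_inverse_macro:
  assumes M: "M > 0" and Tm: "Tm >= 0" and c1: "c1 > 0" and c0: "c0 > 0"
  shows "EV n. \<forall>\<tau> u \<zeta>. \<bar>\<tau>\<bar> <= Tm --> u \<in> vrange M n --> cmod \<zeta> >= c0 * real n powr (1/3 - \<gamma>) -->
     cmod (E0 n (of_real (hs n) * \<zeta>)) >= exp (c1 * cmod \<zeta>^3) --> cmod (1 / EE n \<tau> u \<zeta>) <= exp (- \<sigma> * u) * real n powr - 2"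
proof -
  define \<delta> where "\<delta> = 1/3 - \<gamma>"
  have \<delta>: "\<delta> > 0" "\<epsilon> <= \<delta>" using gam eps(1) eps' by (auto simp: \<delta>_def)
  define D2 where "D2 = 2 * Tm + 2 * M / c0"
  define D1 where "D1 = \<sigma> * M / c0 + 2 / (c0 * \<delta>)"
  have D: "D1 >= 0" "D2 >= 0" using sigma M c0 \<delta> Tm by (auto simp: D1_def D2_def)
  have "EV n. ((D1 + D2) / (c1 * c0)) * real n powr - \<delta> <= 1" using \<delta> by (intro powr_eventually_le) auto
  moreover have "EV n. (1 / c0) * real n powr - \<delta> <= 1" using \<delta> by (intro powr_eventually_le) auto
  ultimately show ?thesis using th_bounds[of Tm] kk_le_1[OF M, of Tm] eventually_ge_at_top[of 1]
  proof eventually_elim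
    case (elim n)
    have n: "real n >= 1" "real n > 0" using elim by simp_all
    show ?case
    proof (intro allI impI)
      fix \<tau> u \<zeta> assume \<tau>: "\<bar>\<tau>\<bar> <= Tm" and u: "u \<in> vrange M n" and \<zeta>: "c0 * real n powr (1/3 - \<gamma>) <= cmod \<zeta>"
        and E: "exp (c1 * cmod \<zeta>^3) <= cmod (E0 n (of_real (hs n) * \<zeta>))"
      define r where "r = cmod \<zeta>"
      have b: "1/2 <= th n \<tau>" "th n \<tau> <= 2" "kk n \<tau> u >= 0" using elim(3,4) \<tau> u by auto
      have pr: "real n powr \<delta> <= r / c0" using \<zeta> c0 by (simp add: r_def \<delta>_def field_simps)
      have inv: "real n powr - \<delta> = 1 / real n powr \<delta>" by (simp add: powr_minus divide_inverse)
      have np: "real n powr \<delta> > 0" using n by simp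
      have lp: "x * (1 / real n powr \<delta>) <= 1 ==> x <= real n powr \<delta>" for x using np by (simp add: pos_divide_le_eq)
      have "(D1 + D2) / (c1 * c0) <= real n powr \<delta>" using elim(1) unfolding inv by (rule lp)
      then have "(D1 + D2) / (c1 * c0) <= r / c0" using pr by linarith
      then have "(D1 + D2) / (c1 * c0) * (c1 * c0) <= (r / c0) * (c1 * c0)" using c0 c1 by (intro mult_right_mono) auto
      then have rb: "D1 + D2 <= c1 * r" using c0 c1 by (simp add: mult.commute)
      have "1 / c0 <= real n powr \<delta>" using elim(2) unfolding inv by (rule lp)
      then have "1 / c0 <= r / c0" using pr by linarith
      then have r1: "r >= 1" using c0 by (simp add: field_simps)
      have "real n powr \<epsilon> <= real n powr \<delta>" using n \<delta> by (intro powr_mono) auto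
      then have "M * real n powr \<epsilon> <= M * (r / c0)" using M pr by (intro mult_left_mono) auto
      then have ub: "\<bar>u\<bar> <= (M / c0) * r" using vrange_abs[OF M elim(5) u] by simp
      have "\<delta> * ln (real n) = ln (real n powr \<delta>)" using n by (simp add: ln_powr)
      also have "\<dots> <= real n powr \<delta>" using np ln_le_minus_one[of "real n powr \<delta>"] by linarith
      finally have "\<delta> * ln (real n) <= r / c0" using pr by linarith
      then have lnb: "2 * ln (real n) <= (2 / (c0 * \<delta>)) * r" using c0 \<delta> by (simp add: field_simps)
      define x where "x = kk n \<tau> u - th n \<tau> * (\<tau> * (Re \<zeta>^2 - Im \<zeta>^2) + u * Re \<zeta>)"
      have rr: "Re \<zeta>^2 + Im \<zeta>^2 = r^2" by (simp add: r_def cmod_power2)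
      have "\<bar>Re \<zeta>^2 - Im \<zeta>^2\<bar> <= r^2" unfolding rr[symmetric] abs_le_iff by simp
      then have "\<bar>\<tau>\<bar> * \<bar>Re \<zeta>^2 - Im \<zeta>^2\<bar> <= Tm * r^2" using \<tau> Tm by (intro mult_mono) auto
      moreover have "\<bar>u\<bar> * \<bar>Re \<zeta>\<bar> <= ((M / c0) * r) * r" using ub abs_Re_le_cmod[of \<zeta>] M c0 r1 by (intro mult_mono) (auto simp: r_def)
      ultimately have "\<bar>\<tau> * (Re \<zeta>^2 - Im \<zeta>^2) + u * Re \<zeta>\<bar> <= Tm * r^2 + (M / c0) * r * r"
        by (intro order_trans[OF abs_triangle_ineq]) (simp add: abs_mult)
      then have "\<bar>th n \<tau> * (\<tau> * (Re \<zeta>^2 - Im \<zeta>^2) + u * Re \<zeta>)\<bar> <= 2 * (Tm * r^2 + (M / c0) * r * r)" unfolding abs_mult[of "th n \<tau>"]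
        using b Tm M c0 r1 by (intro mult_mono) auto
      also have "\<dots> = D2 * r^2" by (simp add: D2_def power2_eq_square algebra_simps)
      finally have "- x <= D2 * r^2" using b(3) by (simp add: x_def abs_le_iff)
      moreover have "\<sigma> * u <= (\<sigma> * M / c0) * r" using mult_left_mono[of u "(M / c0) * r" \<sigma>] ub sigma by (simp add: mult.assoc)
      then have "\<sigma> * u + 2 * ln (real n) <= D1 * r" using lnb by (simp add: D1_def distrib_right)
      moreover have "D1 * r <= D1 * r^2" using r1 D by (intro mult_left_mono) (auto simp: power2_eq_square)
      moreover have "(D1 + D2) * r^2 <= (c1 * r) * r^2" using rb by (intro mult_right_mono) auto
      then have "D1 * r^2 + D2 * r^2 <= c1 * r^3" by (simp add: power2_eq_square power3_eq_cube distrib_right mult.assoc)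
      ultimately have fin: "- (c1 * r^3) - x <= - \<sigma> * u + - (2 * ln (real n))" by simp
      have "cmod (1 / EE n \<tau> u \<zeta>) = 1 / (cmod (E0 n (of_real (hs n) * \<zeta>)) * exp x)"
        unfolding norm_divide cmod_EE x_def by simp
      also have "\<dots> <= 1 / (exp (c1 * r^3) * exp x)" using E unfolding r_def[symmetric] by (intro divide_left_mono mult_right_mono mult_pos_pos) (auto intro: less_le_trans[OF exp_gt_zero])
      also have "\<dots> = exp (- (c1 * r^3) - x)" by (simp add: exp_add[symmetric] exp_minus[symmetric] exp_diff field_simps)
      also have "\<dots> <= exp (- \<sigma> * u + - (2 * ln (real n)))" using fin by simp
      also have "\<dots> = exp (- \<sigma> * u) * real n powr - 2" using n unfolding exp_add by (simp add: powr_def)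
      finally show "cmod (1 / EE n \<tau> u \<zeta>) <= exp (- \<sigma> * u) * real n powr - 2" .
    qed
  qed
qed

end

lemma has_contour_integral_translation:
  "(f has_contour_integral I) ((+) a \<circ> g) \<longleftrightarrow> ((\<lambda>w. f (a + w)) has_contour_integral I) g"
proof -
  have "vector_derivative ((+) a \<circ> g) F = vector_derivative g F" for F
    unfolding vector_derivative_def o_def by (simp add: has_vector_derivative_add_const add.commute[of a])
  then show ?thesis unfolding has_contour_integral_def by simp
qed

lemma contour_integral_translation: "contour_integral ((+) a \<circ> g) f = contour_integral g (\<lambda>w. f (a + w))"
  unfolding contour_integral_def contour_integrable_on_def has_contour_integral_translation ..

lemma valid_path_translation: "valid_path ((+) a \<circ> g) \<longleftrightarrow> valid_path g"
  by (rule valid_path_translation_eq)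

text \<open>For slope at most 1/2 one has x^3 - 3 x y^2 >= x^3 / 4, while |h|^3 <= 2 x^3.\<close>

lemma cone_right:
  assumes "0 < x" "0 <= y" "y <= x / 2"
  shows "Re (Complex x y^3) >= cmod (Complex x y)^3 / 8" "x <= cmod (Complex x y)" "cmod (Complex x y) <= 5 / 4 * x"
proof -
  have y2: "y^2 <= (x/2)^2" using assms by (intro power_mono) auto
  then have y2': "y^2 <= x^2 / 4" by (simp add: power2_eq_square)
  show "x <= cmod (Complex x y)" using complex_Re_le_cmod[of "Complex x y"] by simp
  have "cmod (Complex x y)^2 = x^2 + y^2" by (simp add: cmod_power2)
  also have "\<dots> <= (5/4 * x)^2"
  proof -
    have "(5/4 * x)^2 = 25/16 * x^2" by (simp add: power2_eq_square)
    then show ?thesis using y2' zero_le_power2[of x] by linarith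
  qed
  finally have sq: "cmod (Complex x y)^2 <= (5 / 4 * x)^2" .
  show b: "cmod (Complex x y) <= 5 / 4 * x" by (rule power2_le_imp_le[OF sq]) (use assms(1) in linarith)
  have "cmod (Complex x y)^3 <= (5/4 * x)^3" by (rule power_mono[OF b norm_ge_zero])
  also have "\<dots> = 125/64 * x^3" by (simp add: power3_eq_cube)
  also have "\<dots> <= 2 * x^3" using assms by simp
  finally have 1: "cmod (Complex x y)^3 <= 2 * x^3" .
  have "x * y^2 <= x * (x^2 / 4)" using y2' assms by (intro mult_left_mono) auto
  then have "x^3 - 3 * x * y^2 >= x^3 / 4" by (simp add: power3_eq_cube power2_eq_square)
  then show "Re (Complex x y^3) >= cmod (Complex x y)^3 / 8" using 1 unfolding Re_cube by simp
qed

text \<open>At h = \<rho> (- 1 + i) the real part of h^3 is 2 \<rho>^3; the shift t <= \<rho> / 4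
  covers the end of the vee, whose vertex is not at the origin.\<close>

lemma cone_left:
  assumes "\<rho> > 0" "0 <= t" "t <= \<rho> / 4"
  shows "Re (Complex (- (\<rho> + t)) \<rho>^3) >= cmod (Complex (- (\<rho> + t)) \<rho>)^3 / 8" "\<rho> <= cmod (Complex (- (\<rho> + t)) \<rho>)" "cmod (Complex (- (\<rho> + t)) \<rho>) <= 7 / 4 * \<rho>"
proof -
  define h where "h = Complex (- (\<rho> + t)) \<rho>"
  have "(\<rho> + t)^2 <= (5/4 * \<rho>)^2" using assms by (intro power_mono) auto
  then have q: "(\<rho> + t)^2 <= 25/16 * \<rho>^2" by (simp add: power_mult_distrib power2_eq_square)
  have "cmod h^2 = (\<rho> + t)^2 + \<rho>^2" unfolding cmod_power2 h_def complex.sel power2_minus ..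
  also have "\<dots> <= (7/4 * \<rho>)^2"
  proof -
    have "(7/4 * \<rho>)^2 = 49/16 * \<rho>^2" by (simp add: power2_eq_square)
    then show ?thesis using q zero_le_power2[of \<rho>] by linarith
  qed
  finally have sq: "cmod h^2 <= (7 / 4 * \<rho>)^2" .
  have b: "cmod h <= 7 / 4 * \<rho>" by (rule power2_le_imp_le[OF sq]) (use assms(1) in linarith)
  have "cmod h^3 <= (7/4 * \<rho>)^3" by (rule power_mono[OF b norm_ge_zero])
  also have "\<dots> = 343/64 * \<rho>^3" by (simp add: power3_eq_cube)
  also have "\<dots> <= 8 * \<rho>^3" using assms by simp
  finally have 1: "cmod h^3 / 8 <= \<rho> * \<rho>^2" by (simp add: power3_eq_cube power2_eq_square)
  have "\<rho>^2 <= 3 * \<rho>^2 - (\<rho> + t)^2" using q zero_le_power2[of \<rho>] by linarith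
  then have "\<rho> * \<rho>^2 <= (\<rho> + t) * (3 * \<rho>^2 - (\<rho> + t)^2)" using assms(1,2) by (intro mult_mono) simp_all
  also have "\<dots> = Re (h^3)" unfolding Re_cube h_def complex.sel by (simp add: power3_eq_cube power2_eq_square algebra_simps)
  finally have 2: "\<rho> * \<rho>^2 <= Re (h^3)" .
  from 1 2 b show "Re (Complex (- (\<rho> + t)) \<rho>^3) >= cmod (Complex (- (\<rho> + t)) \<rho>)^3 / 8" "cmod (Complex (- (\<rho> + t)) \<rho>) <= 7 / 4 * \<rho>" unfolding h_def by linarith+
  show "\<rho> <= cmod (Complex (- (\<rho> + t)) \<rho>)" using abs_Im_le_cmod[of h] assms(1) by (simp add: h_def)
qed

section \<open>Contours joining the Airy scale to a macroscopic distance\<close>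

context nibm begin

text \<open>Descends from the end of \<open>macro_path\<close> to the real axis, so that reflection
  can close the contour. As the path is bounded by some B, the rate c0 / 2 is at least c3 |h|^3 with
  c3 = c0 / (2 B^3), the form of bound that \<open>cone_bound\<close> gives.\<close>

lemma macro_rest:
  fixes P :: complex and sg c0 Lmin :: real
  assumes sg: "sg = 1 \<or> sg = -1" and P: "0 < sg * Re P" "0 < Im P"
    and c0: "c0 > 0" "EV n. cmod (E0 n P) >= exp (real n * c0)"
  shows "\<exists>G L K c3. path_bound G K \<and> pathstart G = P \<and> pathfinish G = of_real (sg * L) \<and> L > Lmin \<and> c3 > 0
     \<and> (\<forall>h\<in>path_image G. 0 <= Im h \<and> sg * Re h > sg * Re P / 2)
     \<and> (EV n. \<forall>h\<in>path_image G. cmod (E0 n h) >= exp (c3 * (real n * cmod h^3)))"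
proof -
  obtain g V L where g: "polynomial_function g" "pathstart g = P" "pathfinish g = Complex (sg * L) 1" and L: "L > Lmin" "L > sg * Re P"
    and V: "bounded V" "path_image g \<subseteq> V" "\<And>h. h \<in> V ==> Im h > 0 \<and> sg * Re h > sg * Re P / 2"
    and ev: "EV n. \<forall>h. (h \<in> V \<or> h \<in> closed_segment (Complex (sg * L) 1) (of_real (sg * L))) --> cmod (E0 n h) >= exp (real n * (c0 / 2))"
    using macro_path[OF sg P c0, of Lmin] by (elim exE conjE) (rule that, assumption+, blast+)
  obtain Kg where Kg: "path_bound g Kg" using path_bound_polynomial[OF g(1)] by blast
  define l where "l = linepath (Complex (sg * L) 1) (of_real (sg * L))"
  define G where "G = g +++ l"
  have j: "pathfinish g = pathstart l" by (simp add: g l_def)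
  have pb: "path_bound G (Kg + cmod (of_real (sg * L) - Complex (sg * L) 1))" unfolding G_def l_def
    by (rule path_bound_join[OF Kg path_bound_linepath]) (simp add: g)
  have im: "path_image G = path_image g \<union> closed_segment (Complex (sg * L) 1) (of_real (sg * L))"
    unfolding G_def by (simp add: path_image_join j) (simp add: l_def)
  have "bounded (path_image G)" unfolding im using V by (intro bounded_Un[THEN iffD2] conjI bounded_subset[OF V(1,2)] bounded_closed_segment)
  then obtain B where B: "B > 0" "\<And>h. h \<in> path_image G ==> cmod h <= B" unfolding bounded_pos by blast
  have seg: "Im h >= 0 \<and> sg * Re h = L" if hseg: "h \<in> closed_segment (Complex (sg * L) 1) (of_real (sg * L))" for h
  proof -
    obtain t where t: "0 <= t" "t <= 1" "h = (1 - t) *\<^sub>R Complex (sg * L) 1 + t *\<^sub>R of_real (sg * L)" using hseg unfolding in_segment by blast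
    have "Im h = 1 - t" unfolding t(3) by simp
    moreover have "Re h = sg * L" unfolding t(3) by (simp add: left_diff_distrib)
    moreover have "sg * (sg * L) = L" using sg by (elim disjE) simp_all
    ultimately show ?thesis using t(1,2) by simp
  qed
  have pts: "0 <= Im h \<and> sg * Re h > sg * Re P / 2" if "h \<in> path_image G" for h
  proof (cases "h \<in> path_image g")
    case True
    then show ?thesis using V(2) V(3)[of h] by auto
  next
    case False
    then have "Im h >= 0 \<and> sg * Re h = L" using that seg unfolding im by blast
    then show ?thesis using L(2) P(1) by linarith
  qed
  define c3 where "c3 = c0 / 2 / B^3"
  have c3: "c3 > 0" using c0 B by (simp add: c3_def)
  have "EV n. \<forall>h\<in>path_image G. cmod (E0 n h) >= exp (c3 * (real n * cmod h^3))"
    using ev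
  proof eventually_elim
    case (elim n)
    show ?case
    proof
      fix h assume h: "h \<in> path_image G"
      have "c3 * (real n * cmod h^3) <= c3 * (real n * B^3)" using B h c3 by (intro mult_left_mono power_mono) auto
      also have "\<dots> = real n * (c0 / 2)" using B by (simp add: c3_def)
      finally have "exp (c3 * (real n * cmod h^3)) <= exp (real n * (c0 / 2))" by simp
      also have "\<dots> <= cmod (E0 n h)" using elim h V(2) unfolding im by blast
      finally show "exp (c3 * (real n * cmod h^3)) <= cmod (E0 n h)" .
    qed
  qed
  moreover have "pathstart G = P" "pathfinish G = of_real (sg * L)" by (simp_all add: G_def g l_def)
  ultimately show ?thesis using pb L(1) c3 pts by blast
qed

text \<open>On the left the vee is quitted at height \<rho>, at a point that depends on n through
  the vertex; a horizontal segment leads from it to the fixed start \<open>PL\<close> of the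
  macroscopic path. On the right there is no vee: the contour starts on the real axis at gap / 4,
  short of the first initial point, rises to the line of slope 1/2 and follows it to
  \<open>PR\<close>.\<close>

lemma contours_exist:
  assumes s: "s > 0" and \<rho>1: "\<rho>1 > 0"
  shows "\<exists>\<rho> c1 K. 0 < \<rho> \<and> \<rho> <= \<rho>1 \<and> 0 < c1 \<and> 0 <= K \<and> (EV n. \<exists>RL UR L L'.
     path_bound RL K \<and> pathstart RL = of_real (hs n) * wvee s (\<rho> / hs n) \<and> pathfinish RL = of_real (- L) \<and> L > Lmin \<and>
     path_bound UR K \<and> pathstart UR = of_real (gap n / 4) \<and> pathfinish UR = of_real L' \<and> L' > Lmin \<and>
     (\<forall>h\<in>path_image RL. 0 <= Im h \<and> Re h <= 0 \<and> gap n / 8 <= cmod h \<and> exp (c1 * (real n * cmod h^3)) <= cmod (E0 n h)) \<and>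
     (\<forall>h\<in>path_image UR. 0 <= Im h \<and> gap n / 4 <= Re h \<and> gap n / 8 <= cmod h \<and> exp (c1 * (real n * cmod h^3)) <= cmod (E0 n h)))"
proof -
  obtain \<rho>0 c1 where \<rho>0: "\<rho>0 > 0" and c1: "c1 > 0" and cone: "EV n. \<forall>h. (cmod h <= gap n / 2 \<or> \<bar>Im h\<bar> >= cmod h / 4) \<and> Re (h^3) >= cmod h^3 / 8
     \<and> gap n / 8 <= cmod h \<and> cmod h <= \<rho>0 --> cmod (E0 n h) >= exp (c1 * (real n * cmod h^3))" using cone_bound by blast
  \<comment> \<open>Halved because \<open>PL\<close>, \<open>PR\<close> and the segments leading to
    them have modulus up to 7 \<rho> / 4, which must stay within the radius \<rho>0 of
    \<open>cone_bound\<close>.\<close>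
  define \<rho> where "\<rho> = min (\<rho>0 / 2) \<rho>1"
  have \<rho>: "\<rho> > 0" "2 * \<rho> <= \<rho>0" "\<rho> <= \<rho>1" using \<rho>0 \<rho>1 unfolding \<rho>_def by (simp_all add: min_def)
  have gapsmall: "EV n. gap n < e" if "e > 0" for e using order_tendstoD(2)[OF gap_tendsto_0 that] .
  have cn: "EV n. cmod (E0 n P) >= exp (real n * (c1 * \<rho>^3))" if "\<rho> <= cmod P" "cmod P <= 2 * \<rho>" "\<bar>Im P\<bar> >= cmod P / 4" "Re (P^3) >= cmod P^3 / 8" for P
    using cone gapsmall[OF \<rho>(1)]
  proof eventually_elim
    case (elim n)
    have "gap n / 8 <= cmod P" "cmod P <= \<rho>0" using elim(2) that(1,2) \<rho> by linarith+
    then have 1: "exp (c1 * (real n * cmod P^3)) <= cmod (E0 n P)" using elim(1) that by blast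
    have "real n * (c1 * \<rho>^3) <= real n * (c1 * cmod P^3)" using that(1) \<rho>(1) c1 by (intro mult_left_mono power_mono) auto
    also have "\<dots> = c1 * (real n * cmod P^3)" by simp
    finally have "exp (real n * (c1 * \<rho>^3)) <= exp (c1 * (real n * cmod P^3))" by simp
    then show ?case using 1 by linarith
  qed
  have c0: "c1 * \<rho>^3 > 0" using c1 \<rho> by simp
  define PL where "PL = Complex (- \<rho>) \<rho>"
  define PR where "PR = Complex \<rho> (\<rho> / 2)"
  note cl = cone_left[OF \<rho>(1), of 0, simplified, folded PL_def]
  note cr = cone_right[OF \<rho>(1), of "\<rho> / 2", folded PR_def]
  have evL: "EV n. cmod (E0 n PL) >= exp (real n * (c1 * \<rho>^3))"
    by (rule cn) (use cl \<rho>(1) in \<open>auto simp: PL_def\<close>)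
  have evR: "EV n. cmod (E0 n PR) >= exp (real n * (c1 * \<rho>^3))"
    by (rule cn) (use cr \<rho>(1) in \<open>auto simp: PR_def\<close>)
  obtain GL LL KL cL where GL: "path_bound GL KL" "pathstart GL = PL" "pathfinish GL = of_real (- 1 * LL)" "LL > Lmin" "cL > 0"
    "\<And>h. h \<in> path_image GL ==> 0 <= Im h \<and> - 1 * Re h > - 1 * Re PL / 2"
    "EV n. \<forall>h\<in>path_image GL. cmod (E0 n h) >= exp (cL * (real n * cmod h^3))"
    using macro_rest[of "-1" PL, OF _ _ _ c0 evL, of Lmin] \<rho>(1) by (auto simp: PL_def)
  obtain GR LR KR cR where GR: "path_bound GR KR" "pathstart GR = PR" "pathfinish GR = of_real (1 * LR)" "LR > Lmin" "cR > 0"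
    "\<And>h. h \<in> path_image GR ==> 0 <= Im h \<and> 1 * Re h > 1 * Re PR / 2"
    "EV n. \<forall>h\<in>path_image GR. cmod (E0 n h) >= exp (cR * (real n * cmod h^3))"
    using macro_rest[of 1 PR, OF _ _ _ c0 evR, of Lmin] \<rho>(1) by (auto simp: PR_def)
  define c2' where "c2' = min c1 (min cL cR)"
  have c2': "c2' > 0" "c2' <= c1" "c2' <= cL" "c2' <= cR" using c1 GL(5) GR(5) unfolding c2'_def by (simp_all add: min_def)
  \<comment> \<open>A length bound free of n: the connecting segments measure at most \<rho> on the
    left and 4 \<rho> on the right.\<close>
  define K where "K = 4 * \<rho> + \<bar>KL\<bar> + \<bar>KR\<bar>"
  have weak: "exp (c2' * (real n * cmod h^3)) <= x" if "exp (c * (real n * cmod h^3)) <= x" "c2' <= c" for n h c x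
  proof -
    have "c2' * (real n * cmod h^3) <= c * (real n * cmod h^3)" using that by (intro mult_right_mono) auto
    then have "exp (c2' * (real n * cmod h^3)) <= exp (c * (real n * cmod h^3))" by simp
    then show ?thesis using that(1) by linarith
  qed
  have "EV n. \<exists>RL UR L L'.
     path_bound RL K \<and> pathstart RL = of_real (hs n) * wvee s (\<rho> / hs n) \<and> pathfinish RL = of_real (- L) \<and> L > Lmin \<and>
     path_bound UR K \<and> pathstart UR = of_real (gap n / 4) \<and> pathfinish UR = of_real L' \<and> L' > Lmin \<and>
     (\<forall>h\<in>path_image RL. 0 <= Im h \<and> Re h <= 0 \<and> gap n / 8 <= cmod h \<and> exp (c2' * (real n * cmod h^3)) <= cmod (E0 n h)) \<and>
     (\<forall>h\<in>path_image UR. 0 <= Im h \<and> gap n / 4 <= Re h \<and> gap n / 8 <= cmod h \<and> exp (c2' * (real n * cmod h^3)) <= cmod (E0 n h))"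
    using cone gapsmall[OF \<rho>(1)] hs_le_gap[of s] gapsmall[OF half_gt_zero[OF \<rho>(1)]] eventually_gt_at_top[of 0] GL(7) GR(7)
  proof eventually_elim
    case (elim n)
    have hp: "hs n > 0" using hs_pos elim(5) by simp
    have gp: "gap n > 0" using gap_pos elim(5) by simp
    have g2: "gap n < \<rho>" using elim(2) .
    define W where "W = of_real (hs n) * wvee s (\<rho> / hs n)"
    have W: "W = Complex (- (\<rho> + hs n * s)) \<rho>" using hp \<rho>(1) by (simp add: W_def complex_eq_iff algebra_simps)
    have hss: "0 <= hs n * s" "hs n * s <= \<rho> / 4" using elim(3) elim(4) \<rho>(1) hp s by (auto simp: mult.commute)
    define RL where "RL = linepath W PL +++ GL"
    have dW: "cmod (PL - W) <= \<rho>"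
    proof -
      have "PL - W = of_real (hs n * s)" by (simp add: W PL_def complex_eq_iff)
      then have "cmod (PL - W) = hs n * s" using hss(1) by (simp only: norm_of_real abs_of_nonneg)
      then show ?thesis using hss \<rho>(1) by linarith
    qed
    have RL1: "path_bound RL K" unfolding RL_def
      by (rule path_bound_mono[OF path_bound_join[OF path_bound_linepath GL(1)]]) (use dW \<rho>(1) GL(2) in \<open>auto simp: K_def\<close>)
    have RL2: "path_image RL = closed_segment W PL \<union> path_image GL" unfolding RL_def by (subst path_image_join) (auto simp: GL(2))
    have RL3: "0 <= Im h \<and> Re h <= 0 \<and> gap n / 8 <= cmod h \<and> exp (c2' * (real n * cmod h^3)) <= cmod (E0 n h)" if "h \<in> path_image RL" for h
    proof (cases "h \<in> path_image GL")
      case True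
      have b: "0 <= Im h" "\<rho> / 2 < - Re h" using GL(6)[OF True] by (auto simp: PL_def)
      have "\<rho> / 2 < cmod h" using b(2) abs_Re_le_cmod[of h] by linarith
      then have "gap n / 8 <= cmod h" using g2 gp by linarith
      moreover have "exp (cL * (real n * cmod h^3)) <= cmod (E0 n h)" using elim(6) True by blast
      ultimately show ?thesis using b \<rho>(1) weak[OF _ c2'(3)] by auto
    next
      case False
      then have "h \<in> closed_segment W PL" using that RL2 by blast
      then obtain t where t: "0 <= t" "t <= 1" "h = (1 - t) *\<^sub>R W + t *\<^sub>R PL" unfolding in_segment by blast
      define d where "d = (1 - t) * (hs n * s)"
      have h: "h = Complex (- (\<rho> + d)) \<rho>" unfolding t(3) d_def by (simp add: W PL_def complex_eq_iff algebra_simps)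
      have "d <= 1 * (hs n * s)" unfolding d_def using t hss by (intro mult_right_mono) auto
      then have d: "0 <= d" "d <= \<rho> / 4" using t hss by (auto simp: d_def)
      note c = cone_left[OF \<rho>(1) d, folded h]
      have "\<bar>Im h\<bar> >= cmod h / 4" using c(3) \<rho>(1) by (simp add: h)
      moreover have "gap n / 8 <= cmod h" "cmod h <= \<rho>0" using c(2,3) g2 gp \<rho> by linarith+
      ultimately have "exp (c1 * (real n * cmod h^3)) <= cmod (E0 n h)" using elim(1) c(1) by blast
      then have "exp (c2' * (real n * cmod h^3)) <= cmod (E0 n h)" by (rule weak[OF _ c2'(2)])
      moreover have "0 <= Im h" "Re h <= 0" using \<rho>(1) d by (simp_all add: h)
      ultimately show ?thesis using \<open>gap n / 8 <= cmod h\<close> by blast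
    qed
    define q where "q = gap n / 4"
    have q: "0 < q" "q < \<rho>" using gp g2 by (auto simp: q_def)
    define UR where "UR = linepath (of_real q) (Complex q (q/2)) +++ linepath (Complex q (q/2)) PR +++ GR"
    have d1: "cmod (Complex q (q/2) - of_real q) <= \<rho>"
    proof -
      have "Complex q (q/2) - of_real q = \<i> * of_real (q/2)" by (simp add: complex_eq_iff)
      then have "cmod (Complex q (q/2) - of_real q) = \<bar>q/2\<bar>" by (simp only: norm_mult norm_of_real norm_ii mult_1)
      then show ?thesis using q by simp
    qed
    have d2: "cmod (PR - Complex q (q/2)) <= 3 * \<rho>"
    proof -
      have "cmod (PR - Complex q (q/2)) <= \<bar>Re (PR - Complex q (q/2))\<bar> + \<bar>Im (PR - Complex q (q/2))\<bar>" by (rule cmod_le)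
      also have "\<dots> <= 3 * \<rho>" using q by (simp add: PR_def)
      finally show ?thesis .
    qed
    have UR1: "path_bound UR K" unfolding UR_def
      by (rule path_bound_mono[OF path_bound_join[OF path_bound_linepath path_bound_join[OF path_bound_linepath GR(1)]]])
        (use d1 d2 \<rho>(1) GR(2) in \<open>auto simp: K_def\<close>)
    have UR2: "path_image UR = closed_segment (of_real q) (Complex q (q/2)) \<union> closed_segment (Complex q (q/2)) PR \<union> path_image GR"
      unfolding UR_def by (subst path_image_join, simp add: GR(2))+ (auto simp: GR(2))
    have UR3: "0 <= Im h \<and> gap n / 4 <= Re h \<and> gap n / 8 <= cmod h \<and> exp (c2' * (real n * cmod h^3)) <= cmod (E0 n h)" if "h \<in> path_image UR" for h
    proof (cases "h \<in> path_image GR")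
      case True
      have b: "0 <= Im h" "\<rho> / 2 < Re h" using GR(6)[OF True] by (auto simp: PR_def)
      have "\<rho> / 2 < cmod h" using b(2) abs_Re_le_cmod[of h] by linarith
      then have "gap n / 8 <= cmod h" using g2 gp by linarith
      moreover have "exp (cR * (real n * cmod h^3)) <= cmod (E0 n h)" using elim(7) True by blast
      ultimately show ?thesis using b g2 gp weak[OF _ c2'(4)] by auto
    next
      case False
      have "\<exists>x y. h = Complex x y \<and> q <= x \<and> x <= \<rho> \<and> 0 <= y \<and> y <= x / 2 \<and> (x = q \<or> y = x / 2)"
      proof (cases "h \<in> closed_segment (of_real q) (Complex q (q/2))")
        case True
        then obtain t where t: "0 <= t" "t <= 1" "h = (1 - t) *\<^sub>R of_real q + t *\<^sub>R Complex q (q/2)" unfolding in_segment by blast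
        have "h = Complex q (t * (q / 2))" unfolding t(3) by (simp add: complex_eq_iff algebra_simps)
        moreover have "t * (q / 2) <= 1 * (q / 2)" using t q by (intro mult_right_mono) auto
        moreover have "0 <= t * (q / 2)" using t q by simp
        ultimately show ?thesis using q by (intro exI[of _ q] exI[of _ "t * (q / 2)"]) auto
      next
        case False
        then have "h \<in> closed_segment (Complex q (q/2)) PR" using that UR2 \<open>h \<notin> path_image GR\<close> by blast
        then obtain t where t: "0 <= t" "t <= 1" "h = (1 - t) *\<^sub>R Complex q (q/2) + t *\<^sub>R PR" unfolding in_segment by blast
        define x where "x = q + t * (\<rho> - q)"
        have "h = Complex x (x / 2)" unfolding t(3) x_def by (simp add: PR_def complex_eq_iff algebra_simps)
        moreover have "0 <= t * (\<rho> - q)" using t q by simp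
        moreover have "t * (\<rho> - q) <= 1 * (\<rho> - q)" using t q by (intro mult_right_mono) auto
        ultimately have "h = Complex x (x / 2)" "q <= x" "x <= \<rho>" unfolding x_def by simp_all
        then show ?thesis using q by (intro exI[of _ x] exI[of _ "x / 2"] conjI) auto
      qed
      then obtain x y where h: "h = Complex x y" and xy: "q <= x" "x <= \<rho>" "0 <= y" "y <= x / 2" "x = q \<or> y = x / 2" by blast
      have x0: "0 < x" using q xy by linarith
      note c = cone_right[OF x0 xy(3,4), folded h]
      have "cmod h <= gap n / 2 \<or> \<bar>Im h\<bar> >= cmod h / 4"
      proof (cases "x = q")
        case True
        then have "cmod h <= gap n / 2" using c(3) gp by (simp add: q_def)
        then show ?thesis ..
      next
        case False
        then have "y = x / 2" using xy by blast
        then have "\<bar>Im h\<bar> = x / 2" using x0 by (simp add: h)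
        then have "\<bar>Im h\<bar> >= cmod h / 4" using c(3) x0 by linarith
        then show ?thesis ..
      qed
      moreover have g8: "gap n / 8 <= cmod h" using c(2) xy(1) gp unfolding q_def by linarith
      moreover have "cmod h <= \<rho>0" using c(3) xy(2) \<rho> by linarith
      ultimately have "exp (c1 * (real n * cmod h^3)) <= cmod (E0 n h)" using elim(1) c(1) by blast
      then have "exp (c2' * (real n * cmod h^3)) <= cmod (E0 n h)" by (rule weak[OF _ c2'(2)])
      moreover have "0 <= Im h" "gap n / 4 <= Re h" using xy by (auto simp: h q_def)
      ultimately show ?thesis using g8 by blast
    qed
    have A: "pathstart RL = of_real (hs n) * wvee s (\<rho> / hs n)" "pathfinish RL = of_real (- LL)"
      using GL(2,3) by (simp_all add: RL_def W_def)
    have B: "pathstart UR = of_real (gap n / 4)" "pathfinish UR = of_real LR"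
      using GR(2,3) by (simp_all add: UR_def q_def)
    show ?case
      by (rule exI[of _ RL], rule exI[of _ UR], rule exI[of _ LL], rule exI[of _ LR], intro conjI ballI RL1 UR1 A B GL(4) GR(4))
        (use RL3 UR3 in blast)+
  qed
  moreover have "K >= 0" using \<rho>(1) by (simp add: K_def)
  ultimately show ?thesis using \<rho> c2' by blast
qed

end

section \<open>The kernel in the local variable\<close>

lemma contour_integral_cmult: "contour_integral g (\<lambda>w. c * f w) = c * contour_integral g f"
  unfolding contour_integral_integral by (simp add: mult.assoc)

lemma exp_gmun:
  assumes "n > 0" "\<And>j. j \<in> {1..n} ==> z \<noteq> of_real (X0 n j)"
  shows "exp (of_nat n * gmun X0 n z) = (\<Prod>j=1..n. z - of_real (X0 n j))"
proof -
  have "of_nat n * gmun X0 n z = (\<Sum>j=1..n. Ln (z - of_real (X0 n j)))" using assms(1) by (simp add: gmun_def)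
  then have "exp (of_nat n * gmun X0 n z) = (\<Prod>j=1..n. exp (Ln (z - of_real (X0 n j))))" by (simp add: exp_sum)
  also have "\<dots> = (\<Prod>j=1..n. z - of_real (X0 n j))" using assms(2) by (intro prod.cong) auto
  finally show ?thesis .
qed

text \<open>With z = x + h and y = x + T G + \<nu>, the conjugating exponent cancels every term
  mixing G with T or \<nu>. The remaining G terms are - N G h, which belongs to \<open>E0\<close>,
  and - N G x, free of T and \<nu>, which goes into \<open>Cn\<close>.\<close>

lemma complete_square_conjugated:
  fixes N T G \<nu> h x :: "'a :: field_char_0"
  assumes "T \<noteq> 0"
  shows "N / (2 * T) * (h - (T * G + \<nu>))^2 + (- N * G * (x + T * G + \<nu>) + N * G^2 * T / 2)
    = N * h^2 / (2 * T) - N * G * h - N * h * \<nu> / T + N * \<nu>^2 / (2 * T) - N * G * x"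
  using assms by (simp add: field_simps power2_eq_square)

context nibm begin

definition pX where "pX n z = (\<Prod>j=1..n. z - complex_of_real (X0 n j))" for n z

definition Phi where "Phi n t y z = exp (of_nat n / (2 * of_real t) * (z - of_real y)^2) * pX n z * exp (of_real (fconj psi xs n t y))"
  for n and t y :: real and z

text \<open>Independent of \<tau>, v and \<zeta>, hence the same in the numerator in z and in the
  denominator in w, where it cancels.\<close>

definition Cn where "Cn n = (\<Prod>j=1..n. complex_of_real (xs - X0 n j)) * exp (- (of_nat n * of_real G0 * of_real xs))" for n

definition yAi where "yAi n \<tau> v = xAi psi xs n \<tau> + v / (c2 psi xs * real n powr (2/3))" for n \<tau> v

abbreviation scaledK where "scaledK n \<tau>1 \<tau>2 u v \<equiv> KNIBMconj X0 psi xs n (tAi psi xs n \<tau>1) (tAi psi xs n \<tau>2) (yAi n \<tau>1 u) (yAi n \<tau>2 v) / of_real (c2 psi xs * real n powr (2/3))" for n \<tau>1 \<tau>2 u v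

lemma scaling_identities:
  fixes \<tau> v :: real
  assumes n: "n > 0" and t: "tAi psi xs n \<tau> > 0"
  defines "\<nu> \<equiv> v / (c2 psi xs * real n powr (2/3))" and "t \<equiv> tAi psi xs n \<tau>"
  shows "real n * hs n * \<nu> / t = th n \<tau> * v"
    and "real n * (hs n)^2 * (1 / (2 * t) - 1 / (2 * t0)) = - (th n \<tau> * \<tau>)"
    and "real n * \<nu>^2 / (2 * t) = kk n \<tau> v"
    and "real n * hs n / (c2 psi xs * real n powr (2/3)) = t0"
proof -
  \<comment> \<open>In m = n^(1/3) all powers of n become integer powers and the identities
    rational.\<close>
  define m where "m = real n powr (1/3)"
  have m: "m > 0" using n by (simp add: m_def)
  have nm: "real n = m^3" using n by (simp add: m_def powr_power)
  have n2: "real n powr (2/3) = m^2" using n by (simp add: m_def powr_power)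
  have hm: "hs n = c2 psi xs * t0 / m" using powr_minus_divide[of "real n" "1/3"] by (simp add: hs_def cc_def m_def)
  have tm: "t = t0 + 2 * \<tau> / ((c2 psi xs)^2 * m)" by (simp add: t_def tAi_def t0_def m_def)
  have tp: "t > 0" using t by (simp add: t_def)
  have th': "th n \<tau> = t0 / t" by (simp add: th_def t_def)
  have c: "c2 psi xs > 0" by (rule cc)
  have t0p: "t0 > 0" by (rule t0)
  have \<nu>: "\<nu> = v / (c2 psi xs * m^2)" by (simp add: \<nu>_def n2)
  show "real n * hs n * \<nu> / t = th n \<tau> * v" unfolding nm hm \<nu> th' using m c tp t0p by (simp add: power3_eq_cube power2_eq_square)
  show "real n * hs n / (c2 psi xs * real n powr (2/3)) = t0"
  proof -
    have "real n * hs n = c2 psi xs * t0 * m^2" unfolding nm hm using m by (simp add: power3_eq_cube power2_eq_square)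
    then show ?thesis unfolding n2 using m c by simp
  qed
  have "kk n \<tau> v = v^2 / (2 * t * (c2 psi xs)^2 * m)" by (simp add: kk_def m_def t_def)
  also have "\<dots> = real n * \<nu>^2 / (2 * t)" unfolding nm \<nu> using m c tp by (simp add: power3_eq_cube power2_eq_square)
  finally show "real n * \<nu>^2 / (2 * t) = kk n \<tau> v" ..
  have "1 / (2 * t) - 1 / (2 * t0) = - (t - t0) / (2 * t * t0)" using tp t0p by (simp add: field_simps)
  also have "t - t0 = 2 * \<tau> / ((c2 psi xs)^2 * m)" by (simp add: tm)
  also have "- (2 * \<tau> / ((c2 psi xs)^2 * m)) / (2 * t * t0) = - \<tau> / ((c2 psi xs)^2 * m * t * t0)" by simp
  finally have "1 / (2 * t) - 1 / (2 * t0) = - \<tau> / ((c2 psi xs)^2 * m * t * t0)" .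
  then show "real n * (hs n)^2 * (1 / (2 * t) - 1 / (2 * t0)) = - (th n \<tau> * \<tau>)" unfolding nm hm th' using m c tp t0p
    by (simp add: power3_eq_cube power2_eq_square)
qed

lemma Phi_eq:
  assumes n: "n > 0" and t: "tAi psi xs n \<tau> > 0" and X: "\<And>j. j \<in> {1..n} ==> X0 n j \<noteq> xs"
  shows "Phi n (tAi psi xs n \<tau>) (yAi n \<tau> v) (of_real xs + of_real (hs n) * \<zeta>) = Cn n * EE n \<tau> v \<zeta>"
proof -
  define t where "t = tAi psi xs n \<tau>"
  define \<nu> where "\<nu> = v / (c2 psi xs * real n powr (2/3))"
  define h where "h = complex_of_real (hs n) * \<zeta>"
  have tp: "t > 0" using t by (simp add: t_def)
  have y: "yAi n \<tau> v = xs + t * G0 + \<nu>" by (simp add: yAi_def xAi_def t_def \<nu>_def G0_def)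
  note sc = scaling_identities(1)[OF n t, where v = v, folded \<nu>_def t_def] scaling_identities(2)[OF n t, folded t_def]
    scaling_identities(3)[OF n t, where v = v, folded \<nu>_def t_def]
  have yd: "of_real xs + h - complex_of_real (yAi n \<tau> v) = h - (of_real t * of_real G0 + of_real \<nu>)" by (simp add: y)
  have fc: "complex_of_real (fconj psi xs n t (yAi n \<tau> v)) = - of_nat n * of_real G0 * (of_real xs + of_real t * of_real G0 + of_real \<nu>) + of_nat n * (of_real G0)^2 * of_real t / 2"
    by (simp add: fconj_def y G0_def)
  have "of_nat n / (2 * of_real t) * (of_real xs + h - complex_of_real (yAi n \<tau> v))^2 + of_real (fconj psi xs n t (yAi n \<tau> v))
     = of_nat n / (2 * of_real t) * (h - (of_real t * of_real G0 + of_real \<nu>))^2 + (- of_nat n * of_real G0 * (of_real xs + of_real t * of_real G0 + of_real \<nu>) + of_nat n * (of_real G0)^2 * of_real t / 2)"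
    unfolding yd fc ..
  also have "\<dots> = of_nat n * h^2 / (2 * of_real t) - of_nat n * of_real G0 * h - of_nat n * h * of_real \<nu> / of_real t + of_nat n * (of_real \<nu>)^2 / (2 * of_real t) - of_nat n * of_real G0 * of_real xs"
    by (rule complete_square_conjugated) (use tp in simp)
  also have "of_nat n * h * of_real \<nu> / of_real t = of_real (real n * hs n * \<nu> / t) * \<zeta>" by (simp add: h_def)
  also have "of_nat n * (of_real \<nu>)^2 / (2 * of_real t) = complex_of_real (real n * \<nu>^2 / (2 * t))" by simp
  also have "of_nat n * h^2 / (2 * of_real t) = of_nat n * h^2 / of_real (2 * t0) + of_real (real n * (hs n)^2 * (1 / (2 * t) - 1 / (2 * t0))) * \<zeta>^2"
    by (simp add: h_def power_mult_distrib algebra_simps)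
  finally have e: "of_nat n / (2 * of_real t) * (of_real xs + h - complex_of_real (yAi n \<tau> v))^2 + of_real (fconj psi xs n t (yAi n \<tau> v))
     = of_nat n * (h^2 / of_real (2 * t0) - of_real G0 * h) + (of_real (kk n \<tau> v) - of_real (th n \<tau>) * (of_real \<tau> * \<zeta>^2 + of_real v * \<zeta>)) + - (of_nat n * of_real G0 * of_real xs)"
    unfolding sc by (simp add: algebra_simps)
  have "pX n (of_real xs + h) = (\<Prod>j=1..n. complex_of_real (xs - X0 n j) * (1 + of_real (a n j) * h))"
    unfolding pX_def
  proof (rule prod.cong[OF refl])
    fix j assume "j \<in> {1..n}"
    then have ne: "complex_of_real (xs - X0 n j) \<noteq> 0" using X[of j] by simp
    have "complex_of_real (xs - X0 n j) * of_real (a n j) = 1" unfolding a_def of_real_divide of_real_1 using ne by (simp del: of_real_diff)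
    then have "complex_of_real (xs - X0 n j) * (1 + of_real (a n j) * h) = complex_of_real (xs - X0 n j) + h"
      by (simp add: distrib_left mult.assoc[symmetric] del: of_real_diff)
    then show "of_real xs + h - complex_of_real (X0 n j) = complex_of_real (xs - X0 n j) * (1 + of_real (a n j) * h)" by simp
  qed
  then have p: "pX n (of_real xs + h) = (\<Prod>j=1..n. complex_of_real (xs - X0 n j)) * (\<Prod>j=1..n. 1 + of_real (a n j) * h)" by (simp only: prod.distrib)
  have "Phi n t (yAi n \<tau> v) (of_real xs + h) = exp (of_nat n / (2 * of_real t) * (of_real xs + h - complex_of_real (yAi n \<tau> v))^2 + of_real (fconj psi xs n t (yAi n \<tau> v))) * pX n (of_real xs + h)"
    unfolding Phi_def exp_add by simp
  from this[unfolded e p] show ?thesis unfolding exp_add t_def h_def Cn_def EE_def E0_def by (simp only: mult_ac)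
qed

lemma Cn_nonzero:
  assumes "\<And>j. j \<in> {1..n} ==> X0 n j \<noteq> xs"
  shows "Cn n \<noteq> 0"
proof -
  have "complex_of_real (xs - X0 n j) \<noteq> 0" if "j \<in> {1..n}" for j
    using assms[OF that] by (simp only: of_real_eq_0_iff right_minus_eq)
  then have "(\<Prod>j=1..n. complex_of_real (xs - X0 n j)) \<noteq> 0" unfolding prod_zero_iff[OF finite_atLeastAtMost] by blast
  then show ?thesis by (simp only: Cn_def mult_eq_0_iff exp_not_eq_zero) blast
qed

text \<open>An identity for every n > 0: the drift (s - t) G0 of x - y produces exactly the terms
  that the conjugation removes, and the remaining quadratic has the variance 2 (\<tau>1 - \<tau>2)
  of the Airy Gaussian.\<close>

lemma gaussian_eq:
  fixes \<tau>1 \<tau>2 u v :: real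
  assumes n: "n > 0" and \<tau>: "\<tau>1 > \<tau>2"
  defines "s \<equiv> tAi psi xs n \<tau>1" and "t \<equiv> tAi psi xs n \<tau>2" and "x \<equiv> yAi n \<tau>1 u" and "y \<equiv> yAi n \<tau>2 v"
  shows "sqrt (real n) / sqrt (2 * pi * (s - t)) * exp (- real n * (x - y)^2 / (2 * (s - t))) * exp (fconj psi xs n t y - fconj psi xs n s x) / (c2 psi xs * real n powr (2/3))
    = 1 / sqrt (4 * pi * (\<tau>1 - \<tau>2)) * exp (- ((u - v)^2) / (4 * (\<tau>1 - \<tau>2)))"
proof -
  define m where "m = real n powr (1/3)"
  define d where "d = \<tau>1 - \<tau>2"
  define b where "b = c2 psi xs"
  have d: "d > 0" using \<tau> by (simp add: d_def)
  have m: "m > 0" using n by (simp add: m_def)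
  have nm: "real n = m^3" using n by (simp add: m_def powr_power)
  have n2: "real n powr (2/3) = m^2" using n by (simp add: m_def powr_power)
  have c: "b > 0" unfolding b_def by (rule cc)
  have st: "s - t = 2 * d / (b^2 * m)" by (simp add: s_def t_def tAi_def m_def d_def b_def diff_divide_distrib right_diff_distrib)
  have stp: "s - t > 0" unfolding st using d c m by simp
  define w where "w = (u - v) / (b * m^2)"
  have xy: "x - y = (s - t) * G0 + w" by (simp add: x_def y_def yAi_def xAi_def s_def t_def G0_def n2 w_def b_def diff_divide_distrib left_diff_distrib)
  have "- real n * (x - y)^2 / (2 * (s - t)) = - (real n * G0^2 * (s - t) / 2 + real n * G0 * w + real n * w^2 / (2 * (s - t)))"
    unfolding xy using stp by (simp add: field_simps power2_eq_square)
  moreover have "fconj psi xs n t y - fconj psi xs n s x = real n * G0 * (x - y) - real n * G0^2 * (s - t) / 2"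
    by (simp add: fconj_def G0_def algebra_simps diff_divide_distrib)
  then have "fconj psi xs n t y - fconj psi xs n s x = real n * G0^2 * (s - t) / 2 + real n * G0 * w"
    unfolding xy by (simp add: field_simps power2_eq_square)
  moreover have "real n * w^2 / (2 * (s - t)) = (u - v)^2 / (4 * d)"
    unfolding st nm w_def using d c m by (simp add: power_divide power_mult_distrib power3_eq_cube power2_eq_square)
  ultimately have e: "- real n * (x - y)^2 / (2 * (s - t)) + (fconj psi xs n t y - fconj psi xs n s x) = - ((u - v)^2) / (4 * d)" by simp
  have "sqrt (real n) / sqrt (2 * pi * (s - t)) = sqrt (real n / (2 * pi * (s - t)))" by (simp add: real_sqrt_divide)
  also have "real n / (2 * pi * (s - t)) = (b * m^2)^2 / (4 * pi * d)"
    unfolding st nm using d c m by (simp add: field_simps power3_eq_cube power2_eq_square)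
  also have "sqrt \<dots> = b * m^2 / sqrt (4 * pi * d)" using c m by (simp add: real_sqrt_divide)
  finally have f: "sqrt (real n) / sqrt (2 * pi * (s - t)) = b * m^2 / sqrt (4 * pi * d)" .
  have "sqrt (real n) / sqrt (2 * pi * (s - t)) * exp (- real n * (x - y)^2 / (2 * (s - t))) * exp (fconj psi xs n t y - fconj psi xs n s x) / (b * m^2)
    = sqrt (real n) / sqrt (2 * pi * (s - t)) / (b * m^2) * exp (- real n * (x - y)^2 / (2 * (s - t)) + (fconj psi xs n t y - fconj psi xs n s x))"
    unfolding exp_add by simp
  also have "\<dots> = 1 / sqrt (4 * pi * d) * exp (- ((u - v)^2) / (4 * d))" unfolding e f using c m by simp
  finally show ?thesis unfolding b_def n2 d_def .
qed

text \<open>The logarithmic potential enters only through exp (n g), which is the polynomial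
  \<open>pX\<close>, so its branch cuts leave no trace and \<open>double_contour_shift\<close>
  applies to the circle and the line.\<close>

lemma KNIBM_integral:
  fixes s t x y x1 :: real and G D :: "real \<Rightarrow> complex"
  assumes n: "n > 0" and st: "s > 0" "t > 0" and x1: "\<And>w. w \<in> path_image G ==> Re w < x1" "\<And>w. w \<in> path_image D ==> Re w > x1"
    and G: "valid_path G" "pathfinish G = pathstart G" "path_image G \<inter> of_real ` X0 n ` {1..n} = {}"
    and D: "valid_path D" "pathfinish D = pathstart D" "path_image D \<inter> of_real ` X0 n ` {1..n} = {}"
    and wn: "\<And>j. j \<in> {1..n} ==> winding_number G (of_real (X0 n j)) + winding_number D (of_real (X0 n j)) = 1"
  defines "f \<equiv> \<lambda>r. Phi n t y (of_real x1 + \<i> * of_real r) *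
      (contour_integral G (\<lambda>w. 1 / (Phi n s x w * (of_real x1 + \<i> * of_real r - w))) + contour_integral D (\<lambda>w. 1 / (Phi n s x w * (of_real x1 + \<i> * of_real r - w))))"
  shows "integrable lborel f"
    and "KNIBMconj X0 psi xs n s t x y = of_nat n / ((2 * of_real pi * \<i>)^2 * of_real (sqrt (s * t))) * (\<i> * (LINT r|lborel. f r))
      - (if s > t then of_real (sqrt (real n) / sqrt (2 * pi * (s - t)) * exp (- real n * (x - y)^2 / (2 * (s - t))) * exp (fconj psi xs n t y - fconj psi xs n s x)) else 0)"
proof -
  define R where "R = 1 + Max {\<bar>X0 n j\<bar> | j. j \<in> {1..n}}"
  \<comment> \<open>The factor exp (n y^2 / (2 t)), constant in z, is split off as
    \<open>ey\<close>; what is left has the shape that \<open>double_contour_shift\<close>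
    expects.\<close>
  define A where "A = (\<lambda>z. exp (complex_of_real (real n / (2 * t)) * z^2 + of_real (- real n * y / t) * z))"
  define F where "F = (\<lambda>w. exp (- (of_nat n / (2 * of_real s)) * (w - complex_of_real x)^2))"
  define l where "l = (\<lambda>x r. complex_of_real x + \<i> * complex_of_real r)"
  define f1 where "f1 = (\<lambda>r. A (l (R+1) r) * pX n (l (R+1) r) * contour_integral (circlepath 0 R) (\<lambda>w. F w / (pX n w * (l (R+1) r - w))))"
  define f2 where "f2 = (\<lambda>r. A (l x1 r) * pX n (l x1 r) * (contour_integral G (\<lambda>w. F w / (pX n w * (l x1 r - w)))
                 + contour_integral D (\<lambda>w. F w / (pX n w * (l x1 r - w)))))"
  have set_eq: "{\<bar>X0 n j\<bar> | j. j \<in> {1..n}} = (\<lambda>j. \<bar>X0 n j\<bar>) ` {1..n}" by auto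
  have XR: "\<bar>X0 n j\<bar> < R" if "j \<in> {1..n}" for j
  proof -
    have "\<bar>X0 n j\<bar> <= Max {\<bar>X0 n j\<bar> | j. j \<in> {1..n}}" unfolding set_eq using that by (intro Max_ge) auto
    then show ?thesis by (simp add: R_def)
  qed
  have R0: "R > 0" using XR[of 1] n by simp
  have \<alpha>: "real n / (2 * t) > 0" using n st by simp
  have F: "F holomorphic_on UNIV" unfolding F_def using st by (intro holomorphic_intros) auto
  note hyps = XR R0 \<alpha> F G(1,2) x1(1) G(3) D(1,2) x1(2) D(3) wn
  have shift: "integrable lborel f2" "(LINT r|lborel. f1 r) = (LINT r|lborel. f2 r)"
    unfolding f1_def f2_def A_def l_def pX_def by (rule double_contour_shift[OF hyps]; assumption)+
  define ey where "ey = exp (complex_of_real (real n * y^2 / (2 * t)))"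
  define e1 where "e1 = exp (complex_of_real (fconj psi xs n s x))"
  define e2 where "e2 = exp (complex_of_real (fconj psi xs n t y))"
  have A: "exp (of_nat n / (2 * of_real t) * (z - of_real y)^2) = A z * ey" for z
    unfolding A_def ey_def exp_add[symmetric] using st by (simp add: field_simps power2_eq_square)
  have Ft: "exp (of_nat n / (2 * of_real s) * (w - complex_of_real x)^2) = 1 / F w" for w
    unfolding F_def by (simp add: exp_minus field_simps)
  have Phi2: "Phi n t y z = A z * pX n z * (ey * e2)" for z unfolding Phi_def A e2_def by simp
  have Phi1: "1 / (Phi n s x w * (z - w)) = (1 / e1) * (F w / (pX n w * (z - w)))" for z w
    unfolding Phi_def Ft e1_def by simp
  have ff: "f r = (ey * e2 / e1) * f2 r" for r
    unfolding f_def f2_def Phi2 Phi1 contour_integral_cmult l_def by (simp add: algebra_simps)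
  show "integrable lborel f" unfolding ff[abs_def] using shift(1) by (intro integrable_mult_right) auto
  have Lf: "(LINT r|lborel. f r) = (ey * e2 / e1) * (LINT r|lborel. f1 r)" unfolding ff shift(2) by (rule integral_mult_right_zero)
  have inner: "\<i> * contour_integral (circlepath 0 R)
             (\<lambda>w. exp (of_nat n / (2 * of_real t) * ((l (R+1) r - of_real y)^2 + 2 * of_real t * gmun X0 n (l (R+1) r))
                      - of_nat n / (2 * of_real s) * ((w - of_real x)^2 + 2 * of_real s * gmun X0 n w)) / (l (R+1) r - w)) = (\<i> * ey) * f1 r" for r
  proof -
    have ne: "l (R+1) r \<noteq> of_real (X0 n j)" if "j \<in> {1..n}" for j
      using XR[OF that] by (auto simp: l_def complex_eq_iff)
    have pz: "exp (of_nat n * gmun X0 n (l (R+1) r)) = pX n (l (R+1) r)" unfolding pX_def using n ne by (rule exp_gmun)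
    have "contour_integral (circlepath 0 R)
             (\<lambda>w. exp (of_nat n / (2 * of_real t) * ((l (R+1) r - of_real y)^2 + 2 * of_real t * gmun X0 n (l (R+1) r))
                      - of_nat n / (2 * of_real s) * ((w - of_real x)^2 + 2 * of_real s * gmun X0 n w)) / (l (R+1) r - w))
         = contour_integral (circlepath 0 R) (\<lambda>w. (ey * A (l (R+1) r) * pX n (l (R+1) r)) * (F w / (pX n w * (l (R+1) r - w))))"
    proof (rule contour_integral_eq)
      fix w assume "w \<in> path_image (circlepath 0 R)"
      then have wR: "cmod w = R" using R0 by (simp add: sphere_def)
      have "w \<noteq> of_real (X0 n j)" if "j \<in> {1..n}" for j using XR[OF that] wR by auto
      then have pw: "exp (of_nat n * gmun X0 n w) = pX n w" unfolding pX_def using n by (intro exp_gmun) auto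
      have ex: "of_nat n / (2 * of_real t) * ((l (R+1) r - of_real y)^2 + 2 * of_real t * gmun X0 n (l (R+1) r))
                      - of_nat n / (2 * of_real s) * ((w - of_real x)^2 + 2 * of_real s * gmun X0 n w)
          = of_nat n / (2 * of_real t) * (l (R+1) r - of_real y)^2 + of_nat n * gmun X0 n (l (R+1) r) - (of_nat n / (2 * of_real s) * (w - of_real x)^2 + of_nat n * gmun X0 n w)"
        using st by (simp add: distrib_left)
      show "exp (of_nat n / (2 * of_real t) * ((l (R+1) r - of_real y)^2 + 2 * of_real t * gmun X0 n (l (R+1) r))
                      - of_nat n / (2 * of_real s) * ((w - of_real x)^2 + 2 * of_real s * gmun X0 n w)) / (l (R+1) r - w)
          = (ey * A (l (R+1) r) * pX n (l (R+1) r)) * (F w / (pX n w * (l (R+1) r - w)))"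
        unfolding ex exp_diff exp_add pz pw A Ft by (simp add: mult_ac)
    qed
    then show ?thesis unfolding contour_integral_cmult f1_def by (simp add: mult_ac)
  qed
  have K: "KNIBM X0 n s t x y = of_nat n / ((2 * of_real pi * \<i>)^2 * of_real (sqrt (s * t))) * (LINT r|lborel. (\<i> * ey) * f1 r)
     - (if s > t then of_real (sqrt (real n) / sqrt (2 * pi * (s - t)) * exp (- real n * (x - y)^2 / (2 * (s - t)))) else 0)"
    unfolding KNIBM_def Let_def R_def[symmetric] inner[symmetric] l_def ..
  have ee: "complex_of_real (exp (fconj psi xs n t y - fconj psi xs n s x)) = e2 / e1" by (simp add: e1_def e2_def exp_diff flip: exp_of_real)
  have "(LINT r|lborel. (\<i> * ey) * f1 r) * (e2 / e1) = \<i> * (LINT r|lborel. f r)" unfolding Lf integral_mult_right_zero by simp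
  moreover have "KNIBMconj X0 psi xs n s t x y = of_nat n / ((2 * of_real pi * \<i>)^2 * of_real (sqrt (s * t))) * ((LINT r|lborel. (\<i> * ey) * f1 r) * (e2 / e1))
     - (if s > t then of_real (sqrt (real n) / sqrt (2 * pi * (s - t)) * exp (- real n * (x - y)^2 / (2 * (s - t)))) else 0) * of_real (exp (fconj psi xs n t y - fconj psi xs n s x))"
    unfolding KNIBMconj_def K left_diff_distrib ee by (simp only: mult.assoc)
  ultimately show "KNIBMconj X0 psi xs n s t x y = of_nat n / ((2 * of_real pi * \<i>)^2 * of_real (sqrt (s * t))) * (\<i> * (LINT r|lborel. f r))
      - (if s > t then of_real (sqrt (real n) / sqrt (2 * pi * (s - t)) * exp (- real n * (x - y)^2 / (2 * (s - t))) * exp (fconj psi xs n t y - fconj psi xs n s x)) else 0)"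
    by (auto simp only: of_real_mult mult_zero_left split: if_splits)
qed

text \<open>The contours \<open>G\<close> and \<open>D\<close> below live in the variable \<open>h = z - xs\<close>, the argument \<open>\<zeta>\<close> on the Airy scale.\<close>

definition Jint where "Jint n \<tau> u g \<zeta> = contour_integral g (\<lambda>h. 1 / (EE n \<tau> u (h / of_real (hs n)) * (of_real (hs n) * \<zeta> - h)))" for n \<tau> u g \<zeta>

text \<open>Substituting z = xs + \<open>hs n\<close> * \<zeta> brings out n * \<open>hs n\<close>,
  and n * \<open>hs n\<close> / (c2 n^(2/3)) = \<open>t0\<close>. Apart from 1 / (2 pi i)^2 only the
  prefactor t0 / sqrt (t1 t2), which tends to 1, remains of the constants.\<close>

lemma scaled_kernel:
  fixes \<tau>1 \<tau>2 u v s :: real and G D :: "real \<Rightarrow> complex"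
  assumes n: "n > 0" and t1: "tAi psi xs n \<tau>1 > 0" and t2: "tAi psi xs n \<tau>2 > 0" and X: "\<And>j. j \<in> {1..n} ==> X0 n j \<noteq> xs"
    and x1: "\<And>w. w \<in> path_image G ==> Re w < hs n * s" "\<And>w. w \<in> path_image D ==> Re w > hs n * s"
    and G: "valid_path G" "pathfinish G = pathstart G" "\<And>j. j \<in> {1..n} ==> of_real (X0 n j - xs) \<notin> path_image G"
    and D: "valid_path D" "pathfinish D = pathstart D" "\<And>j. j \<in> {1..n} ==> of_real (X0 n j - xs) \<notin> path_image D"
    and wn: "\<And>j. j \<in> {1..n} ==> winding_number G (of_real (X0 n j - xs)) + winding_number D (of_real (X0 n j - xs)) = 1"
  defines "f \<equiv> \<lambda>y. \<i> * EE n \<tau>2 v (zline s y) * (Jint n \<tau>1 u G (zline s y) + Jint n \<tau>1 u D (zline s y))"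
  shows "integrable lborel f"
    and "scaledK n \<tau>1 \<tau>2 u v
      = of_real (t0 / sqrt (tAi psi xs n \<tau>1 * tAi psi xs n \<tau>2)) / (2 * of_real pi * \<i>)^2 * (LINT y|lborel. f y)
       - airy_gauss \<tau>1 \<tau>2 u v"
proof -
  define t1 where "t1 = tAi psi xs n \<tau>1"
  define t2 where "t2 = tAi psi xs n \<tau>2"
  define X1 where "X1 = xs + hs n * s"
  define TG where "TG = (+) (complex_of_real xs) \<circ> G"
  define TD where "TD = (+) (complex_of_real xs) \<circ> D"
  have tp: "t1 > 0" "t2 > 0" using t1 t2 by (simp_all add: t1_def t2_def)
  have hp: "hs n > 0" using hs_pos n by simp
  have Cn0: "Cn n \<noteq> 0" using X by (rule Cn_nonzero)
  have PG: "path_image TG = (+) (complex_of_real xs) ` path_image G" "path_image TD = (+) (complex_of_real xs) ` path_image D"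
    by (simp_all add: TG_def TD_def path_image_compose)
  have av: "(+) (complex_of_real xs) ` A \<inter> of_real ` X0 n ` {1..n} = {}" if A: "\<And>j. j \<in> {1..n} ==> complex_of_real (X0 n j - xs) \<notin> A" for A
  proof (rule ccontr)
    assume "(+) (complex_of_real xs) ` A \<inter> of_real ` X0 n ` {1..n} \<noteq> {}"
    then obtain w j where w: "w \<in> A" "j \<in> {1..n}" "complex_of_real xs + w = of_real (X0 n j)" by (auto simp del: atLeastAtMost_iff)
    from w(3) have "w = of_real (X0 n j - xs)" by (simp add: eq_diff_eq add.commute)
    with w A show False by blast
  qed
  have avoid: "path_image TG \<inter> of_real ` X0 n ` {1..n} = {}" "path_image TD \<inter> of_real ` X0 n ` {1..n} = {}"
    unfolding PG by (rule av, rule G(3), assumption) (rule av, rule D(3), assumption)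
  have wT: "winding_number ((+) (complex_of_real xs) \<circ> g) (of_real z) = winding_number g (of_real (z - xs))" for g z
  proof -
    have "(\<lambda>w. ((+) (complex_of_real xs) \<circ> g) w - of_real z) = (\<lambda>w. g w - of_real (z - xs))" by (auto simp: fun_eq_iff)
    then show ?thesis using winding_number_offset[of "(+) (complex_of_real xs) \<circ> g" "of_real z"] winding_number_offset[of g "of_real (z - xs)"] by simp
  qed
  have aR: "\<And>w. w \<in> path_image TG ==> Re w < X1" "\<And>w. w \<in> path_image TD ==> Re w > X1"
    unfolding PG X1_def using x1 by auto
  have vG: "valid_path TG" "pathfinish TG = pathstart TG" using G(1,2) by (simp_all add: TG_def valid_path_translation pathstart_compose pathfinish_compose)
  have vD: "valid_path TD" "pathfinish TD = pathstart TD" using D(1,2) by (simp_all add: TD_def valid_path_translation pathstart_compose pathfinish_compose)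
  have wTD: "\<And>j. j \<in> {1..n} ==> winding_number TG (of_real (X0 n j)) + winding_number TD (of_real (X0 n j)) = 1"
    unfolding TG_def TD_def wT by (rule wn)
  define F where "F = (\<lambda>r. Phi n t2 (yAi n \<tau>2 v) (of_real X1 + \<i> * of_real r) *
      (contour_integral TG (\<lambda>w. 1 / (Phi n t1 (yAi n \<tau>1 u) w * (of_real X1 + \<i> * of_real r - w))) + contour_integral TD (\<lambda>w. 1 / (Phi n t1 (yAi n \<tau>1 u) w * (of_real X1 + \<i> * of_real r - w)))))"
  have I: "integrable lborel F"
    and K: "KNIBMconj X0 psi xs n t1 t2 (yAi n \<tau>1 u) (yAi n \<tau>2 v) = of_nat n / ((2 * of_real pi * \<i>)^2 * of_real (sqrt (t1 * t2))) * (\<i> * (LINT r|lborel. F r))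
      - (if t1 > t2 then of_real (sqrt (real n) / sqrt (2 * pi * (t1 - t2)) * exp (- real n * (yAi n \<tau>1 u - yAi n \<tau>2 v)^2 / (2 * (t1 - t2))) * exp (fconj psi xs n t2 (yAi n \<tau>2 v) - fconj psi xs n t1 (yAi n \<tau>1 u))) else 0)"
    unfolding F_def by (rule KNIBM_integral[OF n tp aR vG(1,2) avoid(1) vD(1,2) avoid(2) wTD], assumption+)+
  have line: "of_real X1 + \<i> * of_real (hs n * y) = of_real xs + of_real (hs n) * zline s y" for y
    by (simp add: X1_def zline_def algebra_simps)
  have sub: "contour_integral ((+) (complex_of_real xs) \<circ> g) (\<lambda>w. 1 / (Phi n t1 (yAi n \<tau>1 u) w * (of_real xs + of_real (hs n) * \<zeta> - w))) = (1 / Cn n) * Jint n \<tau>1 u g \<zeta>" for g \<zeta>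
  proof -
    have "1 / (Phi n t1 (yAi n \<tau>1 u) (of_real xs + h) * (of_real xs + of_real (hs n) * \<zeta> - (of_real xs + h)))
        = (1 / Cn n) * (1 / (EE n \<tau>1 u (h / of_real (hs n)) * (of_real (hs n) * \<zeta> - h)))" for h
      using Phi_eq[OF n t1 X, of u "h / of_real (hs n)"] hp by (simp add: t1_def)
    then show ?thesis unfolding contour_integral_translation Jint_def contour_integral_cmult[symmetric] by (rule arg_cong[OF ext])
  qed
  have Fy: "F (0 + hs n * y) * \<i> = f y" for y
    unfolding F_def add_0_left line TG_def TD_def sub f_def
    using Phi_eq[OF n t2 X, of v "zline s y"] Cn0 by (simp add: t2_def field_simps)
  have "integrable lborel (\<lambda>y. F (0 + hs n * y) * \<i>)"
    using lborel_integrable_real_affine[OF I, of "hs n" 0] hp by (intro integrable_mult_left) auto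
  then show "integrable lborel f" unfolding Fy .
  have "(LINT r|lborel. F r) = \<bar>hs n\<bar> *\<^sub>R (LINT y|lborel. F (0 + hs n * y))"
    using hp by (intro lborel_integral_real_affine) auto
  then have "\<i> * (LINT r|lborel. F r) = of_real (hs n) * ((LINT y|lborel. F (0 + hs n * y)) * \<i>)" using hp by (simp add: scaleR_conv_of_real)
  also have "(LINT y|lborel. F (0 + hs n * y)) * \<i> = (LINT y|lborel. f y)" unfolding integral_mult_left_zero[symmetric] Fy ..
  finally have LF: "\<i> * (LINT r|lborel. F r) = of_real (hs n) * (LINT y|lborel. f y)" .
  have "0 < real n powr (1/3)" using n by simp
  then have pos: "0 < 2 / ((c2 psi xs)^2 * real n powr (1/3))" using cc(3) by simp
  have "t1 - t2 = (2 / ((c2 psi xs)^2 * real n powr (1/3))) * (\<tau>1 - \<tau>2)" by (simp add: t1_def t2_def tAi_def diff_divide_distrib right_diff_distrib)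
  moreover have "0 < b * d \<longleftrightarrow> 0 < d" if "0 < b" for b d :: real using that by (simp add: zero_less_mult_iff)
  ultimately have "t1 - t2 > 0 \<longleftrightarrow> \<tau>1 - \<tau>2 > 0" using pos by metis
  then have cond: "t1 > t2 \<longleftrightarrow> \<tau>1 > \<tau>2" by linarith
  have pre: "complex_of_nat n / ((2 * of_real pi * \<i>)^2 * of_real (sqrt (t1 * t2))) * (of_real (hs n) * I) / of_real (c2 psi xs * real n powr (2/3))
     = of_real (t0 / sqrt (t1 * t2)) / (2 * of_real pi * \<i>)^2 * I" for I
  proof -
    have "complex_of_real t0 = of_nat n * of_real (hs n) / of_real (c2 psi xs * real n powr (2/3))"
      unfolding scaling_identities(4)[OF n t1, symmetric] by simp
    then show ?thesis by (simp add: mult_ac)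
  qed
  show "scaledK n \<tau>1 \<tau>2 u v
      = of_real (t0 / sqrt (tAi psi xs n \<tau>1 * tAi psi xs n \<tau>2)) / (2 * of_real pi * \<i>)^2 * (LINT y|lborel. f y)
       - airy_gauss \<tau>1 \<tau>2 u v"
  proof (cases "\<tau>1 > \<tau>2")
    case True
    then show ?thesis using K gaussian_eq[OF n True, of u v] unfolding t1_def[symmetric] t2_def[symmetric] LF
      by (simp only: cond if_True diff_divide_distrib pre of_real_divide[symmetric])
  next
    case False
    then show ?thesis using K unfolding t1_def[symmetric] t2_def[symmetric] LF
      by (simp only: cond if_False diff_zero pre)
  qed
qed

end

section \<open>From contour integrals to estimates of Lebesgue integrals\<close>

lemma contour_integral_linepath_LINT:
  fixes f :: "complex \<Rightarrow> complex"
  assumes Q: "Q > 0" and f: "continuous_on (closed_segment a (a + of_real Q * d)) f"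
  shows "integrable lborel (\<lambda>q. indicator {0..Q} q *\<^sub>R (f (a + of_real q * d) * d))"
    and "contour_integral (linepath a (a + of_real Q * d)) f = (LINT q|lborel. indicator {0..Q} q *\<^sub>R (f (a + of_real q * d) * d))"
proof -
  define F where "F = (\<lambda>q. indicator {0..Q} q *\<^sub>R (f (a + of_real q * d) * d))"
  have seg: "a + of_real q * d \<in> closed_segment a (a + of_real Q * d)" if "q \<in> {0..Q}" for q
    unfolding in_segment by (rule exI[of _ "q / Q"]) (use that Q in \<open>simp add: scaleR_conv_of_real field_simps\<close>)
  have "continuous_on {0..Q} (\<lambda>q. f (a + of_real q * d) * d)"
    by (intro continuous_intros continuous_on_compose2[OF f]) (use seg in auto)
  then have "set_integrable lborel {0..Q} (\<lambda>q. f (a + of_real q * d) * d)" by (rule borel_integrable_atLeastAtMost')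
  then show I: "integrable lborel F" unfolding set_integrable_def F_def .
  have FQ: "F (0 + Q * t) = indicator {0..1} t *\<^sub>R (f (a + of_real (Q * t) * d) * d)" for t
  proof -
    have "0 + Q * t \<in> {0..Q} \<longleftrightarrow> t \<in> {0..1}" using Q by (auto simp: mult_le_cancel_left1 zero_le_mult_iff)
    then show ?thesis by (simp add: F_def indicator_def)
  qed
  have c1: "continuous_on {0..1} (\<lambda>t. f (a + of_real (Q * t) * d) * d)"
  proof (intro continuous_intros continuous_on_compose2[OF f])
    show "(\<lambda>t. a + complex_of_real (Q * t) * d) ` {0..1} \<subseteq> closed_segment a (a + of_real Q * d)"
      using seg Q by (auto simp del: of_real_mult simp: mult_left_le)
  qed
  have "(LINT q|lborel. F q) = \<bar>Q\<bar> *\<^sub>R (LINT t|lborel. F (0 + Q * t))" using Q by (intro lborel_integral_real_affine) auto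
  also have "(LINT t|lborel. F (0 + Q * t)) = (LINT t:{0..1}|lborel. f (a + of_real (Q * t) * d) * d)"
    unfolding FQ set_lebesgue_integral_def ..
  also have "\<dots> = integral {0..1} (\<lambda>t. f (a + of_real (Q * t) * d) * d)"
    by (rule set_borel_integral_eq_integral(2)[OF borel_integrable_atLeastAtMost'[OF c1]])
  also have "\<bar>Q\<bar> *\<^sub>R integral {0..1} (\<lambda>t. f (a + of_real (Q * t) * d) * d) = integral {0..1} (\<lambda>t. f (linepath a (a + of_real Q * d) t) * (a + of_real Q * d - a))"
    using Q unfolding integral_cmul[symmetric] by (intro integral_cong) (simp add: linepath_def scaleR_conv_of_real algebra_simps)
  also have "\<dots> = contour_integral (linepath a (a + of_real Q * d)) f" unfolding contour_integral_integral
    by (intro integral_cong) simp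
  finally show "contour_integral (linepath a (a + of_real Q * d)) f = (LINT q|lborel. F q)" ..
qed

lemma norm_inverse_zline_wvee:
  assumes "s >= 1" shows "cmod (x / (zline s y - wvee s q)) <= cmod x"
proof -
  have "1 <= Re (zline s y - wvee s q)" using assms by simp
  also have "\<dots> <= cmod (zline s y - wvee s q)" by (rule complex_Re_le_cmod)
  finally have "cmod x / cmod (zline s y - wvee s q) <= cmod x / 1" by (intro divide_left_mono) auto
  then show ?thesis by (simp add: norm_divide)
qed

lemma norm_LINT_exp_bound:
  fixes f :: "real \<Rightarrow> complex"
  assumes "\<And>y. cmod (f y) <= B * exp (- \<bar>y\<bar>)"
  shows "cmod (LINT y|lborel. f y) <= B * (LINT y::real|lborel. exp (- \<bar>y\<bar>))"
proof -
  have "B * exp (- \<bar>0\<bar>) >= 0" by (rule order_trans[OF norm_ge_zero assms])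
  then have B: "B >= 0" by simp
  have i: "integrable lborel (\<lambda>y::real. B * exp (- \<bar>y\<bar>))" by (intro integrable_mult_right integrable_exp_minus_abs)
  have "cmod (LINT y|lborel. f y) <= (LINT y|lborel. B * exp (- \<bar>y\<bar>))"
  proof (cases "integrable lborel f")
    case True
    show ?thesis by (rule Bochner_Integration.integral_norm_bound_integral[OF True i]) (rule assms)
  next
    \<comment> \<open>A non-integrable function has integral 0 by convention.\<close>
    case False
    have "0 <= (LINT y|lborel. B * exp (- \<bar>y::real\<bar>))" using B by (intro Bochner_Integration.integral_nonneg) auto
    then show ?thesis using False by (simp add: not_integrable_integral_eq)
  qed
  then show ?thesis by simp
qed

text \<open>With vV and vA for the inner integrals, f - g is, up to the factor i, the sum (P - P0)
  vV + P0 (vV - vA) + P Rst, and each summand contains exactly one small factor N.\<close>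

lemma double_integral_perturbation:
  fixes P P0 V A Rst :: "real \<Rightarrow> complex" and K N Eu Ev s :: real
  defines "f \<equiv> \<lambda>y. \<i> * P y * ((LINT q|lborel. V q / (zline s y - wvee s q)) + Rst y)"
    and "g \<equiv> \<lambda>y. LINT q|lborel. (P0 y * \<i>) * A q / (zline s y - wvee s q)"
    and "I1 \<equiv> LINT y::real|lborel. exp (- \<bar>y\<bar>)"
  assumes int: "integrable lborel f" "integrable lborel g" and s: "s >= 1" and pos: "K >= 0" "N >= 0" "Eu >= 0" "Ev >= 0"
    and m[measurable]: "V \<in> borel_measurable borel" "A \<in> borel_measurable borel"
    and P: "\<And>y. cmod (P y) <= K * Ev * exp (- \<bar>y\<bar>)" "\<And>y. cmod (P0 y) <= K * Ev * exp (- \<bar>y\<bar>)" "\<And>y. cmod (P y - P0 y) <= K * N * Ev * exp (- \<bar>y\<bar>)"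
    and V: "\<And>q. cmod (V q) <= K * Eu * exp (- \<bar>q\<bar>)" "\<And>q. cmod (A q) <= K * Eu * exp (- \<bar>q\<bar>)" "\<And>q. cmod (V q - A q) <= K * N * Eu * exp (- \<bar>q\<bar>)"
    and R: "\<And>y. cmod (Rst y) <= K * N * Eu"
  shows "cmod ((LINT y|lborel. f y) - (LINT y|lborel. g y)) <= K^2 * (2 * I1 + 1) * I1 * N * (Eu * Ev)"
    and "cmod (LINT y|lborel. g y) <= K^2 * I1 * I1 * (Eu * Ev)"
proof -
  have I0: "I1 >= 0" unfolding I1_def by (intro Bochner_Integration.integral_nonneg) auto
  have ml: "(\<lambda>q. B q / (zline s y - wvee s q)) \<in> borel_measurable borel" if [measurable]: "B \<in> borel_measurable borel" for B and y :: real by measurable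
  have i: "integrable lborel (\<lambda>q. B q / (zline s y - wvee s q))" if "B \<in> borel_measurable borel" "\<And>q. cmod (B q) <= c * exp (- \<bar>q\<bar>)" for B c and y :: real
    by (rule integrable_exp_decay[OF ml[OF that(1)]]) (rule order_trans[OF norm_inverse_zline_wvee[OF s] that(2)])
  have b: "cmod (LINT q|lborel. B q / (zline s y - wvee s q)) <= c * I1" if "\<And>q. cmod (B q) <= c * exp (- \<bar>q\<bar>)" for B c and y :: real
    unfolding I1_def by (rule norm_LINT_exp_bound) (rule order_trans[OF norm_inverse_zline_wvee[OF s] that])
  define vV where "vV = (\<lambda>y. LINT q|lborel. V q / (zline s y - wvee s q))"
  define vA where "vA = (\<lambda>y. LINT q|lborel. A q / (zline s y - wvee s q))"
  have vV: "cmod (vV y) <= K * Eu * I1" "cmod (vA y) <= K * Eu * I1" for y unfolding vV_def vA_def using V b by auto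
  have "vV y - vA y = (LINT q|lborel. (V q - A q) / (zline s y - wvee s q))" for y
    unfolding vV_def vA_def diff_divide_distrib by (intro Bochner_Integration.integral_diff[symmetric] i[OF m(1) V(1)] i[OF m(2) V(2)])
  then have vd: "cmod (vV y - vA y) <= K * N * Eu * I1" for y using b[OF V(3)] by simp
  have g: "g y = P0 y * \<i> * vA y" for y unfolding g_def vA_def times_divide_eq_right[symmetric] by (rule integral_mult_right_zero)
  have f: "f y = \<i> * P y * (vV y + Rst y)" for y unfolding f_def vV_def ..
  have gb: "cmod (g y) <= K^2 * I1 * (Eu * Ev) * exp (- \<bar>y\<bar>)" for y
  proof -
    have "cmod (g y) = cmod (P0 y) * cmod (vA y)" unfolding g by (simp add: norm_mult)
    also have "\<dots> <= (K * Ev * exp (- \<bar>y\<bar>)) * (K * Eu * I1)" using pos I0 by (intro mult_mono P vV) auto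
    finally show ?thesis by (simp add: power2_eq_square mult_ac)
  qed
  show "cmod (LINT y|lborel. g y) <= K^2 * I1 * I1 * (Eu * Ev)"
    using norm_LINT_exp_bound[of g, OF gb, folded I1_def] by (simp add: mult_ac)
  have fg: "cmod (f y - g y) <= K^2 * (2 * I1 + 1) * N * (Eu * Ev) * exp (- \<bar>y\<bar>)" for y
  proof -
    have "f y - g y = \<i> * ((P y - P0 y) * vV y + P0 y * (vV y - vA y) + P y * Rst y)" unfolding f g by (simp add: algebra_simps)
    then have "cmod (f y - g y) = cmod ((P y - P0 y) * vV y + P0 y * (vV y - vA y) + P y * Rst y)" by (simp add: norm_mult)
    also have "\<dots> <= cmod (P y - P0 y) * cmod (vV y) + cmod (P0 y) * cmod (vV y - vA y) + cmod (P y) * cmod (Rst y)"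
      unfolding norm_mult[symmetric] by (rule order_trans[OF norm_triangle_ineq add_mono[OF norm_triangle_ineq order_refl]])
    also have "\<dots> <= (K * N * Ev * exp (- \<bar>y\<bar>)) * (K * Eu * I1) + (K * Ev * exp (- \<bar>y\<bar>)) * (K * N * Eu * I1) + (K * Ev * exp (- \<bar>y\<bar>)) * (K * N * Eu)"
      using pos I0 by (intro add_mono mult_mono P vV vd R) auto
    also have "\<dots> = K^2 * (2 * I1 + 1) * N * (Eu * Ev) * exp (- \<bar>y\<bar>)" by (simp add: power2_eq_square algebra_simps)
    finally show ?thesis .
  qed
  have "(LINT y|lborel. f y) - (LINT y|lborel. g y) = (LINT y|lborel. f y - g y)" by (rule Bochner_Integration.integral_diff[OF int, symmetric])
  then show "cmod ((LINT y|lborel. f y) - (LINT y|lborel. g y)) <= K^2 * (2 * I1 + 1) * I1 * N * (Eu * Ev)"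
    using norm_LINT_exp_bound[of "\<lambda>y. f y - g y", OF fg, folded I1_def] by (simp add: mult_ac)
qed

lemma cnj_linepath_compose: "cnj \<circ> linepath a b = linepath (cnj a) (cnj b)"
  by (simp add: fun_eq_iff linepath_def)

context nibm begin

lemma holomorphic_EE: "EE n \<tau> u holomorphic_on A"
  unfolding EE_def[abs_def]
  by (intro holomorphic_intros holomorphic_on_compose_gen[OF _ holomorphic_E0[of n UNIV], unfolded o_def]) auto

lemma measurable_EE [measurable]: "EE n \<tau> u \<in> borel_measurable borel"
  by (intro borel_measurable_continuous_onI holomorphic_on_imp_continuous_on holomorphic_EE)

lemma EE_eq_0_iff: "EE n \<tau> u \<zeta> = 0 \<longleftrightarrow> E0 n (of_real (hs n) * \<zeta>) = 0"
  by (simp add: EE_def)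

lemma norm_EE_cnj: "cmod (EE n \<tau> u (cnj \<zeta>)) = cmod (EE n \<tau> u \<zeta>)"
proof -
  have "E0 n (of_real (hs n) * cnj \<zeta>) = cnj (E0 n (of_real (hs n) * \<zeta>))" unfolding E0_cnj[symmetric] by simp
  then show ?thesis unfolding cmod_EE by simp
qed

text \<open>The vee integrand cut off at height Q, where the contour quits the vee; the indicator
  allows comparison with the Airy integrand on the whole line.\<close>

definition veeint where "veeint n \<tau> u s Q q = indicator {- Q..Q} q *\<^sub>R (wvee' q / EE n \<tau> u (wvee s q))" for n \<tau> u s Q q

lemma Jint_upper:
  fixes \<tau> u b e :: real and U :: "real \<Rightarrow> complex"
  assumes n: "n > 0" and \<zeta>: "Re \<zeta> > 0"
    and U: "valid_path U" "\<And>h. h \<in> path_image U ==> Im h >= 0 \<and> E0 n h \<noteq> 0 \<and> h \<noteq> of_real (hs n) * \<zeta> \<and> cnj h \<noteq> of_real (hs n) * \<zeta>"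
    and ends: "pathstart U = of_real b" "pathfinish U = of_real e"
  defines "f \<equiv> \<lambda>h. 1 / (EE n \<tau> u (h / of_real (hs n)) * (of_real (hs n) * \<zeta> - h))"
  shows "Jint n \<tau> u (U +++ reversepath (cnj \<circ> U)) \<zeta> = contour_integral U f - contour_integral (cnj \<circ> U) f"
    and "\<exists>S. open S \<and> f holomorphic_on S \<and> path_image U \<subseteq> S \<and> cnj ` path_image U \<subseteq> S"
proof -
  have hp: "hs n > 0" using n by (rule hs_pos)
  define S where "S = {h. E0 n h \<noteq> 0} - {of_real (hs n) * \<zeta>}"
  have S: "open S" unfolding S_def
    by (intro open_Diff finite_imp_closed open_Collect_neq holomorphic_on_imp_continuous_on holomorphic_E0) auto
  have EEh: "EE n \<tau> u (h / of_real (hs n)) = 0 \<longleftrightarrow> E0 n h = 0" for h using hp by (simp add: EE_eq_0_iff)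
  have fh: "f holomorphic_on S" unfolding f_def
    using hp by (intro holomorphic_intros holomorphic_on_compose_gen[OF _ holomorphic_EE[of n \<tau> u UNIV], unfolded o_def]) (auto simp: S_def EEh)
  have US: "path_image U \<subseteq> S" "cnj ` path_image U \<subseteq> S" using U(2) by (auto simp: S_def E0_cnj)
  then show "\<exists>S. open S \<and> f holomorphic_on S \<and> path_image U \<subseteq> S \<and> cnj ` path_image U \<subseteq> S" using S fh by blast
  \<comment> \<open>The mirror lemma is stated relative to a real point off the path; a point beyond
    a bound of the path will do.\<close>
  have "bounded (path_image U)" using U(1) bounded_valid_path_image by blast
  then obtain B where B: "\<And>h. h \<in> path_image U ==> cmod h <= B" unfolding bounded_iff by blast
  have x: "of_real (\<bar>B\<bar> + 1) \<notin> path_image U" using B[of "of_real (\<bar>B\<bar> + 1)"] by (auto simp del: of_real_add)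
  have "contour_integral (U +++ reversepath (cnj \<circ> U)) f = contour_integral U f - contour_integral (cnj \<circ> U) f"
  proof (rule winding_number_mirror_path(5)[OF U(1) _ x ends S fh])
    show "path_image (U +++ reversepath (cnj \<circ> U)) \<subseteq> S"
      using US winding_number_mirror_path(3)[OF U(1) _ x ends] U(2) by blast
  qed (use U(2) in blast)
  then show "Jint n \<tau> u (U +++ reversepath (cnj \<circ> U)) \<zeta> = contour_integral U f - contour_integral (cnj \<circ> U) f"
    unfolding Jint_def f_def .
qed

text \<open>The segment is the upper arm of the vee and its reflection the lower one; with q
  replaced by - q in the latter, the difference of the two is an integral over [- Q, Q]. The point q
  = 0, where the arms meet, is a null set.\<close>

lemma veeint_integral:
  fixes \<tau> u s Q y :: real
  assumes n: "n > 0" and s: "s >= 1" and Q: "Q > 0" and nz: "\<And>q. \<bar>q\<bar> <= Q ==> E0 n (of_real (hs n) * wvee s q) \<noteq> 0"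
  defines "f \<equiv> \<lambda>h. 1 / (EE n \<tau> u (h / of_real (hs n)) * (of_real (hs n) * zline s y - h))"
    and "l \<equiv> linepath (of_real (- (hs n * s))) (of_real (hs n) * wvee s Q)"
  shows "contour_integral l f - contour_integral (cnj \<circ> l) f = (LINT q|lborel. veeint n \<tau> u s Q q / (zline s y - wvee s q))"
proof -
  have hp: "hs n > 0" using n by (rule hs_pos)
  define a where "a = complex_of_real (- (hs n * s))"
  define d where "d = complex_of_real (hs n) * (\<i> - 1)"
  have line: "a + of_real q * d = of_real (hs n) * wvee s q" if "q >= 0" for q using that by (simp add: a_def d_def wvee_def algebra_simps)
  have line': "a + of_real q * cnj d = of_real (hs n) * wvee s (- q)" if "q >= 0" for q using that by (simp add: a_def d_def wvee_def algebra_simps)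
  have l: "l = linepath a (a + of_real Q * d)" unfolding l_def a_def[symmetric] using line[of Q] Q by simp
  have l': "cnj \<circ> l = linepath a (a + of_real Q * cnj d)" unfolding l cnj_linepath_compose by (simp add: a_def)
  have fv: "f (of_real (hs n) * wvee s q) * (of_real (hs n) * x) = x / EE n \<tau> u (wvee s q) / (zline s y - wvee s q)" for q x
    using hp by (simp add: f_def flip: right_diff_distrib)
  have cf: "continuous_on (closed_segment a (a + of_real Q * d')) f"
    if eq: "\<And>q. 0 <= q ==> a + of_real q * d' = of_real (hs n) * wvee s (sg * q)" and sg: "\<bar>sg\<bar> = 1" for d' and sg :: real
  proof -
    have *: "E0 n h \<noteq> 0 \<and> h \<noteq> of_real (hs n) * zline s y" if h: "h \<in> closed_segment a (a + of_real Q * d')" for h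
    proof -
      obtain t where t: "0 <= t" "t <= 1" "h = (1 - t) *\<^sub>R a + t *\<^sub>R (a + of_real Q * d')" using h unfolding in_segment by blast
      have "h = a + of_real (t * Q) * d'" unfolding t(3) by (simp add: scaleR_conv_of_real algebra_simps)
      then have h': "h = of_real (hs n) * wvee s (sg * (t * Q))" using eq[of "t * Q"] t Q by simp
      have "\<bar>sg * (t * Q)\<bar> <= Q" using sg t Q by (simp add: abs_mult mult_le_cancel_right1)
      then have "E0 n h \<noteq> 0" unfolding h' by (rule nz)
      moreover have "wvee s (sg * (t * Q)) \<noteq> zline s y" using s by (auto simp: complex_eq_iff)
      ultimately show ?thesis using h' hp by simp
    qed
    show ?thesis unfolding f_def
      by (intro continuous_intros continuous_on_compose2[OF holomorphic_on_imp_continuous_on[OF holomorphic_EE[of n \<tau> u UNIV]]])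
        (use * hp in \<open>auto simp: EE_eq_0_iff\<close>)
  qed
  note L = contour_integral_linepath_LINT[OF Q cf[of d 1]] and L' = contour_integral_linepath_LINT[OF Q cf[of "cnj d" "-1"]]
  define F1 where "F1 = (\<lambda>q. indicator {0..Q} q *\<^sub>R (f (a + of_real q * d) * d))"
  define F2 where "F2 = (\<lambda>q. indicator {0..Q} q *\<^sub>R (f (a + of_real q * cnj d) * cnj d))"
  have I: "integrable lborel F1" "integrable lborel F2" unfolding F1_def F2_def using L(1) L'(1) line line' by auto
  have C: "contour_integral l f = (LINT q|lborel. F1 q)" "contour_integral (cnj \<circ> l) f = (LINT q|lborel. F2 q)"
    unfolding l' unfolding l unfolding F1_def F2_def using L(2) L'(2) line line' by auto
  have F2': "(LINT q|lborel. F2 q) = (LINT q|lborel. F2 (0 + (-1) * q))" using lborel_integral_real_affine[of "-1" F2 0] by simp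
  have I2': "integrable lborel (\<lambda>q. F2 (0 + (-1) * q))" by (rule lborel_integrable_real_affine[OF I(2)]) simp
  have "contour_integral l f - contour_integral (cnj \<circ> l) f = (LINT q|lborel. F1 q - F2 (0 + (-1) * q))"
    unfolding C F2' by (rule Bochner_Integration.integral_diff[OF I(1) I2', symmetric])
  also have "\<dots> = (LINT q|lborel. veeint n \<tau> u s Q q / (zline s y - wvee s q))"
  proof (rule integral_cong_AE)
    show "(\<lambda>q. F1 q - F2 (0 + (-1) * q)) \<in> borel_measurable lborel" using I(1) I2' by (intro borel_measurable_diff) auto
    show "(\<lambda>q. veeint n \<tau> u s Q q / (zline s y - wvee s q)) \<in> borel_measurable lborel" unfolding veeint_def by measurable
    have "F1 q - F2 (0 + (-1) * q) = veeint n \<tau> u s Q q / (zline s y - wvee s q)" if "q \<noteq> 0" for q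
    proof (cases "q > 0")
      case True
      have "F2 (0 + (-1) * q) = 0" using True by (simp add: F2_def)
      moreover have "F1 q = indicator {0..Q} q *\<^sub>R ((\<i> - 1) / EE n \<tau> u (wvee s q) / (zline s y - wvee s q))"
        unfolding F1_def line[OF less_imp_le[OF True]] unfolding d_def fv ..
      ultimately show ?thesis using True by (simp add: veeint_def wvee'_def indicator_def)
    next
      case False
      then have q: "q < 0" "0 <= - q" using that by auto
      have "F1 q = 0" using q by (simp add: F1_def)
      moreover define e :: complex where "e = 1 + \<i>"
      have wv: "wvee' q = e" using q by (simp add: wvee'_def e_def)
      have "cnj d = of_real (hs n) * (- e)" by (simp add: d_def e_def)
      then have "F2 (0 + (-1) * q) = indicator {0..Q} (- q) *\<^sub>R (- e / EE n \<tau> u (wvee s q) / (zline s y - wvee s q))"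
        unfolding F2_def using line'[OF q(2)] fv[of q "- e"] by simp
      ultimately show ?thesis using q by (auto simp: veeint_def wv indicator_def)
    qed
    then show "AE q in lborel. F1 q - F2 (0 + (-1) * q) = veeint n \<tau> u s Q q / (zline s y - wvee s q)"
      using AE_lborel_singleton[of 0] by (rule eventually_mono[rotated]) blast
  qed
  finally show ?thesis .
qed

section \<open>Convergence of the kernel\<close>

text \<open>Lower bounds for |E0| along a contour thereby show that it avoids the initial
  points.\<close>

lemma E0_root:
  assumes "j \<in> {1..n}" "X0 n j \<noteq> xs" shows "E0 n (of_real (X0 n j - xs)) = 0"
proof -
  have "a n j * (X0 n j - xs) = -1" using assms(2) by (simp add: a_def divide_simps)
  then have "1 + complex_of_real (a n j) * of_real (X0 n j - xs) = 0" unfolding of_real_mult[symmetric] by simp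
  then have "(\<Prod>j'=1..n. 1 + complex_of_real (a n j') * of_real (X0 n j - xs)) = 0" using assms(1) by (intro prod_zero) auto
  then show ?thesis by (simp add: E0_def del: of_real_diff)
qed

text \<open>\<open>G\<close> winds once around the points left of \<open>xs\<close> and not around
  the others, \<open>D\<close> once around those on the right. Everything except the vee goes into
  \<open>Rst\<close>: four path integrals whose integrand is at most B / (\<open>hs n\<close> * s),
  as these contours stay at horizontal distance at least \<open>hs n\<close> * s from the vertical
  line.\<close>

lemma kernel_vee_form:
  fixes \<tau>1 \<tau>2 u v s Q K B L L' :: real and RL UR :: "real \<Rightarrow> complex"
  assumes n: "n > 0" and t1: "tAi psi xs n \<tau>1 > 0" and t2: "tAi psi xs n \<tau>2 > 0"
    and X: "\<And>j. j \<in> {1..n} ==> \<bar>X0 n j - xs\<bar> > gap n" and s: "s >= 1" and hg: "(4 * s) * hs n <= gap n / 2" and Q: "Q > 0"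
    and nz: "\<And>q. \<bar>q\<bar> <= Q ==> E0 n (of_real (hs n) * wvee s q) \<noteq> 0"
    and RL: "path_bound RL K" "pathstart RL = of_real (hs n) * wvee s Q" "pathfinish RL = of_real (- L)" "L > \<bar>xs\<bar> + \<bar>bd\<bar>"
    and UR: "path_bound UR K" "pathstart UR = of_real (gap n / 4)" "pathfinish UR = of_real L'" "L' > \<bar>xs\<bar> + \<bar>bd\<bar>"
    and RLp: "\<And>h. h \<in> path_image RL ==> 0 <= Im h \<and> Re h <= 0 \<and> E0 n h \<noteq> 0 \<and> cmod (1 / EE n \<tau>1 u (h / of_real (hs n))) <= B"
    and URp: "\<And>h. h \<in> path_image UR ==> 0 <= Im h \<and> gap n / 4 <= Re h \<and> E0 n h \<noteq> 0 \<and> cmod (1 / EE n \<tau>1 u (h / of_real (hs n))) <= B"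
  defines "f \<equiv> \<lambda>Rst y. \<i> * EE n \<tau>2 v (zline s y) * ((LINT q|lborel. veeint n \<tau>1 u s Q q / (zline s y - wvee s q)) + Rst y)"
  shows "\<exists>Rst. (\<forall>y. cmod (Rst y) <= 4 * (K * (B / (hs n * s)))) \<and> integrable lborel (f Rst) \<and>
     scaledK n \<tau>1 \<tau>2 u v
      = of_real (t0 / sqrt (tAi psi xs n \<tau>1 * tAi psi xs n \<tau>2)) / (2 * of_real pi * \<i>)^2 * (LINT y|lborel. f Rst y)
       - airy_gauss \<tau>1 \<tau>2 u v"
proof -
  have hp: "hs n > 0" using n by (rule hs_pos)
  have gp: "gap n > 0" using n by (rule gap_pos)
  have hsp: "hs n * s > 0" using hp s by simp
  have hg4: "2 * (hs n * s) <= gap n / 4" "hs n * s < gap n" using hg hsp by (simp_all add: mult_ac)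
  have Xne: "X0 n j \<noteq> xs" if "j \<in> {1..n}" for j using X[OF that] gp by auto
  define l where "l = linepath (of_real (- (hs n * s))) (of_real (hs n) * wvee s Q)"
  define U where "U = l +++ RL"
  define G where "G = U +++ reversepath (cnj \<circ> U)"
  define D0 where "D0 = UR +++ reversepath (cnj \<circ> UR)"
  \<comment> \<open>\<open>D0\<close> runs from gap / 4 outwards through the upper half plane and
    back below, so it winds clockwise; hence the reversal.\<close>
  define D where "D = reversepath D0"
  define F where "F = (\<lambda>y h. 1 / (EE n \<tau>1 u (h / of_real (hs n)) * (of_real (hs n) * zline s y - h)))"
  have vl: "valid_path l" by (simp add: l_def)
  have vR: "valid_path RL" "valid_path UR" using RL(1) UR(1) by (auto simp: path_bound_def)
  have lR: "pathfinish l = pathstart RL" by (simp add: l_def RL(2))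
  have vU: "valid_path U" unfolding U_def using vl vR(1) lR by (rule valid_path_join)
  have imU: "path_image U = path_image l \<union> path_image RL" unfolding U_def using lR by (rule path_image_join)
  have lp: "0 <= Im h \<and> Re h <= 0 \<and> E0 n h \<noteq> 0" if h: "h \<in> path_image l" for h
  proof -
    obtain t where t: "0 <= t" "t <= 1" "h = (1 - t) *\<^sub>R of_real (- (hs n * s)) + t *\<^sub>R (of_real (hs n) * wvee s Q)"
      using h unfolding l_def path_image_linepath in_segment by blast
    have tQ: "0 <= t * Q" "t * Q <= Q" using t Q by (auto simp: mult_le_cancel_right1)
    have h': "h = of_real (hs n) * wvee s (t * Q)" unfolding t(3) using tQ Q by (simp add: wvee_def scaleR_conv_of_real algebra_simps)
    have "E0 n h \<noteq> 0" unfolding h' using tQ by (intro nz) simp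
    moreover have "0 <= Im h" unfolding h' using hp tQ by simp
    moreover have "Re h <= 0" unfolding h' using hp tQ s by (simp add: mult_nonneg_nonpos)
    ultimately show ?thesis by blast
  qed
  have ReU: "0 <= Im h \<and> Re h <= 0 \<and> E0 n h \<noteq> 0" if "h \<in> path_image U" for h using that lp RLp unfolding imU by blast
  have zl: "Re (of_real (hs n) * zline s y) = hs n * s" for y by simp
  have z0: "Re (zline s y) > 0" for y using s by simp
  have Up: "Im h >= 0 \<and> E0 n h \<noteq> 0 \<and> h \<noteq> of_real (hs n) * zline s y \<and> cnj h \<noteq> of_real (hs n) * zline s y" if "h \<in> path_image U" for h y
  proof -
    have "Re h \<noteq> hs n * s" "Re (cnj h) \<noteq> hs n * s" using ReU[OF that] hsp by auto
    then show ?thesis using ReU[OF that] zl[of y] by metis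
  qed
  have URq: "Im h >= 0 \<and> E0 n h \<noteq> 0 \<and> h \<noteq> of_real (hs n) * zline s y \<and> cnj h \<noteq> of_real (hs n) * zline s y" if "h \<in> path_image UR" for h y
  proof -
    have "Re h \<noteq> hs n * s" "Re (cnj h) \<noteq> hs n * s" using URp[OF that] hsp hg4 by auto
    then show ?thesis using URp[OF that] zl[of y] by metis
  qed
  have endsU: "pathstart U = of_real (- (hs n * s))" "pathfinish U = of_real (- L)" by (simp_all add: U_def l_def RL(3))
  note JU = Jint_upper[where \<tau> = \<tau>1 and u = u, OF n z0 vU Up endsU]
  note JR = Jint_upper[where \<tau> = \<tau>1 and u = u, OF n z0 vR(2) URq UR(2,3)]
  have xU: "of_real (X0 n j - xs) \<notin> path_image U" "of_real (X0 n j - xs) \<notin> path_image UR" if "j \<in> {1..n}" for j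
    using E0_root[OF that Xne[OF that]] ReU URp by blast+
  have ImU: "\<And>h. h \<in> path_image U ==> Im h >= 0" "\<And>h. h \<in> path_image UR ==> Im h >= 0" using ReU URp by blast+
  have one: "1 \<in> {1..n}" using n by simp
  note mU = winding_number_mirror_path[OF vU ImU(1) xU(1) endsU, folded G_def]
  note mR = winding_number_mirror_path[OF vR(2) ImU(2) xU(2) UR(2,3), folded D0_def]
  have imD: "path_image D = path_image UR \<union> cnj ` path_image UR" unfolding D_def path_image_reversepath by (rule mR(3); (assumption | rule one))
  have imG: "path_image G = path_image U \<union> cnj ` path_image U" by (rule mU(3); (assumption | rule one))
  have vD0: "valid_path D0" "pathfinish D0 = pathstart D0" by ((rule mR(1) mR(2); (assumption | rule one))+)
  have G: "valid_path G" "pathfinish G = pathstart G" by ((rule mU(1) mU(2); (assumption | rule one))+)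
  have D: "valid_path D" "pathfinish D = pathstart D" using vD0 by (simp_all add: D_def)
  have x1: "\<And>w. w \<in> path_image G ==> Re w < hs n * s" "\<And>w. w \<in> path_image D ==> Re w > hs n * s"
  proof -
    show "Re w < hs n * s" if "w \<in> path_image G" for w using that ReU hsp unfolding imG by force
    fix w assume "w \<in> path_image D"
    then have "gap n / 4 <= Re w" using URp unfolding imD by force
    then show "Re w > hs n * s" using hg4 hsp by linarith
  qed
  have cx: "of_real x \<notin> cnj ` A" if "complex_of_real x \<notin> A" for x A using that by (metis complex_cnj_complex_of_real complex_cnj_cnj imageE)
  have av: "of_real (X0 n j - xs) \<notin> path_image G" "of_real (X0 n j - xs) \<notin> path_image D" if "j \<in> {1..n}" for j
    unfolding imG imD using xU[OF that] cx by blast+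
  have wn: "winding_number G (of_real (X0 n j - xs)) + winding_number D (of_real (X0 n j - xs)) = 1" if j: "j \<in> {1..n}" for j
  proof -
    define x where "x = X0 n j - xs"
    have xb: "- L < x" "x < L'" using bd[of j n] j RL(4) UR(4) unfolding x_def by auto
    have wG: "winding_number G (of_real x) = (if x > - L then 1/2 else - 1/2) - (if x > - (hs n * s) then 1/2 else - 1/2)"
      unfolding x_def by (rule mU(4); (assumption | rule j))
    have wD: "winding_number D0 (of_real x) = (if x > L' then 1/2 else - 1/2) - (if x > gap n / 4 then 1/2 else - 1/2)"
      unfolding x_def by (rule mR(4); (assumption | rule j))
    have "winding_number D (of_real x) = - winding_number D0 (of_real x)" unfolding D_def
      using av(2)[OF j] vD0(1) by (intro winding_number_reversepath) (auto simp: x_def D_def valid_path_imp_path simp del: of_real_diff)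
    moreover have "x < - gap n \<or> x > gap n" using X[OF j] unfolding x_def by linarith
    ultimately show ?thesis unfolding x_def[symmetric] wG wD using xb hg4 gp hsp by auto
  qed
  define Rst where "Rst = (\<lambda>y. (contour_integral RL (F y) - contour_integral (cnj \<circ> RL) (F y)) - (contour_integral UR (F y) - contour_integral (cnj \<circ> UR) (F y)))"
  have Fint: "F y contour_integrable_on g" if "valid_path g" "path_image g \<subseteq> path_image U \<union> cnj ` path_image U \<or> path_image g \<subseteq> path_image UR \<union> cnj ` path_image UR" for y g
  proof -
    obtain S1 where S1: "open S1" "F y holomorphic_on S1" "path_image U \<subseteq> S1" "cnj ` path_image U \<subseteq> S1" using JU(2)[of y] unfolding F_def by blast
    obtain S2 where S2: "open S2" "F y holomorphic_on S2" "path_image UR \<subseteq> S2" "cnj ` path_image UR \<subseteq> S2" using JR(2)[of y] unfolding F_def by blast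
    show ?thesis using that(2)
    proof
      assume "path_image g \<subseteq> path_image U \<union> cnj ` path_image U"
      then show ?thesis using S1 that(1) by (intro contour_integrable_holomorphic_simple[OF S1(2,1)]) auto
    next
      assume "path_image g \<subseteq> path_image UR \<union> cnj ` path_image UR"
      then show ?thesis using S2 that(1) by (intro contour_integrable_holomorphic_simple[OF S2(2,1)]) auto
    qed
  qed
  have vc: "valid_path (cnj \<circ> g)" if "valid_path g" for g using that valid_path_cnj by blast
  have i: "F y contour_integrable_on l" "F y contour_integrable_on RL" "F y contour_integrable_on (cnj \<circ> l)" "F y contour_integrable_on (cnj \<circ> RL)"
    "F y contour_integrable_on UR" "F y contour_integrable_on (cnj \<circ> UR)" for y
    by (rule Fint; (rule vl vR vc[OF vl] vc[OF vR(1)] vc[OF vR(2)] | use imU in \<open>auto simp: path_image_compose\<close>))+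
  have cU: "cnj \<circ> U = (cnj \<circ> l) +++ (cnj \<circ> RL)" unfolding U_def by (rule path_compose_join)
  have JG: "Jint n \<tau>1 u G (zline s y) = (LINT q|lborel. veeint n \<tau>1 u s Q q / (zline s y - wvee s q)) + (contour_integral RL (F y) - contour_integral (cnj \<circ> RL) (F y))" for y
  proof -
    have "Jint n \<tau>1 u G (zline s y) = contour_integral U (F y) - contour_integral (cnj \<circ> U) (F y)" unfolding G_def F_def by (rule JU(1))
    also have "contour_integral U (F y) = contour_integral l (F y) + contour_integral RL (F y)"
      unfolding U_def by (rule contour_integral_join[OF i(1,2) vl vR(1)])
    also have "contour_integral (cnj \<circ> U) (F y) = contour_integral (cnj \<circ> l) (F y) + contour_integral (cnj \<circ> RL) (F y)"
      unfolding cU by (rule contour_integral_join[OF i(3,4) vc[OF vl] vc[OF vR(1)]])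
    finally show ?thesis using veeint_integral[OF n s Q nz, where \<tau> = \<tau>1 and u = u and y = y] unfolding l_def F_def by (simp add: algebra_simps)
  qed
  have JD: "Jint n \<tau>1 u D (zline s y) = - (contour_integral UR (F y) - contour_integral (cnj \<circ> UR) (F y))" for y
  proof -
    have "Jint n \<tau>1 u D (zline s y) = - Jint n \<tau>1 u D0 (zline s y)" unfolding Jint_def D_def by (rule contour_integral_reversepath[OF vD0(1)])
    then show ?thesis using JR(1)[of y] unfolding D0_def F_def by simp
  qed
  have eq: "Jint n \<tau>1 u G (zline s y) + Jint n \<tau>1 u D (zline s y) = (LINT q|lborel. veeint n \<tau>1 u s Q q / (zline s y - wvee s q)) + Rst y" for y
    unfolding JG JD Rst_def by simp
  have Fb: "cmod (F y h) <= B / (hs n * s) \<and> cmod (F y (cnj h)) <= B / (hs n * s)"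
    if d: "\<bar>hs n * s - Re h\<bar> >= hs n * s" and b: "cmod (1 / EE n \<tau>1 u (h / of_real (hs n))) <= B" for y h
  proof -
    have b': "cmod (1 / EE n \<tau>1 u (cnj h / of_real (hs n))) <= B" using b norm_EE_cnj[of n \<tau>1 u "h / of_real (hs n)"] by (simp add: norm_divide)
    have *: "cmod (F y w) <= B / (hs n * s)" if "\<bar>hs n * s - Re w\<bar> >= hs n * s" "cmod (1 / EE n \<tau>1 u (w / of_real (hs n))) <= B" for w
    proof -
      have "hs n * s <= cmod (of_real (hs n) * zline s y - w)" using that(1) abs_Re_le_cmod[of "of_real (hs n) * zline s y - w"] by simp
      moreover have "cmod (F y w) = cmod (1 / EE n \<tau>1 u (w / of_real (hs n))) / cmod (of_real (hs n) * zline s y - w)" by (simp add: F_def norm_mult norm_divide)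
      moreover have "0 <= B" by (rule order_trans[OF norm_ge_zero that(2)])
      ultimately show ?thesis using that(2) hsp by (simp only:) (intro frac_le; simp)
    qed
    show ?thesis using *[OF d b] *[of "cnj h"] d b' by simp
  qed
  have pc: "path_bound (cnj \<circ> RL) K" "path_bound (cnj \<circ> UR) K" using path_bound_cnj RL(1) UR(1) by blast+
  have bd4: "cmod (contour_integral RL (F y)) <= K * (B / (hs n * s))" "cmod (contour_integral (cnj \<circ> RL) (F y)) <= K * (B / (hs n * s))"
    "cmod (contour_integral UR (F y)) <= K * (B / (hs n * s))" "cmod (contour_integral (cnj \<circ> UR) (F y)) <= K * (B / (hs n * s))" for y
  proof -
    have R: "cmod (F y h) <= B / (hs n * s) \<and> cmod (F y (cnj h)) <= B / (hs n * s)" if "h \<in> path_image RL" for h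
      using RLp[OF that] hsp by (intro Fb) auto
    have V: "cmod (F y h) <= B / (hs n * s) \<and> cmod (F y (cnj h)) <= B / (hs n * s)" if "h \<in> path_image UR" for h
    proof (rule Fb)
      have "gap n / 4 <= Re h" using URp[OF that] by blast
      then show "hs n * s <= \<bar>hs n * s - Re h\<bar>" using hg4 hsp by linarith
      show "cmod (1 / EE n \<tau>1 u (h / of_real (hs n))) <= B" using URp[OF that] by blast
    qed
    have app: "cmod (contour_integral g (F y)) <= K * (B / (hs n * s))" if "path_bound g K" "F y contour_integrable_on g" "\<And>w. w \<in> path_image g ==> cmod (F y w) <= B / (hs n * s)" for g
      using that unfolding path_bound_def by blast
    show "cmod (contour_integral RL (F y)) <= K * (B / (hs n * s))" using R by (intro app RL i) auto
    show "cmod (contour_integral (cnj \<circ> RL) (F y)) <= K * (B / (hs n * s))" using R by (intro app pc i) (auto simp: path_image_compose)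
    show "cmod (contour_integral UR (F y)) <= K * (B / (hs n * s))" using V by (intro app UR i) auto
    show "cmod (contour_integral (cnj \<circ> UR) (F y)) <= K * (B / (hs n * s))" using V by (intro app pc i) (auto simp: path_image_compose)
  qed
  have Rb: "cmod (Rst y) <= 4 * (K * (B / (hs n * s)))" for y
  proof -
    have "cmod (Rst y) <= (cmod (contour_integral RL (F y)) + cmod (contour_integral (cnj \<circ> RL) (F y))) + (cmod (contour_integral UR (F y)) + cmod (contour_integral (cnj \<circ> UR) (F y)))"
      unfolding Rst_def by (rule order_trans[OF norm_triangle_ineq4 add_mono[OF norm_triangle_ineq4 norm_triangle_ineq4]])
    also have "\<dots> <= (K * (B / (hs n * s)) + K * (B / (hs n * s))) + (K * (B / (hs n * s)) + K * (B / (hs n * s)))" by (intro add_mono bd4)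
    also have "\<dots> = 4 * (K * (B / (hs n * s)))" by (simp add: mult_ac)
    finally show ?thesis .
  qed
  have fe: "\<i> * EE n \<tau>2 v (zline s y) * (Jint n \<tau>1 u G (zline s y) + Jint n \<tau>1 u D (zline s y)) = f Rst y" for y
    unfolding eq f_def ..
  note SK = scaled_kernel[where s = s and u = u and v = v, OF n t1 t2 Xne x1 G av(1) D av(2) wn, unfolded fe]
  show ?thesis using Rb SK by (intro exI[of _ Rst]) blast
qed

text \<open>On the Airy scale the distance gap / 8 is a multiple of n^(1/3 - \<gamma>), so
  \<open>EE_inverse_macro\<close> applies.\<close>

lemma macro_inverse_bound:
  assumes M: "M > 0" and Tm: "Tm >= 0" and c1: "c1 > 0"
  shows "EV n. \<forall>\<tau> u h. \<bar>\<tau>\<bar> <= Tm --> u \<in> vrange M n --> gap n / 8 <= cmod h --> exp (c1 * (real n * cmod h^3)) <= cmod (E0 n h) -->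
     cmod (1 / EE n \<tau> u (h / of_real (hs n))) <= exp (- \<sigma> * u) * real n powr - 2"
proof -
  have "c1 * cc^3 > 0" "mm / (8 * cc) > 0" using c1 cc(1) gap(1) by simp_all
  from EE_inverse_macro[OF M Tm this] show ?thesis using eventually_gt_at_top[of 0]
  proof eventually_elim
    case (elim n)
    then have n: "n > 0" by simp
    have hp: "hs n > 0" using n by (rule hs_pos)
    show ?case
    proof (intro allI impI)
      fix \<tau> u h assume \<tau>: "\<bar>\<tau>\<bar> <= Tm" and u: "u \<in> vrange M n" and h: "gap n / 8 <= cmod h" and E: "exp (c1 * (real n * cmod h^3)) <= cmod (E0 n h)"
      define \<zeta> where "\<zeta> = h / of_real (hs n)"
      have h\<zeta>: "h = of_real (hs n) * \<zeta>" using hp by (simp add: \<zeta>_def)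
      have nh: "cmod h = hs n * cmod \<zeta>" unfolding h\<zeta> norm_mult using hp by simp
      have "real n * cmod h^3 = (real n * hs n^3) * cmod \<zeta>^3" unfolding nh power_mult_distrib by simp
      then have ceq: "c1 * (real n * cmod h^3) = (c1 * cc^3) * cmod \<zeta>^3" unfolding hs_cube[OF n] by simp
      have E': "exp ((c1 * cc^3) * cmod \<zeta>^3) <= cmod (E0 n (of_real (hs n) * \<zeta>))" using E unfolding ceq h\<zeta>[symmetric] .
      have "gap n / 8 = (mm / (8 * cc)) * real n powr (1/3 - \<gamma>) * hs n"
      proof -
        have pr: "real n powr (1/3 - \<gamma>) * real n powr (-1/3) = real n powr - \<gamma>" unfolding powr_add_eq by simp
        have "(mm / (8 * cc)) * real n powr (1/3 - \<gamma>) * hs n = ((mm / (8 * cc)) * cc) * (real n powr (1/3 - \<gamma>) * real n powr (-1/3))"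
          unfolding hs_def by (simp only: mult_ac)
        then show ?thesis unfolding pr using cc(1) by (simp add: gap_def)
      qed
      then have "(mm / (8 * cc)) * real n powr (1/3 - \<gamma>) * hs n <= cmod \<zeta> * hs n" using h unfolding nh by (simp only: mult.commute)
      then have "(mm / (8 * cc)) * real n powr (1/3 - \<gamma>) <= cmod \<zeta>" using hp by (rule mult_right_le_imp_le)
      then show "cmod (1 / EE n \<tau> u (h / of_real (hs n))) <= exp (- \<sigma> * u) * real n powr - 2"
        using elim(1) \<tau> u E' unfolding \<zeta>_def[symmetric] by blast
    qed
  qed
qed

text \<open>The vee is quitted at parameter \<rho> / \<open>hs n\<close>, of order n^(1/3); beyond
  it the Airy integrand has to be negligible by itself.\<close>

lemma tail_decay:
  assumes "\<rho> > 0"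
  shows "EV n. exp (- (\<rho> / hs n)) <= 16^8 * real n powr - \<epsilon>"
proof -
  have "EV n. (cc / (2 * \<rho>)) * real n powr (\<epsilon> / 8 - 1/3) <= 1" using eps' by (intro powr_eventually_le) auto
  then show ?thesis using eventually_gt_at_top[of 0]
  proof eventually_elim
    case (elim n)
    have hp: "hs n > 0" using elim hs_pos by simp
    have "(cc / (2 * \<rho>)) * (real n powr (\<epsilon> / 8) * real n powr (- 1/3)) <= 1" using elim(1) unfolding powr_add_eq by simp
    then have "real n powr (\<epsilon> / 8) * hs n <= 2 * \<rho>" unfolding hs_def using assms by (simp add: field_simps)
    then have "real n powr (\<epsilon> / 8) / 2 <= \<rho> / hs n" using hp by (simp add: field_simps)
    then have "exp (- (\<rho> / hs n)) <= exp (- (real n powr (\<epsilon> / 8)) / 2)" by simp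
    also have "\<dots> <= 16^8 * real n powr - \<epsilon>" using elim(2) by (rule exp_half_decay)
    finally show ?case .
  qed
qed

text \<open>The prefactor is the square root r of \<open>th n \<tau>1 * th n \<tau>2\<close>, and |r
  - 1| <= |r^2 - 1| as r >= 0.\<close>

lemma prefactor_bound:
  "\<exists>C\<ge>0. EV n. \<forall>\<tau>1 \<tau>2. \<bar>\<tau>1\<bar> <= Tm --> \<bar>\<tau>2\<bar> <= Tm -->
     \<bar>t0 / sqrt (tAi psi xs n \<tau>1 * tAi psi xs n \<tau>2) - 1\<bar> <= C * real n powr - \<epsilon> \<and> \<bar>t0 / sqrt (tAi psi xs n \<tau>1 * tAi psi xs n \<tau>2)\<bar> <= 2"
proof -
  obtain C where C: "C >= 0" "EV n. \<forall>\<tau>. \<bar>\<tau>\<bar> <= Tm --> tAi psi xs n \<tau> >= t0 / 2 \<and> tAi psi xs n \<tau> > 0 \<and> \<bar>th n \<tau> - 1\<bar> <= C * real n powr (-1/3)"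
    using tAi_asymp by blast
  have "EV n. \<forall>\<tau>1 \<tau>2. \<bar>\<tau>1\<bar> <= Tm --> \<bar>\<tau>2\<bar> <= Tm -->
     \<bar>t0 / sqrt (tAi psi xs n \<tau>1 * tAi psi xs n \<tau>2) - 1\<bar> <= (3 * C) * real n powr - \<epsilon> \<and> \<bar>t0 / sqrt (tAi psi xs n \<tau>1 * tAi psi xs n \<tau>2)\<bar> <= 2"
    using C(2) th_bounds[of Tm] eventually_ge_at_top[of 1]
  proof eventually_elim
    case (elim n)
    show ?case
    proof (intro allI impI)
      fix \<tau>1 \<tau>2 assume \<tau>: "\<bar>\<tau>1\<bar> <= Tm" "\<bar>\<tau>2\<bar> <= Tm"
      define x where "x = th n \<tau>1"
      define y where "y = th n \<tau>2"
      have b: "1/2 <= x" "x <= 2" "1/2 <= y" "y <= 2" using elim(2) \<tau> unfolding x_def y_def by blast+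
      have d: "\<bar>x - 1\<bar> <= C * real n powr (-1/3)" "\<bar>y - 1\<bar> <= C * real n powr (-1/3)" using elim(1) \<tau> unfolding x_def y_def by blast+
      have tp: "tAi psi xs n \<tau>1 > 0" "tAi psi xs n \<tau>2 > 0" using elim(1) \<tau> by blast+
      have "x * y = t0^2 / (tAi psi xs n \<tau>1 * tAi psi xs n \<tau>2)" by (simp add: x_def y_def th_def power2_eq_square)
      then have pre: "t0 / sqrt (tAi psi xs n \<tau>1 * tAi psi xs n \<tau>2) = sqrt (x * y)" using t0(1) by (simp add: real_sqrt_divide)
      have xy: "0 <= x * y" "x * y <= 4" using b mult_mono[of x 2 y 2] by auto
      define r where "r = sqrt (x * y)"
      have r: "r >= 0" "r * r = x * y" using xy by (auto simp: r_def)
      have "r <= sqrt 4" unfolding r_def using xy by (intro real_sqrt_le_mono)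
      then have r2: "r <= 2" by simp
      have "x * y - 1 = (r - 1) * (r + 1)" using r(2) by (simp add: algebra_simps)
      then have "\<bar>x * y - 1\<bar> = \<bar>r - 1\<bar> * \<bar>r + 1\<bar>" by (simp only: abs_mult)
      moreover have "\<bar>r - 1\<bar> * 1 <= \<bar>r - 1\<bar> * \<bar>r + 1\<bar>" using r by (intro mult_left_mono) auto
      ultimately have 1: "\<bar>r - 1\<bar> <= \<bar>x * y - 1\<bar>" by simp
      have "x * y - 1 = (x - 1) * y + (y - 1)" by (simp add: algebra_simps)
      then have "\<bar>x * y - 1\<bar> <= \<bar>x - 1\<bar> * \<bar>y\<bar> + \<bar>y - 1\<bar>" unfolding abs_mult[symmetric] by simp
      also have "\<dots> <= (C * real n powr (-1/3)) * 2 + C * real n powr (-1/3)" using d b C(1) by (intro add_mono mult_mono) auto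
      also have "\<dots> = (3 * C) * real n powr (-1/3)" by simp
      also have "\<dots> <= (3 * C) * real n powr - \<epsilon>" using C(1) elim(3) eps' by (intro mult_left_mono powr_mono) auto
      finally have "\<bar>r - 1\<bar> <= (3 * C) * real n powr - \<epsilon>" using 1 by linarith
      then show "\<bar>t0 / sqrt (tAi psi xs n \<tau>1 * tAi psi xs n \<tau>2) - 1\<bar> <= (3 * C) * real n powr - \<epsilon> \<and> \<bar>t0 / sqrt (tAi psi xs n \<tau>1 * tAi psi xs n \<tau>2)\<bar> <= 2"
        unfolding pre r_def[symmetric] using r r2 by simp
    qed
  qed
  moreover have "3 * C >= 0" using C(1) by simp
  ultimately show ?thesis by blast
qed

lemma measurable_veeint [measurable]: "veeint n \<tau> u s Q \<in> borel_measurable borel"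
  unfolding veeint_def[abs_def] by measurable

lemma kernel_convergence:
  assumes M: "M > 0" and Tm: "Tm >= 0"
  shows "\<exists>C. EV n. \<forall>\<tau>1 \<tau>2 u v. \<bar>\<tau>1\<bar> <= Tm --> \<bar>\<tau>2\<bar> <= Tm --> u \<in> vrange M n --> v \<in> vrange M n -->
     cmod (scaledK n \<tau>1 \<tau>2 u v - KAiry \<tau>1 \<tau>2 u v)
      <= C * (real n powr - \<epsilon> * (exp (- \<sigma> * u) * exp (- \<sigma> * v)))"
proof -
  \<comment> \<open>2 \<sigma> is needed for the factors exp (- \<sigma> u) and exp (- \<sigma> v),
    2 Tm + 3 for the Gaussian decay on the vertical line.\<close>
  define s where "s = 2 * \<sigma> + 2 * Tm + 3"
  have s: "s >= 2 * \<sigma>" "s >= 2 * Tm + 3" "s >= 1" "s > 0" using sigma Tm by (auto simp: s_def)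
  obtain \<rho>1 where \<rho>1: "\<rho>1 > 0" "EV n. \<forall>q. hs n * \<bar>q\<bar> <= \<rho>1 --> cmod (E0 n (of_real (hs n) * wvee s q)) >= exp (\<bar>q\<bar>^3 / 2 - s^2 * \<bar>q\<bar> - s^3 - 1)"
    using vee_bound[OF s(4)] by blast
  obtain \<rho> c1 K where \<rho>: "0 < \<rho>" "\<rho> <= \<rho>1" and c1: "0 < c1" and K: "0 <= K" and cont: "EV n. \<exists>RL UR L L'.
     path_bound RL K \<and> pathstart RL = of_real (hs n) * wvee s (\<rho> / hs n) \<and> pathfinish RL = of_real (- L) \<and> L > \<bar>xs\<bar> + \<bar>bd\<bar> \<and>
     path_bound UR K \<and> pathstart UR = of_real (gap n / 4) \<and> pathfinish UR = of_real L' \<and> L' > \<bar>xs\<bar> + \<bar>bd\<bar> \<and>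
     (\<forall>h\<in>path_image RL. 0 <= Im h \<and> Re h <= 0 \<and> gap n / 8 <= cmod h \<and> exp (c1 * (real n * cmod h^3)) <= cmod (E0 n h)) \<and>
     (\<forall>h\<in>path_image UR. 0 <= Im h \<and> gap n / 4 <= Re h \<and> gap n / 8 <= cmod h \<and> exp (c1 * (real n * cmod h^3)) <= cmod (E0 n h))"
    using contours_exist[OF s(4) \<rho>1(1), of "\<bar>xs\<bar> + \<bar>bd\<bar>"] by blast
  obtain K1 where K1: "K1 > 0" "\<forall>\<tau> v y. \<bar>\<tau>\<bar> <= Tm --> v >= - M --> cmod (eAi \<tau> v (zline s y)) <= K1 * exp (- \<sigma> * v) * exp (- 2 * \<bar>y\<bar>)"
    "EV n. \<forall>\<tau> v y. \<bar>\<tau>\<bar> <= Tm --> v \<in> vrange M n --> cmod (EE n \<tau> v (zline s y)) <= K1 * exp (- \<sigma> * v) * exp (- 2 * \<bar>y\<bar>)"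
    using EE_zline_bounds[OF M Tm s(1,2)] by blast
  obtain K2 where K2: "K2 >= 0" "EV n. \<forall>\<tau> v y. \<bar>\<tau>\<bar> <= Tm --> v \<in> vrange M n -->
     cmod (EE n \<tau> v (zline s y) - eAi \<tau> v (zline s y)) <= K2 * real n powr - \<epsilon> * exp (- \<sigma> * v) * exp (- \<bar>y\<bar>)"
    using EE_zline_diff[OF M Tm s(1,2)] by blast
  obtain K3 where K3: "K3 > 0" "\<forall>\<tau> u q. \<bar>\<tau>\<bar> <= Tm --> u >= - M --> cmod (1 / eAi \<tau> u (wvee s q)) <= K3 * exp (- \<sigma> * u) * exp (- 2 * \<bar>q\<bar>)"
    "EV n. \<forall>\<tau> u q. \<bar>\<tau>\<bar> <= Tm --> u \<in> vrange M n --> hs n * \<bar>q\<bar> <= \<rho>1 --> cmod (1 / EE n \<tau> u (wvee s q)) <= K3 * exp (- \<sigma> * u) * exp (- 2 * \<bar>q\<bar>)"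
    using EE_wvee_bounds[OF M Tm s(1) \<rho>1(2)] by blast
  obtain K4 where K4: "K4 >= 0" "EV n. \<forall>\<tau> u q. \<bar>\<tau>\<bar> <= Tm --> u \<in> vrange M n --> hs n * \<bar>q\<bar> <= \<rho>1 -->
     cmod (1 / EE n \<tau> u (wvee s q) - 1 / eAi \<tau> u (wvee s q)) <= K4 * real n powr - \<epsilon> * exp (- \<sigma> * u) * exp (- \<bar>q\<bar>)"
    using EE_wvee_diff[OF M Tm s(1) \<rho>1(2)] by blast
  obtain C6 where C6: "C6 >= 0" "EV n. \<forall>\<tau>1 \<tau>2. \<bar>\<tau>1\<bar> <= Tm --> \<bar>\<tau>2\<bar> <= Tm -->
     \<bar>t0 / sqrt (tAi psi xs n \<tau>1 * tAi psi xs n \<tau>2) - 1\<bar> <= C6 * real n powr - \<epsilon> \<and> \<bar>t0 / sqrt (tAi psi xs n \<tau>1 * tAi psi xs n \<tau>2)\<bar> <= 2"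
    using prefactor_bound by blast
  \<comment> \<open>One constant for all envelopes: the factors 2 come from |wvee'| = sqrt 2 <= 2,
    and 16^8 from the tail of the Airy integrand beyond the end of the vee.\<close>
  define KK where "KK = K1 + K2 + 2 * K3 + 2 * K4 + 2 * 16^8 * K3 + 4 * K / cc"
  have Kc: "0 <= 4 * K / cc" using K cc(1) by simp
  have KK: "K1 <= KK" "K2 <= KK" "2 * K3 <= KK" "2 * K4 <= KK" "2 * 16^8 * K3 <= KK" "4 * K / cc <= KK" "0 <= KK"
    using K1(1) K2(1) K3(1) K4(1) Kc unfolding KK_def by simp_all
  define I1 where "I1 = (LINT y::real|lborel. exp (- \<bar>y\<bar>))"
  define CC where "CC = 2 * (KK^2 * (2 * I1 + 1) * I1) + C6 * (KK^2 * I1 * I1)"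
  have sq2: "sqrt 2 <= (2::real)" by (rule real_le_lsqrt) auto
  have "EV n. \<forall>\<tau>1 \<tau>2 u v. \<bar>\<tau>1\<bar> <= Tm --> \<bar>\<tau>2\<bar> <= Tm --> u \<in> vrange M n --> v \<in> vrange M n -->
     cmod (scaledK n \<tau>1 \<tau>2 u v - KAiry \<tau>1 \<tau>2 u v)
      <= CC * (real n powr - \<epsilon> * (exp (- \<sigma> * u) * exp (- \<sigma> * v)))"
    using \<rho>1(2) cont K1(3) K2(2) K3(3) K4(2) C6(2) tail_decay[OF \<rho>(1)] macro_inverse_bound[OF M Tm c1] th_bounds[of Tm] hs_le_gap[of "4 * s"] gap(2) eventually_ge_at_top[of 1]
  proof eventually_elim
    case (elim n)
    have n: "n > 0" "real n >= 1" using elim(13) by simp_all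
    have hp: "hs n > 0" using n(1) by (rule hs_pos)
    define Q where "Q = \<rho> / hs n"
    have Q: "Q > 0" "hs n * Q = \<rho>" using \<rho>(1) hp by (simp_all add: Q_def)
    obtain RL UR L L' where ct: "path_bound RL K" "pathstart RL = of_real (hs n) * wvee s Q" "pathfinish RL = of_real (- L)" "L > \<bar>xs\<bar> + \<bar>bd\<bar>"
       "path_bound UR K" "pathstart UR = of_real (gap n / 4)" "pathfinish UR = of_real L'" "L' > \<bar>xs\<bar> + \<bar>bd\<bar>"
       and RLp: "\<forall>h\<in>path_image RL. 0 <= Im h \<and> Re h <= 0 \<and> gap n / 8 <= cmod h \<and> exp (c1 * (real n * cmod h^3)) <= cmod (E0 n h)"
       and URp: "\<forall>h\<in>path_image UR. 0 <= Im h \<and> gap n / 4 <= Re h \<and> gap n / 8 <= cmod h \<and> exp (c1 * (real n * cmod h^3)) <= cmod (E0 n h)"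
      using elim(2) unfolding Q_def by blast
    have inQ: "hs n * \<bar>q\<bar> <= \<rho>1" if "\<bar>q\<bar> <= Q" for q
    proof -
      have "hs n * \<bar>q\<bar> <= hs n * Q" using that hp by (intro mult_left_mono) auto
      then show ?thesis using Q(2) \<rho>(2) by linarith
    qed
    have nz: "E0 n h \<noteq> 0" if "exp x <= cmod (E0 n h)" for x h using that exp_gt_zero[of x] by auto
    have nzq: "E0 n (of_real (hs n) * wvee s q) \<noteq> 0" if "\<bar>q\<bar> <= Q" for q by (rule nz) (use elim(1) inQ[OF that] in blast)
    have gX: "\<bar>X0 n j - xs\<bar> > gap n" if "j \<in> {1..n}" for j using elim(12) that by blast
    show ?case
    proof (intro allI impI)
      fix \<tau>1 \<tau>2 u v assume \<tau>: "\<bar>\<tau>1\<bar> <= Tm" "\<bar>\<tau>2\<bar> <= Tm" and u: "u \<in> vrange M n" and v: "v \<in> vrange M n"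
      have uM: "u >= - M" "v >= - M" using u v by (auto simp: vrange_def)
      have t: "tAi psi xs n \<tau>1 > 0" "tAi psi xs n \<tau>2 > 0" using elim(10) \<tau> by blast+
      define B where "B = exp (- \<sigma> * u) * real n powr - 2"
      define Eu where "Eu = exp (- \<sigma> * u)"
      define Ev where "Ev = exp (- \<sigma> * v)"
      define N where "N = real n powr - \<epsilon>"
      have pos: "0 <= Eu" "0 <= Ev" "0 <= N" by (simp_all add: Eu_def Ev_def N_def)
      have mB: "cmod (1 / EE n \<tau>1 u (h / of_real (hs n))) <= B" if "gap n / 8 <= cmod h" "exp (c1 * (real n * cmod h^3)) <= cmod (E0 n h)" for h
        using elim(9) \<tau>(1) u that unfolding B_def by blast
      have RLp': "\<And>h. h \<in> path_image RL ==> 0 <= Im h \<and> Re h <= 0 \<and> E0 n h \<noteq> 0 \<and> cmod (1 / EE n \<tau>1 u (h / of_real (hs n))) <= B"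
        using RLp nz mB by blast
      have URp': "\<And>h. h \<in> path_image UR ==> 0 <= Im h \<and> gap n / 4 <= Re h \<and> E0 n h \<noteq> 0 \<and> cmod (1 / EE n \<tau>1 u (h / of_real (hs n))) <= B"
        using URp nz mB by blast
      define A where "A = (\<lambda>q. wvee' q / eAi \<tau>1 u (wvee s q))"
      define V where "V = veeint n \<tau>1 u s Q"
      obtain Rst where R: "\<And>y. cmod (Rst y) <= 4 * (K * (B / (hs n * s)))"
        and fI: "integrable lborel (\<lambda>y. \<i> * EE n \<tau>2 v (zline s y) * ((LINT q|lborel. V q / (zline s y - wvee s q)) + Rst y))"
        and KN: "scaledK n \<tau>1 \<tau>2 u v
      = of_real (t0 / sqrt (tAi psi xs n \<tau>1 * tAi psi xs n \<tau>2)) / (2 * of_real pi * \<i>)^2 * (LINT y|lborel. \<i> * EE n \<tau>2 v (zline s y) * ((LINT q|lborel. V q / (zline s y - wvee s q)) + Rst y))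
       - airy_gauss \<tau>1 \<tau>2 u v"
        using kernel_vee_form[OF n(1) t gX s(3) elim(11) Q(1) nzq ct RLp' URp', of v] unfolding V_def by blast
      have sT: "s >= 2 * \<bar>\<tau>2\<bar> + 1" using s(2) \<tau>(2) by linarith
      note KA = KAiry_shifted(1)[OF sT, where u = u and v = v and ?\<tau>1.0 = \<tau>1] KAiry_shifted(2)[OF sT, where u = u and v = v and ?\<tau>1.0 = \<tau>1]
      have e2: "exp (- 2 * \<bar>x\<bar>) <= exp (- \<bar>x\<bar>)" for x :: real by simp
      have weak: "x <= KK * N' * exp (- \<bar>y\<bar>)" if "x <= k * N' * exp (- 2 * \<bar>y\<bar>)" "k <= KK" "0 <= N'" for x k N' y :: real
      proof -
        have "k * N' * exp (- 2 * \<bar>y\<bar>) <= KK * N' * exp (- \<bar>y\<bar>)" using that KK(7) by (intro mult_mono e2 mult_nonneg_nonneg mult_right_mono) auto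
        then show ?thesis using that(1) by linarith
      qed
      have P1: "cmod (EE n \<tau>2 v (zline s y)) <= KK * Ev * exp (- \<bar>y\<bar>)" for y
        by (rule weak[OF _ KK(1) pos(2)]) (use elim(3) \<tau>(2) v in \<open>unfold Ev_def, blast\<close>)
      have P2: "cmod (eAi \<tau>2 v (zline s y)) <= KK * Ev * exp (- \<bar>y\<bar>)" for y
        by (rule weak[OF _ KK(1) pos(2)]) (use K1(2) \<tau>(2) uM in \<open>unfold Ev_def, blast\<close>)
      have P3: "cmod (EE n \<tau>2 v (zline s y) - eAi \<tau>2 v (zline s y)) <= KK * N * Ev * exp (- \<bar>y\<bar>)" for y
      proof -
        have "cmod (EE n \<tau>2 v (zline s y) - eAi \<tau>2 v (zline s y)) <= K2 * N * Ev * exp (- \<bar>y\<bar>)" using elim(4) \<tau>(2) v unfolding N_def Ev_def by blast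
        also have "\<dots> <= KK * N * Ev * exp (- \<bar>y\<bar>)" using KK(2) pos by (intro mult_right_mono) auto
        finally show ?thesis .
      qed
      have A0: "cmod (A q) <= 2 * (K3 * Eu * exp (- 2 * \<bar>q\<bar>))" for q
      proof -
        have "cmod (A q) = sqrt 2 * cmod (1 / eAi \<tau>1 u (wvee s q))" by (simp add: A_def norm_divide)
        also have "\<dots> <= 2 * (K3 * Eu * exp (- 2 * \<bar>q\<bar>))" using K3(2) \<tau>(1) uM(1) sq2 unfolding Eu_def by (intro mult_mono) auto
        finally show ?thesis .
      qed
      have A1: "cmod (A q) <= KK * Eu * exp (- \<bar>q\<bar>)" for q by (rule weak[OF _ KK(3) pos(1)]) (use A0[of q] in simp)
      have V1: "cmod (V q) <= KK * Eu * exp (- \<bar>q\<bar>)" for q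
      proof (cases "\<bar>q\<bar> <= Q")
        case True
        then have "V q = wvee' q / EE n \<tau>1 u (wvee s q)" unfolding V_def veeint_def by (simp add: indicator_def abs_le_iff)
        then have "cmod (V q) = sqrt 2 * cmod (1 / EE n \<tau>1 u (wvee s q))" by (simp add: norm_divide)
        also have "\<dots> <= 2 * (K3 * Eu * exp (- 2 * \<bar>q\<bar>))" using elim(5) \<tau>(1) u inQ[OF True] sq2 unfolding Eu_def by (intro mult_mono) auto
        finally show ?thesis by (intro weak[OF _ KK(3) pos(1)]) simp
      next
        case False
        then have "V q = 0" unfolding V_def veeint_def by (auto simp: indicator_def)
        then show ?thesis using KK(7) pos by simp
      qed
      have V2: "cmod (V q - A q) <= KK * N * Eu * exp (- \<bar>q\<bar>)" for q
      proof (cases "\<bar>q\<bar> <= Q")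
        case True
        then have "V q = wvee' q / EE n \<tau>1 u (wvee s q)" unfolding V_def veeint_def by (simp add: indicator_def abs_le_iff)
        then have "V q - A q = wvee' q * (1 / EE n \<tau>1 u (wvee s q) - 1 / eAi \<tau>1 u (wvee s q))" by (simp add: A_def right_diff_distrib)
        then have "cmod (V q - A q) = sqrt 2 * cmod (1 / EE n \<tau>1 u (wvee s q) - 1 / eAi \<tau>1 u (wvee s q))" by (simp only: norm_mult norm_wvee')
        also have "\<dots> <= 2 * (K4 * N * Eu * exp (- \<bar>q\<bar>))" using elim(6) \<tau>(1) u inQ[OF True] sq2 unfolding Eu_def N_def by (intro mult_mono) auto
        also have "\<dots> = (2 * K4) * (N * Eu * exp (- \<bar>q\<bar>))" by simp
        also have "\<dots> <= KK * (N * Eu * exp (- \<bar>q\<bar>))" using KK(4) pos by (intro mult_right_mono) auto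
        finally show ?thesis by (simp only: mult.assoc)
      next
        \<comment> \<open>Beyond Q the cut-off integrand vanishes and the whole difference is the
          Airy tail, where half of the decay exp (- 2 |q|) is exchanged for n^(-
          \<epsilon>).\<close>
        case False
        then have "V q = 0" unfolding V_def veeint_def by (auto simp: indicator_def)
        then have "cmod (V q - A q) <= 2 * (K3 * Eu * exp (- 2 * \<bar>q\<bar>))" using A0[of q] by simp
        also have "exp (- 2 * \<bar>q\<bar>) = exp (- \<bar>q\<bar>) * exp (- \<bar>q\<bar>)" unfolding exp_add[symmetric] by simp
        also have "2 * (K3 * Eu * (exp (- \<bar>q\<bar>) * exp (- \<bar>q\<bar>))) <= 2 * (K3 * Eu * ((16^8 * N) * exp (- \<bar>q\<bar>)))"
        proof -
          have "exp (- \<bar>q\<bar>) <= exp (- Q)" using False by simp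
          also have "\<dots> <= 16^8 * N" using elim(8) unfolding Q_def N_def .
          finally have "exp (- \<bar>q\<bar>) <= 16^8 * N" .
          then show ?thesis using K3(1) pos by (intro mult_left_mono mult_right_mono) auto
        qed
        also have "\<dots> = (2 * 16^8 * K3) * (N * Eu * exp (- \<bar>q\<bar>))" by simp
        also have "\<dots> <= KK * (N * Eu * exp (- \<bar>q\<bar>))" using KK(5) pos by (intro mult_right_mono) auto
        finally show ?thesis by (simp only: mult.assoc)
      qed
      \<comment> \<open>The macroscopic bound n^(-2) pays for 1 / \<open>hs n\<close>, of order
        n^(1/3), and leaves far more than n^(- \<epsilon>) requires.\<close>
      have R1: "cmod (Rst y) <= KK * N * Eu" for y
      proof -
        have "B / (hs n * s) <= B / hs n" using hp s(3) by (intro divide_left_mono) (auto simp: B_def)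
        also have "\<dots> = Eu / cc * (real n powr - 2 * real n powr (1/3))"
          using n(1) cc(1) powr_minus_divide[of "real n" "1/3"] by (simp add: B_def Eu_def hs_def)
        also have "real n powr - 2 * real n powr (1/3) = real n powr (- 2 + 1/3)" by (rule powr_add[symmetric])
        also have "Eu / cc * \<dots> <= Eu / cc * N" unfolding N_def using pos cc(1) n eps' by (intro mult_left_mono powr_mono) auto
        finally have "K * (B / (hs n * s)) <= K * (Eu / cc * N)" using K by (intro mult_left_mono)
        then have "cmod (Rst y) <= 4 * (K * (Eu / cc * N))" using R[of y] by linarith
        also have "\<dots> = (4 * K / cc) * (N * Eu)" by simp
        also have "\<dots> <= KK * (N * Eu)" using KK(6) pos by (intro mult_right_mono) auto
        finally show ?thesis by (simp only: mult.assoc)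
      qed
      have mV: "V \<in> borel_measurable borel" "A \<in> borel_measurable borel" unfolding V_def A_def by measurable
      define g where "g = (\<lambda>y. LINT q|lborel. (eAi \<tau>2 v (zline s y) * \<i>) * A q / (zline s y - wvee s q))"
      define f where "f = (\<lambda>y. \<i> * EE n \<tau>2 v (zline s y) * ((LINT q|lborel. V q / (zline s y - wvee s q)) + Rst y))"
      have gI: "integrable lborel g" using KA(1) unfolding g_def A_def .
      note DP = double_integral_perturbation[where P = "\<lambda>y. EE n \<tau>2 v (zline s y)" and ?P0.0 = "\<lambda>y. eAi \<tau>2 v (zline s y)" and V = V and A = A and Rst = Rst and K = KK and N = N and Eu = Eu and Ev = Ev and s = s,
          folded f_def g_def I1_def, OF fI[folded f_def] gI s(3) KK(7) pos(3,1,2) mV P1 P2 P3 V1 A1 V2 R1]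
      define p where "p = t0 / sqrt (tAi psi xs n \<tau>1 * tAi psi xs n \<tau>2)"
      have p: "\<bar>p - 1\<bar> <= C6 * N" "\<bar>p\<bar> <= 2" using elim(7) \<tau> unfolding p_def N_def by blast+
      define Lf where "Lf = (LINT y|lborel. f y)"
      define Lg where "Lg = (LINT y|lborel. g y)"
      have KAg: "KAiry \<tau>1 \<tau>2 u v = 1 / (2 * of_real pi * \<i>)^2 * Lg
         - airy_gauss \<tau>1 \<tau>2 u v"
        using KA(2) unfolding Lg_def g_def A_def .
      define w where "w = 1 / (2 * complex_of_real pi * \<i>)^2"
      have pw: "complex_of_real p / (2 * of_real pi * \<i>)^2 = of_real p * w" by (simp add: w_def)
      have "1 <= (2 * pi)^2" using pi_gt3 by (intro one_le_power) simp
      then have w: "cmod w <= 1" by (simp add: w_def norm_divide norm_mult norm_power divide_le_eq)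
      have "scaledK n \<tau>1 \<tau>2 u v - KAiry \<tau>1 \<tau>2 u v
        = w * (of_real p * (Lf - Lg) + of_real (p - 1) * Lg)"
        unfolding KN KAg f_def[symmetric] p_def[symmetric] Lf_def[symmetric] pw w_def[symmetric] by (simp add: algebra_simps)
      then have "cmod (scaledK n \<tau>1 \<tau>2 u v - KAiry \<tau>1 \<tau>2 u v)
        = cmod w * cmod (of_real p * (Lf - Lg) + of_real (p - 1) * Lg)" by (simp only: norm_mult)
      also have "\<dots> <= 1 * cmod (of_real p * (Lf - Lg) + of_real (p - 1) * Lg)" using w by (intro mult_right_mono) auto
      also have "\<dots> <= \<bar>p\<bar> * cmod (Lf - Lg) + \<bar>p - 1\<bar> * cmod Lg"
        unfolding mult_1 by (rule order_trans[OF norm_triangle_ineq]) (simp only: norm_mult norm_of_real order_refl)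
      also have "\<dots> <= 2 * (KK^2 * (2 * I1 + 1) * I1 * N * (Eu * Ev)) + (C6 * N) * (KK^2 * I1 * I1 * (Eu * Ev))"
        unfolding Lf_def Lg_def using p DP C6(1) pos by (intro add_mono mult_mono) auto
      also have "\<dots> = CC * (N * (Eu * Ev))" by (simp add: CC_def algebra_simps)
      finally show "cmod (scaledK n \<tau>1 \<tau>2 u v - KAiry \<tau>1 \<tau>2 u v)
      <= CC * (real n powr - \<epsilon> * (exp (- \<sigma> * u) * exp (- \<sigma> * v)))" unfolding N_def Eu_def Ev_def .
    qed
  qed
  then show ?thesis by blast
qed

end

theorem mainTheorem1:
  fixes X0 :: "nat \<Rightarrow> nat \<Rightarrow> real" and psi :: "real \<Rightarrow> real"
    and xs c \<kappa> \<epsilon> \<sigma> :: real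
  assumes ordered: "\<And>n i j. 1 \<le> i \<Longrightarrow> i \<le> j \<Longrightarrow> j \<le> n \<Longrightarrow> X0 n i \<le> X0 n j"
    \<comment> \<open>Assumption 1\<close>
    and bounded_supp: "\<exists>B. \<forall>n j. 1 \<le> j \<and> j \<le> n \<longrightarrow> \<bar>X0 n j\<bar> \<le> B"
    and psi_nonneg: "\<And>x. psi x \<ge> 0"
    and psi_int: "integrable lborel psi"
    and psi_prob: "(LINT s|lborel. psi s) = 1"
    and weak_conv: "\<And>f :: real \<Rightarrow> real. continuous_on UNIV f \<Longrightarrow> bounded (range f) \<Longrightarrow>
          (\<lambda>n. (\<Sum>j=1..n. f (X0 n j)) / real n) \<longlonglongrightarrow> (LINT s|lborel. f s * psi s)"
    and psi_cont: "continuous_on (supp_dens psi) psi"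
    and c_pos: "c > 0" and kappa: "\<kappa> > 2"
    and psi_asymp: "psi \<sim>[at xs] (\<lambda>x. c * \<bar>x - xs\<bar> powr \<kappa>)"
    \<comment> \<open>Assumption 2\<close>
    and assm2: "\<exists>M0>0. \<exists>n0. \<forall>n\<ge>n0. \<forall>x. \<bar>Fn X0 n x - Fmu psi x\<bar> \<le> M0 / real n"
    \<comment> \<open>Assumption 3\<close>
    and assm3: "\<exists>m>0. \<exists>n0. \<forall>n\<ge>n0. \<forall>j. 1 \<le> j \<and> j \<le> n \<longrightarrow>
          X0 n j \<notin> {xs - m * real n powr (-1/(\<kappa>+1)) .. xs + m * real n powr (-1/(\<kappa>+1))}"
    and G2_pos: "Gder psi xs 2 > 0"
    and eps: "0 < \<epsilon>" "\<epsilon> < min ((\<kappa> - 2) / (6 * (\<kappa> + 1))) (1/15)"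
    and sigma: "\<sigma> > 0"
  shows "\<forall>T M. compact T \<and> M > 0 \<longrightarrow> (\<exists>C N. \<forall>n\<ge>N. \<forall>\<tau>1\<in>T. \<forall>\<tau>2\<in>T.
           \<forall>u\<in>{-M .. M * real n powr \<epsilon>}. \<forall>v\<in>{-M .. M * real n powr \<epsilon>}.
             cmod (KNIBMconj X0 psi xs n (tAi psi xs n \<tau>1) (tAi psi xs n \<tau>2)
                     (xAi psi xs n \<tau>1 + u / (c2 psi xs * real n powr (2/3)))
                     (xAi psi xs n \<tau>2 + v / (c2 psi xs * real n powr (2/3)))
                   / of_real (c2 psi xs * real n powr (2/3))
                   - KAiry \<tau>1 \<tau>2 u v)
             \<le> C * exp (- \<sigma> * (u + v)) / real n powr \<epsilon>)"
proof (intro allI impI)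
  fix T :: "real set" and M :: real
  assume TM: "compact T \<and> M > 0"
  interpret nibm X0 psi xs c \<kappa> \<epsilon> \<sigma>
    by unfold_locales (fact bounded_supp psi_nonneg psi_int psi_prob weak_conv c_pos kappa psi_asymp assm2 assm3 G2_pos eps sigma)+
  have "bounded T" using TM compact_imp_bounded by blast
  then obtain Tm where Tm: "Tm > 0" "\<And>\<tau>. \<tau> \<in> T \<Longrightarrow> \<bar>\<tau>\<bar> \<le> Tm" unfolding bounded_pos by auto
  obtain C where "\<forall>\<^sub>F n in sequentially. \<forall>\<tau>1 \<tau>2 u v. \<bar>\<tau>1\<bar> \<le> Tm \<longrightarrow> \<bar>\<tau>2\<bar> \<le> Tm \<longrightarrow> u \<in> vrange M n \<longrightarrow> v \<in> vrange M n \<longrightarrow>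
     cmod (KNIBMconj X0 psi xs n (tAi psi xs n \<tau>1) (tAi psi xs n \<tau>2) (yAi n \<tau>1 u) (yAi n \<tau>2 v) / of_real (c2 psi xs * real n powr (2/3)) - KAiry \<tau>1 \<tau>2 u v)
      \<le> C * (real n powr - \<epsilon> * (exp (- \<sigma> * u) * exp (- \<sigma> * v)))"
    using kernel_convergence[of M Tm] TM Tm(1) by auto
  then obtain N where N: "\<And>n \<tau>1 \<tau>2 u v. N \<le> n \<Longrightarrow> \<bar>\<tau>1\<bar> \<le> Tm \<Longrightarrow> \<bar>\<tau>2\<bar> \<le> Tm \<Longrightarrow> u \<in> vrange M n \<Longrightarrow> v \<in> vrange M n \<Longrightarrow>
     cmod (KNIBMconj X0 psi xs n (tAi psi xs n \<tau>1) (tAi psi xs n \<tau>2) (yAi n \<tau>1 u) (yAi n \<tau>2 v) / of_real (c2 psi xs * real n powr (2/3)) - KAiry \<tau>1 \<tau>2 u v)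
      \<le> C * (real n powr - \<epsilon> * (exp (- \<sigma> * u) * exp (- \<sigma> * v)))"
    unfolding eventually_sequentially by blast
  have e: "C * (real n powr - \<epsilon> * (exp (- \<sigma> * u) * exp (- \<sigma> * v))) = C * exp (- \<sigma> * (u + v)) / real n powr \<epsilon>" for n u v
    unfolding exp_add[symmetric] by (simp add: powr_minus_divide distrib_left)
  show "\<exists>C N. \<forall>n\<ge>N. \<forall>\<tau>1\<in>T. \<forall>\<tau>2\<in>T.
           \<forall>u\<in>{-M .. M * real n powr \<epsilon>}. \<forall>v\<in>{-M .. M * real n powr \<epsilon>}.
             cmod (KNIBMconj X0 psi xs n (tAi psi xs n \<tau>1) (tAi psi xs n \<tau>2)
                     (xAi psi xs n \<tau>1 + u / (c2 psi xs * real n powr (2/3)))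
                     (xAi psi xs n \<tau>2 + v / (c2 psi xs * real n powr (2/3)))
                   / of_real (c2 psi xs * real n powr (2/3))
                   - KAiry \<tau>1 \<tau>2 u v)
             \<le> C * exp (- \<sigma> * (u + v)) / real n powr \<epsilon>"
    using N[OF _ Tm(2) Tm(2)] unfolding e yAi_def vrange_def by blast
qed

end
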